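(* Let $k$ be an algebraically closed field, let $f,g\in k[x,y]$ be the defining equations of two affine plane curves $C=V(f)$, $D=V(g)\subset\mathbb{A}^2_k$ without common component, and suppose $0\in C\cap D$. Let $A=k[x,y]_{(x,y)}$ and let $c$ and $d$ be the initial degrees of $f$ and $g$. Let $e_1=e(f_1,g_1;A[x/y])$, $e_2=e(f_2,g_2;A[y/x])$ and $e_3=e(f_1,g_1;A[x/y,y/x])$, where $f_1,g_1$ (resp. $f_2,g_2$) denote the strict transforms of $f,g$ in $A[x/y]$ (resp. in $A[y/x]$). Then: (a) $e(f,g;A)=c\cdot d+t+\ell$, where $t$ is the number of common tangents of $C$ and $D$ in $(0,0)$ counted with multiplicities and $\ell\ge 0$ is the constant value, for all $n\gg 0$, of $$\ell_A\Big(\big((fA,\mathfrak{m}^n):_A g\big)\big/\big(((fA,\mathfrak{m}^n):_A g)\cap (fA,\mathfrak{m}^{n-d-1})\big)\Big).$$ (b) $e(f,g;A)=c\cdot d+e_1+e_2-e_3$. (c) Suppose $C$ and $D$ do not intersect transversally in the origin. Then $e(f,g;A)\le c\cdot d+e_1+e_2$, with equality if and only if one of the coordinate axes is a common tangent of $C$ and $D$ in $(0,0)$.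
   Context: $\mathfrak{m}=(x,y)A$ is the maximal ideal of $A$; $\ell_A$ denotes length of an $A$-module; $(fA,\mathfrak{m}^n)$ denotes the ideal $fA+\mathfrak{m}^n$. $e(f,g;A)$ is the local intersection multiplicity at the origin, i.e. the multiplicity of the parameter ideal $(f,g)A$, equal to $\ell_A(A/(f,g)A)$. The initial degree of $f$ is the $c$ with $f\in\mathfrak{m}^c\setminus\mathfrak{m}^{c+1}$, and $f^\star\in k[X,Y]=G_A(\mathfrak{m})=\oplus_{n\ge0}\mathfrak{m}^n/\mathfrak{m}^{n+1}$ denotes the initial form of $f$ (its homogeneous part of lowest degree $c$); similarly $d$ and $g^\star$ for $g$. The curves intersect transversally in the origin if and only if $f^\star,g^\star$ form a homogeneous system of parameters of $k[X,Y]$. The common tangents in the origin are the lines given by the linear factors of $h=\gcd(f^\star,g^\star)$, and the number of common tangents counted with multiplicities is $t=\deg h$. $A[x/y]$, $A[y/x]$, $A[x/y,y/x]$ are the subrings of the field $k(x,y)$ generated over $A$ by the indicated elements (the affine blowing up rings of $\mathfrak{m}$). The strict transforms are $f_1=f/y^c$, $g_1=g/y^d\in A[x/y]$ and $f_2=f/x^c$, $g_2=g/x^d\in A[y/x]$. For one of these rings $B$ and an ideal $I\subset B$ with $B/I$ of finite length, $e(I;B):=\sum_i e(IB_{\mathfrak{m}_i};B_{\mathfrak{m}_i})$, the sum of multiplicities over the finitely many maximal ideals $\mathfrak{m}_i$ of $B$ containing $I$ (it is $0$ if $I=B$).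
   Formalization: In (c), equality holds iff one of the coordinate axes is a common tangent and every common tangent is a coordinate axis; as worded the "if" fails, e.g. f=x(x-y)+y^3, g=x(x-y)+x^3 (char not 3): e=7, but cd+e_1+e_2=9. *)

theory Defs
  imports "HOL-Algebra.Algebraic_Closure_Type" "HOL-Algebra.Ideal_Product" "HOL-Algebra.Generated_Rings" "HOL-Library.Extended_Nat"
begin

section \<open>Length, dimension and multiplicity\<close>

text \<open>
  For ideals \<open>N \<subseteq> M\<close> of \<open>R\<close>, the submodules of \<open>M/N\<close> are the \<open>J/N\<close> with \<open>J\<close> an ideal of \<open>R\<close>
  between \<open>N\<close> and \<open>M\<close>. So the supremum of the lengths of strict chains of such \<open>J\<close> is the length
  of the \<open>R\<close>-module \<open>M/N\<close>.
\<close>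

definition quot_length :: "('a, 'b) ring_scheme \<Rightarrow> 'a set \<Rightarrow> 'a set \<Rightarrow> enat" where
  "quot_length R M N = Sup {enat n |n. \<exists>J :: nat \<Rightarrow> 'a set.
     (\<forall>i\<le>n. ideal (J i) R \<and> N \<subseteq> J i \<and> J i \<subseteq> M) \<and> (\<forall>i<n. J i \<subset> J (Suc i))}"

definition krull_dim :: "('a, 'b) ring_scheme \<Rightarrow> enat" where
  "krull_dim R = Sup {enat n |n. \<exists>P :: nat \<Rightarrow> 'a set.
     (\<forall>i\<le>n. primeideal (P i) R) \<and> (\<forall>i<n. P i \<subset> P (Suc i))}"

abbreviation ideal_power :: "('a, 'b) ring_scheme \<Rightarrow> 'a set \<Rightarrow> nat \<Rightarrow> 'a set" where
  "ideal_power R I n \<equiv> I [^]\<^bsub>ideals_set R\<^esub> n"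

text \<open>
  The Hilbert--Samuel multiplicity of an ideal \<open>I\<close> of finite colength in a local ring \<open>R\<close> of
  dimension \<open>d\<close>, i.e. the limit of \<open>d! length(R/I^n) / n^d\<close>.
\<close>

definition multiplicity_of_ideal :: "('a, 'b) ring_scheme \<Rightarrow> 'a set \<Rightarrow> real" where
  "multiplicity_of_ideal R I = (let d = the_enat (krull_dim R) in
     lim (\<lambda>n. fact d * real (the_enat (quot_length R (carrier R) (ideal_power R I n))) / real n ^ d))"

definition colon_ideal :: "('a, 'b) ring_scheme \<Rightarrow> 'a set \<Rightarrow> 'a \<Rightarrow> 'a set" where
  "colon_ideal R J g = {a \<in> carrier R. a \<otimes>\<^bsub>R\<^esub> g \<in> J}"


section \<open>Subrings of a field\<close>

text \<open>All rings of fractions below are subsets of one field, given by a type.\<close>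

definition subring_of :: "'a::field set \<Rightarrow> 'a ring" where
  "subring_of B = ring_of_type_algebra\<lparr>carrier := B\<rparr>"

definition localization :: "'a::field set \<Rightarrow> 'a set \<Rightarrow> 'a set" where
  "localization B P = {a / b |a b. a \<in> B \<and> b \<in> B - P}"

definition total_multiplicity :: "'a::field set \<Rightarrow> 'a set \<Rightarrow> real" where
  "total_multiplicity B I = (\<Sum>M \<in> {M. maximalideal M (subring_of B) \<and> I \<subseteq> M}.
     let L = subring_of (localization B M) in multiplicity_of_ideal L (Idl\<^bsub>L\<^esub> I))"


section \<open>Polynomials in two variables\<close>

text \<open>
  \<open>k[x,y]\<close> is the type \<open>'k poly poly\<close>, read as \<open>k[x][y]\<close>: the coefficient of \<open>x^i y^j\<close>
  in \<open>p\<close> is \<open>coeff (coeff p j) i\<close>.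
\<close>

definition eval2 :: "'k::comm_ring_1 poly poly \<Rightarrow> 'k \<Rightarrow> 'k \<Rightarrow> 'k" where
  "eval2 p u v = poly (poly p [:v:]) u"

definition curve :: "'k::comm_ring_1 poly poly \<Rightarrow> ('k \<times> 'k) set" where
  "curve p = {(u, v). eval2 p u v = 0}"

definition curve_components :: "'k::field poly poly \<Rightarrow> ('k \<times> 'k) set set" where
  "curve_components p = {curve q |q. Factorial_Ring.irreducible q \<and> q dvd p}"

definition homogeneous_part :: "nat \<Rightarrow> 'k::comm_ring_1 poly poly \<Rightarrow> 'k poly poly" where
  "homogeneous_part n p = (\<Sum>j\<le>n. monom (monom (coeff (coeff p j) (n - j)) (n - j)) j)"

definition homogeneous :: "nat \<Rightarrow> 'k::zero poly poly \<Rightarrow> bool" where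
  "homogeneous n p \<longleftrightarrow> (\<forall>i j. coeff (coeff p j) i \<noteq> 0 \<longrightarrow> i + j = n)"

definition total_degree :: "'k::zero poly poly \<Rightarrow> nat" where
  "total_degree p = Max {i + j |i j. coeff (coeff p j) i \<noteq> 0}"

text \<open>
  Since \<open>k[X,Y]\<close> has dimension two, a homogeneous system of parameters consists of two
  homogeneous elements of positive degree whose residue ring has finite length.
\<close>

definition homogeneous_sop :: "'k::field poly poly \<Rightarrow> 'k poly poly \<Rightarrow> bool" where
  "homogeneous_sop F G \<longleftrightarrow>
     (\<exists>m>0. homogeneous m F) \<and> (\<exists>m>0. homogeneous m G) \<and>
     (let R = (ring_of_type_algebra :: 'k poly poly ring)
      in quot_length R (carrier R) (Idl\<^bsub>R\<^esub> {F, G}) \<noteq> \<infinity>)"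


section \<open>The local ring of the plane at the origin and its blowing up rings\<close>

type_synonym 'k rational_function = "'k poly poly fract"

definition frac_x :: "'k::field rational_function" where
  "frac_x = to_fract [:[:0, 1:]:]"

definition frac_y :: "'k::field rational_function" where
  "frac_y = to_fract [:0, 1:]"

definition origin_ring :: "'k::field rational_function set" where
  "origin_ring = (let B = range to_fract in localization B (Idl\<^bsub>subring_of B\<^esub> {frac_x, frac_y}))"

abbreviation origin_A :: "'k::field rational_function ring" where
  "origin_A \<equiv> subring_of origin_ring"

definition origin_ideal :: "'k::field rational_function set" where
  "origin_ideal = Idl\<^bsub>origin_A\<^esub> {frac_x, frac_y}"

definition blowup_ring :: "'k::field rational_function set \<Rightarrow> 'k rational_function set" where
  "blowup_ring S = generate_ring ring_of_type_algebra (origin_ring \<union> S)"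

definition intersection_multiplicity :: "'k::field poly poly \<Rightarrow> 'k poly poly \<Rightarrow> real" where
  "intersection_multiplicity f g =
     multiplicity_of_ideal origin_A (Idl\<^bsub>origin_A\<^esub> {to_fract f, to_fract g})"

definition blowup_multiplicity ::
    "'k::field rational_function set \<Rightarrow> 'k rational_function \<Rightarrow> 'k rational_function \<Rightarrow> real" where
  "blowup_multiplicity B F G = total_multiplicity B (Idl\<^bsub>subring_of B\<^esub> {F, G})"

definition initial_degree :: "'k::field poly poly \<Rightarrow> nat" where
  "initial_degree f = (THE c. to_fract f \<in>
     ideal_power origin_A origin_ideal c - ideal_power origin_A origin_ideal (c + 1))"

definition initial_form :: "'k::field poly poly \<Rightarrow> 'k poly poly" where
  "initial_form f = homogeneous_part (initial_degree f) f"

text \<open>The ideal \<open>(fA, m^n)\<close> of \<open>A\<close>.\<close>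

definition ideal_plus_power :: "'k::field poly poly \<Rightarrow> nat \<Rightarrow> 'k rational_function set" where
  "ideal_plus_power f n =
     Idl\<^bsub>origin_A\<^esub> (insert (to_fract f) (ideal_power origin_A origin_ideal n))"


section \<open>Tangents at the origin\<close>

definition transversal_at_origin :: "'k::field poly poly \<Rightarrow> 'k poly poly \<Rightarrow> bool" where
  "transversal_at_origin f g \<longleftrightarrow> homogeneous_sop (initial_form f) (initial_form g)"

text \<open>
  The greatest common divisor is only determined up to a nonzero constant, on which neither
  its degree nor the lines defined by its linear factors depend.
\<close>

definition tangent_gcd :: "'k::field poly poly \<Rightarrow> 'k poly poly \<Rightarrow> 'k poly poly" where
  "tangent_gcd f g = somegcd ring_of_type_algebra (initial_form f) (initial_form g)"

definition common_tangent_number :: "'k::field poly poly \<Rightarrow> 'k poly poly \<Rightarrow> nat" where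
  "common_tangent_number f g = total_degree (tangent_gcd f g)"

definition linear_form :: "'k::field \<Rightarrow> 'k \<Rightarrow> 'k poly poly" where
  "linear_form a b = [:[:0, a:], [:b:]:]"

definition common_tangents :: "'k::field poly poly \<Rightarrow> 'k poly poly \<Rightarrow> ('k \<times> 'k) set set" where
  "common_tangents f g = {curve (linear_form a b) |a b.
     (a, b) \<noteq> (0, 0) \<and> linear_form a b dvd tangent_gcd f g}"

definition x_axis :: "('k::field \<times> 'k) set" where
  "x_axis = {(u, v). v = 0}"

definition y_axis :: "('k::field \<times> 'k) set" where
  "y_axis = {(u, v). u = 0}"

text \<open>
  That some axis is a common tangent does not suffice for equality in the estimate
  \<open>e(f,g;A) \<le> c d + e1 + e2\<close>. For \<open>f = x(x - y) + y^3\<close> and \<open>g = x(x - y) + x^3\<close> in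
  characteristic different from 3, the line \<open>x = 0\<close> is a common tangent, but \<open>c = d = 2\<close>,
  \<open>e(f,g;A) = 7\<close>, \<open>e1 = 3\<close> and \<open>e2 = e3 = 2\<close>, because \<open>x = y\<close> is a common tangent too.
  The condition for equality is that the common tangents be coordinate axes.
\<close>

end

theory Submission
  imports Defs "Berlekamp_Zassenhaus.Unique_Factorization_Poly"
begin

text \<open>
  Let \<open>m\<close> be the maximal ideal of \<open>A\<close> and \<open>f*\<close>, \<open>g*\<close> the initial forms. Comparing the Koszul complex
  of \<open>f, g\<close> over \<open>A\<close> with its filtered version shows that \<open>m^n / (f m^(n-c) + g m^(n-d))\<close> has length
  \<open>e(f,g;A) - c d\<close> for \<open>n \<ge> c + d\<close>. For a linear form \<open>\<lambda>\<close> that does not divide \<open>f*\<close>, division by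
  \<open>\<lambda>^n\<close> identifies this quotient with \<open>B/(f/\<lambda>^c, g/\<lambda>^d)\<close>, where \<open>B\<close> is an affine chart of the blowing
  up that contains all common points of the strict transforms on the exceptional line. Hence
  \<open>e(f,g;A) - c d\<close> is the sum of the intersection multiplicities at these points, which are the
  common zeros of \<open>f*\<close> and \<open>g*\<close>. Distributing the points over the three blowing up rings gives (b)
  and (c).

  For (a), additivity of length shows that \<open>((f, m^n) : g) / (f, m^(n-d))\<close> also has length
  \<open>e(f,g;A) - c d\<close>. Its part in \<open>m^(n-d-1)\<close> is computed by leading forms: a form \<open>H\<close> of
  degree \<open>n-d-1\<close> occurs if and only if \<open>f*\<close> divides \<open>H g*\<close>, i.e. \<open>f*/h\<close> divides \<open>H\<close>. Modulo the
  multiples of \<open>f*\<close> these forms make up a space of dimension \<open>deg h = t\<close>.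
\<close>

section \<open>Lengths of subquotients\<close>

text \<open>All rings and modules are subsets of the one field of rational functions, and lengths
  are taken over the constants whenever objects over different rings are compared. Algebraic
  closedness enters by splitting binary forms into linear ones: every point that matters is
  rational, with the constants as residue field, so length over its local ring is dimension over the
  constants. The obstacle is that multiplicity is defined as a Hilbert-Samuel limit normalised by
  the Krull dimension. Dimension two has to be proved for every local ring involved, and the two
  generators have to be shown to form a regular sequence, before a multiplicity becomes a colength.
  The chart of the linear form is in general none of the three blowing up rings; it is an auxiliary
  ring in which all contributions are summed at once. For the transfer, the local ring at a point of
  the exceptional line is defined by numerators and denominators in \<open>k[x,y]\<close>, without
  reference to a chart.\<close>

definition submod :: "'a::comm_ring_1 set \<Rightarrow> 'a set \<Rightarrow> bool" where
  "submod R V \<longleftrightarrow> 0 \<in> V \<and> (\<forall>u\<in>V. \<forall>v\<in>V. u - v \<in> V) \<and> (\<forall>r\<in>R. \<forall>v\<in>V. r * v \<in> V)"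

definition splus :: "'a::comm_ring_1 set \<Rightarrow> 'a set \<Rightarrow> 'a set" (infixl \<open>\<boxplus>\<close> 65) where
  "U \<boxplus> V = {u + v |u v. u \<in> U \<and> v \<in> V}"

definition smul :: "'a::comm_ring_1 \<Rightarrow> 'a set \<Rightarrow> 'a set" (infixr \<open>*\<^sub>S\<close> 75) where
  "c *\<^sub>S V = {c * v |v. v \<in> V}"

definition mchain :: "'a::comm_ring_1 set \<Rightarrow> 'a set \<Rightarrow> 'a set \<Rightarrow> nat \<Rightarrow> (nat \<Rightarrow> 'a set) \<Rightarrow> bool" where
  "mchain R V W n J \<longleftrightarrow>
     (\<forall>i\<le>n. submod R (J i) \<and> W \<subseteq> J i \<and> J i \<subseteq> V) \<and> (\<forall>i<n. J i \<subset> J (Suc i))"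

text \<open>The scalars \<open>R\<close> are a parameter and may be any set: the same pair
  \<open>V\<close>, \<open>W\<close> is measured over a local ring and over the constants.\<close>

definition rlen :: "'a::comm_ring_1 set \<Rightarrow> 'a set \<Rightarrow> 'a set \<Rightarrow> enat" where
  "rlen R V W = Sup {enat n |n. \<exists>J. mchain R V W n J}"

lemma submodI:
  assumes "0 \<in> V" "\<And>u v. u \<in> V \<Longrightarrow> v \<in> V \<Longrightarrow> u - v \<in> V" "\<And>r v. r \<in> R \<Longrightarrow> v \<in> V \<Longrightarrow> r * v \<in> V"
  shows "submod R V"
  using assms by (auto simp: submod_def)

lemma submod_zero: "submod R V \<Longrightarrow> 0 \<in> V"
  and submod_diff: "submod R V \<Longrightarrow> u \<in> V \<Longrightarrow> v \<in> V \<Longrightarrow> u - v \<in> V"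
  and submod_mult: "submod R V \<Longrightarrow> r \<in> R \<Longrightarrow> v \<in> V \<Longrightarrow> r * v \<in> V"
  by (auto simp: submod_def)

lemma submod_uminus: "submod R V \<Longrightarrow> v \<in> V \<Longrightarrow> - v \<in> V"
  by (metis diff_0 submod_diff submod_zero)

lemma submod_add: "submod R V \<Longrightarrow> u \<in> V \<Longrightarrow> v \<in> V \<Longrightarrow> u + v \<in> V"
  by (metis diff_minus_eq_add submod_diff submod_uminus)

lemma submod_subset: "submod R V \<Longrightarrow> S \<subseteq> R \<Longrightarrow> submod S V"
  by (auto simp: submod_def)

lemma submod_Int: "submod R U \<Longrightarrow> submod R V \<Longrightarrow> submod R (U \<inter> V)"
  by (auto simp: submod_def)

lemma splusI: "u \<in> U \<Longrightarrow> v \<in> V \<Longrightarrow> u + v \<in> U \<boxplus> V"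
  by (auto simp: splus_def)

lemma splusE:
  assumes "w \<in> U \<boxplus> V" obtains u v where "u \<in> U" "v \<in> V" "w = u + v"
  using assms by (auto simp: splus_def)

lemma smulE:
  assumes "w \<in> c *\<^sub>S V" obtains v where "v \<in> V" "w = c * v"
  using assms by (auto simp: smul_def)

lemma smulI: "v \<in> V \<Longrightarrow> c * v \<in> c *\<^sub>S V"
  by (auto simp: smul_def)

lemma submod_splus:
  assumes "submod R U" "submod R V" shows "submod R (U \<boxplus> V)"
proof (rule submodI)
  show "0 \<in> U \<boxplus> V"
    using splusI[OF submod_zero submod_zero, OF assms] by simp
next
  fix u v assume "u \<in> U \<boxplus> V" "v \<in> U \<boxplus> V"
  then obtain a b a' b' where "a \<in> U" "b \<in> V" "u = a + b" "a' \<in> U" "b' \<in> V" "v = a' + b'"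
    by (elim splusE) blast
  moreover from this have "u - v = (a - a') + (b - b')" by simp
  ultimately show "u - v \<in> U \<boxplus> V"
    by (metis assms splusI submod_diff)
next
  fix r v assume "r \<in> R" "v \<in> U \<boxplus> V"
  then show "r * v \<in> U \<boxplus> V"
    by (elim splusE) (metis assms distrib_left splusI submod_mult)
qed

lemma submod_smul:
  assumes "submod R V" shows "submod R (c *\<^sub>S V)"
proof (rule submodI)
  show "0 \<in> c *\<^sub>S V"
    using smulI[OF submod_zero[OF assms], of c] by simp
next
  fix u v assume "u \<in> c *\<^sub>S V" "v \<in> c *\<^sub>S V"
  then show "u - v \<in> c *\<^sub>S V"
    by (elim smulE) (metis assms right_diff_distrib smulI submod_diff)
next
  fix r v assume "r \<in> R" "v \<in> c *\<^sub>S V"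
  then show "r * v \<in> c *\<^sub>S V"
    by (elim smulE) (metis assms mult.left_commute smulI submod_mult)
qed

lemma splus_upper1:
  assumes "submod R V" shows "U \<subseteq> U \<boxplus> V"
proof
  fix u assume "u \<in> U"
  from splusI[OF this submod_zero[OF assms]] show "u \<in> U \<boxplus> V" by simp
qed

lemma splus_commute: "U \<boxplus> V = V \<boxplus> U"
proof -
  have "U \<boxplus> V \<subseteq> V \<boxplus> U" for U V :: "'a set"
    by (metis add.commute splusE splusI subsetI)
  then show ?thesis by blast
qed

lemma splus_upper2: "submod R U \<Longrightarrow> V \<subseteq> U \<boxplus> V"
  using splus_upper1 by (subst splus_commute)

lemma splus_least:
  assumes "submod R W" "U \<subseteq> W" "V \<subseteq> W" shows "U \<boxplus> V \<subseteq> W"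
proof
  fix w assume "w \<in> U \<boxplus> V"
  then obtain u v where "u \<in> U" "v \<in> V" "w = u + v" by (rule splusE)
  then show "w \<in> W" using assms submod_add[OF assms(1)] by blast
qed

lemma splus_mono: "U \<subseteq> U' \<Longrightarrow> V \<subseteq> V' \<Longrightarrow> U \<boxplus> V \<subseteq> U' \<boxplus> V'"
  by (auto simp: splus_def)

lemma smul_mono: "U \<subseteq> V \<Longrightarrow> c *\<^sub>S U \<subseteq> c *\<^sub>S V"
  by (auto simp: smul_def)

lemma splus_absorb: "submod R U \<Longrightarrow> submod R V \<Longrightarrow> V \<subseteq> U \<Longrightarrow> U \<boxplus> V = U"
  by (intro subset_antisym splus_least splus_upper1) auto

lemma modular_law:
  assumes "submod R W" "U \<subseteq> W"
  shows "(U \<boxplus> V) \<inter> W = U \<boxplus> (V \<inter> W)"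
proof (intro equalityI subsetI)
  fix w assume w: "w \<in> (U \<boxplus> V) \<inter> W"
  then obtain u v where uv: "u \<in> U" "v \<in> V" "w = u + v" by (auto elim: splusE)
  with w assms have "w - u \<in> W" by (meson IntD2 subsetD submod_diff)
  with uv show "w \<in> U \<boxplus> (V \<inter> W)" by (auto intro: splusI)
next
  fix w assume "w \<in> U \<boxplus> (V \<inter> W)"
  then obtain u v where uv: "u \<in> U" "v \<in> V" "v \<in> W" "w = u + v" by (auto elim: splusE)
  then show "w \<in> (U \<boxplus> V) \<inter> W"
    using submod_add[OF assms(1)] assms(2) splusI[OF uv(1,2)] by blast
qed

text \<open>The lengths of strict chains are closed downwards, so a natural number below their
  supremum is itself the length of a chain. This turns inequalities between lengths into
  constructions of chains and treats infinite length on the same footing.\<close>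

lemma enat_le_Sup_iff:
  assumes "\<And>n. Q (Suc n) \<Longrightarrow> Q n" and "Q 0"
  shows "enat n \<le> Sup {enat n |n. Q n} \<longleftrightarrow> Q n"
proof
  assume "Q n"
  then show "enat n \<le> Sup {enat n |n. Q n}" by (auto intro: Sup_upper)
next
  assume le: "enat n \<le> Sup {enat n |n. Q n}"
  show "Q n"
  proof (rule ccontr)
    assume nQ: "\<not> Q n"
    have down: "k \<le> m \<Longrightarrow> Q m \<Longrightarrow> Q k" for k m
      by (induction m) (use assms le_Suc_eq in auto)
    obtain m where m: "n = Suc m" using nQ assms(2) by (cases n) auto
    have "Sup {enat n |n. Q n} \<le> enat m"
    proof (rule Sup_least)
      fix x assume "x \<in> {enat n |n. Q n}"
      then obtain k where k: "x = enat k" "Q k" by blast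
      have "\<not> Suc m \<le> k" using nQ down k m by blast
      then show "x \<le> enat m" using k by simp
    qed
    then show False using le m using order_trans[OF le, of "enat m"] m by simp
  qed
qed

lemma enat_le_rlen_iff:
  assumes "submod R W" "W \<subseteq> V"
  shows "enat n \<le> rlen R V W \<longleftrightarrow> (\<exists>J. mchain R V W n J)"
  unfolding rlen_def
proof (rule enat_le_Sup_iff)
  show "\<exists>J. mchain R V W n J" if ex: "\<exists>J. mchain R V W (Suc n) J" for n
  proof -
    obtain J where "mchain R V W (Suc n) J" using ex by blast
    then have "mchain R V W n J" by (simp add: mchain_def)
    then show ?thesis by blast
  qed
  show "\<exists>J. mchain R V W 0 J"
    using assms by (intro exI[of _ "\<lambda>_. W"]) (auto simp: mchain_def)
qed

lemma enat_leI:
  fixes x y :: enat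
  assumes "\<And>n. enat n \<le> x \<Longrightarrow> enat n \<le> y" shows "x \<le> y"
proof (cases x)
  case (enat n)
  then show ?thesis using assms by auto
next
  case infinity
  then have "enat n \<le> y" for n using assms by auto
  then have "y = \<infinity>"
    by (metis Suc_n_not_le_n enat_ord_simps(1) not_infinity_eq)
  then show ?thesis by simp
qed

lemma enat_add_leI:
  fixes x y z :: enat
  assumes "\<And>a b. enat a \<le> x \<Longrightarrow> enat b \<le> y \<Longrightarrow> enat (a + b) \<le> z" shows "x + y \<le> z"
proof (rule enat_leI)
  fix n assume n: "enat n \<le> x + y"
  have "\<exists>a b. enat a \<le> x \<and> enat b \<le> y \<and> n = a + b"
  proof (cases x)
    case (enat a)
    then show ?thesis
    proof (cases "n \<le> a")
      case True
      then show ?thesis using enat by (intro exI[of _ n] exI[of _ 0]) (auto simp: zero_enat_def[symmetric])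
    next
      case False
      then show ?thesis using enat n by (intro exI[of _ a] exI[of _ "n - a"]) (cases y, auto)
    qed
  next
    case infinity
    then show ?thesis by (intro exI[of _ n] exI[of _ 0]) (auto simp: zero_enat_def[symmetric])
  qed
  then show "enat n \<le> z" using assms by auto
qed

lemma rlen_mono:
  assumes "submod R W" "W \<subseteq> W'" "submod R W'" "W' \<subseteq> V'" "V' \<subseteq> V"
  shows "rlen R V' W' \<le> rlen R V W"
proof (rule enat_leI)
  fix n assume "enat n \<le> rlen R V' W'"
  then obtain J where "mchain R V' W' n J" using assms by (auto simp: enat_le_rlen_iff)
  then have "mchain R V W n J" using assms unfolding mchain_def by (metis order_trans)
  then show "enat n \<le> rlen R V W" using assms by (subst enat_le_rlen_iff) auto
qed

lemma rlen_superadditive: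
  assumes "submod R W" "submod R U" "W \<subseteq> U" "U \<subseteq> V"
  shows "rlen R V U + rlen R U W \<le> rlen R V W"
proof (rule enat_add_leI)
  fix a b assume "enat a \<le> rlen R V U" "enat b \<le> rlen R U W"
  then obtain J J' where J: "mchain R V U a J" "mchain R U W b J'"
    using assms by (auto simp: enat_le_rlen_iff)
  \<comment> \<open>The lower chain is kept in full and \<open>J 0\<close> is dropped, because
    \<open>J 0\<close> may coincide with \<open>J' b\<close>; the step from \<open>J' b\<close> to
    \<open>J 1\<close> is still strict.\<close>
  define K where "K i = (if i \<le> b then J' i else J (i - b))" for i
  have strict: "K i \<subset> K (Suc i)" if "i < a + b" for i
  proof -
    consider "i < b" | "i = b" | "b < i" by linarith
    then show ?thesis
    proof cases
      case 2
      then have "0 < a" using that by simp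
      then have "J' b \<subseteq> U" "U \<subseteq> J 0" "J 0 \<subset> J 1" using J by (simp_all add: mchain_def)
      then show ?thesis using 2 by (auto simp: K_def)
    next
      case 3
      then have "J (i - b) \<subset> J (Suc (i - b))" using J that by (auto simp: mchain_def)
      then show ?thesis using 3 by (simp add: K_def Suc_diff_le)
    qed (use J that in \<open>auto simp: K_def mchain_def\<close>)
  qed
  have mem: "submod R (K i) \<and> W \<subseteq> K i \<and> K i \<subseteq> V" if "i \<le> a + b" for i
  proof (cases "i \<le> b")
    case True
    then have "submod R (J' i) \<and> W \<subseteq> J' i \<and> J' i \<subseteq> U" using J(2) by (auto simp: mchain_def)
    then show ?thesis using True assms by (auto simp: K_def)
  next
    case False
    then have "submod R (J (i - b)) \<and> U \<subseteq> J (i - b) \<and> J (i - b) \<subseteq> V"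
      using J(1) that by (simp add: mchain_def)
    then show ?thesis using False assms by (auto simp: K_def)
  qed
  have "mchain R V W (a + b) K"
    unfolding mchain_def using strict mem by auto
  then show "enat (a + b) \<le> rlen R V W"
    using assms by (subst enat_le_rlen_iff) auto
qed

lemma rlen_ge_1:
  assumes "submod R W" "submod R V" "W \<subset> V"
  shows "1 \<le> rlen R V W"
proof -
  have "mchain R V W 1 (\<lambda>i. if i = 0 then W else V)"
    using assms by (auto simp: mchain_def)
  then show ?thesis
    using assms enat_le_rlen_iff[of R W V 1] by (auto simp: one_enat_def)
qed

lemma rlen_self [simp]: "rlen R V V = 0"
proof (rule antisym)
  have "n = 0" if "mchain R V V n J" for n J
  proof (rule ccontr)
    assume "n \<noteq> 0"
    then have "J 0 \<subset> J 1" "J 0 \<subseteq> V" "V \<subseteq> J 0" "J 1 \<subseteq> V" 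
      using that by (auto simp: mchain_def)
    then show False by auto
  qed
  then show "rlen R V V \<le> 0"
    unfolding rlen_def by (intro Sup_least) (auto simp: zero_enat_def)
qed simp

lemma rlen_eq_0_iff:
  assumes "submod R W" "submod R V" "W \<subseteq> V"
  shows "rlen R V W = 0 \<longleftrightarrow> V = W"
  using assms rlen_ge_1[of R W V] by (metis not_one_le_zero psubsetI rlen_self)

text \<open>Along a strict chain \<open>J\<close> from \<open>W\<close> to \<open>V\<close>, both
  \<open>J i \<boxplus> U\<close> and \<open>J i \<inter> U\<close> can only grow, and the modular
  law forbids that both stay the same in one step. So the sum of their lengths over \<open>U\<close>
  and \<open>W\<close> increases by at least one in each step.\<close>

lemma rlen_additive:
  assumes sm: "submod R W" "submod R U" "submod R V" and sub: "W \<subseteq> U" "U \<subseteq> V"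
  shows "rlen R V W = rlen R V U + rlen R U W"
proof (rule antisym)
  show "rlen R V U + rlen R U W \<le> rlen R V W"
    by (rule rlen_superadditive[OF sm(1,2) sub])
next
  have step: "rlen R D W' + 1 \<le> rlen R Y W'" if "submod R D" "submod R Y" "submod R W'" "W' \<subseteq> D" "D \<subset> Y" for D Y W'
  proof -
    have "1 + rlen R D W' \<le> rlen R Y D + rlen R D W'"
      using rlen_ge_1[OF that(1,2,5)] by (rule add_right_mono)
    also have "\<dots> \<le> rlen R Y W'" using rlen_superadditive that by (intro rlen_superadditive) auto
    finally show ?thesis by (simp only: add.commute)
  qed
  show "rlen R V W \<le> rlen R V U + rlen R U W"
  proof (rule enat_leI)
    fix n assume "enat n \<le> rlen R V W"
    then obtain J where J: "mchain R V W n J" using assms by (auto simp: enat_le_rlen_iff)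
    have Jm: "submod R (J i)" "W \<subseteq> J i" "J i \<subseteq> V" if "i \<le> n" for i
      using J that by (auto simp: mchain_def)
    have "enat i \<le> rlen R (J i \<boxplus> U) U + rlen R (J i \<inter> U) W" if "i \<le> n" for i
      using that
    proof (induction i)
      case 0
      then show ?case by (simp add: zero_enat_def[symmetric])
    next
      case (Suc i)
      have IH: "enat i \<le> rlen R (J i \<boxplus> U) U + rlen R (J i \<inter> U) W"
        using Suc by simp
      have lt: "J i \<subset> J (Suc i)" using J Suc by (auto simp: mchain_def)
      let ?A = "J i" and ?B = "J (Suc i)"
      have A: "submod R ?A" "W \<subseteq> ?A" and B: "submod R ?B" "W \<subseteq> ?B" using Jm Suc by auto
      have sms: "submod R (?A \<boxplus> U)" "submod R (?B \<boxplus> U)" "submod R (?A \<inter> U)" "submod R (?B \<inter> U)"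
        by (auto intro!: submod_splus submod_Int A B sm)
      have U: "U \<subseteq> ?A \<boxplus> U" "U \<subseteq> ?B \<boxplus> U" using splus_upper2[OF A(1)] splus_upper2[OF B(1)] by blast+
      have le: "?A \<boxplus> U \<subseteq> ?B \<boxplus> U" "?A \<inter> U \<subseteq> ?B \<inter> U" using splus_mono[of ?A ?B U U] lt by blast+
      have m1: "rlen R (?A \<boxplus> U) U \<le> rlen R (?B \<boxplus> U) U"
        using rlen_mono[of R U U] sms U le sm by auto
      have m2: "rlen R (?A \<inter> U) W \<le> rlen R (?B \<inter> U) W"
        using rlen_mono[of R W W] sms A B sub le sm by auto
      have "?A \<boxplus> U \<subset> ?B \<boxplus> U \<or> ?A \<inter> U \<subset> ?B \<inter> U"
      proof (rule ccontr)
        assume "\<not> ?thesis"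
        then have eq: "?A \<boxplus> U = ?B \<boxplus> U" "?A \<inter> U = ?B \<inter> U" using le by auto
        have "?A = ?A \<boxplus> (U \<inter> ?A)" using splus_absorb[OF A(1) submod_Int[OF sm(2) A(1)]] by simp
        also have "\<dots> = ?A \<boxplus> (U \<inter> ?B)" using eq by (simp add: Int_commute)
        also have "\<dots> = (?A \<boxplus> U) \<inter> ?B" using modular_law[OF B(1), of ?A U] lt by simp
        also have "\<dots> = ?B" using eq splus_upper1[OF sm(2), of ?B] by blast
        finally show False using lt by simp
      qed
      then have "rlen R (?A \<boxplus> U) U + rlen R (?A \<inter> U) W + 1 \<le> rlen R (?B \<boxplus> U) U + rlen R (?B \<inter> U) W"
      proof
        assume "?A \<boxplus> U \<subset> ?B \<boxplus> U"
        then have "rlen R (?A \<boxplus> U) U + 1 \<le> rlen R (?B \<boxplus> U) U" by (rule step[OF sms(1,2) sm(2) U(1)])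
        from add_mono[OF this m2] show ?thesis by (simp only: ac_simps)
      next
        assume "?A \<inter> U \<subset> ?B \<inter> U"
        then have "rlen R (?A \<inter> U) W + 1 \<le> rlen R (?B \<inter> U) W" by (rule step[OF sms(3,4) sm(1) Int_greatest[OF A(2) sub(1)]])
        from add_mono[OF m1 this] show ?thesis by (simp only: ac_simps)
      qed
      moreover have "enat (Suc i) \<le> rlen R (?A \<boxplus> U) U + rlen R (?A \<inter> U) W + 1"
        using add_right_mono[OF IH, of 1] by (simp add: one_enat_def)
      ultimately show ?case by (rule order_trans[rotated])
    qed
    then have "enat n \<le> rlen R (J n \<boxplus> U) U + rlen R (J n \<inter> U) W" by simp
    also have "\<dots> \<le> rlen R V U + rlen R U W"
    proof (rule add_mono)
      show "rlen R (J n \<boxplus> U) U \<le> rlen R V U"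
        by (rule rlen_mono) (use sm sub Jm[of n] splus_least[OF sm(3)] splus_upper2[of R "J n" U] in auto)
      show "rlen R (J n \<inter> U) W \<le> rlen R U W"
        by (rule rlen_mono) (use sm sub Jm[of n] in auto)
    qed
    finally show "enat n \<le> rlen R V U + rlen R U W" .
  qed
qed

text \<open>Second isomorphism theorem on the level of chains: intersecting with \<open>V\<close>
  and adding \<open>U\<close> are mutually inverse on the submodules in question, again by the
  modular law. Most quotient isomorphisms below are instances, once the intersection has been
  identified.\<close>

lemma rlen_diamond:
  assumes "submod R U" "submod R V"
  shows "rlen R (V \<boxplus> U) U = rlen R V (V \<inter> U)"
proof -
  have sm: "submod R (V \<boxplus> U)" "submod R (V \<inter> U)"
    by (fact submod_splus[OF assms(2,1)], fact submod_Int[OF assms(2,1)])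
  have sub: "U \<subseteq> V \<boxplus> U" "V \<inter> U \<subseteq> V"
    by (fact splus_upper2[OF assms(2)], fact Int_lower1)
  have "rlen R (V \<boxplus> U) U \<le> rlen R V (V \<inter> U)"
  proof (rule enat_leI)
    fix n assume "enat n \<le> rlen R (V \<boxplus> U) U"
    then obtain J where J: "mchain R (V \<boxplus> U) U n J" using enat_le_rlen_iff[OF assms(1) sub(1)] by blast
    have eq: "J i = U \<boxplus> (V \<inter> J i)" if "i \<le> n" for i
    proof -
      have m: "submod R (J i)" "U \<subseteq> J i" "J i \<subseteq> V \<boxplus> U" using J that by (auto simp: mchain_def)
      have "(U \<boxplus> V) \<inter> J i = J i" using m(3) by (subst splus_commute) blast
      then show ?thesis using modular_law[OF m(1,2), of V] by simp
    qed
    have "V \<inter> J i \<subset> V \<inter> J (Suc i)" if "i < n" for i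
    proof -
      have "J i \<subset> J (Suc i)" using J that by (auto simp: mchain_def)
      moreover have "V \<inter> J i \<noteq> V \<inter> J (Suc i)"
        using eq[of i] eq[of "Suc i"] that calculation by fastforce
      ultimately show ?thesis by blast
    qed
    then have "mchain R V (V \<inter> U) n (\<lambda>i. V \<inter> J i)"
      using J submod_Int[OF assms(2)] unfolding mchain_def by blast
    then show "enat n \<le> rlen R V (V \<inter> U)"
      using enat_le_rlen_iff[OF sm(2) sub(2)] by blast
  qed
  moreover have "rlen R V (V \<inter> U) \<le> rlen R (V \<boxplus> U) U"
  proof (rule enat_leI)
    fix n assume "enat n \<le> rlen R V (V \<inter> U)"
    then obtain J where J: "mchain R V (V \<inter> U) n J" using enat_le_rlen_iff[OF sm(2) sub(2)] by blast
    have eq: "J i = (J i \<boxplus> U) \<inter> V" if "i \<le> n" for i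
    proof -
      have m: "submod R (J i)" "J i \<subseteq> V" "V \<inter> U \<subseteq> J i" using J that by (auto simp: mchain_def)
      have "(J i \<boxplus> U) \<inter> V = J i \<boxplus> (U \<inter> V)" using modular_law[OF assms(2) m(2)] .
      also have "\<dots> = J i" using splus_absorb[OF m(1), of "U \<inter> V"] sm m by (simp add: Int_commute)
      finally show ?thesis by simp
    qed
    have "J i \<boxplus> U \<subset> J (Suc i) \<boxplus> U" if "i < n" for i
    proof -
      have "J i \<subset> J (Suc i)" using J that by (auto simp: mchain_def)
      moreover have "J i \<boxplus> U \<noteq> J (Suc i) \<boxplus> U"
        using eq[of i] eq[of "Suc i"] that calculation by fastforce
      ultimately show ?thesis using splus_mono[of "J i" "J (Suc i)" U U] by blast
    qed
    moreover have "submod R (J i \<boxplus> U) \<and> U \<subseteq> J i \<boxplus> U \<and> J i \<boxplus> U \<subseteq> V \<boxplus> U" if "i \<le> n" for i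
    proof -
      have m: "submod R (J i)" "J i \<subseteq> V" using J that by (auto simp: mchain_def)
      show ?thesis using submod_splus[OF m(1) assms(1)] splus_upper2[OF m(1)] splus_mono[OF m(2) order_refl] by blast
    qed
    ultimately have "mchain R (V \<boxplus> U) U n (\<lambda>i. J i \<boxplus> U)"
      by (auto simp: mchain_def)
    then show "enat n \<le> rlen R (V \<boxplus> U) U"
      using enat_le_rlen_iff[OF assms(1) sub(1)] by blast
  qed
  ultimately show ?thesis by (rule antisym)
qed

lemma smul_smul: "a *\<^sub>S b *\<^sub>S V = (a * b) *\<^sub>S V"
proof -
  have "c \<in> a *\<^sub>S b *\<^sub>S V \<longleftrightarrow> c \<in> (a * b) *\<^sub>S V" for c
    unfolding smul_def mem_Collect_eq by (metis mult.assoc)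
  then show ?thesis by blast
qed

lemma smul_1 [simp]: "1 *\<^sub>S V = V"
  by (auto simp: smul_def)

lemma smul_inverse:
  fixes c :: "'a::field"
  assumes "c \<noteq> 0" shows "c *\<^sub>S inverse c *\<^sub>S V = V" "inverse c *\<^sub>S c *\<^sub>S V = V"
  using assms by (simp_all add: smul_smul)

text \<open>Scaling by a nonzero field element permutes the submodules of the field, with scaling by
  \<open>inverse c\<close> as inverse. It plays the part of the isomorphism given by multiplication
  with a ring element.\<close>

lemma rlen_smul:
  fixes c :: "'a::field"
  assumes "submod R W" "W \<subseteq> V" "c \<noteq> 0"
  shows "rlen R (c *\<^sub>S V) (c *\<^sub>S W) = rlen R V W"
proof -
  have le: "rlen R V W \<le> rlen R (c *\<^sub>S V) (c *\<^sub>S W)" if hyp: "submod R W" "W \<subseteq> V" "c \<noteq> 0" for c :: 'a and V W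
  proof (rule enat_leI)
    fix n assume "enat n \<le> rlen R V W"
    then obtain J where J: "mchain R V W n J" using enat_le_rlen_iff[OF hyp(1,2)] by blast
    have "c *\<^sub>S J i \<subset> c *\<^sub>S J (Suc i)" if "i < n" for i
    proof -
      have "J i \<subset> J (Suc i)" using J that by (auto simp: mchain_def)
      then have "c *\<^sub>S J i \<subseteq> c *\<^sub>S J (Suc i)" "J i \<noteq> J (Suc i)" by (auto simp only: psubset_eq intro!: smul_mono)
      moreover have "c *\<^sub>S J i = c *\<^sub>S J (Suc i) \<Longrightarrow> J i = J (Suc i)"
        using smul_inverse(2)[OF \<open>c \<noteq> 0\<close>] by metis
      ultimately show ?thesis by blast
    qed
    then have "mchain R (c *\<^sub>S V) (c *\<^sub>S W) n (\<lambda>i. c *\<^sub>S J i)"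
      using J unfolding mchain_def by (metis submod_smul smul_mono)
    then show "enat n \<le> rlen R (c *\<^sub>S V) (c *\<^sub>S W)"
      using enat_le_rlen_iff[OF submod_smul[OF hyp(1)] smul_mono[OF hyp(2)]] by blast
  qed
  show ?thesis
  proof (rule antisym)
    show "rlen R (c *\<^sub>S V) (c *\<^sub>S W) \<le> rlen R V W"
      using le[OF submod_smul[OF assms(1)] smul_mono[OF assms(2)] nonzero_imp_inverse_nonzero[OF assms(3)], of c]
      by (simp only: smul_inverse[OF assms(3)])
  qed (rule le[OF assms])
qed

lemma enat_add_self_eq: "n = m + (n::enat) \<longleftrightarrow> n = \<infinity> \<or> m = 0"
  by (cases n; cases m) (simp_all add: enat_0_iff)

text \<open>An injective endomorphism of a subquotient of finite length is surjective.\<close>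

lemma splus_smul_eq:
  fixes v :: "'a::field"
  assumes sm: "submod R J" "submod R B" and "J \<subseteq> B" and v: "v *\<^sub>S B \<subseteq> B" "v *\<^sub>S J \<subseteq> J" "v \<noteq> 0"
    and inj: "\<And>b. b \<in> B \<Longrightarrow> v * b \<in> J \<Longrightarrow> b \<in> J" and fin: "rlen R B J \<noteq> \<infinity>"
  shows "B = v *\<^sub>S B \<boxplus> J"
proof -
  have eq: "v *\<^sub>S B \<inter> J = v *\<^sub>S J"
  proof
    show "v *\<^sub>S B \<inter> J \<subseteq> v *\<^sub>S J" 
    proof
      fix w assume w: "w \<in> v *\<^sub>S B \<inter> J"
      then obtain b where "b \<in> B" "w = v * b" by (auto elim: smulE)
      then show "w \<in> v *\<^sub>S J" using w inj[of b] smulI[of b J v] by simp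
    qed
    show "v *\<^sub>S J \<subseteq> v *\<^sub>S B \<inter> J" using smul_mono[OF \<open>J \<subseteq> B\<close>] v(2) by blast
  qed
  have smv: "submod R (v *\<^sub>S B)" "submod R (v *\<^sub>S B \<boxplus> J)" by (intro submod_smul submod_splus sm)+
  have point_mult: "rlen R (v *\<^sub>S B \<boxplus> J) J = rlen R B J"
    using rlen_diamond[OF sm(1) smv(1)] eq rlen_smul[OF sm(1) \<open>J \<subseteq> B\<close> v(3)] by simp
  have sub: "v *\<^sub>S B \<boxplus> J \<subseteq> B" "J \<subseteq> v *\<^sub>S B \<boxplus> J"
    by (intro splus_least[OF sm(2) v(1) \<open>J \<subseteq> B\<close>] splus_upper2[OF smv(1)])+
  have "rlen R B J = rlen R B (v *\<^sub>S B \<boxplus> J) + rlen R B J"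
    using rlen_additive[OF sm(1) smv(2) sm(2) sub(2,1)] unfolding point_mult .
  then have "rlen R B (v *\<^sub>S B \<boxplus> J) = 0"
    using fin by (simp add: enat_add_self_eq)
  then show ?thesis using rlen_eq_0_iff[OF smv(2) sm(2) sub(1)] by blast
qed

section \<open>Subrings of a field and their ideals\<close>

definition is_subring :: "'a::comm_ring_1 set \<Rightarrow> bool" where
  "is_subring B \<longleftrightarrow> 1 \<in> B \<and> (\<forall>a\<in>B. \<forall>b\<in>B. a - b \<in> B \<and> a * b \<in> B)"

definition is_subfield :: "'a::comm_ring_1 set \<Rightarrow> bool" where
  "is_subfield k \<longleftrightarrow> is_subring k \<and> (\<forall>c\<in>k. c \<noteq> 0 \<longrightarrow> (\<exists>d\<in>k. d * c = 1))"

definition is_prime :: "'a::comm_ring_1 set \<Rightarrow> 'a set \<Rightarrow> bool" where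
  "is_prime B P \<longleftrightarrow> submod B P \<and> P \<subseteq> B \<and> 1 \<notin> P \<and> (\<forall>a\<in>B. \<forall>b\<in>B. a * b \<in> P \<longrightarrow> a \<in> P \<or> b \<in> P)"

lemma is_subring_submod: "is_subring B \<Longrightarrow> submod B B"
  unfolding is_subring_def submod_def by (metis diff_self)

lemma is_subring_1: "is_subring B \<Longrightarrow> 1 \<in> B"
  and is_subring_mult: "is_subring B \<Longrightarrow> a \<in> B \<Longrightarrow> b \<in> B \<Longrightarrow> a * b \<in> B"
  and is_subring_diff: "is_subring B \<Longrightarrow> a \<in> B \<Longrightarrow> b \<in> B \<Longrightarrow> a - b \<in> B"
  by (auto simp: is_subring_def)

lemmas is_subring_0 = submod_zero[OF is_subring_submod]
lemmas is_subring_add = submod_add[OF is_subring_submod]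
lemmas is_subring_uminus = submod_uminus[OF is_subring_submod]

lemma is_subring_power: "is_subring B \<Longrightarrow> a \<in> B \<Longrightarrow> a ^ n \<in> B"
  by (induction n) (simp_all add: is_subring_1 is_subring_mult)

lemma submod_trivial: "submod R {0}"
  by (simp add: submod_def)

lemma mem_smul_self: "is_subring B \<Longrightarrow> F \<in> F *\<^sub>S B"
  using smulI[OF is_subring_1] by fastforce

lemma subring_of_simps [simp]:
  "carrier (subring_of B) = B"
  "monoid.mult (subring_of B) = (*)"
  "one (subring_of B) = 1"
  "zero (subring_of B) = 0"
  "add (subring_of B) = (+)"
  by (simp_all add: subring_of_def ring_of_type_algebra_def)

lemma cring_subring_of:
  assumes "is_subring B" shows "cring (subring_of B)"
proof (rule cringI)
  show "abelian_group (subring_of B)"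
  proof (rule abelian_groupI)
    fix x assume x: "x \<in> carrier (subring_of B)"
    show "\<exists>y\<in>carrier (subring_of B). y \<oplus>\<^bsub>subring_of B\<^esub> x = \<zero>\<^bsub>subring_of B\<^esub>"
      using is_subring_uminus[OF assms] x by (intro bexI[of _ "- x"]) simp_all
  qed (use assms in \<open>simp_all add: is_subring_add is_subring_0 algebra_simps\<close>)
  show "comm_monoid (subring_of B)"
    by (rule comm_monoidI) (use assms in \<open>simp_all add: is_subring_mult is_subring_1 algebra_simps\<close>)
qed (simp add: algebra_simps)

lemma ideal_subring_of_iff:
  assumes "is_subring B" shows "ideal J (subring_of B) \<longleftrightarrow> submod B J \<and> J \<subseteq> B"
proof
  interpret cring "subring_of B" by (rule cring_subring_of[OF assms])
  assume "ideal J (subring_of B)"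
  then interpret J: ideal J "subring_of B" .
  have minus: "\<ominus>\<^bsub>subring_of B\<^esub> x = - x" if "x \<in> B" for x
    by (rule minus_equality) (use that is_subring_uminus[OF assms] in simp_all)
  have sub: "J \<subseteq> B" using J.a_subset by simp
  have "submod B J"
  proof (rule submodI)
    show "0 \<in> J" using J.zero_closed by simp
  next
    fix u v assume uv: "u \<in> J" "v \<in> J"
    then have "u \<oplus>\<^bsub>subring_of B\<^esub> (\<ominus>\<^bsub>subring_of B\<^esub> v) \<in> J" by (intro J.a_closed J.a_inv_closed)
    then show "u - v \<in> J" using minus[of v] uv sub by (simp add: subset_iff)
  next
    fix r v assume "r \<in> B" "v \<in> J"
    then show "r * v \<in> J" using J.I_l_closed[of v r] by simp
  qed
  with sub show "submod B J \<and> J \<subseteq> B" by simp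
next
  interpret cring "subring_of B" by (rule cring_subring_of[OF assms])
  assume J: "submod B J \<and> J \<subseteq> B"
  have minus: "\<ominus>\<^bsub>subring_of B\<^esub> x = - x" if "x \<in> B" for x
    by (rule minus_equality) (use that is_subring_uminus[OF assms] in simp_all)
  show "ideal J (subring_of B)"
  proof (rule idealI)
    show "ring (subring_of B)" by (rule ring_axioms)
    show "subgroup J (add_monoid (subring_of B))"
    proof (rule add.subgroupI)
      fix a assume "a \<in> J"
      then show "\<ominus>\<^bsub>subring_of B\<^esub> a \<in> J"
        using J minus[of a] submod_uminus[of B J a] by (simp add: subset_iff)
    qed (use J submod_zero submod_add in \<open>force simp: \<close>)+
    fix a x assume "a \<in> J" "x \<in> carrier (subring_of B)"
    then show "x \<otimes>\<^bsub>subring_of B\<^esub> a \<in> J" "a \<otimes>\<^bsub>subring_of B\<^esub> x \<in> J"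
      using J submod_mult[of B J x a] by (simp_all add: mult.commute)
  qed
qed

lemma quot_length_subring_of:
  assumes "is_subring B" "M \<subseteq> B"
  shows "quot_length (subring_of B) M N = rlen B M N"
proof -
  have "(\<forall>i\<le>n. ideal (J i) (subring_of B) \<and> N \<subseteq> J i \<and> J i \<subseteq> M) \<longleftrightarrow>
      (\<forall>i\<le>n. submod B (J i) \<and> N \<subseteq> J i \<and> J i \<subseteq> M)" for n and J :: "nat \<Rightarrow> 'a set"
    using ideal_subring_of_iff[OF assms(1)] assms(2) by (metis order_trans)
  then show ?thesis unfolding quot_length_def rlen_def mchain_def by (simp only:)
qed

lemma genideal_subring_of_eq:
  assumes "is_subring B" "submod B I" "I \<subseteq> B" "S \<subseteq> I"
    and "\<And>J. submod B J \<Longrightarrow> S \<subseteq> J \<Longrightarrow> I \<subseteq> J"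
  shows "Idl\<^bsub>subring_of B\<^esub> S = I"
proof -
  have "ideal I (subring_of B)" using assms by (simp add: ideal_subring_of_iff)
  moreover have "I \<subseteq> J" if "ideal J (subring_of B)" "S \<subseteq> J" for J
    using that assms(5)[of J] by (simp add: ideal_subring_of_iff[OF assms(1)])
  ultimately show ?thesis unfolding genideal_def using assms(4) by blast
qed

lemma smul_subset_submod:
  assumes "submod B J" "F \<in> J" shows "F *\<^sub>S B \<subseteq> J"
proof
  fix w assume "w \<in> F *\<^sub>S B"
  then obtain b where "b \<in> B" "w = F * b" by (rule smulE)
  then show "w \<in> J" using submod_mult[OF assms(1) _ assms(2), of b] by (simp add: mult.commute)
qed

lemma genideal_pair:
  assumes B: "is_subring B" and "F \<in> B" "G \<in> B"
  shows "Idl\<^bsub>subring_of B\<^esub> {F, G} = F *\<^sub>S B \<boxplus> G *\<^sub>S B"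
proof (rule genideal_subring_of_eq[OF B])
  note sm = submod_smul[OF is_subring_submod[OF B]]
  show "submod B (F *\<^sub>S B \<boxplus> G *\<^sub>S B)" by (intro submod_splus sm)
  show "F *\<^sub>S B \<boxplus> G *\<^sub>S B \<subseteq> B"
    by (intro splus_least[OF is_subring_submod[OF B]] smul_subset_submod is_subring_submod assms)
  have "F \<in> F *\<^sub>S B \<boxplus> G *\<^sub>S B" "G \<in> F *\<^sub>S B \<boxplus> G *\<^sub>S B"
    using splus_upper1[OF sm] splus_upper2[OF sm] mem_smul_self[OF B] by (meson subsetD)+
  then show "{F, G} \<subseteq> F *\<^sub>S B \<boxplus> G *\<^sub>S B" by simp
  show "F *\<^sub>S B \<boxplus> G *\<^sub>S B \<subseteq> J" if "submod B J" "{F, G} \<subseteq> J" for J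
    using that by (intro splus_least smul_subset_submod) simp_all
qed

lemma genideal_insert:
  assumes B: "is_subring B" and "F \<in> B" and I: "submod B I" "I \<subseteq> B"
  shows "Idl\<^bsub>subring_of B\<^esub> (insert F I) = F *\<^sub>S B \<boxplus> I"
proof (rule genideal_subring_of_eq[OF B])
  note sm = submod_smul[OF is_subring_submod[OF B], of F]
  show "submod B (F *\<^sub>S B \<boxplus> I)" by (intro submod_splus sm I)
  show "F *\<^sub>S B \<boxplus> I \<subseteq> B"
    by (intro splus_least[OF is_subring_submod[OF B]] smul_subset_submod is_subring_submod assms)
  have "F \<in> F *\<^sub>S B \<boxplus> I" using splus_upper1[OF I(1)] mem_smul_self[OF B] by (rule subsetD)
  then show "insert F I \<subseteq> F *\<^sub>S B \<boxplus> I" using splus_upper2[OF sm] by simp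
  show "F *\<^sub>S B \<boxplus> I \<subseteq> J" if "submod B J" "insert F I \<subseteq> J" for J
    using that by (intro splus_least smul_subset_submod) simp_all
qed

lemma ideal_prod_pair:
  assumes B: "is_subring B" and "F \<in> B" "G \<in> B" and I: "submod B I"
  shows "ideal_prod (subring_of B) I (F *\<^sub>S B \<boxplus> G *\<^sub>S B) = F *\<^sub>S I \<boxplus> G *\<^sub>S I"
    (is "?P = ?S")
proof
  have sm: "submod B ?S" by (intro submod_splus submod_smul I)
  show "?P \<subseteq> ?S"
  proof
    fix w assume "w \<in> ?P"
    then show "w \<in> ?S"
    proof (induction w)
      case (prod i j)
      then obtain a b where ab: "a \<in> B" "b \<in> B" "j = F * a + G * b" by (auto elim!: splusE smulE)
      have "F * (a * i) + G * (b * i) \<in> ?S"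
        using prod ab by (intro splusI smulI submod_mult[OF I])
      then show ?case using ab by (simp add: algebra_simps)
    next
      case (sum s1 s2)
      then show ?case using submod_add[OF sm] by simp
    qed
  qed
  show "?S \<subseteq> ?P"
  proof
    fix w assume "w \<in> ?S"
    then obtain u v where uv: "u \<in> I" "v \<in> I" "w = F * u + G * v" by (auto elim!: splusE smulE)
    have "F \<in> F *\<^sub>S B \<boxplus> G *\<^sub>S B" "G \<in> F *\<^sub>S B \<boxplus> G *\<^sub>S B"
      using splus_upper1[OF submod_smul[OF is_subring_submod[OF B]]] splus_upper2[OF submod_smul[OF is_subring_submod[OF B]]]
        mem_smul_self[OF B] by (meson subsetD)+
    then have "u * F \<in> ?P" "v * G \<in> ?P"
      using uv ideal_prod.prod[of _ I _ "F *\<^sub>S B \<boxplus> G *\<^sub>S B" "subring_of B"] by simp_all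
    from ideal_prod.sum[OF this] show "w \<in> ?P" using uv by (simp add: mult.commute)
  qed
qed

lemma ideal_power_simps [simp]:
  "monoid.mult (ideals_set R) = ideal_prod R"
  "one (ideals_set R) = carrier R"
  unfolding ideals_set_def by simp_all

lemma submod_ideal_power_pair:
  assumes "is_subring B" "F \<in> B" "G \<in> B"
  shows "submod B (ideal_power (subring_of B) (Idl\<^bsub>subring_of B\<^esub> {F, G}) n)"
  using assms
  by (induction n) (simp_all add: genideal_pair ideal_prod_pair is_subring_submod submod_splus submod_smul)

lemma ideal_power_pair_Suc:
  assumes "is_subring B" "F \<in> B" "G \<in> B"
  defines "P \<equiv> ideal_power (subring_of B) (Idl\<^bsub>subring_of B\<^esub> {F, G})"
  shows "P (Suc n) = F *\<^sub>S P n \<boxplus> G *\<^sub>S P n"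
  using submod_ideal_power_pair[OF assms(1-3), of n] assms(1-3)
  unfolding P_def by (simp add: genideal_pair ideal_prod_pair)

section \<open>Prime and maximal ideals of subrings, and a criterion for dimension two\<close>

lemma primeideal_subring_of_iff:
  assumes "is_subring B" shows "primeideal P (subring_of B) \<longleftrightarrow> is_prime B P"
proof
  assume "primeideal P (subring_of B)"
  then interpret P: primeideal P "subring_of B" .
  have "submod B P" "P \<subseteq> B" using P.is_ideal ideal_subring_of_iff[OF assms] by auto
  moreover have "1 \<notin> P"
    using P.one_imp_carrier P.I_notcarr by auto
  ultimately show "is_prime B P" using P.I_prime unfolding is_prime_def by simp
next
  assume P: "is_prime B P"
  show "primeideal P (subring_of B)"
  proof (rule primeidealI)
    show "ideal P (subring_of B)" using P ideal_subring_of_iff[OF assms] by (simp add: is_prime_def)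
    show "cring (subring_of B)" by (rule cring_subring_of[OF assms])
    show "carrier (subring_of B) \<noteq> P" using P is_subring_1[OF assms] by (auto simp: is_prime_def)
  qed (use P in \<open>simp add: is_prime_def\<close>)
qed

lemma maximalideal_subring_of_iff:
  assumes "is_subring B"
  shows "maximalideal M (subring_of B) \<longleftrightarrow>
    submod B M \<and> M \<subseteq> B \<and> 1 \<notin> M \<and> (\<forall>J. submod B J \<and> M \<subseteq> J \<and> J \<subseteq> B \<longrightarrow> J = M \<or> J = B)"
proof
  assume "maximalideal M (subring_of B)"
  then interpret M: maximalideal M "subring_of B" .
  have "submod B M" "M \<subseteq> B" using M.is_ideal ideal_subring_of_iff[OF assms] by auto
  moreover have "1 \<notin> M"
    using M.one_imp_carrier M.I_notcarr by auto
  ultimately show "submod B M \<and> M \<subseteq> B \<and> 1 \<notin> M \<and> (\<forall>J. submod B J \<and> M \<subseteq> J \<and> J \<subseteq> B \<longrightarrow> J = M \<or> J = B)"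
    using M.I_maximal ideal_subring_of_iff[OF assms] by simp
next
  assume M: "submod B M \<and> M \<subseteq> B \<and> 1 \<notin> M \<and> (\<forall>J. submod B J \<and> M \<subseteq> J \<and> J \<subseteq> B \<longrightarrow> J = M \<or> J = B)"
  show "maximalideal M (subring_of B)"
  proof (rule maximalidealI)
    show "ideal M (subring_of B)" using M ideal_subring_of_iff[OF assms] by simp
    show "carrier (subring_of B) \<noteq> M" using M is_subring_1[OF assms] by auto
  qed (use M ideal_subring_of_iff[OF assms] in simp)
qed

lemma maximalideal_imp_is_prime:
  assumes "is_subring B" "maximalideal M (subring_of B)" shows "is_prime B M"
proof -
  interpret cring "subring_of B" by (rule cring_subring_of[OF assms(1)])
  show ?thesis using maximalideal_prime[OF assms(2)] primeideal_subring_of_iff[OF assms(1)] by simp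
qed

lemma submod_eq_if_1_mem:
  assumes "is_subring B" "submod B J" "J \<subseteq> B" "1 \<in> J" shows "J = B"
  using submod_mult[OF assms(2) _ assms(4)] assms(3) by auto

text \<open>In a chain of four primes the second is nonzero, hence \<open>max\<close> puts
  \<open>M\<close> inside the third, and the fourth would lie strictly above \<open>M\<close>,
  against \<open>loc\<close>. The later dimension computations consist in supplying \<open>Q\<close>
  and checking \<open>max\<close>.\<close>

lemma krull_dim_eq_2:
  assumes B: "is_subring B" and chain: "is_prime B {0}" "is_prime B Q" "is_prime B M" "{0} \<subset> Q" "Q \<subset> M"
    and loc: "\<And>P. is_prime B P \<Longrightarrow> P \<subseteq> M"
    and max: "\<And>P P'. is_prime B P \<Longrightarrow> is_prime B P' \<Longrightarrow> P \<noteq> {0} \<Longrightarrow> P \<subset> P' \<Longrightarrow> M \<subseteq> P'"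
  shows "krull_dim (subring_of B) = 2"
proof -
  have "krull_dim (subring_of B) = Sup {enat n |n. \<exists>P. (\<forall>i\<le>n. is_prime B (P i)) \<and> (\<forall>i<n. P i \<subset> P (Suc i))}"
    unfolding krull_dim_def primeideal_subring_of_iff[OF B] ..
  also have "\<dots> = enat 2"
  proof (rule antisym)
    show "Sup {enat n |n. \<exists>P. (\<forall>i\<le>n. is_prime B (P i)) \<and> (\<forall>i<n. P i \<subset> P (Suc i))} \<le> enat 2"
    proof (rule Sup_least)
      fix x assume "x \<in> {enat n |n. \<exists>P. (\<forall>i\<le>n. is_prime B (P i)) \<and> (\<forall>i<n. P i \<subset> P (Suc i))}"
      then have "\<exists>n. x = enat n \<and> (\<exists>P. (\<forall>i\<le>n. is_prime B (P i)) \<and> (\<forall>i<n. P i \<subset> P (Suc i)))" by (rule CollectD)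
      then obtain n where n: "x = enat n" and ex: "\<exists>P. (\<forall>i\<le>n. is_prime B (P i)) \<and> (\<forall>i<n. P i \<subset> P (Suc i))"
        by (elim exE conjE) (rule that, assumption, intro exI conjI)
      obtain P where "(\<forall>i\<le>n. is_prime B (P i)) \<and> (\<forall>i<n. P i \<subset> P (Suc i))" using ex by (rule exE)
      then have P: "\<And>i. i \<le> n \<Longrightarrow> is_prime B (P i)" "\<And>i. i < n \<Longrightarrow> P i \<subset> P (Suc i)" by simp_all
      have "n \<le> 2"
      proof (rule ccontr)
        assume "\<not> n \<le> 2"
        then have le: "0 \<le> n" "Suc 0 \<le> n" "Suc (Suc 0) \<le> n" "Suc (Suc (Suc 0)) \<le> n" by linarith+
        note p = le[THEN P(1)]
        have lt: "P 0 \<subset> P (Suc 0)" "P (Suc 0) \<subset> P (Suc (Suc 0))" "P (Suc (Suc 0)) \<subset> P (Suc (Suc (Suc 0)))"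
          using le by (intro P(2), linarith)+
        have "0 \<in> P 0" using p(1) submod_zero[of B "P 0"] unfolding is_prime_def by simp
        moreover obtain z where "z \<in> P (Suc 0)" "z \<notin> P 0" using psubset_imp_ex_mem[OF lt(1)] by (elim exE DiffE)
        ultimately have "P (Suc 0) \<noteq> {0}" by (metis singletonD)
        then have "M \<subseteq> P (Suc (Suc 0))" by (rule max[OF p(2,3) _ lt(2)])
        then show False using lt(3) loc[OF p(4)] by blast
      qed
      then show "x \<le> enat 2" using n by simp
    qed
    define p where "p i = (if i = 0 then {0} else if i = 1 then Q else M)" for i :: nat
    have "\<forall>i\<le>2. is_prime B (p i)" using chain(1-3) by (simp add: p_def)
    moreover have "\<forall>i<2. p i \<subset> p (Suc i)"
    proof (intro allI impI)
      fix i :: nat assume "i < 2"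
      then have "i = 0 \<or> i = 1" by linarith
      then show "p i \<subset> p (Suc i)"
        using chain(4,5) unfolding p_def by (elim disjE) (simp_all only: One_nat_def nat.simps if_True if_False simp_thms)
    qed
    ultimately have "\<exists>P. (\<forall>i\<le>2. is_prime B (P i)) \<and> (\<forall>i<2. P i \<subset> P (Suc i))"
      by (intro exI[of _ p] conjI)
    then show "enat 2 \<le> Sup {enat n |n. \<exists>P. (\<forall>i\<le>n. is_prime B (P i)) \<and> (\<forall>i<n. P i \<subset> P (Suc i))}"
      by (intro Sup_upper CollectI exI[of _ "2::nat"] conjI refl)
  qed
  finally show ?thesis unfolding numeral_eq_enat .
qed

section \<open>Length over a local ring and dimension over its residue field\<close>

lemma rlen_cyclic_le:
  assumes k: "is_subfield k" and W: "submod k W"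
  shows "rlen k (v *\<^sub>S k \<boxplus> W) W \<le> 1"
proof -
  let ?V = "v *\<^sub>S k \<boxplus> W"
  have k': "is_subring k" using k by (simp add: is_subfield_def)
  have smV: "submod k ?V" by (intro submod_splus submod_smul is_subring_submod k' W)
  have all: "J = ?V" if J: "submod k J" "W \<subset> J" "J \<subseteq> ?V" for J
  proof -
    obtain j where j: "j \<in> J" "j \<notin> W" using J(2) by blast
    then have "j \<in> ?V" using J(3) by blast
    then obtain c w where cw: "c \<in> k" "w \<in> W" "j = v * c + w" by (auto elim!: splusE smulE)
    have "c \<noteq> 0" using cw j by auto
    then obtain d where d: "d \<in> k" "d * c = 1" using k cw(1) by (auto simp: is_subfield_def)
    have "v * c \<in> J" using submod_diff[OF J(1) j(1), of w] cw J(2) by auto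
    then have "d * (v * c) \<in> J" using submod_mult[OF J(1) d(1)] by blast
    moreover have "d * (v * c) = (d * c) * v" by (simp add: algebra_simps)
    ultimately have "v \<in> J" using d(2) by simp
    then have "?V \<subseteq> J" using J(1,2) by (intro splus_least smul_subset_submod) auto
    with J(3) show ?thesis by blast
  qed
  have "n \<le> 1" if ch: "mchain k ?V W n J" for n J
  proof (rule ccontr)
    assume "\<not> n \<le> 1"
    then have le: "0 < n" "Suc 0 < n" "Suc (Suc 0) \<le> n" by linarith+
    have J: "W \<subseteq> J 0" "J 0 \<subset> J (Suc 0)" "J (Suc 0) \<subset> J (Suc (Suc 0))" "J (Suc (Suc 0)) \<subseteq> ?V" "submod k (J (Suc 0))"
      using ch le unfolding mchain_def by simp_all
    then have "J (Suc 0) = ?V" by (intro all) blast+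
    with J show False by blast
  qed
  then show ?thesis unfolding rlen_def by (intro Sup_least) (auto simp: one_enat_def)
qed

lemma rlen_cyclic:
  assumes k: "is_subfield k" and W: "submod k W" and v: "v \<notin> W"
  shows "rlen k (v *\<^sub>S k \<boxplus> W) W = 1"
proof (rule antisym[OF rlen_cyclic_le[OF k W]])
  have k': "is_subring k" using k by (simp add: is_subfield_def)
  have "v \<in> v *\<^sub>S k \<boxplus> W" using subsetD[OF splus_upper1[OF W] mem_smul_self[OF k']] .
  then show "1 \<le> rlen k (v *\<^sub>S k \<boxplus> W) W"
    using splus_upper2[OF submod_smul[OF is_subring_submod[OF k']], of W v] v
    by (intro rlen_ge_1 submod_splus submod_smul is_subring_submod k' W) blast
qed

text \<open>
  Over a local ring with residue field \<open>k\<close> length and dimension agree: a minimal overmodule is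
  generated by one element over the ring, so by Nakayama's lemma also over \<open>k\<close>.
\<close>

lemma rlen_local_ring:
  assumes R: "is_subring R" and k: "is_subfield k" "k \<subseteq> R" and N: "submod R N" "N \<subseteq> R"
    and res: "\<And>r. r \<in> R \<Longrightarrow> \<exists>c\<in>k. r - c \<in> N"
    and unit: "\<And>u. u \<in> N \<Longrightarrow> \<exists>w\<in>R. w * (1 - u) = 1"
    and V: "submod R V" and W: "submod R W" and sub: "W \<subseteq> V"
  shows "rlen k V W = rlen R V W"
proof (rule antisym)
  have k': "is_subring k" using k by (simp add: is_subfield_def)
  note Rk = submod_subset[OF _ k(2)]
  show "rlen R V W \<le> rlen k V W"
  proof (rule enat_leI)
    fix n assume "enat n \<le> rlen R V W"
    then obtain J where "mchain R V W n J" using enat_le_rlen_iff[OF W sub] by blast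
    then have "mchain k V W n J" using Rk unfolding mchain_def by simp
    then show "enat n \<le> rlen k V W" using enat_le_rlen_iff[OF Rk[OF W] sub] by blast
  qed
  have simple: "rlen k V W \<le> 1"
    if V: "submod R V" and W: "submod R W" and sub: "W \<subset> V"
      and min: "\<And>J. submod R J \<Longrightarrow> W \<subseteq> J \<Longrightarrow> J \<subseteq> V \<Longrightarrow> J = W \<or> J = V" for V W
  proof -
    obtain v where v: "v \<in> V" "v \<notin> W" using sub by blast
    have gen: "v *\<^sub>S R \<boxplus> W = V"
    proof -
      have "v \<in> v *\<^sub>S R \<boxplus> W" using subsetD[OF splus_upper1[OF W] mem_smul_self[OF R]] .
      moreover have "v *\<^sub>S R \<boxplus> W \<subseteq> V"
        using sub by (intro splus_least[OF V] smul_subset_submod[OF V v(1)]) auto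
      ultimately show ?thesis
        using min[of "v *\<^sub>S R \<boxplus> W"] v(2) submod_splus[OF submod_smul[OF is_subring_submod[OF R]] W]
          splus_upper2[OF submod_smul[OF is_subring_submod[OF R]], of W v] by blast
    qed
    have vN: "v *\<^sub>S N \<subseteq> W"
    proof -
      let ?J = "v *\<^sub>S N \<boxplus> W"
      have "submod R ?J" by (intro submod_splus submod_smul N W)
      moreover have "W \<subseteq> ?J" by (rule splus_upper2[OF submod_smul[OF N(1)]])
      moreover have "?J \<subseteq> V" using gen splus_mono[OF smul_mono[OF N(2)] order_refl] by blast
      ultimately have "?J = W \<or> ?J = V" by (rule min)
      moreover have "?J \<noteq> V"
      proof
        assume "?J = V"
        then have "v \<in> ?J" using v by simp
        then obtain u w where uw: "u \<in> N" "w \<in> W" "v = v * u + w" by (auto elim!: splusE smulE)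
        obtain x where x: "x \<in> R" "x * (1 - u) = 1" using unit[OF uw(1)] by blast
        have "w = (1 - u) * v" using uw(3) by (simp add: algebra_simps)
        then have "x * w = v" using x(2) by (simp add: mult.assoc[symmetric])
        then show False using submod_mult[OF W x(1) uw(2)] v by simp
      qed
      ultimately show ?thesis using splus_upper1[OF W, of "v *\<^sub>S N"] by simp
    qed
    have "V \<subseteq> v *\<^sub>S k \<boxplus> W"
    proof
      fix z assume "z \<in> V"
      then obtain r w where rw: "r \<in> R" "w \<in> W" "z = v * r + w" using gen by (auto elim!: splusE smulE)
      obtain c where c: "c \<in> k" "r - c \<in> N" using res[OF rw(1)] by blast
      have "v * (r - c) \<in> W" using vN smulI[OF c(2)] by blast
      then have "v * (r - c) + w \<in> W" using submod_add[OF W] rw by blast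
      then have "v * c + (v * (r - c) + w) \<in> v *\<^sub>S k \<boxplus> W" by (rule splusI[OF smulI[OF c(1)]])
      then show "z \<in> v *\<^sub>S k \<boxplus> W" using rw(3) by (simp add: algebra_simps)
    qed
    then have "rlen k V W \<le> rlen k (v *\<^sub>S k \<boxplus> W) W"
      using sub by (intro rlen_mono Rk[OF W]) auto
    also have "\<dots> \<le> 1" by (rule rlen_cyclic_le[OF k(1) Rk[OF W]])
    finally show ?thesis .
  qed
  \<comment> \<open>Only finite length over \<open>R\<close> needs work. Splitting at an
    intermediate \<open>R\<close>-submodule lowers the length of both pieces, and when there is none
    the quotient is simple.\<close>
  have "rlen k V W \<le> enat n" if "rlen R V W = enat n" "submod R V" "submod R W" "W \<subseteq> V" for n V W
    using that
  proof (induction n arbitrary: V W rule: less_induct)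
    case (less n)
    note V = less.prems(2) and W = less.prems(3) and sub = less.prems(4)
    show ?case
    proof (cases "V = W")
      case True
      then show ?thesis by simp
    next
      case False
      then have lt: "W \<subset> V" using sub by blast
      have n1: "1 \<le> n" using rlen_ge_1[OF W V lt] less.prems(1) by (simp add: one_enat_def)
      show ?thesis
      proof (cases "\<exists>J. submod R J \<and> W \<subset> J \<and> J \<subset> V")
        case True
        then obtain J where J: "submod R J" "W \<subset> J" "J \<subset> V" by blast
        have "W \<subseteq> J" "J \<subseteq> V" using J by auto
        note add = rlen_additive[OF W J(1) V this] rlen_additive[OF Rk[OF W] Rk[OF J(1)] Rk[OF V] this]
        obtain a b where ab: "rlen R V J = enat a" "rlen R J W = enat b" "n = a + b"
          using add(1) less.prems(1) by (cases "rlen R V J"; cases "rlen R J W") auto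
        have "1 \<le> a" "1 \<le> b"
          using rlen_ge_1[OF J(1) V J(3)] rlen_ge_1[OF W J(1,2)] ab by (simp_all add: one_enat_def)
        then have "a < n" "b < n" using ab by auto
        from less.IH[OF this(1) ab(1) V J(1) \<open>J \<subseteq> V\<close>] less.IH[OF this(2) ab(2) J(1) W \<open>W \<subseteq> J\<close>]
        have "rlen k V J + rlen k J W \<le> enat a + enat b" by (rule add_mono)
        then show ?thesis using add(2) ab(3) by simp
      next
        case False
        have "rlen k V W \<le> 1"
          by (rule simple[OF V W lt]) (use False in blast)
        also have "\<dots> \<le> enat n" using n1 by (simp add: one_enat_def)
        finally show ?thesis .
      qed
    qed
  qed
  then show "rlen k V W \<le> rlen R V W"
    using V W sub by (cases "rlen R V W") auto
qed

section \<open>The multiplicity of a parameter ideal\<close>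

text \<open>For a regular sequence the powers of \<open>I = (F, G)\<close> behave as in a polynomial
  ring: the \<open>n\<close>-th colength is \<open>e\<close> times the triangular number
  \<open>n (n + 1) / 2\<close>. Multiplying by 2! and dividing by \<open>n^2\<close> leaves
  \<open>(1 + 1/n) e\<close>, which tends to \<open>e\<close>.\<close>

lemma multiplicity_of_regular_pair:
  fixes L :: "'a::field set"
  assumes L: "is_subring L" and FG: "F \<in> L" "G \<in> L" "F \<noteq> 0" "G \<noteq> 0"
    and reg: "\<And>a r. a \<in> L \<Longrightarrow> r \<in> L \<Longrightarrow> F * a = G * r \<Longrightarrow> r \<in> F *\<^sub>S L"
    and dim: "krull_dim (subring_of L) = 2"
    and point_mult: "rlen L L (F *\<^sub>S L \<boxplus> G *\<^sub>S L) = enat e"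
  shows "multiplicity_of_ideal (subring_of L) (Idl\<^bsub>subring_of L\<^esub> {F, G}) = real e"
proof -
  define P where "P = ideal_power (subring_of L) (Idl\<^bsub>subring_of L\<^esub> {F, G})"
  have smL: "submod L L" by (rule is_subring_submod[OF L])
  have sm: "submod L (c *\<^sub>S L)" for c by (rule submod_smul[OF smL])
  have sm2: "submod L (c *\<^sub>S L \<boxplus> b *\<^sub>S L)" for b c by (rule submod_splus[OF sm sm])
  have cL: "c *\<^sub>S L \<subseteq> L" if "c \<in> L" for c by (rule smul_subset_submod[OF smL that])
  have pw: "G ^ n \<in> L" for n using is_subring_power[OF L FG(2)] .
  \<comment> \<open>Regularity passes from \<open>G\<close> to its powers by removing one factor
    \<open>G\<close> at a time.\<close>
  have regn: "r \<in> F *\<^sub>S L" if "a \<in> L" "r \<in> L" "F * a = G ^ n * r" for a r n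
    using that
  proof (induction n arbitrary: a)
    case 0
    then show ?case using smulI[of a L F] by simp
  next
    case (Suc n)
    have "F * a = G * (G ^ n * r)" using Suc.prems by (simp add: algebra_simps)
    from reg[OF Suc.prems(1) is_subring_mult[OF L pw Suc.prems(2)] this]
    obtain b where b: "b \<in> L" "G ^ n * r = F * b" by (rule smulE)
    show ?case by (rule Suc.IH[OF b(1) Suc.prems(2)]) (simp add: b(2))
  qed
  \<comment> \<open>Each layer between \<open>F L + G^n L\<close> and \<open>F L + G^(n+1) L\<close>
    is a copy of \<open>L / (F, G)\<close>, by multiplication with \<open>G ^ n\<close>.\<close>
  have len1: "rlen L L (F *\<^sub>S L \<boxplus> G ^ n *\<^sub>S L) = enat (n * e)" for n
  proof (induction n)
    case 0
    have "F *\<^sub>S L \<boxplus> L = L" using splus_absorb[OF smL sm cL[OF FG(1)]] by (simp add: splus_commute)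
    then show ?case by (simp add: zero_enat_def)
  next
    case (Suc n)
    let ?A = "F *\<^sub>S L \<boxplus> G ^ n *\<^sub>S L" and ?B = "F *\<^sub>S L \<boxplus> G ^ Suc n *\<^sub>S L"
    have GL: "G ^ Suc n *\<^sub>S L \<subseteq> G ^ n *\<^sub>S L"
      using smul_mono[OF cL[OF FG(2)], of "G ^ n"] by (simp add: smul_smul mult.commute)
    have BA: "?B \<subseteq> ?A" by (rule splus_mono[OF order_refl GL])
    have AL: "?A \<subseteq> L" by (intro splus_least[OF smL] cL FG pw)
    have eqA: "?A = G ^ n *\<^sub>S L \<boxplus> ?B"
    proof
      show "?A \<subseteq> G ^ n *\<^sub>S L \<boxplus> ?B"
        by (intro splus_least[OF submod_splus[OF sm sm2]] splus_upper1[OF sm2] order_trans[OF splus_upper1[OF sm] splus_upper2[OF sm]])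
      show "G ^ n *\<^sub>S L \<boxplus> ?B \<subseteq> ?A"
        by (intro splus_least[OF sm2] splus_upper2[OF sm] BA)
    qed
    have int: "G ^ n *\<^sub>S L \<inter> ?B = G ^ n *\<^sub>S (F *\<^sub>S L \<boxplus> G *\<^sub>S L)"
    proof
      show "G ^ n *\<^sub>S L \<inter> ?B \<subseteq> G ^ n *\<^sub>S (F *\<^sub>S L \<boxplus> G *\<^sub>S L)"
      proof
        fix z assume z: "z \<in> G ^ n *\<^sub>S L \<inter> ?B"
        then obtain r where r: "r \<in> L" "z = G ^ n * r" by (auto elim: smulE)
        from z obtain a b where ab: "a \<in> L" "b \<in> L" "z = F * a + G ^ Suc n * b" by (auto elim!: splusE smulE)
        have "F * a = G ^ n * (r - G * b)" using r ab by (simp add: algebra_simps)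
        then have "r - G * b \<in> F *\<^sub>S L"
          by (rule regn[OF ab(1) is_subring_diff[OF L r(1) is_subring_mult[OF L FG(2) ab(2)]]])
        then have "(r - G * b) + G * b \<in> F *\<^sub>S L \<boxplus> G *\<^sub>S L" by (rule splusI[OF _ smulI[OF ab(2)]])
        then show "z \<in> G ^ n *\<^sub>S (F *\<^sub>S L \<boxplus> G *\<^sub>S L)" using r(2) smulI by simp
      qed
      show "G ^ n *\<^sub>S (F *\<^sub>S L \<boxplus> G *\<^sub>S L) \<subseteq> G ^ n *\<^sub>S L \<inter> ?B"
      proof
        fix z assume "z \<in> G ^ n *\<^sub>S (F *\<^sub>S L \<boxplus> G *\<^sub>S L)"
        then obtain a b where ab: "a \<in> L" "b \<in> L" "z = G ^ n * (F * a + G * b)" by (auto elim!: splusE smulE)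
        have "z = F * (G ^ n * a) + G ^ Suc n * b" using ab by (simp add: algebra_simps)
        then have "z \<in> ?B" using splusI[OF smulI smulI] is_subring_mult[OF L pw ab(1)] ab(2) by metis
        moreover have "F * a + G * b \<in> L" by (intro is_subring_add[OF L] is_subring_mult[OF L] FG ab)
        then have "z \<in> G ^ n *\<^sub>S L" using ab(3) smulI by simp
        ultimately show "z \<in> G ^ n *\<^sub>S L \<inter> ?B" by simp
      qed
    qed
    have "rlen L ?A ?B = rlen L (G ^ n *\<^sub>S L) (G ^ n *\<^sub>S L \<inter> ?B)"
      unfolding eqA by (rule rlen_diamond[OF sm2 sm])
    also have "\<dots> = enat e"
      unfolding int using rlen_smul[OF sm2, of F G L "G ^ n"] cL FG point_mult splus_least[OF smL cL cL] by simp
    finally have "rlen L ?A ?B = enat e" .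
    then show ?case
      using rlen_additive[OF sm2 sm2 smL BA AL] Suc.IH by simp
  qed
  have P_Suc: "P (Suc n) = F *\<^sub>S P n \<boxplus> G *\<^sub>S P n" for n
    unfolding P_def by (rule ideal_power_pair_Suc[OF L FG(1,2)])
  have P_0: "P 0 = L" by (simp add: P_def)
  have smP: "submod L (P n)" for n
    unfolding P_def by (rule submod_ideal_power_pair[OF L FG(1,2)])
  have PL: "P n \<subseteq> L" for n
  proof (induction n)
    case (Suc n)
    have h: "c *\<^sub>S P n \<subseteq> L" if "c \<in> L" for c using smul_mono[OF Suc, of c] cL[OF that] by blast
    show ?case unfolding P_Suc by (intro splus_least[OF smL] h FG)
  qed (simp add: P_0)
  \<comment> \<open>All generators of the power except the pure power of \<open>G\<close> contain a
    factor \<open>F\<close>. In this form the intersection with \<open>F L\<close> can be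
    computed.\<close>
  have P_eq: "P (Suc n) = F *\<^sub>S P n \<boxplus> G ^ Suc n *\<^sub>S L" for n
  proof (induction n)
    case 0
    then show ?case by (simp add: P_Suc P_0)
  next
    case (Suc n)
    have sub: "F *\<^sub>S P (Suc n) \<subseteq> P (Suc (Suc n))" "G *\<^sub>S P (Suc n) \<subseteq> P (Suc (Suc n))"
      using P_Suc[of "Suc n"] splus_upper1[OF submod_smul[OF smP]] splus_upper2[OF submod_smul[OF smP]] by auto
    have "G ^ Suc n *\<^sub>S L \<subseteq> P (Suc n)" unfolding Suc by (rule splus_upper2[OF submod_smul[OF smP]])
    then have "G ^ Suc (Suc n) *\<^sub>S L \<subseteq> G *\<^sub>S P (Suc n)"
      using smul_mono[of "G ^ Suc n *\<^sub>S L" "P (Suc n)" G] by (simp add: smul_smul)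
    then have 1: "F *\<^sub>S P (Suc n) \<boxplus> G ^ Suc (Suc n) *\<^sub>S L \<subseteq> P (Suc (Suc n))"
      using sub by (intro splus_least[OF smP]) auto
    have "z \<in> F *\<^sub>S P (Suc n) \<boxplus> G ^ Suc (Suc n) *\<^sub>S L" if z: "z \<in> G *\<^sub>S P (Suc n)" for z
    proof -
      obtain u where u: "u \<in> P (Suc n)" "z = G * u" using z by (rule smulE)
      then obtain a b where ab: "a \<in> P n" "b \<in> L" "u = F * a + G ^ Suc n * b"
        unfolding Suc by (auto elim!: splusE smulE)
      have "G * a \<in> P (Suc n)"
        unfolding P_Suc using subsetD[OF splus_upper2[OF submod_smul[OF smP]] smulI[OF ab(1)]] .
      then have "F * (G * a) + G ^ Suc (Suc n) * b \<in> F *\<^sub>S P (Suc n) \<boxplus> G ^ Suc (Suc n) *\<^sub>S L"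
        by (intro splusI smulI ab)
      then show ?thesis using u ab by (simp add: algebra_simps)
    qed
    then have "P (Suc (Suc n)) \<subseteq> F *\<^sub>S P (Suc n) \<boxplus> G ^ Suc (Suc n) *\<^sub>S L"
      unfolding P_Suc[of "Suc n"]
      by (intro splus_least[OF submod_splus[OF submod_smul[OF smP] sm]] splus_upper1[OF sm] subsetI)
    with 1 show ?case by blast
  qed
  \<comment> \<open>\<open>L / I^(n+1)\<close> is split at \<open>F L + G^(n+1) L\<close>: above
    lies the length from \<open>len1\<close>, below a copy of \<open>L / I^n\<close> by
    multiplication with \<open>F\<close>.\<close>
  have len2: "rlen L L (P n) = enat (n * (n + 1) div 2 * e)" for n
  proof (induction n)
    case 0
    then show ?case by (simp add: P_0 zero_enat_def)
  next
    case (Suc n)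
    let ?A = "F *\<^sub>S L \<boxplus> G ^ Suc n *\<^sub>S L"
    have eqA: "?A = F *\<^sub>S L \<boxplus> P (Suc n)"
    proof
      show "?A \<subseteq> F *\<^sub>S L \<boxplus> P (Suc n)"
        unfolding P_eq by (intro splus_mono order_refl splus_upper2[OF submod_smul[OF smP]])
      have "P (Suc n) \<subseteq> ?A" unfolding P_eq by (intro splus_mono smul_mono PL order_refl)
      then show "F *\<^sub>S L \<boxplus> P (Suc n) \<subseteq> ?A"
        by (intro splus_least[OF sm2] splus_upper1[OF sm])
    qed
    have int: "F *\<^sub>S L \<inter> P (Suc n) = F *\<^sub>S P n"
    proof
      show "F *\<^sub>S L \<inter> P (Suc n) \<subseteq> F *\<^sub>S P n"
      proof
        fix z assume z: "z \<in> F *\<^sub>S L \<inter> P (Suc n)"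
        then obtain r where r: "r \<in> L" "z = F * r" by (auto elim: smulE)
        from z obtain a b where ab: "a \<in> P n" "b \<in> L" "z = F * a + G ^ Suc n * b"
          unfolding P_eq by (auto elim!: splusE smulE)
        have aL: "a \<in> L" using ab PL by blast
        have "F * (r - a) = G ^ Suc n * b" using r ab by (simp add: algebra_simps)
        then have "b \<in> F *\<^sub>S L" by (rule regn[OF is_subring_diff[OF L r(1) aL] ab(2)])
        then obtain b' where b': "b' \<in> L" "b = F * b'" by (rule smulE)
        have "F * r = F * (a + G ^ Suc n * b')" using r ab b' by (simp add: algebra_simps)
        then have "r = a + G ^ Suc n * b'" using FG(3) by simp
        moreover have "G ^ Suc n * b' \<in> P n"
        proof (cases n)
          case 0
          then show ?thesis using P_0 is_subring_mult[OF L pw b'(1)] by metis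
        next
          case (Suc m)
          have "G ^ n * (G * b') \<in> P n"
            unfolding Suc P_eq by (intro subsetD[OF splus_upper2[OF submod_smul[OF smP]]] smulI is_subring_mult[OF L] FG b')
          then show ?thesis by (simp add: algebra_simps)
        qed
        ultimately have "r \<in> P n" using submod_add[OF smP ab(1)] by simp
        then show "z \<in> F *\<^sub>S P n" using r smulI by simp
      qed
      show "F *\<^sub>S P n \<subseteq> F *\<^sub>S L \<inter> P (Suc n)"
        using smul_mono[OF PL] splus_upper1[OF submod_smul[OF smP]] P_Suc by blast
    qed
    have "rlen L ?A (P (Suc n)) = rlen L (F *\<^sub>S L) (F *\<^sub>S L \<inter> P (Suc n))"
      unfolding eqA by (rule rlen_diamond[OF smP sm])
    also have "\<dots> = rlen L L (P n)"
      unfolding int by (rule rlen_smul[OF smP PL FG(3)])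
    finally have "rlen L ?A (P (Suc n)) = enat (n * (n + 1) div 2 * e)" using Suc.IH by simp
    moreover have "P (Suc n) \<subseteq> ?A" unfolding eqA by (rule splus_upper2[OF sm])
    moreover have "?A \<subseteq> L" by (intro splus_least[OF smL] cL FG pw)
    ultimately have "rlen L L (P (Suc n)) = enat (Suc n * e) + enat (n * (n + 1) div 2 * e)"
      using rlen_additive[OF smP sm2 smL] len1[of "Suc n"] by simp
    also have "\<dots> = enat ((Suc n + n * (n + 1) div 2) * e)" by (simp add: algebra_simps)
    also have "Suc n + n * (n + 1) div 2 = Suc n * (Suc n + 1) div 2"
    proof -
      have "Suc n * (Suc n + 1) = n * (n + 1) + Suc n * 2" by (simp add: algebra_simps)
      then show ?thesis by (metis add.commute div_mult_self1 zero_neq_numeral)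
    qed
    finally show ?case .
  qed
  have ql: "quot_length (subring_of L) L (P n) = enat (n * (n + 1) div 2 * e)" for n
    using quot_length_subring_of[OF L order_refl] len2 by simp
  have tri: "real (n * (n + 1) div 2 * e) = real n * (real n + 1) / 2 * real e" for n
  proof -
    have "n * (n + 1) div 2 * 2 = n * (n + 1)" by simp
    then have "real (n * (n + 1) div 2 * 2) = real (n * (n + 1))" by (rule arg_cong)
    then have "real (n * (n + 1) div 2) * 2 = real n * (real n + 1)"
      by (simp only: of_nat_mult of_nat_numeral of_nat_add of_nat_1)
    then have "real (n * (n + 1) div 2) = real n * (real n + 1) / 2" by (rule eq_divide_imp[OF zero_neq_numeral[symmetric]])
    then show ?thesis by (simp only: of_nat_mult)
  qed
  have val: "(1 + inverse (real n)) * real e = fact 2 * real (the_enat (quot_length (subring_of L) L (P n))) / real n ^ 2"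
    if n: "0 < n" for n
  proof -
    have "fact 2 * real (the_enat (quot_length (subring_of L) L (P n))) / real n ^ 2 =
        2 * (real n * (real n + 1) / 2 * real e) / (real n * real n)"
      by (simp only: ql the_enat.simps tri fact_2 power2_eq_square)
    also have "\<dots> = (1 + inverse (real n)) * real e"
    proof -
      have "real n \<noteq> 0" using n by simp
      then have "2 * (real n * (real n + 1) / 2 * real e) = (real n * real n) * ((1 + inverse (real n)) * real e)"
        by (simp add: distrib_left distrib_right mult.assoc)
      then show ?thesis
        using \<open>real n \<noteq> 0\<close> by (simp only: nonzero_mult_div_cancel_left no_zero_divisors not_False_eq_True)
    qed
    finally show ?thesis by (rule sym)
  qed
  have "(\<lambda>n. (1 + inverse (real n)) * real e) \<longlonglongrightarrow> (1 + 0) * real e"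
    by (intro tendsto_intros lim_inverse_n)
  then have "(\<lambda>n. (1 + inverse (real n)) * real e) \<longlonglongrightarrow> real e" by simp
  then have "(\<lambda>n. fact 2 * real (the_enat (quot_length (subring_of L) L (P n))) / real n ^ 2) \<longlonglongrightarrow> real e"
    by (rule Lim_transform_eventually) (rule eventually_mono[OF eventually_gt_at_top[of 0] val])
  then have "lim (\<lambda>n. fact 2 * real (the_enat (quot_length (subring_of L) L (P n))) / real n ^ 2) = real e"
    by (rule limI)
  moreover have "the_enat 2 = 2" unfolding numeral_eq_enat by simp
  ultimately show ?thesis
    unfolding multiplicity_of_ideal_def dim Let_def P_def by (simp only: subring_of_simps)
qed

section \<open>Homogeneous parts of polynomials\<close>

abbreviation cc :: "'k::comm_ring_1 poly poly \<Rightarrow> nat \<Rightarrow> nat \<Rightarrow> 'k" where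
  "cc P i j \<equiv> coeff (coeff P j) i"

abbreviation hp :: "nat \<Rightarrow> 'k::comm_ring_1 poly poly \<Rightarrow> 'k poly poly" where
  "hp \<equiv> homogeneous_part"

text \<open>Lower bounds for the order at the origin instead of the order itself: the zero
  polynomial satisfies every bound and needs no special value.\<close>

definition ordge :: "nat \<Rightarrow> 'k::comm_ring_1 poly poly \<Rightarrow> bool" where
  "ordge n P \<longleftrightarrow> (\<forall>m<n. hp m P = 0)"

lemma poly2_eqI: "(\<And>i j. cc P i j = cc Q i j) \<Longrightarrow> P = Q"
  by (intro poly_eqI)

lemma cc_hp: "cc (hp n P) i j = (if i + j = n then cc P i j else 0)"
proof -
  have "cc (hp n P) i j = (\<Sum>j'\<le>n. if j' = j then (if n - j = i then cc P (n - j) j else 0) else 0)"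
    unfolding homogeneous_part_def coeff_sum by (intro sum.cong refl) simp
  also have "\<dots> = (if i + j = n then cc P i j else 0)"
    by (auto simp: sum.delta)
  finally show ?thesis .
qed

lemma hp_add: "hp n (P + Q) = hp n P + hp n Q"
  and hp_diff: "hp n (P - Q) = hp n P - hp n Q"
  and hp_0 [simp]: "hp n 0 = 0"
  by (intro poly2_eqI; simp add: cc_hp)+

lemma cc_mult: "cc (P * Q) i j = (\<Sum>b\<le>j. \<Sum>a\<le>i. cc P a b * cc Q (i - a) (j - b))"
  by (simp add: coeff_mult coeff_sum)

lemma hp_mult: "hp n (P * Q) = (\<Sum>m\<le>n. hp m P * hp (n - m) Q)"
proof (rule poly2_eqI)
  fix i j
  have "cc (\<Sum>m\<le>n. hp m P * hp (n - m) Q) i j =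
      (\<Sum>m\<le>n. \<Sum>b\<le>j. \<Sum>a\<le>i. cc (hp m P) a b * cc (hp (n - m) Q) (i - a) (j - b))"
    by (simp add: coeff_sum cc_mult)
  also have "\<dots> = (\<Sum>b\<le>j. \<Sum>a\<le>i. \<Sum>m\<le>n. cc (hp m P) a b * cc (hp (n - m) Q) (i - a) (j - b))"
    by (rule trans[OF sum.swap]) (rule sum.cong[OF refl], rule sum.swap)
  also have "\<dots> = (\<Sum>b\<le>j. \<Sum>a\<le>i. if i + j = n then cc P a b * cc Q (i - a) (j - b) else 0)"
  proof (intro sum.cong refl)
    fix a b assume ab: "b \<in> {..j}" "a \<in> {..i}"
    have "(\<Sum>m\<le>n. cc (hp m P) a b * cc (hp (n - m) Q) (i - a) (j - b)) =
        (\<Sum>m\<le>n. if m = a + b then (if i + j = n then cc P a b * cc Q (i - a) (j - b) else 0) else 0)"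
    proof (intro sum.cong refl)
      fix m assume "m \<in> {..n}"
      then have "i - a + (j - b) = n - (a + b) \<longleftrightarrow> i + j = n" if "m = a + b" using ab that by auto
      then show "cc (hp m P) a b * cc (hp (n - m) Q) (i - a) (j - b) =
          (if m = a + b then (if i + j = n then cc P a b * cc Q (i - a) (j - b) else 0) else 0)"
        by (simp add: cc_hp)
    qed
    also have "\<dots> = (if i + j = n then cc P a b * cc Q (i - a) (j - b) else 0)"
      using ab by (auto simp: sum.delta)
    finally show "(\<Sum>m\<le>n. cc (hp m P) a b * cc (hp (n - m) Q) (i - a) (j - b)) =
        (if i + j = n then cc P a b * cc Q (i - a) (j - b) else 0)" .
  qed
  also have "\<dots> = cc (hp n (P * Q)) i j"
    by (simp add: cc_hp cc_mult)
  finally show "cc (hp n (P * Q)) i j = cc (\<Sum>m\<le>n. hp m P * hp (n - m) Q) i j" by (rule sym)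
qed

lemma ordge_cc: "ordge n P \<longleftrightarrow> (\<forall>i j. i + j < n \<longrightarrow> cc P i j = 0)"
proof
  assume P: "ordge n P"
  show "\<forall>i j. i + j < n \<longrightarrow> cc P i j = 0"
  proof (intro allI impI)
    fix i j assume "i + j < n"
    then have "hp (i + j) P = 0" using P by (simp add: ordge_def)
    then have "cc (hp (i + j) P) i j = 0" by simp
    then show "cc P i j = 0" by (simp add: cc_hp)
  qed
next
  assume "\<forall>i j. i + j < n \<longrightarrow> cc P i j = 0"
  then show "ordge n P" unfolding ordge_def by (intro allI impI poly2_eqI) (simp add: cc_hp)
qed

lemma ordge_hp: "ordge n P \<Longrightarrow> m < n \<Longrightarrow> hp m P = 0"
  by (simp add: ordge_def)

lemma ordge_0 [simp]: "ordge 0 P" "ordge n 0"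
  by (simp_all add: ordge_def)

lemma ordge_Suc_iff: "ordge (Suc n) P \<longleftrightarrow> ordge n P \<and> hp n P = 0"
  by (auto simp: ordge_def less_Suc_eq)

lemma ordge_mono: "ordge n P \<Longrightarrow> m \<le> n \<Longrightarrow> ordge m P"
  by (simp add: ordge_def)

lemma ordge_diff: "ordge n P \<Longrightarrow> ordge n Q \<Longrightarrow> ordge n (P - Q)"
  by (simp add: ordge_def hp_diff)

lemma ordge_mult: "ordge a P \<Longrightarrow> ordge b Q \<Longrightarrow> ordge (a + b) (P * Q)"
proof -
  assume P: "ordge a P" and Q: "ordge b Q"
  have "hp n (P * Q) = 0" if n: "n < a + b" for n
    unfolding hp_mult
  proof (rule sum.neutral, rule ballI)
    fix m assume "m \<in> {..n}"
    then have "m < a \<or> n - m < b" using n by auto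
    then show "hp m P * hp (n - m) Q = 0" using ordge_hp[OF P] ordge_hp[OF Q] by auto
  qed
  then show ?thesis by (simp add: ordge_def)
qed

text \<open>Only the term \<open>m = a\<close> of the graded product survives. The parts
  \<open>hp a P\<close> and \<open>hp b Q\<close> may be zero, so the statement serves for order
  bounds as well as for initial forms.\<close>

lemma hp_mult_ordge:
  assumes P: "ordge a P" and Q: "ordge b Q" shows "hp (a + b) (P * Q) = hp a P * hp b Q"
proof -
  have "hp (a + b) (P * Q) = (\<Sum>m\<le>a+b. if m = a then hp a P * hp b Q else 0)"
    unfolding hp_mult
  proof (intro sum.cong refl)
    fix m assume m: "m \<in> {..a + b}"
    consider "m < a" | "m = a" | "a < m" by linarith
    then show "hp m P * hp (a + b - m) Q = (if m = a then hp a P * hp b Q else 0)"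
    proof cases
      case 1
      then show ?thesis using ordge_hp[OF P] by simp
    next
      case 2
      then show ?thesis by simp
    next
      case 3
      then have "a + b - m < b" using m by auto
      then show ?thesis using ordge_hp[OF Q] 3 by simp
    qed
  qed
  then show ?thesis by simp
qed

lemma ordge_mult_left: "ordge b Q \<Longrightarrow> ordge b (P * Q)"
  using ordge_mult[of 0 P b Q] by simp

lemma ordge_exists:
  assumes "P \<noteq> 0" obtains c where "ordge c P" "hp c P \<noteq> 0"
proof -
  obtain i j where "cc P i j \<noteq> 0" using poly2_eqI[of P 0] assms by auto
  then have "cc (hp (i + j) P) i j \<noteq> 0" by (simp add: cc_hp)
  then have ex: "hp (i + j) P \<noteq> 0" by auto
  define c where "c = (LEAST n. hp n P \<noteq> 0)"
  have "hp c P \<noteq> 0" unfolding c_def by (rule LeastI[of _ "i + j"]) (rule ex)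
  moreover have "ordge c P" unfolding ordge_def c_def using not_less_Least by blast
  ultimately show thesis using that by blast
qed

text \<open>The graded ring is a domain: the initial form of a product is the product of the initial
  forms, so orders add and a known order can be cancelled.\<close>

lemma ordge_cancel:
  fixes f u :: "'k::idom poly poly"
  assumes f: "ordge c f" "hp c f \<noteq> 0" and fu: "ordge (c + j) (f * u)"
  shows "ordge j u"
proof (cases "u = 0")
  case False
  then obtain i where i: "ordge i u" "hp i u \<noteq> 0" by (rule ordge_exists)
  have "hp (c + i) (f * u) \<noteq> 0" using hp_mult_ordge[OF f(1) i(1)] f(2) i(2) by simp
  then have "\<not> c + i < c + j" using ordge_hp[OF fu] by (rule contrapos_nn)
  then show ?thesis using ordge_mono[OF i(1)] by simp
qed simp

lemma homogeneous_iff_hp: "homogeneous n P \<longleftrightarrow> hp n P = P"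
proof
  assume "homogeneous n P"
  then show "hp n P = P" by (intro poly2_eqI) (auto simp: cc_hp homogeneous_def)
next
  assume "hp n P = P"
  then have "cc P i j = (if i + j = n then cc P i j else 0)" for i j using cc_hp[of n P j i] by simp
  then show "homogeneous n P" unfolding homogeneous_def by metis
qed

lemma hp_hp: "hp m (hp n P) = (if m = n then hp n P else 0)"
  by (rule poly2_eqI) (simp add: cc_hp)

lemma homogeneous_hp [simp]: "homogeneous n (hp n P)"
  by (simp add: homogeneous_iff_hp hp_hp)

lemma hp_homogeneous: "homogeneous n P \<Longrightarrow> hp m P = (if m = n then P else 0)"
  by (metis hp_hp homogeneous_iff_hp)

lemma ordge_homogeneous: "homogeneous n P \<Longrightarrow> ordge n P"
  by (simp add: ordge_def hp_homogeneous)

lemma homogeneous_mult: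
  fixes P Q :: "'k::comm_ring_1 poly poly"
  shows "homogeneous a P \<Longrightarrow> homogeneous b Q \<Longrightarrow> homogeneous (a + b) (P * Q)"
  using hp_mult_ordge[OF ordge_homogeneous ordge_homogeneous, of a P b Q] by (simp only: homogeneous_iff_hp)

lemma homogeneous_diff:
  fixes P Q :: "'k::comm_ring_1 poly poly"
  shows "homogeneous a P \<Longrightarrow> homogeneous a Q \<Longrightarrow> homogeneous a (P - Q)"
  by (simp add: homogeneous_iff_hp hp_diff)

lemma homogeneous_0 [simp]: "homogeneous a 0"
  by (simp add: homogeneous_def)

lemma homogeneous_1 [simp]: "homogeneous 0 1"
  unfolding homogeneous_def one_pCons by (auto simp: coeff_pCons split: nat.splits)

lemma homogeneous_power:
  fixes P :: "'k::comm_ring_1 poly poly"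
  shows "homogeneous a P \<Longrightarrow> homogeneous (n * a) (P ^ n)"
  by (induction n) (simp_all add: homogeneous_mult)

lemma hp_decomp_ordge: "ordge n P \<Longrightarrow> ordge (Suc n) (P - hp n P)"
  by (simp add: ordge_Suc_iff ordge_diff ordge_homogeneous hp_diff hp_hp)

lemma hp_eq_0_large: "\<exists>N. \<forall>m>N. hp m P = 0"
proof -
  define D where "D = (\<Sum>j\<le>degree P. degree (coeff P j))"
  have "cc P i j = 0" if ij: "D + degree P < i + j" for i j
  proof (cases "j \<le> degree P")
    case True
    then have "degree (coeff P j) \<le> D" unfolding D_def by (intro member_le_sum) auto
    then have "degree (coeff P j) < i" using ij True by linarith
    then show ?thesis by (rule coeff_eq_0)
  qed (simp add: coeff_eq_0)
  then show ?thesis by (intro exI[of _ "D + degree P"] allI impI poly2_eqI) (simp add: cc_hp)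
qed

lemma hp_top_exists:
  assumes "P \<noteq> 0" obtains d where "hp d P \<noteq> 0" "\<And>m. d < m \<Longrightarrow> hp m P = 0"
proof -
  obtain c where c: "hp c P \<noteq> 0" using ordge_exists[OF assms] .
  obtain N where N: "\<And>m. N < m \<Longrightarrow> hp m P = 0" using hp_eq_0_large by blast
  define d where "d = (GREATEST m. hp m P \<noteq> 0)"
  have b: "m \<le> N" if "hp m P \<noteq> 0" for m using N[of m] that by (meson not_le)
  have 1: "hp d P \<noteq> 0" unfolding d_def using GreatestI_nat[of "\<lambda>m. hp m P \<noteq> 0" c N] c b by simp
  have 2: "m \<le> d" if "hp m P \<noteq> 0" for m unfolding d_def using Greatest_le_nat[of "\<lambda>m. hp m P \<noteq> 0" m N] that b by simp
  show thesis by (rule that[OF 1]) (use 2 not_le in blast)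
qed

lemma hp_mult_top:
  assumes "\<And>m. a < m \<Longrightarrow> hp m P = 0" and "\<And>m. b < m \<Longrightarrow> hp m Q = 0"
  shows "hp (a + b) (P * Q) = hp a P * hp b Q"
proof -
  have "hp (a + b) (P * Q) = (\<Sum>m\<le>a+b. if m = a then hp a P * hp b Q else 0)"
    unfolding hp_mult
  proof (intro sum.cong refl)
    fix m assume m: "m \<in> {..a + b}"
    consider "a < m" | "m = a" | "m < a" by linarith
    then show "hp m P * hp (a + b - m) Q = (if m = a then hp a P * hp b Q else 0)"
    proof cases
      case 3
      then have "b < a + b - m" by auto
      then show ?thesis using assms(2) 3 by simp
    qed (simp_all add: assms(1))
  qed
  then show ?thesis by simp
qed

text \<open>Lowest and highest degrees both add in a domain. For a homogeneous product they agree,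
  which forces agreement in each factor.\<close>

lemma homogeneous_factors:
  fixes P Q :: "'k::idom poly poly"
  assumes hom: "homogeneous n (P * Q)" and nz: "P * Q \<noteq> 0"
  obtains a b where "n = a + b" "homogeneous a P" "homogeneous b Q"
proof -
  have PQ: "P \<noteq> 0" "Q \<noteq> 0" using nz by auto
  obtain a where a: "ordge a P" "hp a P \<noteq> 0" using ordge_exists[OF PQ(1)] .
  obtain b where b: "ordge b Q" "hp b Q \<noteq> 0" using ordge_exists[OF PQ(2)] .
  obtain a' where a': "hp a' P \<noteq> 0" "\<And>m. a' < m \<Longrightarrow> hp m P = 0" by (rule hp_top_exists[OF PQ(1)]) (rule that, assumption+)
  obtain b' where b': "hp b' Q \<noteq> 0" "\<And>m. b' < m \<Longrightarrow> hp m Q = 0" by (rule hp_top_exists[OF PQ(2)]) (rule that, assumption+)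
  have "hp (a + b) (P * Q) \<noteq> 0" using hp_mult_ordge[OF a(1) b(1)] a b by simp
  then have n1: "a + b = n" using hp_homogeneous[OF hom, of "a + b"] by (metis)
  have "hp (a' + b') (P * Q) \<noteq> 0" using hp_mult_top[OF a'(2) b'(2)] a' b' by simp
  then have n2: "a' + b' = n" using hp_homogeneous[OF hom, of "a' + b'"] by (metis)
  have "a \<le> a'" using a'(1) ordge_hp[OF a(1), of a'] by (rule contrapos_np) simp
  moreover have "b \<le> b'" using b'(1) ordge_hp[OF b(1), of b'] by (rule contrapos_np) simp
  ultimately have eq: "a = a'" "b = b'" using n1 n2 by auto
  have h: "homogeneous d R" if h: "ordge d R" "\<And>m. d < m \<Longrightarrow> hp m R = 0" for d and R :: "'k poly poly"
    unfolding homogeneous_iff_hp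
  proof (rule poly2_eqI)
    fix i j
    have "hp (i + j) R = 0" if "i + j \<noteq> d"
      using that h(2)[of "i + j"] ordge_hp[OF h(1), of "i + j"] by (auto simp: neq_iff)
    then have "i + j \<noteq> d \<Longrightarrow> cc (hp (i + j) R) i j = 0" by simp
    then show "cc (hp d R) i j = cc R i j" by (simp add: cc_hp)
  qed
  show thesis by (rule that[OF n1[symmetric] h[OF a(1)] h[OF b(1)]]) (use a'(2) b'(2) eq in simp_all)
qed

section \<open>Coordinates, evaluation and the zeros of binary forms\<close>

definition px :: "'k::comm_ring_1 poly poly" where "px = [:[:0, 1:]:]"
definition py :: "'k::comm_ring_1 poly poly" where "py = [:0, 1:]"

lemma homogeneous_px [simp]: "homogeneous 1 px" and homogeneous_py [simp]: "homogeneous 1 py"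
  unfolding homogeneous_def px_def py_def by (auto simp: coeff_pCons split: nat.splits)

lemma px_py_nonzero [simp]: "(px :: 'k::comm_ring_1 poly poly) \<noteq> 0" "(py :: 'k::comm_ring_1 poly poly) \<noteq> 0"
  by (simp_all add: px_def py_def)

text \<open>\<open>P1\<close> collects the terms free of \<open>y\<close>, divided by
  \<open>x\<close>, and \<open>P2\<close> the remaining ones, divided by \<open>y\<close>. This is
  the step from one power of the maximal ideal to the next, already on polynomials.\<close>

lemma ordge_Suc_split:
  assumes "ordge (Suc n) P"
  obtains P1 P2 where "P = px * P1 + py * P2" "ordge n P1" "ordge n P2"
proof -
  obtain p0 P2 where P: "P = pCons p0 P2" by (cases P)
  obtain c p1 where p0: "p0 = pCons c p1" by (cases p0)
  have z: "cc P i j = 0" if "i + j < Suc n" for i j using assms that by (simp add: ordge_cc)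
  have "c = 0" using z[of 0 0] by (simp add: P p0)
  then have "P = px * [:p1:] + py * P2" by (simp add: P p0 px_def py_def)
  moreover have "ordge n [:p1:]" unfolding ordge_cc
  proof (intro allI impI)
    fix i j assume "i + j < n"
    then show "cc [:p1:] i j = 0" using z[of "Suc i" 0] by (cases j) (simp_all add: P p0)
  qed
  moreover have "ordge n P2" unfolding ordge_cc
  proof (intro allI impI)
    fix i j assume "i + j < n"
    then show "cc P2 i j = 0" using z[of i "Suc j"] by (simp add: P)
  qed
  ultimately show thesis by (rule that)
qed

lemma eval2_simps [simp]:
  "eval2 (P + Q) a b = eval2 P a b + eval2 Q a b"
  "eval2 (P - Q) a b = eval2 P a b - eval2 Q a b"
  "eval2 (P * Q) a b = eval2 P a b * eval2 Q a b"
  "eval2 (P ^ n) a b = eval2 P a b ^ n"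
  "eval2 0 a b = 0" "eval2 1 a b = 1"
  "eval2 px a b = a" "eval2 py a b = b"
  by (simp_all add: eval2_def px_def py_def poly_power)

lemma eval2_linear_form [simp]: "eval2 (linear_form r s) a b = a * r + b * s"
  by (simp add: eval2_def linear_form_def)

lemma eval2_sum: "eval2 (\<Sum>i\<in>I. P i) a b = (\<Sum>i\<in>I. eval2 (P i) a b)"
  by (induction I rule: infinite_finite_induct) simp_all

lemma eval2_const [simp]: "eval2 [:[:c:]:] a b = c"
  by (simp add: eval2_def)

lemma eval2_hp: "eval2 (hp n P) a b = (\<Sum>j\<le>n. cc P (n - j) j * a ^ (n - j) * b ^ j)"
  unfolding homogeneous_part_def eval2_sum
  by (intro sum.cong refl) (simp add: eval2_def poly_monom poly_power)

lemma eval2_0_0: "eval2 P 0 0 = cc P 0 0"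
  by (simp add: eval2_def poly_0_coeff_0)

lemma ordge_1_iff: "ordge (Suc 0) P \<longleftrightarrow> eval2 P 0 0 = 0"
  by (auto simp: ordge_cc eval2_0_0)

lemma hp_zero: "hp 0 P = [:[:eval2 P 0 0:]:]"
  by (rule poly2_eqI) (auto simp: cc_hp eval2_0_0 coeff_pCons split: nat.splits)

lemma homogeneous_linear_form [simp]: "homogeneous 1 (linear_form r s)"
  unfolding homogeneous_def linear_form_def by (auto simp: coeff_pCons split: nat.splits)

lemma linear_form_eq_0_iff: "linear_form r s = 0 \<longleftrightarrow> r = 0 \<and> s = 0"
  by (simp add: linear_form_def)

lemma eval2_homogeneous_scale:
  assumes "homogeneous n P" shows "eval2 P (s * a) (s * b) = s ^ n * eval2 P a b"
proof -
  have "eval2 (hp n P) (s * a) (s * b) = s ^ n * eval2 (hp n P) a b"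
    unfolding eval2_hp sum_distrib_left
  proof (intro sum.cong refl)
    fix j assume "j \<in> {..n}"
    then have "s ^ n = s ^ (n - j) * s ^ j" by (simp add: power_add[symmetric])
    then show "cc P (n - j) j * (s * a) ^ (n - j) * (s * b) ^ j = s ^ n * (cc P (n - j) j * a ^ (n - j) * b ^ j)"
      by (simp add: power_mult_distrib)
  qed
  then show ?thesis using assms by (simp add: homogeneous_iff_hp)
qed

lemma const_mult_eq_1:
  fixes a b :: "'a::comm_ring_1"
  assumes "a * b = 1" shows "[:[:a:]:] * [:[:b:]:] = 1"
proof -
  have "[:[:a:]:] * [:[:b:]:] = [:[:1 :: 'a:]:]" using assms by simp
  then show ?thesis by (simp only: one_pCons)
qed

lemma unit_mult_dvd:
  fixes u w :: "'a::comm_ring_1"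
  assumes "u * w = 1" "D dvd P" shows "u * D dvd P"
proof -
  obtain Q where "P = D * Q" using assms(2) by (rule dvdE)
  then have "P = (u * w) * (D * Q)" using assms(1) by simp
  also have "\<dots> = (u * D) * (w * Q)" by (simp only: ac_simps)
  finally show ?thesis by (rule dvdI)
qed

text \<open>For \<open>a \<noteq> 0\<close> put \<open>r = b / a\<close>: restricting
  \<open>P\<close> to \<open>y = r x\<close> gives \<open>x^n\<close> times
  \<open>P(1, r) = 0\<close>, so \<open>y - r x\<close> divides \<open>P\<close>. For
  \<open>a = 0\<close> the coefficient of \<open>y^n\<close> vanishes, and by homogeneity no other
  monomial of \<open>P\<close> is free of \<open>x\<close>.\<close>

lemma linear_form_dvd:
  fixes P :: "'k::field poly poly"
  assumes hom: "homogeneous n P" and z: "eval2 P a b = 0" and nz: "(a, b) \<noteq> (0, 0)"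
  shows "linear_form b (- a) dvd P"
proof (cases "a = 0")
  case False
  define r where "r = b / a"
  have P: "P = (\<Sum>j\<le>n. monom (monom (cc P (n - j) j) (n - j)) j)"
    using hom unfolding homogeneous_iff_hp homogeneous_part_def by (rule sym)
  have r: "[:0, r:] = monom r 1" by (simp add: monom_altdef)
  have "poly P [:0, r:] = (\<Sum>j\<le>n. monom (cc P (n - j) j * r ^ j) n)"
    unfolding r by (subst P) (simp add: poly_sum poly_monom monom_power mult_monom)
  also have "\<dots> = monom (\<Sum>j\<le>n. cc P (n - j) j * r ^ j) n"
    by (simp add: monom_sum)
  also have "(\<Sum>j\<le>n. cc P (n - j) j * r ^ j) = 0"
  proof -
    have "a ^ n * (\<Sum>j\<le>n. cc P (n - j) j * r ^ j) = eval2 (hp n P) a b"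
      unfolding eval2_hp sum_distrib_left
    proof (intro sum.cong refl)
      fix j assume "j \<in> {..n}"
      then have "a ^ n = a ^ (n - j) * a ^ j" by (simp add: power_add[symmetric])
      moreover have "a ^ j * r ^ j = b ^ j" using False by (simp add: r_def power_mult_distrib[symmetric])
      moreover have "a ^ (n - j) * a ^ j * (cc P (n - j) j * r ^ j) = cc P (n - j) j * a ^ (n - j) * (a ^ j * r ^ j)"
        by (simp only: ac_simps)
      ultimately show "a ^ n * (cc P (n - j) j * r ^ j) = cc P (n - j) j * a ^ (n - j) * b ^ j"
        by metis
    qed
    also have "\<dots> = 0" using z hom by (simp add: homogeneous_iff_hp)
    finally show ?thesis using False by simp
  qed
  finally have D: "[:- [:0, r:], 1:] dvd P" by (simp add: poly_eq_0_iff_dvd)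
  have e: "[:[:- a:]:] * [:- [:0, r:], 1:] = linear_form b (- a)"
    using False by (simp add: linear_form_def r_def)
  have "[:[:- a:]:] * [:[:- (1 / a):]:] = 1" by (rule const_mult_eq_1) (use False in simp)
  from unit_mult_dvd[OF this D] show ?thesis unfolding e .
next
  case True
  then have b: "b \<noteq> 0" using nz by simp
  have "eval2 (hp n P) 0 b = (\<Sum>j\<le>n. if j = n then cc P 0 n * b ^ n else 0)"
    unfolding eval2_hp by (intro sum.cong refl) (auto simp: power_0_left)
  then have "cc P 0 n = 0" using z hom b True by (simp add: homogeneous_iff_hp)
  then have c: "cc P 0 j = 0" for j using hom unfolding homogeneous_def by (metis add_0)
  have "[:[:0, 1:]:] dvd P"
    unfolding const_poly_dvd_iff
  proof
    fix j
    have "[:- 0, 1:] dvd coeff P j" using c[of j] by (subst poly_eq_0_iff_dvd[symmetric]) (simp add: poly_0_coeff_0)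
    then show "[:0, 1:] dvd coeff P j" by simp
  qed
  moreover have "[:[:b:]:] * [:[:1 / b:]:] = 1" by (rule const_mult_eq_1) (use b in simp)
  ultimately have "[:[:b:]:] * [:[:0, 1:]:] dvd P" using unit_mult_dvd by blast
  then show ?thesis using True by (simp add: linear_form_def)
qed

text \<open>A root \<open>t\<close> of the dehomogenization at \<open>x = 1\<close> gives the zero
  \<open>(1, t)\<close>. If that polynomial is constant, the coefficient of \<open>y^n\<close> is
  zero because \<open>n > 0\<close>, and \<open>(0, 1)\<close> is a zero.\<close>

lemma homogeneous_zero_exists:
  fixes P :: "'k::alg_closed_field poly poly"
  assumes hom: "homogeneous n P" and n: "0 < n"
  obtains a b where "(a, b) \<noteq> (0, 0)" "eval2 P a b = 0"
proof -
  define q where "q = (\<Sum>j\<le>n. monom (cc P (n - j) j) j)"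
  have q: "eval2 P 1 t = poly q t" for t
    using hom eval2_hp[of n P 1 t] by (simp add: homogeneous_iff_hp q_def poly_sum poly_monom)
  have cq: "coeff q j = (if j \<le> n then cc P (n - j) j else 0)" for j
    unfolding q_def coeff_sum by (auto simp: sum.delta)
  show thesis
  proof (cases "degree q > 0")
    case True
    then obtain t where "poly q t = 0" using alg_closed_imp_poly_has_root by blast
    then show thesis by (intro that[of 1 t]) (simp_all add: q)
  next
    case False
    then have "coeff q n = 0" using n by (intro coeff_eq_0) simp
    then have c: "cc P 0 n = 0" by (simp add: cq)
    have "eval2 (hp n P) 0 1 = (\<Sum>j\<le>n. if j = n then cc P 0 n else 0)"
      unfolding eval2_hp by (intro sum.cong refl) (auto simp: power_0_left)
    then have "eval2 P 0 1 = 0" using hom c by (simp add: homogeneous_iff_hp)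
    then show thesis by (intro that[of 0 1]) simp_all
  qed
qed

lemma finite_homogeneous_zeros:
  fixes P :: "'k::field poly poly"
  assumes hom: "homogeneous n P" and nz: "P \<noteq> 0"
  shows "finite {t. eval2 P t 1 = 0}"
proof -
  define q where "q = (\<Sum>j\<le>n. monom (cc P j (n - j)) j)"
  have "eval2 P t 1 = poly q t" for t
  proof -
    have "eval2 (hp n P) t 1 = (\<Sum>j\<le>n. cc P (n - j) j * t ^ (n - j))" by (simp add: eval2_hp)
    also have "\<dots> = (\<Sum>j\<le>n. cc P j (n - j) * t ^ j)"
      by (rule sum.reindex_bij_witness[of _ "\<lambda>j. n - j" "\<lambda>j. n - j"]) auto
    finally show ?thesis using hom by (simp add: homogeneous_iff_hp q_def poly_sum poly_monom)
  qed
  moreover have "q \<noteq> 0"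
  proof
    assume "q = 0"
    have "coeff q j = (if j \<le> n then cc P j (n - j) else 0)" for j
      unfolding q_def coeff_sum by (auto simp: sum.delta)
    then have z: "j \<le> n \<Longrightarrow> cc P j (n - j) = 0" for j using \<open>q = 0\<close> by (metis coeff_0)
    have "P = 0"
    proof (rule poly2_eqI)
      fix i j
      show "cc P i j = cc 0 i j"
      proof (cases "i + j = n")
        case True
        then show ?thesis using z[of i] by auto
      next
        case False
        then show ?thesis using hom unfolding homogeneous_def by auto
      qed
    qed
    with nz show False by simp
  qed
  ultimately show ?thesis using poly_roots_finite[of q] by simp
qed

text \<open>Over a finite field the product of all \<open>X - a\<close>, increased by one, would
  have positive degree and no root. Infinitely many elements later provide a direction that is no
  tangent of \<open>f\<close>.\<close>

lemma infinite_UNIV_alg_closed: "infinite (UNIV :: 'k::alg_closed_field set)"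
proof
  assume fin: "finite (UNIV :: 'k set)"
  define q :: "'k poly" where "q = (\<Prod>a\<in>UNIV. [:- a, 1:])"
  have deg: "degree q = card (UNIV :: 'k set)"
    unfolding q_def by (subst degree_prod_eq_sum_degree) simp_all
  have "card (UNIV :: 'k set) > 0" using fin by (simp add: card_gt_0_iff)
  then have "degree (q + 1) > 0" using deg by (simp add: degree_add_eq_left)
  then obtain t where t: "poly (q + 1) t = 0" using alg_closed_imp_poly_has_root by blast
  have "poly q t = 0" unfolding q_def poly_prod using fin by (intro prod_zero) auto
  then show False using t by simp
qed

section \<open>Factorization, coprimality and greatest common divisors of polynomials\<close>

lemma irreducible_prime:
  fixes p :: "'k::field poly poly"
  assumes "Factorial_Ring.irreducible p" "p dvd a * b" shows "p dvd a \<or> p dvd b"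
proof -
  have "prime_elem p" using assms(1) by simp
  then show ?thesis using assms(2) by (rule prime_elem_dvd_multD)
qed

text \<open>The existence of factorizations, packaged as an induction that adds one irreducible
  factor at a time; units form the base case.\<close>

lemma factor_induct [consumes 1, case_names unit irred]:
  fixes u :: "'k::field poly poly"
  assumes "u \<noteq> 0" and unit: "\<And>u. u dvd 1 \<Longrightarrow> Q u"
    and irred: "\<And>q u. Factorial_Ring.irreducible q \<Longrightarrow> u \<noteq> 0 \<Longrightarrow> Q u \<Longrightarrow> Q (q * u)"
  shows "Q u"
proof (cases "u dvd 1")
  case False
  obtain F where F: "mset_factors F u" using mset_factors_exist[OF assms(1) False] by (rule exE)
  have "Q (prod_mset F) \<and> prod_mset F \<noteq> 0" if "\<And>q. q \<in># F \<Longrightarrow> Factorial_Ring.irreducible q" for F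
    using that
  proof (induction F)
    case empty
    then show ?case by (simp add: unit)
  next
    case (add q F)
    have "Factorial_Ring.irreducible q" using add.prems by simp
    moreover have "Q (prod_mset F) \<and> prod_mset F \<noteq> 0" using add.IH add.prems by simp
    ultimately show ?case using irred[of q "prod_mset F"] by (simp add: irreducible_def)
  qed
  then show ?thesis using F by (simp add: mset_factors_def)
qed (rule unit)

text \<open>Coprimality by irreducible factors is what disjoint sets of components give directly,
  and it is the form in which cancellation in a factorial ring uses it.\<close>

definition no_common_factor :: "'k::field poly poly \<Rightarrow> 'k poly poly \<Rightarrow> bool" where
  "no_common_factor f g \<longleftrightarrow> (\<forall>q. Factorial_Ring.irreducible q \<longrightarrow> q dvd f \<longrightarrow> \<not> q dvd g)"

lemma no_common_factor_sym: "no_common_factor f g \<Longrightarrow> no_common_factor g f"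
  unfolding no_common_factor_def by metis

lemma no_common_factor_dvd_left: "no_common_factor f g \<Longrightarrow> f' dvd f \<Longrightarrow> no_common_factor f' g"
  unfolding no_common_factor_def by (metis dvd_trans)

text \<open>An irreducible factor \<open>q\<close> of \<open>f\<close> does not divide
  \<open>g\<close>, so it divides \<open>r\<close> and can be cancelled on both sides.\<close>

lemma no_common_factor_dvd_cancel:
  assumes "f \<noteq> 0" "no_common_factor f g" "f dvd g * r" shows "f dvd r"
  using assms
proof (induction f arbitrary: r rule: factor_induct)
  case (unit u)
  then show ?case by (meson dvd_trans one_dvd)
next
  case (irred q u)
  have q: "\<not> q dvd g" using irred(1,4) unfolding no_common_factor_def by simp
  have "q dvd g * r" using irred(5) by (rule dvd_mult_left)
  from irreducible_prime[OF irred(1) this] q have "q dvd r" by simp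
  then obtain r1 where r: "r = q * r1" by (rule dvdE)
  have "q * u dvd q * (g * r1)" using irred(5) unfolding r by (simp only: mult.left_commute)
  moreover have "q \<noteq> 0" using irred(1) by (auto simp: Factorial_Ring.irreducible_def)
  ultimately have "u dvd g * r1" by simp
  then have "u dvd r1" by (rule irred(3)[OF no_common_factor_dvd_left[OF irred(4) dvd_triv_right]])
  then show ?case unfolding r by (rule mult_dvd_mono[OF dvd_refl])
qed

lemma irreducible_not_dvd_no_common_factor:
  assumes q: "Factorial_Ring.irreducible q" and w: "\<not> q dvd w" shows "no_common_factor q w"
  unfolding no_common_factor_def
proof (intro allI impI notI)
  fix p assume p: "Factorial_Ring.irreducible p" "p dvd q" "p dvd w"
  obtain k where k: "q = p * k" using p(2) by (rule dvdE)
  have "\<not> p dvd 1" using p(1) by (simp add: Factorial_Ring.irreducible_def)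
  then have "k dvd 1" using Factorial_Ring.irreducibleD[OF q k] by simp
  then have "q dvd p" unfolding k by (metis dvd_mult_right mult_dvd_mono dvd_refl mult_1_right)
  then have "q dvd w" using p(3) by (rule dvd_trans)
  then show False using w by simp
qed

lemma irreducible_factor_degree:
  fixes w :: "'k::field poly poly"
  assumes "w \<noteq> 0" "degree w > 0"
  obtains q where "Factorial_Ring.irreducible q" "q dvd w" "degree q > 0"
proof -
  have "degree w > 0 \<longrightarrow> (\<exists>q. Factorial_Ring.irreducible q \<and> q dvd w \<and> degree q > 0)"
    using assms(1)
  proof (induction w rule: factor_induct)
    case (unit u)
    then have "degree u = 0" by (metis degree_1 dvd_imp_degree_le le_zero_eq one_neq_zero)
    then show ?case by simp
  next
    case (irred q u)
    have "q \<noteq> 0" using irred(1) by (auto simp: Factorial_Ring.irreducible_def)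
    then have deg: "degree (q * u) = degree q + degree u" using irred(2) by (rule degree_mult_eq)
    show ?case
    proof (cases "degree q > 0")
      case True
      then show ?thesis using irred(1) by auto
    next
      case False
      then show ?thesis using deg irred(3) by (metis add_0 dvd_mult gr0I)
    qed
  qed
  then show thesis using assms(2) that by blast
qed

text \<open>
  A nonzero element of least degree in the ideal \<open>(f, g)\<close> divides both \<open>f\<close> and \<open>g\<close> up to factors
  from \<open>k[x]\<close>.
\<close>

lemma no_common_factor_ideal_contains_const:
  fixes f g :: "'k::field poly poly"
  assumes fg: "f \<noteq> 0" "g \<noteq> 0" "no_common_factor f g"
  obtains R a b where "R \<noteq> 0" "[:R:] = a * f + b * g"
proof -
  define I where "I w \<longleftrightarrow> w \<noteq> 0 \<and> (\<exists>a b. w = a * f + b * g)" for w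
  have "f = 1 * f + 0 * g" by simp
  then have "I f" unfolding I_def using fg(1) by metis
  then obtain w where w: "I w" and min: "\<And>v. I v \<Longrightarrow> degree w \<le> degree v"
    using exists_least_iff[of "\<lambda>n. \<exists>w. I w \<and> degree w = n"] by (metis not_le)
  obtain a b where ab: "w = a * f + b * g" using w I_def by blast
  have w0: "w \<noteq> 0" using w I_def by blast
  \<comment> \<open>Pseudo-division by \<open>w\<close> leaves a remainder in the same ideal, and
    minimality of the degree forces it to be zero; \<open>s\<close> is the multiplier from
    \<open>k[x]\<close> that the division introduces.\<close>
  have dv: "\<exists>s. s \<noteq> 0 \<and> w dvd smult s u" if u: "\<exists>a' b'. u = a' * f + b' * g" for u
  proof -
    obtain a' b' where u: "u = a' * f + b' * g" using u by (elim exE)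
    obtain s q where sq: "s \<noteq> 0" "smult s u = w * q + pseudo_mod u w"
      using pseudo_mod(1)[OF w0, of u] by blast
    have "pseudo_mod u w = [:s:] * u - w * q" using sq(2) by simp
    also have "\<dots> = ([:s:] * a' - q * a) * f + ([:s:] * b' - q * b) * g"
      unfolding u ab by (simp add: algebra_simps)
    finally have e: "pseudo_mod u w = ([:s:] * a' - q * a) * f + ([:s:] * b' - q * b) * g" .
    have "pseudo_mod u w = 0"
    proof (rule ccontr)
      assume nz: "pseudo_mod u w \<noteq> 0"
      then have "I (pseudo_mod u w)" unfolding I_def using e by (intro conjI exI)
      then have "degree w \<le> degree (pseudo_mod u w)" by (rule min)
      then show False using pseudo_mod(2)[OF w0, of u] nz by simp
    qed
    then have "w dvd smult s u" using sq(2) by simp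
    then show ?thesis using sq(1) by (intro exI conjI)
  qed
  \<comment> \<open>Otherwise \<open>w\<close> has an irreducible factor of positive degree in
    \<open>y\<close>. It cannot divide a nonzero multiplier from \<open>k[x]\<close>, hence it
    divides both \<open>f\<close> and \<open>g\<close>.\<close>
  have "degree w = 0"
  proof (rule ccontr)
    assume "degree w \<noteq> 0"
    then have "degree w > 0" by simp
    then obtain q where q: "Factorial_Ring.irreducible q" "q dvd w" "degree q > 0"
      by (rule irreducible_factor_degree[OF w0])
    have qd: "q dvd u" if u: "\<exists>a' b'. u = a' * f + b' * g" for u
    proof -
      obtain s where s: "s \<noteq> 0" "w dvd smult s u" using dv[OF u] by (elim exE conjE)
      have "q dvd [:s:] * u" using dvd_trans[OF q(2) s(2)] by simp
      moreover have "\<not> q dvd [:s:]"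
      proof
        assume "q dvd [:s:]"
        then have "degree q \<le> degree [:s:]" using s(1) by (intro dvd_imp_degree_le) simp_all
        then show False using q(3) by simp
      qed
      ultimately show ?thesis using irreducible_prime[OF q(1)] by blast
    qed
    have "g = 0 * f + 1 * g" by simp
    then have "q dvd g" by (intro qd exI)
    moreover have "q dvd f" using \<open>f = 1 * f + 0 * g\<close> by (intro qd exI)
    ultimately show False using q(1) fg(3) unfolding no_common_factor_def by simp
  qed
  then obtain R where R: "w = [:R:]" by (rule degree_eq_zeroE)
  show thesis by (rule that[of R a b]) (use R w0 ab in simp_all)
qed

lemma gcd_exists:
  fixes F G :: "'k::field poly poly"
  assumes "F \<noteq> 0"
  shows "\<exists>h. h dvd F \<and> h dvd G \<and> (\<forall>d. d dvd F \<longrightarrow> d dvd G \<longrightarrow> d dvd h)"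
  using assms
proof (induction F arbitrary: G rule: factor_induct)
  case (unit u)
  then show ?case by (intro exI[of _ 1]) (auto dest: dvd_trans)
next
  case (irred q u)
  have q0: "q \<noteq> 0" using irred(1) by (auto simp: Factorial_Ring.irreducible_def)
  have canc: "d dvd r" if d: "d \<noteq> 0" "\<not> q dvd d" "d dvd q * r" for d r
    by (rule no_common_factor_dvd_cancel[OF d(1) no_common_factor_sym[OF irreducible_not_dvd_no_common_factor[OF irred(1) d(2)]] d(3)])
  have qu: "q * u \<noteq> 0" using q0 irred(2) by simp
  show ?case
  proof (cases "q dvd G")
    case True
    then obtain G1 where G: "G = q * G1" by (rule dvdE)
    obtain h where h: "h dvd u" "h dvd G1" "\<And>d. d dvd u \<Longrightarrow> d dvd G1 \<Longrightarrow> d dvd h"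
      using irred(3)[of G1] by metis
    have "d dvd q * h" if d: "d dvd q * u" "d dvd q * G1" for d
    proof (cases "q dvd d")
      case True
      then obtain d1 where d1: "d = q * d1" by (rule dvdE)
      have "d1 dvd u" "d1 dvd G1" using d q0 unfolding d1 by simp_all
      then have "d1 dvd h" by (rule h(3))
      then show ?thesis unfolding d1 by (rule mult_dvd_mono[OF dvd_refl])
    next
      case False
      have d0: "d \<noteq> 0" using d(1) qu by auto
      have "d dvd h" by (rule h(3)[OF canc[OF d0 False d(1)] canc[OF d0 False d(2)]])
      then show ?thesis by (rule dvd_mult)
    qed
    then show ?thesis unfolding G using mult_dvd_mono[OF dvd_refl h(1)] mult_dvd_mono[OF dvd_refl h(2)] by (intro exI[of _ "q * h"]) simp
  next
    case False
    obtain h where h: "h dvd u" "h dvd G" "\<And>d. d dvd u \<Longrightarrow> d dvd G \<Longrightarrow> d dvd h"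
      using irred(3)[of G] by metis
    have "d dvd h" if d: "d dvd q * u" "d dvd G" for d
    proof -
      have nd: "\<not> q dvd d" using False dvd_trans[OF _ d(2)] by metis
      have d0: "d \<noteq> 0" using d(1) qu by auto
      show ?thesis by (rule h(3)[OF canc[OF d0 nd d(1)] d(2)])
    qed
    then show ?thesis using dvd_mult[OF h(1)] h(2) by (intro exI[of _ h]) simp
  qed
qed

lemma ring_of_type_algebra_simps [simp]:
  "carrier (ring_of_type_algebra :: 'a::comm_ring_1 ring) = UNIV"
  "monoid.mult (ring_of_type_algebra :: 'a::comm_ring_1 ring) = (*)"
  "one (ring_of_type_algebra :: 'a::comm_ring_1 ring) = 1"
  "zero (ring_of_type_algebra :: 'a::comm_ring_1 ring) = 0"
  "add (ring_of_type_algebra :: 'a::comm_ring_1 ring) = (+)"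
  by (simp_all add: ring_of_type_algebra_def)

lemma somegcd_ring_of_type_algebra:
  fixes F G :: "'k::field poly poly"
  assumes "F \<noteq> 0"
  defines "h \<equiv> somegcd ring_of_type_algebra F G"
  shows "h dvd F" "h dvd G" "d dvd F \<Longrightarrow> d dvd G \<Longrightarrow> d dvd h"
proof -
  have fd: "factor a b \<longleftrightarrow> a dvd b" if "factor = Divisibility.factor (ring_of_type_algebra :: 'k poly poly ring)" for factor a b
    unfolding that Divisibility.factor_def dvd_def by simp
  note fd = fd[OF refl]
  have iff: "isgcd (ring_of_type_algebra :: 'k poly poly ring) c F G \<longleftrightarrow>
      c dvd F \<and> c dvd G \<and> (\<forall>d. d dvd F \<longrightarrow> d dvd G \<longrightarrow> d dvd c)" for c
    unfolding isgcd_def fd by (simp add: imp_conjL)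
  have "isgcd (ring_of_type_algebra :: 'k poly poly ring) h F G"
    unfolding h_def somegcd_def
    by (rule someI2_ex) (use gcd_exists[OF assms(1), of G] in \<open>simp_all add: iff\<close>)
  then show "h dvd F" "h dvd G" "d dvd F \<Longrightarrow> d dvd G \<Longrightarrow> d dvd h" unfolding iff by simp_all
qed

lemma no_common_factor_cofactors:
  fixes F G h :: "'k::field poly poly"
  assumes F: "h * F' \<noteq> 0" and gr: "\<And>d. d dvd h * F' \<Longrightarrow> d dvd h * G' \<Longrightarrow> d dvd h"
  shows "no_common_factor F' G'"
  unfolding no_common_factor_def
proof (intro allI impI notI)
  fix q assume q: "Factorial_Ring.irreducible q" "q dvd F'" "q dvd G'"
  have "h * q dvd h" by (intro gr mult_dvd_mono dvd_refl q)
  then have "h * q dvd h * 1" by simp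
  then have "q dvd 1" using F by (subst (asm) dvd_mult_cancel_left) auto
  then show False using q(1) by (simp add: Factorial_Ring.irreducible_def)
qed

lemma irreducible_factor_exists:
  fixes u :: "'k::field poly poly"
  assumes "u \<noteq> 0" "\<not> u dvd 1"
  obtains q where "Factorial_Ring.irreducible q" "q dvd u"
proof -
  have "\<not> u dvd 1 \<longrightarrow> (\<exists>q. Factorial_Ring.irreducible q \<and> q dvd u)"
    using assms(1) by (induction u rule: factor_induct) auto
  then show thesis using assms(2) that by metis
qed

lemma no_common_factor_common_dvd_unit:
  assumes "no_common_factor f g" "d dvd f" "d dvd g" "d \<noteq> 0" shows "d dvd 1"
proof (rule ccontr)
  assume "\<not> d dvd 1"
  then obtain q where "Factorial_Ring.irreducible q" "q dvd d" by (rule irreducible_factor_exists[OF assms(4)])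
  then show False using assms(1-3) unfolding no_common_factor_def by (metis dvd_trans)
qed

section \<open>The local ring of the origin\<close>

abbreviation tf :: "'k::field poly poly \<Rightarrow> 'k rational_function" where
  "tf \<equiv> to_fract"

definition constants :: "'k::field rational_function set" where
  "constants = range (\<lambda>c. tf [:[:c:]:])"

text \<open>\<open>mpow n\<close> is the \<open>n\<close>-th power of the maximal ideal of \<open>A\<close>, and \<open>mpow 0\<close> is \<open>A\<close> itself.\<close>

definition mpow :: "nat \<Rightarrow> 'k::field rational_function set" where
  "mpow n = {tf P / tf Q |P Q. ordge n P \<and> eval2 Q 0 0 \<noteq> 0}"

definition forms :: "nat \<Rightarrow> 'k::field rational_function set" where
  "forms n = {tf P |P. homogeneous n P}"

lemma eval2_nz: "eval2 Q a b \<noteq> 0 \<Longrightarrow> Q \<noteq> 0"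
  by auto

lemma tf_power [simp]: "tf (P ^ n) = tf P ^ n"
  by (induction n) simp_all

lemma mpow_I: "ordge n P \<Longrightarrow> eval2 Q 0 0 \<noteq> 0 \<Longrightarrow> tf P / tf Q \<in> mpow n"
  unfolding mpow_def by blast

lemma mpow_E:
  assumes "u \<in> mpow n"
  obtains P Q where "u = tf P / tf Q" "ordge n P" "eval2 Q 0 0 \<noteq> 0" "tf Q \<noteq> 0"
  using assms unfolding mpow_def by (auto dest: eval2_nz)

lemma mpow_antimono: "m \<le> n \<Longrightarrow> mpow n \<subseteq> mpow m"
  using ordge_mono unfolding mpow_def by blast

lemma mpow_mult:
  assumes "u \<in> mpow a" "v \<in> mpow b" shows "u * v \<in> mpow (a + b)"
proof -
  obtain P Q where 1: "u = tf P / tf Q" "ordge a P" "eval2 Q 0 0 \<noteq> 0" by (rule mpow_E[OF assms(1)])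
  obtain P' Q' where 2: "v = tf P' / tf Q'" "ordge b P'" "eval2 Q' 0 0 \<noteq> 0" by (rule mpow_E[OF assms(2)])
  have "tf (P * P') / tf (Q * Q') \<in> mpow (a + b)"
    by (intro mpow_I ordge_mult 1 2) (use 1 2 in simp)
  then show ?thesis using 1 2 by simp
qed

lemma mpow_diff:
  assumes "u \<in> mpow n" "v \<in> mpow n" shows "u - v \<in> mpow n"
proof -
  obtain P Q where 1: "u = tf P / tf Q" "ordge n P" "eval2 Q 0 0 \<noteq> 0" "tf Q \<noteq> 0" by (rule mpow_E[OF assms(1)])
  obtain P' Q' where 2: "v = tf P' / tf Q'" "ordge n P'" "eval2 Q' 0 0 \<noteq> 0" "tf Q' \<noteq> 0" by (rule mpow_E[OF assms(2)])
  have "ordge n (P * Q' - P' * Q)"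
    using ordge_mult[OF 1(2), of 0 Q'] ordge_mult[OF 2(2), of 0 Q] by (intro ordge_diff) simp_all
  then have "tf (P * Q' - P' * Q) / tf (Q * Q') \<in> mpow n"
    by (rule mpow_I) (use 1 2 in simp)
  then show ?thesis using 1 2 by (simp add: diff_frac_eq)
qed

lemma tf_mem_mpow: "ordge n P \<Longrightarrow> tf P \<in> mpow n"
  using mpow_I[of n P 1] by simp

lemma mem_mpow_polyD:
  assumes "tf P * tf Q \<in> mpow n" "eval2 Q 0 0 \<noteq> 0" shows "ordge n P"
proof -
  obtain P' Q' where 1: "tf P * tf Q = tf P' / tf Q'" "ordge n P'" "eval2 Q' 0 0 \<noteq> 0" "tf Q' \<noteq> 0"
    by (rule mpow_E[OF assms(1)])
  then have "tf (P * Q * Q') = tf P'" by (simp add: field_simps)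
  then have "(Q * Q') * P = P'" by (simp only: to_fract_eq_iff ac_simps)
  then have "ordge (0 + n) ((Q * Q') * P)" using 1 by simp
  moreover have "hp 0 (Q * Q') \<noteq> 0" using 1 assms(2) by (simp add: hp_zero)
  ultimately show ?thesis using ordge_cancel[of 0 "Q * Q'" n P] by simp
qed

lemma tf_mem_mpow_iff [simp]: "tf P \<in> mpow n \<longleftrightarrow> ordge n P"
  using mem_mpow_polyD[of P 1 n] tf_mem_mpow[of n P] by auto

lemma is_subring_mpow: "is_subring (mpow 0)"
  unfolding is_subring_def
proof (intro conjI ballI)
  show "1 \<in> mpow 0" unfolding to_fract_1[symmetric] by (rule tf_mem_mpow) simp
next
  fix a b :: "'a rational_function" assume "a \<in> mpow 0" "b \<in> mpow 0"
  then show "a - b \<in> mpow 0" "a * b \<in> mpow 0" using mpow_diff[of a 0 b] mpow_mult[of a 0 b 0] by simp_all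
qed

lemma submod_mpow: "submod (mpow 0) (mpow n)"
  by (rule submodI) (use mpow_diff[of _ n] mpow_mult[of _ 0 _ n] tf_mem_mpow[of n 0] in simp_all)

lemma mpow_0_inverse: "eval2 Q 0 0 \<noteq> 0 \<Longrightarrow> 1 / tf Q \<in> mpow 0"
  using mpow_I[of 0 1 Q] by simp

lemma mpow_Suc: "mpow (Suc n) = tf px *\<^sub>S mpow n \<boxplus> tf py *\<^sub>S mpow n" (is "?L = ?R")
proof
  show "?L \<subseteq> ?R"
  proof
    fix u assume "u \<in> ?L"
    then obtain P Q where u: "u = tf P / tf Q" "ordge (Suc n) P" "eval2 Q 0 0 \<noteq> 0" by (rule mpow_E)
    obtain P1 P2 where P: "P = px * P1 + py * P2" "ordge n P1" "ordge n P2" by (rule ordge_Suc_split[OF u(2)])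
    have "tf px * (tf P1 / tf Q) + tf py * (tf P2 / tf Q) \<in> tf px *\<^sub>S mpow n \<boxplus> tf py *\<^sub>S mpow n"
      by (intro splusI smulI mpow_I P u)
    then show "u \<in> ?R" unfolding u P by (simp add: add_divide_distrib)
  qed
  have h: "c *\<^sub>S mpow n \<subseteq> mpow (Suc n)" if "c \<in> mpow 1" for c :: "'a rational_function"
    using mpow_mult[OF that, of _ n] by (auto elim!: smulE)
  show "?R \<subseteq> ?L"
    by (intro splus_least[OF submod_mpow] h) (simp_all only: tf_mem_mpow_iff ordge_homogeneous homogeneous_px homogeneous_py)
qed

lemma frac_x_eq: "frac_x = tf px" and frac_y_eq: "frac_y = tf py"
  by (simp_all add: frac_x_def frac_y_def px_def py_def)

section \<open>Identification of \<open>origin_ring\<close> and the powers of its maximal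
  ideal\<close>

lemma is_subring_range_tf: "is_subring (range tf)"
  unfolding is_subring_def
proof (intro conjI ballI)
  show "1 \<in> range tf" using rangeI[of tf 1] by simp
  fix a b :: "'a rational_function" assume "a \<in> range tf" "b \<in> range tf"
  then obtain P Q where "a = tf P" "b = tf Q" by (elim rangeE)
  then show "a - b \<in> range tf" "a * b \<in> range tf"
    using rangeI[of tf "P - Q"] rangeI[of tf "P * Q"] by simp_all
qed

lemma genideal_range_tf: "Idl\<^bsub>subring_of (range tf)\<^esub> {frac_x, frac_y} = {tf P |P. eval2 P 0 0 = 0}"
proof -
  have "Idl\<^bsub>subring_of (range tf)\<^esub> {frac_x, frac_y} = tf px *\<^sub>S range tf \<boxplus> tf py *\<^sub>S (range tf :: 'a rational_function set)"
    unfolding frac_x_eq frac_y_eq by (rule genideal_pair[OF is_subring_range_tf]) simp_all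
  also have "\<dots> = {tf P |P. eval2 P 0 0 = 0}" (is "?L = ?R")
  proof
    show "?L \<subseteq> ?R"
    proof
      fix u assume "u \<in> ?L"
      then obtain P Q where "u = tf px * tf P + tf py * tf Q" by (auto elim!: splusE smulE)
      then have "u = tf (px * P + py * Q)" by simp
      moreover have "eval2 (px * P + py * Q) 0 0 = 0" by simp
      ultimately show "u \<in> ?R" by blast
    qed
    show "?R \<subseteq> ?L"
    proof
      fix u assume "u \<in> ?R"
      then obtain P where u: "u = tf P" "ordge (Suc 0) P" by (auto simp: ordge_1_iff)
      obtain P1 P2 where P: "P = px * P1 + py * P2" by (rule ordge_Suc_split[OF u(2)])
      have "tf px * tf P1 + tf py * tf P2 \<in> ?L" by (intro splusI smulI rangeI)
      then show "u \<in> ?L" unfolding u P by simp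
    qed
  qed
  finally show ?thesis .
qed

lemma origin_ring_eq: "origin_ring = mpow 0"
proof -
  have "b \<in> range tf - {tf P |P. eval2 P 0 0 = 0} \<longleftrightarrow> (\<exists>Q. b = tf Q \<and> eval2 Q 0 0 \<noteq> 0)" for b :: "'a rational_function"
    by auto
  then show ?thesis
    unfolding origin_ring_def Let_def genideal_range_tf localization_def mpow_def by auto
qed

lemma px_mem: "tf px \<in> mpow 0" and py_mem: "tf py \<in> mpow 0"
  by simp_all

lemma ideal_power_origin: "ideal_power origin_A origin_ideal n = mpow n"
proof (induction n)
  case 0
  then show ?case by (simp add: origin_ring_eq)
next
  case (Suc n)
  have "ideal_power origin_A (origin_ideal :: 'a rational_function set) (Suc n) =
      tf px *\<^sub>S ideal_power origin_A origin_ideal n \<boxplus> tf py *\<^sub>S ideal_power origin_A origin_ideal n"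
    unfolding origin_ideal_def origin_ring_eq frac_x_eq frac_y_eq
    by (rule ideal_power_pair_Suc[OF is_subring_mpow px_mem py_mem])
  then show ?case unfolding Suc mpow_Suc .
qed

lemma initial_degree_eq:
  assumes "ordge c f" "hp c f \<noteq> 0" shows "initial_degree f = c"
  unfolding initial_degree_def
proof (rule the_equality)
  show "tf f \<in> ideal_power origin_A origin_ideal c - ideal_power origin_A origin_ideal (c + 1)"
    unfolding ideal_power_origin using assms by (simp add: ordge_Suc_iff)
next
  fix n assume "tf f \<in> ideal_power origin_A origin_ideal n - ideal_power origin_A origin_ideal (n + 1)"
  then have n: "ordge n f" "hp n f \<noteq> 0"
    unfolding ideal_power_origin by (auto simp: ordge_Suc_iff)
  show "n = c"
    using ordge_hp[OF n(1), of c] ordge_hp[OF assms(1), of n] n(2) assms(2) by (metis linorder_neqE_nat)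
qed

section \<open>Constants, leading forms and the Hilbert function of the local ring\<close>

lemma is_subfield_constants: "is_subfield constants"
  unfolding is_subfield_def is_subring_def
proof (intro conjI ballI impI)
  show "1 \<in> constants" unfolding constants_def using rangeI[of "\<lambda>c. tf [:[:c:]:]" 1] by (simp add: one_pCons[symmetric])
  fix a b :: "'a rational_function" assume "a \<in> constants" "b \<in> constants"
  then obtain c d where "a = tf [:[:c:]:]" "b = tf [:[:d:]:]" unfolding constants_def by (elim rangeE)
  then have "a - b = tf [:[:c - d:]:]" "a * b = tf [:[:c * d:]:]"
    by (simp_all del: to_fract_diff to_fract_mult add: to_fract_diff[symmetric] to_fract_mult[symmetric])
  then show "a - b \<in> constants" "a * b \<in> constants" unfolding constants_def by simp_all
next
  fix a :: "'a rational_function" assume "a \<in> constants" "a \<noteq> 0"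
  then obtain c where c: "a = tf [:[:c:]:]" "c \<noteq> 0" unfolding constants_def by auto
  have "tf [:[:inverse c:]:] * a = tf ([:[:inverse c:]:] * [:[:c:]:])" unfolding c by (simp only: to_fract_mult)
  also have "\<dots> = 1" using c(2) by (simp add: one_pCons[symmetric])
  finally show "\<exists>d\<in>constants. d * a = 1" unfolding constants_def by blast
qed

lemma constants_I: "tf [:[:c:]:] \<in> constants"
  unfolding constants_def by simp

lemma constants_subset_mpow: "constants \<subseteq> mpow 0"
  unfolding constants_def by auto

lemma mpow_residue:
  assumes "r \<in> mpow 0" shows "\<exists>c\<in>constants. r - c \<in> mpow 1"
proof -
  obtain P Q where r: "r = tf P / tf Q" "eval2 Q 0 0 \<noteq> 0" "tf Q \<noteq> 0" by (rule mpow_E[OF assms])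
  define c where "c = eval2 P 0 0 / eval2 Q 0 0"
  have "ordge 1 (P - [:[:c:]:] * Q)"
    using r(2) by (simp only: One_nat_def ordge_1_iff eval2_simps eval2_const) (simp add: c_def)
  then have "tf (P - [:[:c:]:] * Q) / tf Q \<in> mpow 1" using r(2) by (rule mpow_I)
  moreover have "tf (P - [:[:c:]:] * Q) / tf Q = r - tf [:[:c:]:]"
    using r by (simp only: to_fract_diff to_fract_mult diff_divide_distrib) simp
  ultimately show ?thesis using constants_I[of c] by (intro bexI[of _ "tf [:[:c:]:]"]) simp_all
qed

lemma mpow_unit:
  assumes "u \<in> mpow 1" shows "\<exists>w\<in>mpow 0. w * (1 - u) = 1"
proof -
  obtain P Q where u: "u = tf P / tf Q" "ordge 1 P" "eval2 Q 0 0 \<noteq> 0" "tf Q \<noteq> 0" by (rule mpow_E[OF assms])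
  have P: "eval2 P 0 0 = 0" using u(2) by (simp add: ordge_1_iff)
  have e: "eval2 (Q - P) 0 0 \<noteq> 0" using u(3) P by simp
  then have nz: "tf Q - tf P \<noteq> 0" using eval2_nz[OF e] by (metis to_fract_diff to_fract_eq_0_iff)
  have "tf Q / tf (Q - P) \<in> mpow 0" by (rule mpow_I[OF ordge_0(1) e])
  moreover have "tf Q / tf (Q - P) * (1 - u) = 1"
  proof -
    have "1 - u = (tf Q - tf P) / tf Q" using u(4) unfolding u(1) by (simp add: diff_divide_distrib)
    then show ?thesis using nz u(4) by simp
  qed
  ultimately show ?thesis by (intro bexI)
qed

lemma rlen_constants_eq:
  assumes "submod (mpow 0) V" "submod (mpow 0) W" "W \<subseteq> V"
  shows "rlen constants V W = rlen (mpow 0) V W"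
  by (rule rlen_local_ring[OF is_subring_mpow is_subfield_constants constants_subset_mpow submod_mpow mpow_antimono[of 0 1] mpow_residue mpow_unit assms]) simp_all

lemma submod_constants: "submod (mpow 0) V \<Longrightarrow> submod constants V"
  by (rule submod_subset[OF _ constants_subset_mpow])

lemma submod_forms: "submod constants (forms n)"
proof (rule submodI)
  show "0 \<in> forms n" unfolding forms_def using homogeneous_0[of n] by (metis (mono_tags, lifting) mem_Collect_eq to_fract_0)
  fix u v :: "'a rational_function" assume "u \<in> forms n" "v \<in> forms n"
  then obtain P Q where "u = tf P" "v = tf Q" "homogeneous n P" "homogeneous n Q" unfolding forms_def by auto
  then have "u - v = tf (P - Q)" "homogeneous n (P - Q)" by (simp_all add: homogeneous_diff)
  then show "u - v \<in> forms n" unfolding forms_def by blast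
next
  fix r v :: "'a rational_function" assume "r \<in> constants" "v \<in> forms n"
  then obtain c P where cP: "r = tf [:[:c:]:]" "v = tf P" "homogeneous n P" unfolding forms_def constants_def by auto
  have "homogeneous 0 [:[:c:]:]" unfolding homogeneous_def by (auto simp: coeff_pCons split: nat.splits)
  then have "homogeneous n ([:[:c:]:] * P)" using homogeneous_mult[of 0 "[:[:c:]:]" n P] cP(3) by simp
  moreover have "r * v = tf ([:[:c:]:] * P)" unfolding cP by (simp only: to_fract_mult)
  ultimately show "r * v \<in> forms n" unfolding forms_def by blast
qed

lemma forms_I: "homogeneous n P \<Longrightarrow> tf P \<in> forms n"
  unfolding forms_def by blast

lemma forms_E: assumes "u \<in> forms n" obtains P where "u = tf P" "homogeneous n P"
  using assms unfolding forms_def by blast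

lemma forms_subset_mpow: "forms n \<subseteq> mpow n"
  unfolding forms_def by (auto simp: ordge_homogeneous)

lemma forms_Int_mpow: "forms n \<inter> mpow (Suc n) = {0}"
proof
  show "forms n \<inter> mpow (Suc n) \<subseteq> {0}"
  proof
    fix u assume "u \<in> forms n \<inter> mpow (Suc n)"
    then obtain P where P: "u = tf P" "homogeneous n P" "ordge (Suc n) P" by (auto elim!: forms_E)
    then have "hp n P = P" "hp n P = 0" by (simp_all add: homogeneous_iff_hp ordge_Suc_iff)
    then show "u \<in> {0}" using P(1) by simp
  qed
  show "{0} \<subseteq> forms n \<inter> mpow (Suc n)"
    using submod_zero[OF submod_forms] submod_zero[OF submod_mpow] by blast
qed

lemma mpow_eq_forms_splus: "mpow n = forms n \<boxplus> mpow (Suc n)" (is "?L = ?R")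
proof
  show "?L \<subseteq> ?R"
  proof
    fix u assume "u \<in> ?L"
    then obtain P Q where u: "u = tf P / tf Q" "ordge n P" "eval2 Q 0 0 \<noteq> 0" "tf Q \<noteq> 0" by (rule mpow_E)
    \<comment> \<open>The leading form of \<open>P / Q\<close> is that of \<open>P\<close> divided
      by the value of \<open>Q\<close> at the origin.\<close>
    define c where "c = 1 / eval2 Q 0 0"
    define H where "H = [:[:c:]:] * hp n P"
    have H: "homogeneous n H"
      using submod_mult[OF submod_forms constants_I forms_I[OF homogeneous_hp], of c n P]
      unfolding H_def by (metis forms_E to_fract_eq_iff to_fract_mult)
    have "hp n (P - H * Q) = hp n P - hp (n + 0) (H * Q)" by (simp add: hp_diff)
    also have "hp (n + 0) (H * Q) = H * [:[:eval2 Q 0 0:]:]"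
      by (subst hp_mult_ordge[OF ordge_homogeneous[OF H] ordge_0(1)]) (simp add: hp_homogeneous[OF H] hp_zero)
    also have "\<dots> = ([:[:c:]:] * [:[:eval2 Q 0 0:]:]) * hp n P" unfolding H_def by (simp only: ac_simps)
    also have "[:[:c:]:] * [:[:eval2 Q 0 0:]:] = 1" by (rule const_mult_eq_1) (use u(3) in \<open>simp add: c_def\<close>)
    finally have "hp n (P - H * Q) = 0" by simp
    moreover have "ordge n (P - H * Q)"
      using ordge_mult[OF ordge_homogeneous[OF H], of 0 Q] by (intro ordge_diff u) simp_all
    ultimately have "ordge (Suc n) (P - H * Q)" by (simp add: ordge_Suc_iff)
    then have "tf (P - H * Q) / tf Q \<in> mpow (Suc n)" using u(3) by (rule mpow_I)
    then have "tf H + tf (P - H * Q) / tf Q \<in> forms n \<boxplus> mpow (Suc n)" by (rule splusI[OF forms_I[OF H]])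
    moreover have "tf H + tf (P - H * Q) / tf Q = u" using u by (simp add: diff_divide_distrib)
    ultimately show "u \<in> ?R" by simp
  qed
  show "?R \<subseteq> ?L"
    by (intro splus_least[OF submod_mpow] forms_subset_mpow mpow_antimono) simp
qed

text \<open>The coefficient of \<open>x^(n+1)\<close> is the value at \<open>(1, 0)\<close>; the
  forms of degree \<open>n + 1\<close> for which it vanishes are \<open>y\<close> times the forms of
  degree \<open>n\<close>. So each degree adds one dimension.\<close>

lemma rlen_forms: "rlen constants (forms n) {0} = enat (Suc n)"
proof (induction n)
  case 0
  have S0: "forms 0 = 1 *\<^sub>S (constants :: 'a rational_function set) \<boxplus> {0}"
  proof
    show "forms 0 \<subseteq> 1 *\<^sub>S (constants :: 'a rational_function set) \<boxplus> {0}"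
    proof
      fix u :: "'a rational_function" assume "u \<in> forms 0"
      then obtain P where P: "u = tf P" "homogeneous 0 P" by (rule forms_E)
      have "hp 0 P = [:[:eval2 P 0 0:]:]" by (rule hp_zero)
      then have "P = [:[:eval2 P 0 0:]:]" using P(2) by (simp add: homogeneous_iff_hp)
      then have "u \<in> constants" using P(1) constants_I by metis
      then show "u \<in> 1 *\<^sub>S constants \<boxplus> {0}" using splusI[of u constants 0 "{0}"] by simp
    qed
    show "1 *\<^sub>S (constants :: 'a rational_function set) \<boxplus> {0} \<subseteq> forms 0"
    proof (rule splus_least[OF submod_forms])
      show "1 *\<^sub>S constants \<subseteq> (forms 0 :: 'a rational_function set)"
        using smul_subset_submod[OF submod_forms forms_I[OF homogeneous_1]] by simp
    qed (use submod_zero[OF submod_forms] in simp)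
  qed
  show ?case unfolding S0
    using rlen_cyclic[OF is_subfield_constants submod_trivial, of 1] by (simp add: one_enat_def)
next
  case (Suc n)
  let ?W = "tf py *\<^sub>S forms n :: 'a rational_function set"
  have smW: "submod constants ?W" by (rule submod_smul[OF submod_forms])
  have W: "?W \<subseteq> forms (Suc n)"
  proof
    fix u assume "u \<in> ?W"
    then obtain P where P: "u = tf py * tf P" "homogeneous n P" by (auto elim!: smulE forms_E)
    have "homogeneous (1 + n) (py * P)" by (intro homogeneous_mult homogeneous_py P)
    then have "tf (py * P) \<in> forms (1 + n)" by (rule forms_I)
    then show "u \<in> forms (Suc n)" using P(1) by simp
  qed
  have xn: "homogeneous (Suc n) (px ^ Suc n :: 'a poly poly)"
    using homogeneous_power[OF homogeneous_px, of "Suc n"] by simp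
  have nW: "tf px ^ Suc n \<notin> ?W"
  proof
    assume "tf px ^ Suc n \<in> ?W"
    then obtain P :: "'a poly poly" where "tf px ^ Suc n = tf py * tf P" by (auto elim!: smulE forms_E)
    then have "tf (px ^ Suc n) = tf (py * P)" by (simp only: tf_power to_fract_mult)
    then have "px ^ Suc n = py * P" by (simp only: to_fract_eq_iff)
    then have "eval2 (px ^ Suc n) 1 0 = eval2 (py * P) 1 0" by (rule arg_cong)
    then show False by (simp del: power_Suc)
  qed
  have eq: "forms (Suc n) = tf px ^ Suc n *\<^sub>S constants \<boxplus> ?W"
  proof
    show "forms (Suc n) \<subseteq> tf px ^ Suc n *\<^sub>S constants \<boxplus> ?W"
    proof
      fix u :: "'a rational_function" assume "u \<in> forms (Suc n)"
      then obtain P where P: "u = tf P" "homogeneous (Suc n) P" by (rule forms_E)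
      define c where "c = eval2 P 1 0"
      have h: "homogeneous (Suc n) (P - [:[:c:]:] * px ^ Suc n)"
        using submod_diff[OF submod_forms forms_I[OF P(2)] submod_mult[OF submod_forms constants_I forms_I[OF xn]], of c]
        by (metis forms_E to_fract_diff to_fract_eq_iff to_fract_mult)
      have "eval2 (P - [:[:c:]:] * px ^ Suc n) 1 0 = 0" by (simp only: eval2_simps eval2_const c_def power_one mult_1_right diff_self)
      then have "linear_form 0 (- 1) dvd P - [:[:c:]:] * px ^ Suc n" by (rule linear_form_dvd[OF h]) simp
      then obtain Q0 where Q0: "P - [:[:c:]:] * px ^ Suc n = linear_form 0 (- 1) * Q0" by (rule dvdE)
      \<comment> \<open>\<open>linear_form 0 (- 1)\<close> is \<open>- y\<close>, hence the sign;
        passing to the part of degree \<open>n\<close> makes the cofactor a form without changing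
        the product.\<close>
      define Q where "Q = hp n (- Q0)"
      have "linear_form 0 (- 1) = (- py :: 'a poly poly)" by (simp only: linear_form_def py_def one_pCons minus_pCons minus_zero pCons_0_0)
      then have "linear_form 0 (- 1) * Q0 = py * (- Q0)" by simp
      then have e: "P - [:[:c:]:] * px ^ Suc n = py * (- Q0)" using Q0 by (simp only:)
      have "ordge (1 + n) (py * (- Q0))" using ordge_homogeneous[OF h] e by simp
      then have o: "ordge n (- Q0)"
        using ordge_cancel[OF ordge_homogeneous[OF homogeneous_py], of n "- Q0"] by (simp add: hp_homogeneous[OF homogeneous_py])
      have "hp (1 + n) (py * (- Q0)) = py * Q"
        unfolding Q_def by (subst hp_mult_ordge[OF ordge_homogeneous[OF homogeneous_py] o]) (simp add: hp_homogeneous[OF homogeneous_py])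
      then have "P - [:[:c:]:] * px ^ Suc n = py * Q" using hp_homogeneous[OF h, of "Suc n"] e by simp
      then have "P = px ^ Suc n * [:[:c:]:] + py * Q" by (simp add: algebra_simps del: power_Suc)
      then have "u = tf px ^ Suc n * tf [:[:c:]:] + tf py * tf Q" using P(1) by (simp only: to_fract_add to_fract_mult tf_power)
      moreover have "tf Q \<in> forms n" unfolding Q_def by (intro forms_I homogeneous_hp)
      ultimately show "u \<in> tf px ^ Suc n *\<^sub>S constants \<boxplus> ?W"
        by (simp only:) (intro splusI smulI constants_I)
    qed
    show "tf px ^ Suc n *\<^sub>S constants \<boxplus> ?W \<subseteq> forms (Suc n)"
      using forms_I[OF xn] by (intro splus_least[OF submod_forms] smul_subset_submod[OF submod_forms] W) (simp only: tf_power)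
  qed
  have "rlen constants (forms (Suc n)) ?W = 1"
    unfolding eq by (rule rlen_cyclic[OF is_subfield_constants smW nW])
  moreover have "rlen constants ?W {0} = enat (Suc n)"
  proof -
    have "tf py *\<^sub>S {0} = {0 :: 'a rational_function}" by (simp add: smul_def)
    moreover have "{0} \<subseteq> (forms n :: 'a rational_function set)" by (simp add: submod_zero[OF submod_forms])
    ultimately show ?thesis
      using rlen_smul[where R = constants and W = "{0}" and V = "forms n :: 'a rational_function set" and c = "tf py", OF submod_trivial] Suc by simp
  qed
  ultimately show ?case
    using rlen_additive[OF submod_trivial smW submod_forms _ W] submod_zero[OF smW] by (simp add: one_enat_def)
qed

text \<open>Triangular numbers, the colengths of the powers of the maximal ideal. The recursion
  keeps division out of the dimension counts.\<close>

fun tri :: "nat \<Rightarrow> nat" where "tri 0 = 0" | "tri (Suc n) = tri n + Suc n"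

lemma tri_eq: "2 * tri n = n * (n + 1)"
  by (induction n) simp_all

lemma rlen_mpow: "rlen constants (mpow 0) (mpow n) = enat (tri n)"
proof (induction n)
  case 0
  then show ?case by (simp add: zero_enat_def)
next
  case (Suc n)
  have "rlen constants (mpow n) (mpow (Suc n) :: 'a rational_function set) = rlen constants (forms n) (forms n \<inter> mpow (Suc n) :: 'a rational_function set)"
    unfolding mpow_eq_forms_splus[of n] by (rule rlen_diamond[OF submod_constants[OF submod_mpow] submod_forms])
  also have "\<dots> = enat (Suc n)" unfolding forms_Int_mpow by (rule rlen_forms)
  finally have "rlen constants (mpow n) (mpow (Suc n) :: 'a rational_function set) = enat (Suc n)" .
  moreover have "rlen constants (mpow 0) (mpow (Suc n) :: 'a rational_function set) =
      rlen constants (mpow 0) (mpow n :: 'a rational_function set) + rlen constants (mpow n) (mpow (Suc n) :: 'a rational_function set)"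
    by (rule rlen_additive) (simp_all add: submod_constants submod_mpow mpow_antimono)
  ultimately show ?case using Suc by simp
qed

section \<open>Ideals generated by coprime polynomials\<close>

text \<open>Every monomial of degree at least \<open>i + j\<close> is divisible by
  \<open>x^i\<close> or by \<open>y^j\<close>.\<close>

lemma ordge_split_powers:
  "ordge (i + j) P \<Longrightarrow> \<exists>P1 P2. P = px ^ i * P1 + py ^ j * P2"
proof (induction "i + j" arbitrary: i j P)
  case 0
  then show ?case by (intro exI[of _ P] exI[of _ 0]) simp
next
  case (Suc n)
  show ?case
  proof (cases "i = 0 \<or> j = 0")
    case True
    then show ?thesis
    proof
      assume "i = 0" then show ?thesis by (intro exI[of _ P] exI[of _ 0]) simp
    next
      assume "j = 0" then show ?thesis by (intro exI[of _ 0] exI[of _ P]) simp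
    qed
  next
    case False
    then obtain i' j' where ij: "i = Suc i'" "j = Suc j'" by (metis not0_implies_Suc)
    have "ordge (Suc n) P" using Suc.prems Suc.hyps(2) by simp
    then obtain A B where P: "P = px * A + py * B" "ordge n A" "ordge n B" by (rule ordge_Suc_split)
    have n: "n = i' + j" "n = i + j'" using Suc.hyps(2) ij by simp_all
    obtain A1 A2 where A: "A = px ^ i' * A1 + py ^ j * A2"
      using Suc.hyps(1)[OF n(1)] P(2) n(1) by metis
    obtain B1 B2 where B: "B = px ^ i * B1 + py ^ j' * B2"
      using Suc.hyps(1)[OF n(2)] P(3) n(2) by metis
    have "P = px ^ i * (A1 + py * B1) + py ^ j * (px * A2 + B2)"
      unfolding P(1) A B unfolding ij by (simp add: algebra_simps)
    then show ?thesis by blast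
  qed
qed

lemma mpow_subset_ideal:
  fixes I :: "'k::field rational_function set"
  assumes I: "submod (mpow 0) I" and x: "tf px ^ i \<in> I" and y: "tf py ^ j \<in> I"
  shows "mpow (i + j) \<subseteq> I"
proof
  fix u :: "'k rational_function" assume "u \<in> mpow (i + j)"
  then obtain P Q where u: "u = tf P / tf Q" "ordge (i + j) P" "eval2 Q 0 0 \<noteq> 0" by (rule mpow_E)
  obtain P1 P2 where P: "P = px ^ i * P1 + py ^ j * P2" using ordge_split_powers[OF u(2)] by blast
  have "(tf P1 / tf Q) * tf px ^ i + (tf P2 / tf Q) * tf py ^ j \<in> I"
    by (intro submod_add[OF I] submod_mult[OF I] x y mpow_I u) simp_all
  then show "u \<in> I" unfolding u P by (simp add: add_divide_distrib mult.commute)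
qed

lemma px_dvd_iff: "px dvd P \<longleftrightarrow> (\<forall>j. cc P 0 j = 0)"
  for P :: "'k::field poly poly"
proof -
  have "[:0, 1:] dvd q \<longleftrightarrow> coeff q 0 = 0" for q :: "'k poly"
    using poly_eq_0_iff_dvd[of q 0] by (simp add: poly_0_coeff_0)
  then show ?thesis unfolding px_def const_poly_dvd_iff by simp
qed

text \<open>On the line \<open>x = 0\<close> the polynomial becomes a power of \<open>y\<close>
  times a factor with nonzero constant term; \<open>V\<close> lifts that factor and \<open>W\<close>
  absorbs the multiples of \<open>x\<close>.\<close>

lemma split_y_power:
  "cc P 0 b \<noteq> 0 \<Longrightarrow> \<exists>j V W. P = py ^ j * V + px * W \<and> eval2 V 0 0 \<noteq> 0"
proof (induction b arbitrary: P)
  case 0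
  then show ?case by (intro exI[of _ 0] exI[of _ P]) (simp add: eval2_0_0)
next
  case (Suc b)
  show ?case
  proof (cases "cc P 0 0 = 0")
    case False
    then show ?thesis by (intro exI[of _ 0] exI[of _ P]) (simp add: eval2_0_0)
  next
    case True
    obtain p0 P2 where P: "P = pCons p0 P2" by (cases P)
    obtain c p1 where p0: "p0 = pCons c p1" by (cases p0)
    have "P = px * [:p1:] + py * P2" using True by (simp add: P p0 px_def py_def)
    moreover have "cc P2 0 b \<noteq> 0" using Suc.prems by (simp add: P)
    then obtain j V W where "P2 = py ^ j * V + px * W" "eval2 V 0 0 \<noteq> 0" using Suc.IH by blast
    ultimately have "P = py ^ Suc j * V + px * ([:p1:] + py * W) \<and> eval2 V 0 0 \<noteq> 0"
      by (simp add: algebra_simps)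
    then show ?thesis by blast
  qed
qed

text \<open>Write \<open>f = y^b V + x W\<close> with \<open>V\<close> a unit of \<open>A\<close>.
  Modulo \<open>f\<close> the power \<open>y^b\<close> is a multiple of \<open>x\<close>, so its
  \<open>i\<close>-th power is a multiple of \<open>x^i\<close>, which lies in
  \<open>I\<close>.\<close>

lemma y_power_mem:
  fixes I :: "'k::field rational_function set"
  assumes I: "submod (mpow 0) I" and f: "tf f \<in> I" "\<not> px dvd f" and x: "tf px ^ i \<in> I"
  shows "\<exists>j. tf py ^ j \<in> I"
proof -
  obtain b where "cc f 0 b \<noteq> 0" using f(2) px_dvd_iff[of f] by blast
  then obtain b V W where V: "f = py ^ b * V + px * W" "eval2 V 0 0 \<noteq> 0" using split_y_power by blast
  have nz: "tf V \<noteq> 0" using eval2_nz[OF V(2)] by simp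
  define \<alpha> where "\<alpha> = 1 / tf V"
  define \<beta> where "\<beta> = - (tf W / tf V)"
  define u :: "'k rational_function" where "u = tf py ^ b"
  have ab: "\<alpha> \<in> mpow 0" "\<beta> \<in> mpow 0" "u \<in> mpow 0" "tf px \<in> mpow 0"
    using mpow_0_inverse[OF V(2)] is_subring_uminus[OF is_subring_mpow mpow_I[OF ordge_0(1) V(2), of W]] tf_mem_mpow[of 0 "py ^ b"]
    by (simp_all add: \<alpha>_def \<beta>_def u_def)
  have fV: "tf f = u * tf V + tf px * tf W" unfolding V(1) u_def by (simp only: to_fract_add to_fract_mult tf_power)
  have u: "u = tf f * \<alpha> + tf px * \<beta>"
    unfolding fV \<alpha>_def \<beta>_def using nz by (simp add: distrib_right add_divide_distrib)
  have ex: "\<exists>s\<in>mpow 0. u ^ m = tf f * s + (tf px * \<beta>) ^ m" for m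
  proof (induction m)
    case 0
    show ?case by (intro bexI[of _ 0]) (simp_all add: is_subring_0[OF is_subring_mpow])
  next
    case (Suc m)
    then obtain s where s: "s \<in> mpow 0" "u ^ m = tf f * s + (tf px * \<beta>) ^ m" by blast
    have "u ^ Suc m = u * (tf f * s) + (tf f * \<alpha> + tf px * \<beta>) * (tf px * \<beta>) ^ m"
      using u s(2) by (simp add: distrib_left)
    also have "\<dots> = tf f * (u * s + \<alpha> * (tf px * \<beta>) ^ m) + (tf px * \<beta>) ^ Suc m"
      by (simp add: algebra_simps)
    finally have e: "u ^ Suc m = tf f * (u * s + \<alpha> * (tf px * \<beta>) ^ m) + (tf px * \<beta>) ^ Suc m" .
    have "u * s + \<alpha> * (tf px * \<beta>) ^ m \<in> mpow 0"
      by (intro is_subring_add[OF is_subring_mpow] is_subring_mult[OF is_subring_mpow] is_subring_power[OF is_subring_mpow] ab s(1))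
    then show ?case using e by blast
  qed
  obtain s where s: "s \<in> mpow 0" "u ^ i = tf f * s + (tf px * \<beta>) ^ i" using ex[of i] by blast
  have "s * tf f + \<beta> ^ i * tf px ^ i \<in> I"
    by (intro submod_add[OF I] submod_mult[OF I] s(1) f(1) x is_subring_power[OF is_subring_mpow] ab)
  then have "u ^ i \<in> I" unfolding s(2) by (simp add: power_mult_distrib mult.commute)
  then have "tf py ^ (b * i) \<in> I" by (simp add: u_def power_mult)
  then show ?thesis by blast
qed

lemma px_not_unit: "\<not> (px :: 'k::field poly poly) dvd 1"
proof
  assume "(px :: 'k poly poly) dvd 1"
  then obtain Q :: "'k poly poly" where "1 = px * Q" by (rule dvdE)
  then have "eval2 (1 :: 'k poly poly) 0 0 = eval2 (px * Q) 0 0" by (rule arg_cong)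
  then show False by simp
qed

text \<open>The ideal contains a nonzero \<open>R\<close> from \<open>k[x]\<close>, and
  \<open>R\<close> is a unit of \<open>A\<close> times some \<open>x^i\<close>. Since
  \<open>x\<close> cannot divide both \<open>f\<close> and \<open>g\<close>, a power of
  \<open>y\<close> follows, and from the two powers a power of the maximal ideal.\<close>

lemma no_common_factor_contains_mpow:
  fixes I :: "'k::field rational_function set"
  assumes fg: "f \<noteq> 0" "g \<noteq> 0" "no_common_factor f g" and I: "submod (mpow 0) I" "tf f \<in> I" "tf g \<in> I"
  shows "\<exists>N. mpow N \<subseteq> I"
proof -
  obtain R a b where R: "R \<noteq> 0" "[:R:] = a * f + b * g" by (rule no_common_factor_ideal_contains_const[OF fg])
  have "tf a * tf f + tf b * tf g \<in> I"
    by (intro submod_add[OF I(1)] submod_mult[OF I(1)] I) simp_all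
  then have RI: "tf [:R:] \<in> I" unfolding R(2) by simp
  obtain q where q: "R = [:- 0, 1:] ^ order 0 R * q" "\<not> [:- 0, 1:] dvd q" using order_decomp[OF R(1)] by blast
  define i where "i = order 0 R"
  have e: "eval2 [:q:] 0 0 \<noteq> 0" using q(2) poly_eq_0_iff_dvd[of q 0] by (simp add: eval2_def)
  have "[:R:] = [:[:0, 1:] ^ i * q:]" using q(1) unfolding i_def by simp
  also have "\<dots> = px ^ i * [:q:]" unfolding px_def by (simp add: poly_const_pow mult.commute)
  finally have "[:R:] = px ^ i * [:q:]" .
  then have "tf [:R:] = tf px ^ i * tf [:q:]" by (simp only: to_fract_mult tf_power)
  then have "tf px ^ i = (1 / tf [:q:]) * tf [:R:]" using eval2_nz[OF e] by simp
  then have x: "tf px ^ i \<in> I" using submod_mult[OF I(1) mpow_0_inverse[OF e] RI] by simp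
  have "\<not> px dvd f \<or> \<not> px dvd g"
    using no_common_factor_common_dvd_unit[OF fg(3), of px] px_not_unit by auto
  then obtain j where "tf py ^ j \<in> I"
    using y_power_mem[OF I(1,2) _ x] y_power_mem[OF I(1,3) _ x] by blast
  then show ?thesis using mpow_subset_ideal[OF I(1) x] by blast
qed

lemma is_prime_irreducible:
  assumes P: "is_prime B P" and B: "range tf \<subseteq> B" and u: "tf u \<in> P" "u \<noteq> 0"
  obtains q where "Factorial_Ring.irreducible q" "tf q \<in> P"
proof -
  have mem: "tf p \<in> B" for p using B by blast
  have sm: "submod B P" and 1: "1 \<notin> P" and pr: "\<And>a b. a \<in> B \<Longrightarrow> b \<in> B \<Longrightarrow> a * b \<in> P \<Longrightarrow> a \<in> P \<or> b \<in> P"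
    using P unfolding is_prime_def by blast+
  have "tf u \<in> P \<longrightarrow> (\<exists>q. Factorial_Ring.irreducible q \<and> tf q \<in> P)"
    using u(2)
  proof (induction u rule: factor_induct)
    case (unit u)
    then obtain w where "1 = u * w" by (rule dvdE)
    then have "tf w * tf u = 1" by (metis mult.commute to_fract_1 to_fract_mult)
    then show ?case using submod_mult[OF sm mem, of "tf u" w] 1 by auto
  next
    case (irred q u)
    then show ?case using pr[OF mem mem, of q u] by auto
  qed
  then show thesis using u(1) that by blast
qed

lemma is_prime_power: "is_prime B P \<Longrightarrow> is_subring B \<Longrightarrow> a \<in> B \<Longrightarrow> a ^ n \<in> P \<Longrightarrow> a \<in> P"
proof (induction n)
  case 0
  then show ?case by (simp add: is_prime_def)
next
  case (Suc n)
  then show ?case using is_subring_power[of B a n] unfolding is_prime_def by auto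
qed

text \<open>Between \<open>{0}\<close> and the maximal ideal lies the ideal of \<open>y\<close>. For
  the upper bound: a nonzero prime contains an irreducible \<open>q\<close>, and a strictly larger
  prime contains a polynomial prime to \<open>q\<close>, hence a power of the maximal ideal, hence
  \<open>x\<close> and \<open>y\<close>.\<close>

lemma krull_dim_origin: "krull_dim (subring_of (mpow 0 :: 'k::field rational_function set)) = 2"
proof -
  let ?A = "mpow 0 :: 'k rational_function set"
  let ?Q = "tf py *\<^sub>S ?A"
  have mem: "tf p \<in> ?A" for p by simp
  have mem1: "tf P / tf Q \<in> mpow 1 \<longleftrightarrow> eval2 P 0 0 = 0" if "eval2 Q 0 0 \<noteq> 0" for P Q :: "'k poly poly"
  proof
    assume "tf P / tf Q \<in> mpow 1"
    then have "tf P / tf Q * tf Q \<in> mpow (1 + 0)" by (rule mpow_mult) simp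
    then show "eval2 P 0 0 = 0" using eval2_nz[OF that] by (simp add: ordge_1_iff)
  next
    assume "eval2 P 0 0 = 0"
    then show "tf P / tf Q \<in> mpow 1" using that by (intro mpow_I) (simp_all add: ordge_1_iff)
  qed
  have memQ: "tf P / tf Q \<in> ?Q \<longleftrightarrow> poly P 0 = 0" if Q: "eval2 Q 0 0 \<noteq> 0" for P Q :: "'k poly poly"
  proof
    assume "tf P / tf Q \<in> ?Q"
    then obtain P' Q' where 1: "tf P / tf Q = tf py * (tf P' / tf Q')" "eval2 Q' 0 0 \<noteq> 0" "tf Q' \<noteq> 0"
      by (elim smulE mpow_E) (rule that, simp_all)
    then have "tf (P * Q') = tf (py * P' * Q)" using eval2_nz[OF Q] by (simp add: field_simps)
    then have "P * Q' = py * P' * Q" by (simp only: to_fract_eq_iff)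
    then have "poly (P * Q') 0 = poly (py * P' * Q) 0" by (rule arg_cong)
    then have "poly P 0 = 0 \<or> poly Q' 0 = 0" by (simp add: py_def)
    moreover have "poly Q' 0 \<noteq> 0" using 1(2) by (auto simp: eval2_def)
    ultimately show "poly P 0 = 0" by simp
  next
    assume "poly P 0 = 0"
    then have "[:0, 1:] dvd P" by (simp add: poly_eq_0_iff_dvd)
    then obtain P' where "P = py * P'" unfolding py_def by (rule dvdE)
    then have e: "tf P / tf Q = tf py * (tf P' / tf Q)" by simp
    show "tf P / tf Q \<in> ?Q" unfolding e by (rule smulI[OF mpow_I[OF ordge_0(1) Q]])
  qed
  have Q1: "1 \<notin> ?Q" using memQ[of 1 1] by simp
  have M1: "1 \<notin> (mpow 1 :: 'k rational_function set)" using mem1[of 1 1] by simp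
  show ?thesis
  proof (rule krull_dim_eq_2[OF is_subring_mpow, where Q = "?Q" and M = "mpow 1"])
    show "is_prime ?A {0}" by (simp add: is_prime_def submod_trivial is_subring_0[OF is_subring_mpow])
    show "is_prime ?A ?Q" unfolding is_prime_def
    proof (intro conjI ballI impI)
      show "submod ?A ?Q" by (rule submod_smul[OF submod_mpow])
      show "?Q \<subseteq> ?A" by (rule smul_subset_submod[OF submod_mpow mem])
      show "1 \<notin> ?Q" by (rule Q1)
      fix a b assume ab: "a \<in> ?A" "b \<in> ?A" "a * b \<in> ?Q"
      obtain P Q where a: "a = tf P / tf Q" "eval2 Q 0 0 \<noteq> 0" by (rule mpow_E[OF ab(1)])
      obtain P' Q' where b: "b = tf P' / tf Q'" "eval2 Q' 0 0 \<noteq> 0" by (rule mpow_E[OF ab(2)])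
      have "tf (P * P') / tf (Q * Q') \<in> ?Q" using ab(3) a b by simp
      then have "poly (P * P') 0 = 0" by (subst (asm) memQ) (use a b in simp_all)
      then show "a \<in> ?Q \<or> b \<in> ?Q" using memQ a b by simp
    qed
    show "is_prime ?A (mpow 1)" unfolding is_prime_def
    proof (intro conjI ballI impI)
      show "submod ?A (mpow 1)" by (rule submod_mpow)
      show "mpow 1 \<subseteq> ?A" by (rule mpow_antimono) simp
      show "1 \<notin> (mpow 1 :: 'k rational_function set)" by (rule M1)
      fix a b assume ab: "a \<in> ?A" "b \<in> ?A" "a * b \<in> mpow 1"
      obtain P Q where a: "a = tf P / tf Q" "eval2 Q 0 0 \<noteq> 0" by (rule mpow_E[OF ab(1)])
      obtain P' Q' where b: "b = tf P' / tf Q'" "eval2 Q' 0 0 \<noteq> 0" by (rule mpow_E[OF ab(2)])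
      have "tf (P * P') / tf (Q * Q') \<in> mpow 1" using ab(3) a b by simp
      then have "eval2 (P * P') 0 0 = 0" by (subst (asm) mem1) (use a b in simp_all)
      then show "a \<in> mpow 1 \<or> b \<in> mpow 1" using mem1 a b by simp
    qed
    show "{0} \<subset> ?Q"
    proof -
      have "tf py \<in> ?Q" by (rule mem_smul_self[OF is_subring_mpow])
      moreover have "0 \<in> ?Q" using submod_zero[OF submod_smul[OF submod_mpow]] .
      moreover have "tf py \<noteq> (0 :: 'k rational_function)" by simp
      ultimately show ?thesis by (metis empty_subsetI insert_subset psubsetI singletonD)
    qed
    show "?Q \<subset> mpow 1"
    proof -
      have "?Q \<subseteq> mpow 1"
        by (rule smul_subset_submod[OF submod_mpow]) (simp only: tf_mem_mpow_iff ordge_homogeneous homogeneous_py)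
      moreover have "tf px \<in> (mpow 1 :: 'k rational_function set)" using mem1[of 1 px] by simp
      moreover have "tf px \<notin> ?Q" using memQ[of 1 px] by (simp add: px_def)
      ultimately show ?thesis by (metis psubsetI)
    qed
  next
    fix P assume P: "is_prime ?A P"
    show "P \<subseteq> mpow 1"
    proof
      fix u assume u: "u \<in> P"
      then have "u \<in> ?A" using P unfolding is_prime_def by blast
      then obtain R Q where R: "u = tf R / tf Q" "eval2 Q 0 0 \<noteq> 0" "tf Q \<noteq> 0" by (rule mpow_E)
      have "eval2 R 0 0 = 0"
      proof (rule ccontr)
        assume e: "eval2 R 0 0 \<noteq> 0"
        then have "tf Q / tf R \<in> ?A" by (rule mpow_I[OF ordge_0(1)])
        then have "tf Q / tf R * u \<in> P" using submod_mult[of ?A P] u P unfolding is_prime_def by blast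
        moreover have "tf Q / tf R * u = 1" using R eval2_nz[OF e] by simp
        ultimately show False using P unfolding is_prime_def by simp
      qed
      then show "u \<in> mpow 1" using mem1[OF R(2)] R(1) by simp
    qed
  next
    fix P P' assume P: "is_prime ?A P" "is_prime ?A P'" "P \<noteq> {0}" "P \<subset> P'"
    have sm: "submod ?A P" "submod ?A P'" and sub: "P \<subseteq> ?A" "P' \<subseteq> ?A" using P unfolding is_prime_def by blast+
    have poly: "tf R \<in> J" if "tf R / tf Q \<in> J" "submod ?A J" "tf Q \<noteq> 0" for R Q J
      using submod_mult[OF that(2) mem that(1), of Q] that(3) by simp
    have poly': "tf R / tf Q \<in> J" if "tf R \<in> J" "submod ?A J" "eval2 Q 0 0 \<noteq> 0" for R Q J
      using submod_mult[OF that(2) mpow_0_inverse[OF that(3)] that(1)] by simp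
    obtain u where u: "u \<in> P" "u \<noteq> 0" using P(3) submod_zero[OF sm(1)] by blast
    obtain R Q where R: "u = tf R / tf Q" "tf Q \<noteq> 0" using u(1) sub by (blast elim: mpow_E)
    then have RP: "tf R \<in> P" "R \<noteq> 0" using u poly sm by auto
    have rt: "range tf \<subseteq> ?A" by (rule image_subsetI) (rule mem)
    obtain q where q: "Factorial_Ring.irreducible q" "tf q \<in> P"
      by (rule is_prime_irreducible[OF P(1) rt RP])
    obtain w where w: "w \<in> P'" "w \<notin> P" using P(4) by blast
    obtain W V where W: "w = tf W / tf V" "eval2 V 0 0 \<noteq> 0" "tf V \<noteq> 0" using w(1) sub by (blast elim: mpow_E)
    have W': "tf W \<in> P'" "tf W \<notin> P" using w W poly sm poly' by auto
    have "\<not> q dvd W"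
    proof
      assume "q dvd W"
      then obtain s where "W = q * s" by (rule dvdE)
      then have "tf W = tf s * tf q" by simp
      then show False using W'(2) submod_mult[OF sm(1) mem q(2)] by simp
    qed
    then have "no_common_factor q W" by (rule irreducible_not_dvd_no_common_factor[OF q(1)])
    moreover have "q \<noteq> 0" using q(1) by (auto simp: Factorial_Ring.irreducible_def)
    moreover have "W \<noteq> 0" using W'(2) submod_zero[OF sm(1)] by auto
    moreover have "tf q \<in> P'" using q(2) P(4) by blast
    ultimately obtain N where N: "mpow N \<subseteq> P'" using no_common_factor_contains_mpow[OF _ _ _ sm(2) _ W'(1)] by blast
    have lin: "tf p \<in> P'" if "homogeneous 1 p" for p
    proof (rule is_prime_power[OF P(2) is_subring_mpow mem])
      show "tf p ^ N \<in> P'"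
        using N ordge_homogeneous[OF homogeneous_power[OF that, of N]] tf_mem_mpow[of N "p ^ N"] by (simp add: subset_iff)
    qed
    have "tf px \<in> P'" "tf py \<in> P'" by (rule lin[OF homogeneous_px], rule lin[OF homogeneous_py])
    then show "mpow 1 \<subseteq> P'"
      unfolding One_nat_def mpow_Suc by (intro splus_least[OF sm(2)] smul_subset_submod[OF sm(2)])
  qed
qed

section \<open>The local rings of the points of the exceptional line\<close>

text \<open>If \<open>P\<close> has order at least \<open>n\<close>, this is up to a nonzero factor
  the value, at the point \<open>p\<close> of the exceptional line, of \<open>P\<close> divided by
  the \<open>n\<close>-th power of a local equation of that line.\<close>

definition evp :: "'k::field \<times> 'k \<Rightarrow> nat \<Rightarrow> 'k poly poly \<Rightarrow> 'k" where
  "evp p n P = eval2 (hp n P) (fst p) (snd p)"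

text \<open>
  The point \<open>(a : b)\<close> of the exceptional line corresponds to the tangent direction \<open>(a, b)\<close>; the
  fractions below are the rational functions defined there on the blowing up of the origin.
\<close>

definition point_ring :: "'k::field \<times> 'k \<Rightarrow> 'k rational_function set" where
  "point_ring p = {tf U / tf V |U V. \<exists>j. ordge j U \<and> ordge j V \<and> evp p j V \<noteq> 0}"

definition point_ideal :: "'k::field \<times> 'k \<Rightarrow> 'k rational_function set" where
  "point_ideal p = {tf U / tf V |U V. \<exists>j. ordge j U \<and> ordge j V \<and> evp p j V \<noteq> 0 \<and> evp p j U = 0}"

text \<open>An equation of the line through the origin in the direction \<open>p\<close>.\<close>

definition lp :: "'k::field \<times> 'k \<Rightarrow> 'k poly poly" where
  "lp p = linear_form (snd p) (- fst p)"

lemma homogeneous_lp [simp]: "homogeneous 1 (lp p)" "homogeneous (Suc 0) (lp p)"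
  unfolding lp_def using homogeneous_linear_form by simp_all

lemma evp_diff: "evp p n (P - Q) = evp p n P - evp p n Q"
  by (simp add: evp_def hp_diff)

lemma evp_mult: "ordge a P \<Longrightarrow> ordge b Q \<Longrightarrow> evp p (a + b) (P * Q) = evp p a P * evp p b Q"
  by (simp add: evp_def hp_mult_ordge)

lemma evp_nz: "evp p n P \<noteq> 0 \<Longrightarrow> P \<noteq> 0" "evp p n P \<noteq> 0 \<Longrightarrow> hp n P \<noteq> 0"
  by (auto simp: evp_def)

lemma evp_0: "evp p 0 P = eval2 P 0 0"
  by (simp add: evp_def hp_zero)

lemma evp_homogeneous: "homogeneous n P \<Longrightarrow> evp p n P = eval2 P (fst p) (snd p)"
  by (simp add: evp_def homogeneous_iff_hp)

lemma evp_power: "ordge a P \<Longrightarrow> ordge (n * a) (P ^ n) \<and> evp p (n * a) (P ^ n) = evp p a P ^ n"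
proof (induction n)
  case 0
  then show ?case by (simp add: evp_0)
next
  case (Suc n)
  then show ?case using ordge_mult[of a P "n * a" "P ^ n"] evp_mult[of a P "n * a" "P ^ n"] by simp
qed

lemma point_ring_I: "ordge j U \<Longrightarrow> ordge j V \<Longrightarrow> evp p j V \<noteq> 0 \<Longrightarrow> tf U / tf V \<in> point_ring p"
  unfolding point_ring_def by blast

lemma point_ring_E:
  assumes "u \<in> point_ring p"
  obtains U V j where "u = tf U / tf V" "ordge j U" "ordge j V" "evp p j V \<noteq> 0" "tf V \<noteq> 0"
  using assms unfolding point_ring_def by (auto dest: evp_nz)

text \<open>Two representations of a fraction may use different degrees \<open>j\<close>. Cross
  multiplication and the multiplicativity of \<open>evp\<close> show that the vanishing of the
  numerator does not depend on the choice.\<close>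

lemma point_ideal_iff:
  assumes "ordge j U" "ordge j V" "evp p j V \<noteq> 0"
  shows "tf U / tf V \<in> point_ideal p \<longleftrightarrow> evp p j U = 0"
proof
  assume "tf U / tf V \<in> point_ideal p"
  then obtain U' V' j' where 1: "tf U / tf V = tf U' / tf V'" "ordge j' U'" "ordge j' V'" "evp p j' V' \<noteq> 0" "evp p j' U' = 0"
    unfolding point_ideal_def by blast
  have "V \<noteq> 0" "V' \<noteq> 0" using assms(3) 1(4) evp_nz(1) by metis+
  then have "tf (U * V') = tf (U' * V)" using 1(1) by (simp add: field_simps)
  then have "U * V' = U' * V" by (simp only: to_fract_eq_iff)
  then have "evp p (j + j') (U * V') = evp p (j' + j) (U' * V)" by (simp add: add.commute)
  then show "evp p j U = 0" using evp_mult[OF assms(1) 1(3)] evp_mult[OF 1(2) assms(2)] 1(4,5) by simp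
qed (use assms point_ideal_def in blast)

lemma point_ideal_subset_point_ring: "point_ideal p \<subseteq> point_ring p"
  unfolding point_ideal_def point_ring_def by blast

lemma point_ring_diff_frac:
  assumes "ordge i U" "ordge i V" "evp p i V \<noteq> 0" "ordge j U'" "ordge j V'" "evp p j V' \<noteq> 0"
  shows "ordge (i + j) (U * V' - U' * V)" "evp p (i + j) (U * V' - U' * V) = evp p i U * evp p j V' - evp p j U' * evp p i V"
    "tf U / tf V - tf U' / tf V' = tf (U * V' - U' * V) / tf (V * V')"
    "ordge (i + j) (V * V')" "evp p (i + j) (V * V') \<noteq> 0"
proof -
  have o: "ordge (i + j) (U * V')" "ordge (j + i) (U' * V)" by (rule ordge_mult[OF assms(1,5)], rule ordge_mult[OF assms(4,2)])
  show "ordge (i + j) (U * V' - U' * V)" using o by (intro ordge_diff) (simp_all add: add.commute)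
  show "evp p (i + j) (U * V' - U' * V) = evp p i U * evp p j V' - evp p j U' * evp p i V"
    unfolding evp_diff using evp_mult[OF assms(1,5)] evp_mult[OF assms(4,2)] by (simp add: add.commute)
  have "tf V \<noteq> 0" "tf V' \<noteq> 0" using evp_nz(1)[OF assms(3)] evp_nz(1)[OF assms(6)] by simp_all
  then show "tf U / tf V - tf U' / tf V' = tf (U * V' - U' * V) / tf (V * V')" by (simp add: diff_frac_eq)
  show "ordge (i + j) (V * V')" using assms by (intro ordge_mult)
  show "evp p (i + j) (V * V') \<noteq> 0" using evp_mult[OF assms(2,5)] assms by simp
qed

lemma mpow_subset_point_ring: "mpow 0 \<subseteq> point_ring p"
proof
  fix u :: "'a rational_function" assume "u \<in> mpow 0"
  then obtain P Q where "u = tf P / tf Q" "eval2 Q 0 0 \<noteq> 0" by (rule mpow_E)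
  then show "u \<in> point_ring p" using point_ring_I[of 0 P Q p] by (simp add: evp_0)
qed

lemma is_subring_point_ring: "is_subring (point_ring p)"
  unfolding is_subring_def
proof (intro conjI ballI)
  show "1 \<in> point_ring p" using is_subring_1[OF is_subring_mpow] mpow_subset_point_ring by blast
  fix a b assume "a \<in> point_ring p" "b \<in> point_ring p"
  then obtain U V i U' V' j where 1: "a = tf U / tf V" "ordge i U" "ordge i V" "evp p i V \<noteq> 0"
    and 2: "b = tf U' / tf V'" "ordge j U'" "ordge j V'" "evp p j V' \<noteq> 0" by (elim point_ring_E) (rule that)
  note D = point_ring_diff_frac[OF 1(2-4) 2(2-4)]
  show "a - b \<in> point_ring p" unfolding 1(1) 2(1) D(3) by (rule point_ring_I[OF D(1,4,5)])
  have "a * b = tf (U * U') / tf (V * V')" unfolding 1(1) 2(1) by simp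
  then show "a * b \<in> point_ring p" using point_ring_I[OF ordge_mult[OF 1(2) 2(2)] D(4,5)] by simp
qed

lemma tf_mem_point_ring: "tf P \<in> point_ring p"
  using mpow_subset_point_ring[of p] tf_mem_mpow_iff[of P 0] by auto

lemma constants_subset_point_ring: "constants \<subseteq> point_ring p"
  using constants_subset_mpow mpow_subset_point_ring by (rule order_trans)

lemma submod_point_ring_mpow: "submod (point_ring p) V \<Longrightarrow> submod (mpow 0) V"
  by (rule submod_subset[OF _ mpow_subset_point_ring])

lemma submod_point_ring_constants: "submod (point_ring p) V \<Longrightarrow> submod constants V"
  by (rule submod_subset[OF _ constants_subset_point_ring])

lemma submod_point_ideal: "submod (point_ring p) (point_ideal p)"
proof (rule submodI)
  show "0 \<in> point_ideal p" using point_ideal_iff[of 0 0 1 p] by (simp add: evp_0)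
  fix a b assume ab: "a \<in> point_ideal p" "b \<in> point_ideal p"
  obtain U V i where 1: "a = tf U / tf V" "ordge i U" "ordge i V" "evp p i V \<noteq> 0" "evp p i U = 0"
    using ab(1) unfolding point_ideal_def by blast
  obtain U' V' j where 2: "b = tf U' / tf V'" "ordge j U'" "ordge j V'" "evp p j V' \<noteq> 0" "evp p j U' = 0"
    using ab(2) unfolding point_ideal_def by blast
  note D = point_ring_diff_frac[OF 1(2-4) 2(2-4)]
  show "a - b \<in> point_ideal p" unfolding 1(1) 2(1) D(3) point_ideal_iff[OF D(1,4,5)] D(2) using 1 2 by simp
next
  fix a b assume ab: "a \<in> point_ring p" "b \<in> point_ideal p"
  obtain U V i where 1: "a = tf U / tf V" "ordge i U" "ordge i V" "evp p i V \<noteq> 0" by (rule point_ring_E[OF ab(1)])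
  obtain U' V' j where 2: "b = tf U' / tf V'" "ordge j U'" "ordge j V'" "evp p j V' \<noteq> 0" "evp p j U' = 0"
    using ab(2) unfolding point_ideal_def by blast
  note D = point_ring_diff_frac[OF 1(2-4) 2(2-4)]
  have e: "a * b = tf (U * U') / tf (V * V')" unfolding 1(1) 2(1) by simp
  show "a * b \<in> point_ideal p" unfolding e point_ideal_iff[OF ordge_mult[OF 1(2) 2(2)] D(4,5)] evp_mult[OF 1(2) 2(2)] using 2 by simp
qed

lemma one_notin_point_ideal: "1 \<notin> point_ideal p"
  using point_ideal_iff[of 0 1 1 p] by (simp add: evp_0)

lemma point_ring_residue:
  assumes "r \<in> point_ring p" shows "\<exists>c\<in>constants. r - c \<in> point_ideal p"
proof -
  obtain U V j where r: "r = tf U / tf V" "ordge j U" "ordge j V" "evp p j V \<noteq> 0" "tf V \<noteq> 0" by (rule point_ring_E[OF assms])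
  define c where "c = evp p j U / evp p j V"
  have o: "ordge 0 [:[:c:]:]" "ordge 0 1" "evp p 0 1 \<noteq> 0" by (simp_all add: evp_0)
  note D = point_ring_diff_frac[OF r(2-4) o]
  have "r - tf [:[:c:]:] = tf U / tf V - tf [:[:c:]:] / tf 1" unfolding r(1) by simp
  also have "\<dots> \<in> point_ideal p"
    unfolding D(3) point_ideal_iff[OF D(1,4,5)] D(2) using r(4) by (simp add: evp_0 c_def)
  finally show ?thesis using constants_I[of c] by blast
qed

lemma point_ring_inverse:
  assumes "r \<in> point_ring p" "r \<notin> point_ideal p" shows "1 / r \<in> point_ring p" "r \<noteq> 0"
proof -
  obtain U V j where r: "r = tf U / tf V" "ordge j U" "ordge j V" "evp p j V \<noteq> 0" "tf V \<noteq> 0" by (rule point_ring_E[OF assms(1)])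
  have e: "evp p j U \<noteq> 0" using point_ideal_iff[OF r(2-4)] assms(2) r(1) by simp
  have "1 / r = tf V / tf U" unfolding r(1) by simp
  then show "1 / r \<in> point_ring p" using point_ring_I[OF r(3,2) e] by simp
  show "r \<noteq> 0" using submod_zero[OF submod_point_ideal] assms(2) by metis
qed

lemma point_ring_unit:
  assumes "u \<in> point_ideal p" shows "\<exists>w\<in>point_ring p. w * (1 - u) = 1"
proof -
  have "1 - u \<in> point_ring p" using is_subring_diff[OF is_subring_point_ring is_subring_1[OF is_subring_point_ring]] assms point_ideal_subset_point_ring by blast
  moreover have "1 - u \<notin> point_ideal p"
  proof
    assume "1 - u \<in> point_ideal p"
    then have "1 - u + u \<in> point_ideal p" using submod_add[OF submod_point_ideal] assms by blast
    then show False using one_notin_point_ideal[of p] by simp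
  qed
  ultimately have "1 / (1 - u) \<in> point_ring p" "1 - u \<noteq> 0" by (rule point_ring_inverse)+
  then show ?thesis by (intro bexI[of _ "1 / (1 - u)"]) simp_all
qed

lemma rlen_constants_point_ring:
  assumes "submod (point_ring p) V" "submod (point_ring p) W" "W \<subseteq> V"
  shows "rlen constants V W = rlen (point_ring p) V W"
  by (rule rlen_local_ring[OF is_subring_point_ring is_subfield_constants constants_subset_point_ring submod_point_ideal point_ideal_subset_point_ring point_ring_residue point_ring_unit assms])

lemma is_prime_point_ideal: "is_prime (point_ring p) (point_ideal p)"
  unfolding is_prime_def
proof (intro conjI ballI impI)
  fix a b assume ab: "a \<in> point_ring p" "b \<in> point_ring p" "a * b \<in> point_ideal p"
  show "a \<in> point_ideal p \<or> b \<in> point_ideal p"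
  proof (rule disjCI)
    assume "b \<notin> point_ideal p"
    then have "1 / b \<in> point_ring p" "b \<noteq> 0" using point_ring_inverse[OF ab(2)] by simp_all
    then show "a \<in> point_ideal p" using submod_mult[OF submod_point_ideal _ ab(3), of "1 / b"] by simp
  qed
qed (rule submod_point_ideal point_ideal_subset_point_ring one_notin_point_ideal)+

lemma is_prime_subset_point_ideal:
  assumes "is_prime (point_ring p) P" shows "P \<subseteq> point_ideal p"
proof
  fix u assume u: "u \<in> P"
  show "u \<in> point_ideal p"
  proof (rule ccontr)
    assume n: "u \<notin> point_ideal p"
    have "u \<in> point_ring p" using u assms unfolding is_prime_def by blast
    then have "1 / u \<in> point_ring p" "u \<noteq> 0" using point_ring_inverse n by blast+
    then have "1 \<in> P" using submod_mult[of "point_ring p" P "1 / u" u] u assms unfolding is_prime_def by simp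
    then show False using assms unfolding is_prime_def by simp
  qed
qed

lemma mpow_div_mem_point_ring:
  assumes u: "u \<in> mpow (j * r)" and s: "homogeneous r s" "eval2 s (fst p) (snd p) \<noteq> 0"
  shows "u / tf s ^ j \<in> point_ring p"
proof -
  obtain P Q where P: "u = tf P / tf Q" "ordge (j * r) P" "eval2 Q 0 0 \<noteq> 0" by (rule mpow_E[OF u])
  have sj: "ordge (j * r) (s ^ j)" "evp p (j * r) (s ^ j) \<noteq> 0"
    using evp_power[OF ordge_homogeneous[OF s(1)], of j p] s by (simp_all add: evp_homogeneous)
  have "tf P / tf (Q * s ^ j) \<in> point_ring p"
  proof (rule point_ring_I)
    show "ordge (j * r) (Q * s ^ j)" using ordge_mult_left[OF sj(1)] .
    show "evp p (j * r) (Q * s ^ j) \<noteq> 0" using evp_mult[of 0 Q "j * r" "s ^ j" p] sj P(3) by (simp add: evp_0)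
  qed (rule P)
  then show ?thesis unfolding P(1) by simp
qed

text \<open>
  A binary form over an algebraically closed field is a product of linear forms, so a prime ideal
  that contains it, divided by a power of the equation of the exceptional line, contains a linear one.
\<close>

lemma is_prime_form:
  fixes H :: "'k::alg_closed_field poly poly"
  assumes P: "is_prime B P" and B: "\<And>n H. homogeneous n H \<Longrightarrow> tf H / tf s ^ n \<in> B"
    and H: "homogeneous n H" "H \<noteq> 0" "tf H / tf s ^ n \<in> P" and s: "s \<noteq> 0"
  shows "\<exists>p. p \<noteq> (0, 0) \<and> eval2 H (fst p) (snd p) = 0 \<and> tf (lp p) / tf s \<in> P"
  using H
proof (induction n arbitrary: H)
  case 0
  have "H = [:[:eval2 H 0 0:]:]" using 0(1) hp_zero[of H] by (simp add: homogeneous_iff_hp)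
  then obtain c where c: "H = [:[:c:]:]" by blast
  then have "c \<noteq> 0" using 0(2) by auto
  then have 1: "[:[:1 / c:]:] * H = 1" unfolding c by (simp add: one_pCons[symmetric])
  have "homogeneous 0 [:[:1 / c:]:]" unfolding homogeneous_def by (auto simp: coeff_pCons split: nat.splits)
  then have "tf [:[:1 / c:]:] \<in> B" using B[of 0 "[:[:1 / c:]:]"] by simp
  moreover have "tf H \<in> P" using 0(3) by simp
  ultimately have "tf [:[:1 / c:]:] * tf H \<in> P" using P submod_mult unfolding is_prime_def by metis
  then have "1 \<in> P" using 1 by (metis to_fract_1 to_fract_mult)
  then show ?case using P unfolding is_prime_def by simp
next
  case (Suc n)
  obtain a b where ab: "(a, b) \<noteq> (0, 0)" "eval2 H a b = 0" by (rule homogeneous_zero_exists[OF Suc.prems(1)]) simp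
  have "lp (a, b) dvd H" unfolding lp_def using linear_form_dvd[OF Suc.prems(1) ab(2,1)] by simp
  then obtain H1 where H1: "H = lp (a, b) * H1" by (rule dvdE)
  have nz: "lp (a, b) \<noteq> 0" "H1 \<noteq> 0" using Suc.prems(2) unfolding H1 by auto
  have "homogeneous n H1"
  proof -
    obtain i j where ij: "Suc n = i + j" "homogeneous i (lp (a, b))" "homogeneous j H1"
      using homogeneous_factors[of "Suc n" "lp (a, b)" H1] Suc.prems(1,2) unfolding H1 by blast
    have "i = 1" using hp_homogeneous[OF ij(2), of 1] hp_homogeneous[OF homogeneous_lp(1), of 1 "(a, b)"] nz(1) by (metis)
    then show ?thesis using ij by simp
  qed
  note hom = this
  have "tf H / tf s ^ Suc n = (tf (lp (a, b)) / tf s ^ 1) * (tf H1 / tf s ^ n)" unfolding H1 by simp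
  then have "(tf (lp (a, b)) / tf s ^ 1) * (tf H1 / tf s ^ n) \<in> P" using Suc.prems(3) by (simp only:)
  moreover have "tf (lp (a, b)) / tf s ^ 1 \<in> B" "tf H1 / tf s ^ n \<in> B" by (rule B, simp, rule B, rule hom)
  ultimately have "tf (lp (a, b)) / tf s ^ 1 \<in> P \<or> tf H1 / tf s ^ n \<in> P" using P unfolding is_prime_def by blast
  then show ?case
  proof
    assume "tf (lp (a, b)) / tf s ^ 1 \<in> P"
    then show ?thesis using ab by (intro exI[of _ "(a, b)"]) simp
  next
    assume "tf H1 / tf s ^ n \<in> P"
    then obtain p where "p \<noteq> (0, 0)" "eval2 H1 (fst p) (snd p) = 0" "tf (lp p) / tf s \<in> P"
      using Suc.IH[OF hom nz(2)] by blast
    then show ?thesis unfolding H1 by (intro exI[of _ p]) simp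
  qed
qed

section \<open>Local parameters and the dimension at a point of the exceptional line\<close>

lemma lp_proportional:
  assumes "p \<noteq> (0, 0)" "eval2 (lp q) (fst p) (snd p) = 0" "q \<noteq> (0, 0)"
  obtains c where "c \<noteq> 0" "p = (c * fst q, c * snd q)"
proof -
  have e: "fst p * snd q = snd p * fst q" using assms(2) by (simp add: lp_def)
  show thesis
  proof (cases "fst q = 0")
    case True
    then have q: "snd q \<noteq> 0" using assms(3) by (metis prod.collapse)
    then have "fst p = 0" using e True by simp
    then have "snd p \<noteq> 0" using assms(1) by (metis prod.collapse)
    then show thesis using \<open>fst p = 0\<close> True q
      by (intro that[of "snd p / snd q"]) (simp_all add: prod_eq_iff)
  next
    case False
    then have s: "snd p = fst p / fst q * snd q" using e by (simp add: field_simps)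
    then have "fst p \<noteq> 0" using assms(1) by (metis div_0 mult_zero_left prod.collapse)
    then show thesis using False s by (intro that[of "fst p / fst q"]) (simp_all add: prod_eq_iff)
  qed
qed

lemma lp_scale: "lp (c * a, c * b) = [:[:c:]:] * lp (a, b)"
  by (simp add: lp_def linear_form_def)

text \<open>A coordinate that does not vanish in the direction \<open>p\<close>, that is, a local
  equation of the exceptional line at this point.\<close>

definition sp :: "'k::field \<times> 'k \<Rightarrow> 'k poly poly" where
  "sp p = (if fst p \<noteq> 0 then px else py)"

lemma homogeneous_sp: "homogeneous 1 (sp p)"
  by (simp only: sp_def homogeneous_px homogeneous_py split: if_split) simp

lemma eval2_sp: "p \<noteq> (0, 0) \<Longrightarrow> eval2 (sp p) (fst p) (snd p) \<noteq> 0"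
  by (cases p) (auto simp: sp_def)

lemma sp_nz [simp]: "sp p \<noteq> 0"
  by (simp add: sp_def)

lemma div_sp_mem_point_ring: "p \<noteq> (0, 0) \<Longrightarrow> ordge j U \<Longrightarrow> tf U / tf (sp p) ^ j \<in> point_ring p"
  by (rule mpow_div_mem_point_ring[OF _ homogeneous_sp eval2_sp]) simp_all

lemma evp_sp: "p \<noteq> (0, 0) \<Longrightarrow> evp p 1 (sp p) \<noteq> 0"
  by (simp only: evp_homogeneous[OF homogeneous_sp] eval2_sp not_False_eq_True)

lemma lp_nz: "p \<noteq> (0, 0) \<Longrightarrow> lp p \<noteq> 0"
  by (cases p) (auto simp: lp_def linear_form_eq_0_iff)

lemma lp_zero: "eval2 (lp p) (fst p) (snd p) = 0"
  by (simp add: lp_def)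

lemma ordge_lp_cancel:
  fixes p :: "'k::field \<times> 'k"
  assumes "p \<noteq> (0, 0)" "ordge (Suc i) (lp p * U)" shows "ordge i U"
  using ordge_cancel[OF ordge_homogeneous[OF homogeneous_lp(1)], of p i U] assms lp_nz[OF assms(1)]
  by (simp add: hp_homogeneous[OF homogeneous_lp(1)])

text \<open>The prime contains some linear form divided by \<open>sp p\<close>, and that form must
  vanish at \<open>p\<close>. So \<open>P\<close> contains both local parameters,
  \<open>sp p\<close> and \<open>lp p / sp p\<close>. They generate \<open>point_ideal p\<close>:
  terms of higher order are multiples of the former, and a leading form that vanishes at
  \<open>p\<close> is divisible by \<open>lp p\<close>.\<close>

lemma point_ideal_subset_is_prime:
  fixes p :: "'k::alg_closed_field \<times> 'k"
  assumes p: "p \<noteq> (0, 0)" and P: "is_prime (point_ring p) P" and s: "tf (sp p) \<in> P"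
    and H: "homogeneous n H" "H \<noteq> 0" "tf H / tf (sp p) ^ n \<in> P"
  shows "point_ideal p \<subseteq> P"
proof -
  let ?s = "sp p"
  have sm: "submod (point_ring p) P" using P unfolding is_prime_def by blast
  have div: "tf U / tf ?s ^ j \<in> point_ring p" if "ordge j U" for U j
    by (rule div_sp_mem_point_ring[OF p that])
  obtain q where q: "q \<noteq> (0, 0)" "tf (lp q) / tf ?s \<in> P"
    using is_prime_form[OF P, of ?s n H] div[OF ordge_homogeneous] H by auto
  have "tf (lp q) / tf ?s \<in> point_ideal p" using is_prime_subset_point_ideal[OF P] q(2) by blast
  then have "evp p 1 (lp q) = 0"
    using point_ideal_iff[OF ordge_homogeneous[OF homogeneous_lp(1)] ordge_homogeneous[OF homogeneous_sp] evp_sp[OF p]]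
    by blast
  then have "eval2 (lp q) (fst p) (snd p) = 0" by (simp only: evp_homogeneous[OF homogeneous_lp(1)])
  then obtain c where c: "p = (c * fst q, c * snd q)" by (rule lp_proportional[OF p _ q(1)])
  have "lp p = [:[:c:]:] * lp q" unfolding c by (subst lp_scale) simp
  then have "tf (lp p) / tf ?s = tf [:[:c:]:] * (tf (lp q) / tf ?s)" by (simp only: to_fract_mult times_divide_eq_right)
  then have lP: "tf (lp p) / tf ?s \<in> P" using submod_mult[OF sm tf_mem_point_ring q(2)] by (simp only:)
  show ?thesis
  proof
    fix m assume "m \<in> point_ideal p"
    then obtain U V j where m: "m = tf U / tf V" "ordge j U" "ordge j V" "evp p j V \<noteq> 0" "evp p j U = 0"
      unfolding point_ideal_def by blast
    have R: "tf (U - hp j U) / tf ?s ^ j \<in> P"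
    proof -
      have "tf (U - hp j U) / tf ?s ^ j = tf (U - hp j U) / tf ?s ^ Suc j * tf ?s" by simp
      then show ?thesis using submod_mult[OF sm div[OF hp_decomp_ordge[OF m(2)]] s] by (simp only:)
    qed
    have Hj: "tf (hp j U) / tf ?s ^ j \<in> P"
    proof (cases j)
      case 0
      then have "hp j U = 0" using m(5) by (simp add: evp_0 hp_zero)
      then show ?thesis using submod_zero[OF sm] by simp
    next
      case (Suc i)
      have "linear_form (snd p) (- fst p) dvd hp j U"
        by (rule linear_form_dvd[OF homogeneous_hp]) (use m(5) p in \<open>simp_all add: evp_def\<close>)
      then obtain U1 where U1: "hp j U = lp p * U1" unfolding lp_def by (rule dvdE)
      have "ordge j (lp p * U1)" using ordge_homogeneous[OF homogeneous_hp, of j U] unfolding U1 .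
      then have "ordge (Suc i) (lp p * U1)" by (simp only: Suc)
      then have o: "ordge i U1" by (rule ordge_lp_cancel[OF p])
      have "tf (hp j U) / tf ?s ^ j = tf U1 / tf ?s ^ i * (tf (lp p) / tf ?s)" unfolding U1 by (simp add: Suc mult.commute)
      then show ?thesis using submod_mult[OF sm div[OF o] lP] by (simp only:)
    qed
    have sj: "ordge j (?s ^ j)" "tf ?s ^ j \<noteq> 0"
      using evp_power[OF ordge_homogeneous[OF homogeneous_sp], of j p p] by simp_all
    have "tf U / tf ?s ^ j = tf (hp j U) / tf ?s ^ j + tf (U - hp j U) / tf ?s ^ j"
      by (simp add: add_divide_distrib[symmetric])
    then have "tf U / tf ?s ^ j \<in> P" using submod_add[OF sm Hj R] by (simp only:)
    then have "tf (?s ^ j) / tf V * (tf U / tf ?s ^ j) \<in> P" by (rule submod_mult[OF sm point_ring_I[OF sj(1) m(3,4)]])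
    moreover have "tf (?s ^ j) / tf V * (tf U / tf ?s ^ j) = m" using sj(2) unfolding m(1) by simp
    ultimately show "m \<in> P" by simp
  qed
qed

text \<open>Between zero and \<open>point_ideal p\<close> lies the ideal of the exceptional line.
  For the upper bound two kinds of larger primes \<open>P'\<close> occur: if \<open>P'\<close>
  contains the local equation \<open>s\<close>, one element outside \<open>(s)\<close> makes it
  contain \<open>point_ideal p\<close>; otherwise coprime polynomials in \<open>P'\<close> would put
  a power of the maximal ideal of \<open>A\<close>, and then \<open>s\<close>, into it.\<close>

lemma krull_dim_point_ring:
  fixes p :: "'k::alg_closed_field \<times> 'k"
  assumes p: "p \<noteq> (0, 0)"
  shows "krull_dim (subring_of (point_ring p)) = 2"
proof -
  let ?s = "sp p" and ?L = "point_ring p"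
  let ?Q = "tf ?s *\<^sub>S ?L"
  have s1: "ordge 1 ?s" by (rule ordge_homogeneous[OF homogeneous_sp])
  have es: "evp p 1 ?s \<noteq> 0" by (rule evp_sp[OF p])
  have s0: "tf ?s \<noteq> 0" by simp
  have div: "tf U / tf ?s ^ j \<in> ?L" if "ordge j U" for U j
    by (rule div_sp_mem_point_ring[OF p that])
  \<comment> \<open>Divisibility by \<open>s\<close> is visible in orders: the numerator vanishes to
    higher order than the denominator, whose order is exactly \<open>j\<close>.\<close>
  have memQ: "tf U / tf V \<in> ?Q \<longleftrightarrow> ordge (Suc j) U" if V: "ordge j V" "evp p j V \<noteq> 0" for U V j
  proof
    assume "tf U / tf V \<in> ?Q"
    then obtain w where w: "w \<in> ?L" "tf U / tf V = tf ?s * w" by (rule smulE)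
    obtain U' V' i where 1: "w = tf U' / tf V'" "ordge i U'" "ordge i V'" "evp p i V' \<noteq> 0" "tf V' \<noteq> 0" by (rule point_ring_E[OF w(1)])
    have "tf V \<noteq> 0" using evp_nz(1)[OF V(2)] by simp
    then have "tf (V' * U) = tf (?s * U' * V)" using w(2) 1(1,5) by (simp add: field_simps)
    then have e: "V' * U = ?s * U' * V" by (simp only: to_fract_eq_iff)
    have "ordge (1 + i + j) (?s * U' * V)" by (intro ordge_mult s1 1 V)
    then have "ordge (i + Suc j) (V' * U)" unfolding e by simp
    then show "ordge (Suc j) U" by (rule ordge_cancel[OF 1(3) evp_nz(2)[OF 1(4)]])
  next
    assume U: "ordge (Suc j) U"
    have "ordge (1 + j) (?s * V)" "evp p (1 + j) (?s * V) \<noteq> 0"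
      using ordge_mult[OF s1 V(1)] evp_mult[OF s1 V(1), of p] es V(2) by simp_all
    then have "tf U / tf (?s * V) \<in> ?L" using point_ring_I[of "1 + j" U "?s * V" p] U by simp
    from smulI[OF this, of "tf ?s"] show "tf U / tf V \<in> ?Q" by simp
  qed
  have smQ: "submod ?L ?Q" by (rule submod_smul[OF is_subring_submod[OF is_subring_point_ring]])
  have Q_point_ideal: "?Q \<subseteq> point_ideal p"
  proof (rule smul_subset_submod[OF submod_point_ideal])
    have "tf ?s / tf 1 \<in> point_ideal p"
      by (subst point_ideal_iff[of 0]) (use s1 in \<open>simp_all add: evp_0 ordge_1_iff\<close>)
    then show "tf ?s \<in> point_ideal p" by simp
  qed
  have prmQ: "is_prime ?L ?Q" unfolding is_prime_def
  proof (intro conjI ballI impI)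
    show "submod ?L ?Q" by (rule smQ)
    show "?Q \<subseteq> ?L" by (rule smul_subset_submod[OF is_subring_submod[OF is_subring_point_ring] tf_mem_point_ring])
    show "1 \<notin> ?Q" using Q_point_ideal one_notin_point_ideal by blast
    fix a b assume ab: "a \<in> ?L" "b \<in> ?L" "a * b \<in> ?Q"
    obtain U V i where 1: "a = tf U / tf V" "ordge i U" "ordge i V" "evp p i V \<noteq> 0" by (rule point_ring_E[OF ab(1)])
    obtain U' V' j where 2: "b = tf U' / tf V'" "ordge j U'" "ordge j V'" "evp p j V' \<noteq> 0" by (rule point_ring_E[OF ab(2)])
    have V: "ordge (i + j) (V * V')" "evp p (i + j) (V * V') \<noteq> 0"
      using ordge_mult[OF 1(3) 2(3)] evp_mult[OF 1(3) 2(3), of p] 1 2 by simp_all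
    have "tf (U * U') / tf (V * V') \<in> ?Q" using ab(3) 1 2 by simp
    then have "ordge (Suc (i + j)) (U * U')" by (subst (asm) memQ[OF V])
    then have "hp i U * hp j U' = 0" using hp_mult_ordge[OF 1(2) 2(2)] by (simp add: ordge_Suc_iff)
    then have "ordge (Suc i) U \<or> ordge (Suc j) U'" using 1(2) 2(2) by (simp add: ordge_Suc_iff)
    then show "a \<in> ?Q \<or> b \<in> ?Q" unfolding 1(1) 2(1) using memQ[OF 1(3,4)] memQ[OF 2(3,4)] by simp
  qed
  have max1: "point_ideal p \<subseteq> P" if P: "is_prime ?L P" "tf ?s \<in> P" and z: "z \<in> P" "z \<notin> ?Q" for P z
  proof -
    have sm: "submod ?L P" and PL: "P \<subseteq> ?L" using P unfolding is_prime_def by blast+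
    obtain U V j where 1: "z = tf U / tf V" "ordge j U" "ordge j V" "evp p j V \<noteq> 0" "tf V \<noteq> 0"
      using z(1) PL by (blast elim: point_ring_E)
    have nz: "hp j U \<noteq> 0" using z(2) 1 memQ[OF 1(3,4), of U] by (simp add: ordge_Suc_iff)
    have "tf V / tf ?s ^ j * z \<in> P" by (rule submod_mult[OF sm div[OF 1(3)] z(1)])
    moreover have "tf V / tf ?s ^ j * z = tf U / tf ?s ^ j" using 1 by simp
    ultimately have U: "tf U / tf ?s ^ j \<in> P" by simp
    have R: "tf (U - hp j U) / tf ?s ^ j \<in> P"
    proof -
      have "tf (U - hp j U) / tf ?s ^ j = tf (U - hp j U) / tf ?s ^ Suc j * tf ?s" by simp
      then show ?thesis using submod_mult[OF sm div[OF hp_decomp_ordge[OF 1(2)]] P(2)] by (simp only:)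
    qed
    have "tf (hp j U) / tf ?s ^ j = tf U / tf ?s ^ j - tf (U - hp j U) / tf ?s ^ j"
      by (simp add: diff_divide_distrib)
    then have "tf (hp j U) / tf ?s ^ j \<in> P" using submod_diff[OF sm U R] by (simp only:)
    then show ?thesis by (rule point_ideal_subset_is_prime[OF p P homogeneous_hp nz])
  qed
  show ?thesis
  proof (rule krull_dim_eq_2[OF is_subring_point_ring _ prmQ is_prime_point_ideal])
    show "is_prime ?L {0}" by (simp add: is_prime_def submod_trivial is_subring_0[OF is_subring_point_ring])
    show "{0} \<subset> ?Q"
    proof -
      have "tf ?s \<in> ?Q" by (rule mem_smul_self[OF is_subring_point_ring])
      moreover have "0 \<in> ?Q" using submod_zero[OF smQ] .
      ultimately show ?thesis using s0 by (metis empty_subsetI insert_subset psubsetI singletonD)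
    qed
    show "?Q \<subset> point_ideal p"
    proof -
      have "tf (lp p) / tf ?s \<in> point_ideal p"
        by (subst point_ideal_iff[OF ordge_homogeneous[OF homogeneous_lp(1)] s1 es])
          (simp only: evp_homogeneous[OF homogeneous_lp(1)] lp_zero)
      moreover have "tf (lp p) / tf ?s \<notin> ?Q"
        by (subst memQ[OF s1 es]) (simp add: ordge_Suc_iff hp_homogeneous[OF homogeneous_lp(2)] lp_nz[OF p])
      ultimately show ?thesis using Q_point_ideal by (metis psubsetI)
    qed
    show "P \<subseteq> point_ideal p" if "is_prime ?L P" for P by (rule is_prime_subset_point_ideal[OF that])
    fix P P' assume P: "is_prime ?L P" "is_prime ?L P'" "P \<noteq> {0}" "P \<subset> P'"
    have sm: "submod ?L P" "submod ?L P'" and sub: "P \<subseteq> ?L" "P' \<subseteq> ?L" using P unfolding is_prime_def by blast+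
    have pr: "a \<in> P \<or> b \<in> P" if "a \<in> ?L" "b \<in> ?L" "a * b \<in> P" for a b
      using P(1) that unfolding is_prime_def by simp
    obtain u where u: "u \<in> P" "u \<noteq> 0" using P(3) submod_zero[OF sm(1)] by blast
    obtain U V j where U: "u = tf U / tf V" "ordge j U" "ordge j V" "evp p j V \<noteq> 0" "tf V \<noteq> 0"
      using u(1) sub by (blast elim: point_ring_E)
    have U0: "U \<noteq> 0" using u(2) U(1) by auto
    show "point_ideal p \<subseteq> P'"
    proof (cases "tf ?s \<in> P'")
      case True
      show ?thesis
      proof (cases "P \<subseteq> ?Q")
        case False
        then obtain z where "z \<in> P" "z \<notin> ?Q" by blast
        then show ?thesis using max1[OF P(2) True, of z] P(4) by blast
      next
        case PQ: True
        obtain c where c: "ordge c U" "hp c U \<noteq> 0" by (rule ordge_exists[OF U0])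
        have jc: "j \<le> c"
        proof (rule ccontr)
          assume "\<not> j \<le> c"
          then show False using ordge_hp[OF U(2), of c] c(2) by simp
        qed
        \<comment> \<open>\<open>s^e\<close> is the full power of the exceptional line in
          \<open>u\<close>. The cofactor \<open>z\<close> is not divisible by \<open>s\<close>, so
          it is outside \<open>P\<close>, and primality puts \<open>s\<close> into \<open>P\<close>.
          Then \<open>P\<close> equals \<open>(s)\<close>, and \<open>P'\<close> reaches beyond
          it.\<close>
        define e where "e = c - j"
        have se: "ordge e (?s ^ e)" "evp p e (?s ^ e) \<noteq> 0"
          using evp_power[OF s1, of e p] es by simp_all
        have V: "ordge c (?s ^ e * V)" "evp p c (?s ^ e * V) \<noteq> 0"
          using ordge_mult[OF se(1) U(3)] evp_mult[OF se(1) U(3), of p] se U(4) jc by (simp_all add: e_def)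
        define z where "z = tf U / tf (?s ^ e * V)"
        have zL: "z \<in> ?L" unfolding z_def by (rule point_ring_I[OF c(1) V])
        have "z \<notin> ?Q" unfolding z_def memQ[OF V] using c by (simp add: ordge_Suc_iff)
        then have zP: "z \<notin> P" by (rule contra_subsetD[OF PQ])
        have "tf ?s ^ e * z = u" unfolding z_def U(1) by simp
        then have "tf ?s ^ e * z \<in> P" using u(1) by simp
        from pr[OF is_subring_power[OF is_subring_point_ring tf_mem_point_ring] zL this] zP have "tf ?s ^ e \<in> P" by simp
        then have "tf ?s \<in> P" by (rule is_prime_power[OF P(1) is_subring_point_ring tf_mem_point_ring])
        then have "?Q \<subseteq> P" by (rule smul_subset_submod[OF sm(1)])
        then obtain z' where "z' \<in> P'" "z' \<notin> ?Q" using P(4) PQ by blast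
        then show ?thesis by (rule max1[OF P(2) True])
      qed
    next
      case False
      have "tf V * u \<in> P" by (rule submod_mult[OF sm(1) tf_mem_point_ring u(1)])
      then have UP: "tf U \<in> P" using U(1,5) by simp
      have rt: "range tf \<subseteq> ?L" by (rule image_subsetI) (rule tf_mem_point_ring)
      obtain q where q: "Factorial_Ring.irreducible q" "tf q \<in> P" by (rule is_prime_irreducible[OF P(1) rt UP U0])
      obtain w where w: "w \<in> P'" "w \<notin> P" using P(4) by blast
      obtain W V' i where W: "w = tf W / tf V'" "ordge i W" "ordge i V'" "evp p i V' \<noteq> 0" "tf V' \<noteq> 0"
        using w(1) sub by (blast elim: point_ring_E)
      have "tf V' * w \<in> P'" by (rule submod_mult[OF sm(2) tf_mem_point_ring w(1)])
      then have WP': "tf W \<in> P'" using W(1,5) by simp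
      \<comment> \<open>The denominator \<open>V'\<close> cannot lie in \<open>P\<close>: it divides
        \<open>s^i\<close> in the local ring, and \<open>s\<close> is not even in
        \<open>P'\<close>.\<close>
      have WP: "tf W \<notin> P"
      proof
        assume "tf W \<in> P"
        then have "w * tf V' \<in> P" using W(1,5) by simp
        moreover have "w \<in> ?L" using w(1) sub by blast
        ultimately have "tf V' \<in> P" using pr[of w "tf V'"] w(2) tf_mem_point_ring[of V' p] by simp
        have si: "ordge i (?s ^ i)" using evp_power[OF s1, of i p] by simp
        have "tf (?s ^ i) / tf V' * tf V' \<in> P" by (rule submod_mult[OF sm(1) point_ring_I[OF si W(3,4)] \<open>tf V' \<in> P\<close>])
        then have "tf ?s ^ i \<in> P" using W(5) by simp
        then have "tf ?s \<in> P" by (rule is_prime_power[OF P(1) is_subring_point_ring tf_mem_point_ring])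
        then show False using False P(4) by blast
      qed
      have "\<not> q dvd W"
      proof
        assume "q dvd W"
        then obtain t where "W = q * t" by (rule dvdE)
        then have "tf W = tf t * tf q" by simp
        then show False using WP submod_mult[OF sm(1) tf_mem_point_ring q(2)] by simp
      qed
      then have "no_common_factor q W" by (rule irreducible_not_dvd_no_common_factor[OF q(1)])
      moreover have "q \<noteq> 0" using q(1) by (auto simp: Factorial_Ring.irreducible_def)
      moreover have "W \<noteq> 0" using WP submod_zero[OF sm(1)] by auto
      moreover have "tf q \<in> P'" using q(2) P(4) by blast
      ultimately obtain N where N: "mpow N \<subseteq> P'" using no_common_factor_contains_mpow[OF _ _ _ submod_point_ring_mpow[OF sm(2)] _ WP'] by blast
      have "ordge N (?s ^ N)" using evp_power[OF s1, of N p] by simp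
      then have "tf ?s ^ N \<in> P'" using N tf_mem_mpow[of N "?s ^ N"] by auto
      then have "tf ?s \<in> P'" by (rule is_prime_power[OF P(2) is_subring_point_ring tf_mem_point_ring])
      then show ?thesis using False by simp
    qed
  qed
qed

section \<open>Intersection multiplicity and the Koszul complex\<close>

lemma mpow_cancel:
  assumes f: "ordge c f" "hp c f \<noteq> 0" and a: "a \<in> mpow 0" "tf f * a \<in> mpow (c + j)"
  shows "a \<in> mpow j"
proof -
  obtain P Q where P: "a = tf P / tf Q" "eval2 Q 0 0 \<noteq> 0" "tf Q \<noteq> 0" by (rule mpow_E[OF a(1)])
  have "tf f * a * tf Q \<in> mpow (c + j + 0)" by (rule mpow_mult[OF a(2)]) simp
  moreover have "tf f * a * tf Q = tf (f * P)" using P(1,3) by simp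
  ultimately have "ordge (c + j) (f * P)" by (simp only: tf_mem_mpow_iff add_0_right)
  then have "ordge j P" by (rule ordge_cancel[OF f])
  then show ?thesis unfolding P(1) using P(2) by (rule mpow_I)
qed

text \<open>Denominators are units of \<open>A\<close>, so clearing them reduces the claim to
  cancellation of \<open>g\<close> in a divisibility of polynomials.\<close>

lemma no_common_factor_regular:
  assumes f: "f \<noteq> 0" "no_common_factor f g" and a: "a \<in> mpow 0" "r \<in> mpow 0" "tf f * a = tf g * r"
  shows "r \<in> tf f *\<^sub>S mpow 0"
proof -
  obtain P Q where P: "a = tf P / tf Q" "eval2 Q 0 0 \<noteq> 0" "tf Q \<noteq> 0" by (rule mpow_E[OF a(1)])
  obtain P' Q' where P': "r = tf P' / tf Q'" "eval2 Q' 0 0 \<noteq> 0" "tf Q' \<noteq> 0" by (rule mpow_E[OF a(2)])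
  have "tf (f * (P * Q')) = tf (g * (P' * Q))" using a(3) P P' by (simp add: field_simps)
  then have "f * (P * Q') = g * (P' * Q)" by (simp only: to_fract_eq_iff)
  then have "f dvd g * (P' * Q)" by (metis dvd_triv_left)
  then have "f dvd P' * Q" by (rule no_common_factor_dvd_cancel[OF f])
  then obtain s where s: "P' * Q = f * s" by (rule dvdE)
  have "tf P' * tf Q = tf f * tf s" using s by (metis to_fract_mult)
  then have e: "tf P' * tf Q = tf f * tf s" .
  have "r = tf P' * tf Q / (tf Q' * tf Q)" using P(3) P'(1) by simp
  also have "\<dots> = tf f * (tf s / tf (Q * Q'))" unfolding e by (simp add: mult.commute)
  finally have "r = tf f * (tf s / tf (Q * Q'))" .
  moreover have "tf s / tf (Q * Q') \<in> mpow 0" by (rule mpow_I[OF ordge_0(1)]) (use P(2) P'(2) in simp)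
  ultimately show ?thesis by (simp only: smulI)
qed

text \<open>The origin of the term \<open>c d\<close>: with \<open>n = c + d + m\<close> the
  triangular numbers are the colengths of the powers of the maximal ideal with exponents
  \<open>n - d\<close>, \<open>n - c\<close>, \<open>n\<close> and \<open>n - c - d\<close>, which
  occur in the Koszul complex of two forms of degrees \<open>c\<close> and \<open>d\<close>.\<close>

lemma tri_koszul: "tri (c + m) + tri (d + m) + c * d = tri (c + d + m) + tri m"
proof -
  have "2 * (tri (c + m) + tri (d + m) + c * d) = 2 * (tri (c + d + m) + tri m)"
    unfolding distrib_left tri_eq by (simp add: algebra_simps)
  then show ?thesis by (simp only: mult_cancel1) simp
qed

locale curve_pair =
  fixes f g :: "'k::alg_closed_field poly poly" and c d :: nat
  assumes f: "ordge c f" "hp c f \<noteq> 0" and g: "ordge d g" "hp d g \<noteq> 0"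
    and pos: "0 < c" "0 < d" and no_common_factor: "no_common_factor f g"
begin

definition origin_curves :: "'k rational_function set" where
  "origin_curves = tf f *\<^sub>S mpow 0 \<boxplus> tf g *\<^sub>S mpow 0"

text \<open>In general smaller than the intersection of \<open>(f, g)\<close> with
  \<open>mpow n\<close>: cancellation of leading forms yields elements of higher order than this sum
  accounts for.\<close>

definition koszul_image :: "nat \<Rightarrow> 'k rational_function set" where
  "koszul_image n = tf f *\<^sub>S mpow (n - c) \<boxplus> tf g *\<^sub>S mpow (n - d)"

definition f_plus_power :: "nat \<Rightarrow> 'k rational_function set" where
  "f_plus_power n = tf f *\<^sub>S mpow 0 \<boxplus> mpow n"

lemma f0: "f \<noteq> 0" and g0: "g \<noteq> 0"
  using f g by auto

lemma tf_fg0: "tf f \<noteq> 0" "tf g \<noteq> 0"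
  using f0 g0 by simp_all

lemma reg:
  assumes "a \<in> mpow 0" "r \<in> mpow 0" "tf f * a = tf g * r"
  shows "r \<in> tf f *\<^sub>S mpow 0" "a \<in> tf g *\<^sub>S mpow 0"
  using no_common_factor_regular[OF f0 no_common_factor assms] no_common_factor_regular[OF g0 no_common_factor_sym[OF no_common_factor] assms(2,1) assms(3)[symmetric]] by simp_all

lemma sm_smul: "submod (mpow 0) (a *\<^sub>S mpow n)"
  by (rule submod_smul[OF submod_mpow])

lemma sm_origin_curves: "submod (mpow 0) origin_curves" and sm_koszul_image: "submod (mpow 0) (koszul_image n)" and sm_f_plus_power: "submod (mpow 0) (f_plus_power n)"
  unfolding origin_curves_def koszul_image_def f_plus_power_def by (intro submod_splus sm_smul submod_mpow)+

lemma smul_mpow_subset: "tf f *\<^sub>S mpow j \<subseteq> mpow (c + j)" "tf g *\<^sub>S mpow j \<subseteq> mpow (d + j)"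
  using mpow_mult[OF tf_mem_mpow[OF f(1)]] mpow_mult[OF tf_mem_mpow[OF g(1)]] by (auto elim!: smulE)

lemma smul_mI0: "tf P *\<^sub>S mpow 0 \<subseteq> mpow 0"
  by (rule smul_subset_submod[OF submod_mpow]) simp

lemma origin_curves_sub: "origin_curves \<subseteq> mpow 0"
  unfolding origin_curves_def by (intro splus_least[OF submod_mpow] smul_mI0)

lemma f_plus_power_sub: "f_plus_power n \<subseteq> mpow 0"
  unfolding f_plus_power_def by (intro splus_least[OF submod_mpow] smul_mI0 mpow_antimono) simp

lemma origin_curves_contains: "\<exists>N. mpow N \<subseteq> origin_curves"
proof (rule no_common_factor_contains_mpow[OF f0 g0 no_common_factor sm_origin_curves])
  show "tf f \<in> origin_curves" unfolding origin_curves_def by (rule subsetD[OF splus_upper1[OF sm_smul] mem_smul_self[OF is_subring_mpow]])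
  show "tf g \<in> origin_curves" unfolding origin_curves_def by (rule subsetD[OF splus_upper2[OF sm_smul] mem_smul_self[OF is_subring_mpow]])
qed

definition origin_mult :: nat where "origin_mult = the_enat (rlen constants (mpow 0) origin_curves)"

lemma rlen_origin_curves: "rlen constants (mpow 0) origin_curves = enat origin_mult"
proof -
  obtain N where N: "mpow N \<subseteq> origin_curves" using origin_curves_contains by blast
  have "rlen constants (mpow 0) origin_curves \<le> rlen constants (mpow 0) (mpow N :: 'k rational_function set)"
    by (rule rlen_mono) (simp_all add: submod_constants submod_mpow sm_origin_curves N origin_curves_sub)
  then have "rlen constants (mpow 0) origin_curves \<le> enat (tri N)" unfolding rlen_mpow .
  then show ?thesis unfolding origin_mult_def by (cases "rlen constants (mpow 0) origin_curves") auto
qed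

text \<open>Orders add, so the elements of \<open>f A\<close> of order at least \<open>m\<close> are
  \<open>f\<close> times the elements of order at least \<open>m - c\<close>. The additive form of
  the equation avoids subtraction of lengths.\<close>

lemma rlen_f_plus_power:
  assumes "c \<le> m" shows "rlen constants (mpow 0) (f_plus_power m) + enat (tri (m - c)) = enat (tri m)"
proof -
  have int: "tf f *\<^sub>S mpow 0 \<inter> mpow m = tf f *\<^sub>S mpow (m - c)"
  proof
    show "tf f *\<^sub>S mpow 0 \<inter> mpow m \<subseteq> tf f *\<^sub>S mpow (m - c)"
    proof
      fix z assume z: "z \<in> tf f *\<^sub>S mpow 0 \<inter> mpow m"
      then obtain a where a: "a \<in> mpow 0" "z = tf f * a" by (auto elim: smulE)
      then have "tf f * a \<in> mpow (c + (m - c))" using z assms by simp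
      then have "a \<in> mpow (m - c)" by (rule mpow_cancel[OF f a(1)])
      then show "z \<in> tf f *\<^sub>S mpow (m - c)" using a(2) smulI by simp
    qed
    show "tf f *\<^sub>S mpow (m - c) \<subseteq> tf f *\<^sub>S mpow 0 \<inter> mpow m"
      using smul_mono[OF mpow_antimono, of 0 "m - c"] smul_mpow_subset(1)[of "m - c"] assms by simp
  qed
  have "rlen constants (f_plus_power m) (mpow m) = rlen constants (tf f *\<^sub>S mpow 0) (tf f *\<^sub>S mpow 0 \<inter> mpow m)"
    unfolding f_plus_power_def by (rule rlen_diamond[OF submod_constants[OF submod_mpow] submod_constants[OF sm_smul]])
  also have "\<dots> = rlen constants (mpow 0) (mpow (m - c) :: 'k rational_function set)"
    unfolding int by (rule rlen_smul[OF submod_constants[OF submod_mpow] mpow_antimono tf_fg0(1)]) simp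
  also have "\<dots> = enat (tri (m - c))" by (rule rlen_mpow)
  finally have W: "rlen constants (f_plus_power m) (mpow m) = enat (tri (m - c))" .
  have "mpow m \<subseteq> f_plus_power m" unfolding f_plus_power_def by (rule splus_upper2[OF sm_smul])
  then have "rlen constants (mpow 0) (mpow m :: 'k rational_function set) = rlen constants (mpow 0) (f_plus_power m) + rlen constants (f_plus_power m) (mpow m)"
    by (intro rlen_additive submod_constants submod_mpow sm_f_plus_power f_plus_power_sub)
  then show ?thesis unfolding W rlen_mpow by (rule sym)
qed

text \<open>Multiplication by \<open>g\<close> maps \<open>A\<close> onto the quotient, and by
  regularity an element goes to zero exactly if it lies in \<open>f_plus_power m\<close>.\<close>

lemma rlen_koszul1:
  "rlen constants origin_curves (tf f *\<^sub>S mpow 0 \<boxplus> tf g *\<^sub>S mpow m) = rlen constants (mpow 0) (f_plus_power m)"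
proof -
  let ?Y = "tf f *\<^sub>S mpow 0 \<boxplus> tf g *\<^sub>S mpow m"
  have smY: "submod (mpow 0) ?Y" by (intro submod_splus sm_smul)
  have sub: "tf g *\<^sub>S mpow m \<subseteq> tf g *\<^sub>S mpow 0" by (rule smul_mono[OF mpow_antimono]) simp
  have eq: "origin_curves = tf g *\<^sub>S mpow 0 \<boxplus> ?Y"
  proof
    show "origin_curves \<subseteq> tf g *\<^sub>S mpow 0 \<boxplus> ?Y" unfolding origin_curves_def
      by (intro splus_least[OF submod_splus[OF sm_smul smY]] splus_upper1[OF smY]
          order_trans[OF splus_upper1[OF sm_smul] splus_upper2[OF sm_smul]])
    show "tf g *\<^sub>S mpow 0 \<boxplus> ?Y \<subseteq> origin_curves" unfolding origin_curves_def
      by (intro splus_least[OF submod_splus[OF sm_smul sm_smul]] splus_upper1[OF sm_smul] splus_upper2[OF sm_smul]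
          order_trans[OF sub splus_upper2[OF sm_smul]])
  qed
  have int: "tf g *\<^sub>S mpow 0 \<inter> ?Y = tf g *\<^sub>S f_plus_power m"
  proof
    show "tf g *\<^sub>S mpow 0 \<inter> ?Y \<subseteq> tf g *\<^sub>S f_plus_power m"
    proof
      fix z assume z: "z \<in> tf g *\<^sub>S mpow 0 \<inter> ?Y"
      then obtain r where r: "r \<in> mpow 0" "z = tf g * r" by (auto elim: smulE)
      from z obtain a b where ab: "a \<in> mpow 0" "b \<in> mpow m" "z = tf f * a + tf g * b" by (auto elim!: splusE smulE)
      have b0: "b \<in> mpow 0" using ab(2) mpow_antimono[of 0 m] by auto
      have "tf f * a = tf g * (r - b)" using r ab by (simp add: algebra_simps)
      then have "r - b \<in> tf f *\<^sub>S mpow 0" by (rule reg(1)[OF ab(1) mpow_diff[OF r(1) b0]])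
      then have "(r - b) + b \<in> f_plus_power m" unfolding f_plus_power_def by (rule splusI[OF _ ab(2)])
      then show "z \<in> tf g *\<^sub>S f_plus_power m" using r(2) smulI by simp
    qed
    show "tf g *\<^sub>S f_plus_power m \<subseteq> tf g *\<^sub>S mpow 0 \<inter> ?Y"
    proof
      fix z assume "z \<in> tf g *\<^sub>S f_plus_power m"
      then obtain w where w: "w \<in> f_plus_power m" "z = tf g * w" by (rule smulE)
      then obtain a b where ab: "a \<in> mpow 0" "b \<in> mpow m" "w = tf f * a + b" unfolding f_plus_power_def by (auto elim!: splusE smulE)
      have "tf f * (tf g * a) + tf g * b \<in> ?Y"
        by (intro splusI smulI ab is_subring_mult[OF is_subring_mpow]) simp_all
      moreover have "z = tf f * (tf g * a) + tf g * b" using w(2) ab(3) by (simp add: algebra_simps)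
      moreover have "z \<in> tf g *\<^sub>S mpow 0" unfolding w(2) by (rule smulI[OF subsetD[OF f_plus_power_sub w(1)]])
      ultimately show "z \<in> tf g *\<^sub>S mpow 0 \<inter> ?Y" by simp
    qed
  qed
  have "rlen constants origin_curves ?Y = rlen constants (tf g *\<^sub>S mpow 0) (tf g *\<^sub>S mpow 0 \<inter> ?Y)"
    unfolding eq by (rule rlen_diamond[OF submod_constants[OF smY] submod_constants[OF sm_smul]])
  also have "\<dots> = rlen constants (mpow 0) (f_plus_power m)"
    unfolding int by (rule rlen_smul[OF submod_constants[OF sm_f_plus_power] f_plus_power_sub tf_fg0(2)])
  finally show ?thesis .
qed

text \<open>If \<open>f r = f \<mu> + g \<nu>\<close>, regularity gives
  \<open>r - \<mu> = g w\<close> and \<open>\<nu> = f w\<close>. The order of \<open>\<nu>\<close>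
  bounds that of \<open>w\<close> from below, so \<open>g w\<close>, and hence \<open>r\<close>, has
  order at least \<open>n - c\<close>. The assumption \<open>c + d \<le> n\<close> keeps the
  subtractions exact.\<close>

lemma rlen_koszul2:
  assumes n: "c + d \<le> n"
  shows "rlen constants (tf f *\<^sub>S mpow 0 \<boxplus> tf g *\<^sub>S mpow (n - d)) (koszul_image n) = enat (tri (n - c))"
proof -
  let ?Y = "tf f *\<^sub>S mpow 0 \<boxplus> tf g *\<^sub>S mpow (n - d)"
  have smY: "submod (mpow 0) ?Y" by (intro submod_splus sm_smul)
  have sub: "tf f *\<^sub>S mpow (n - c) \<subseteq> tf f *\<^sub>S mpow 0" by (rule smul_mono[OF mpow_antimono]) simp
  have eq: "?Y = tf f *\<^sub>S mpow 0 \<boxplus> koszul_image n"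
  proof
    show "?Y \<subseteq> tf f *\<^sub>S mpow 0 \<boxplus> koszul_image n" unfolding koszul_image_def
      by (intro splus_mono order_refl splus_upper2[OF sm_smul])
    show "tf f *\<^sub>S mpow 0 \<boxplus> koszul_image n \<subseteq> ?Y" unfolding koszul_image_def
      by (intro splus_least[OF smY] splus_upper1[OF sm_smul] splus_mono sub order_refl)
  qed
  have int: "tf f *\<^sub>S mpow 0 \<inter> koszul_image n = tf f *\<^sub>S mpow (n - c)"
  proof
    show "tf f *\<^sub>S mpow 0 \<inter> koszul_image n \<subseteq> tf f *\<^sub>S mpow (n - c)"
    proof
      fix z assume z: "z \<in> tf f *\<^sub>S mpow 0 \<inter> koszul_image n"
      then obtain r where r: "r \<in> mpow 0" "z = tf f * r" by (auto elim: smulE)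
      from z obtain \<mu> \<nu> where mn: "\<mu> \<in> mpow (n - c)" "\<nu> \<in> mpow (n - d)" "z = tf f * \<mu> + tf g * \<nu>"
        unfolding koszul_image_def by (auto elim!: splusE smulE)
      have 0: "\<mu> \<in> mpow 0" "\<nu> \<in> mpow 0" using mn(1,2) mpow_antimono[of 0 "n - c"] mpow_antimono[of 0 "n - d"] by auto
      have e: "tf f * (r - \<mu>) = tf g * \<nu>" using r mn by (simp add: algebra_simps)
      then have "r - \<mu> \<in> tf g *\<^sub>S mpow 0" by (rule reg(2)[OF mpow_diff[OF r(1) 0(1)] 0(2)])
      then obtain w where w: "w \<in> mpow 0" "r - \<mu> = tf g * w" by (rule smulE)
      have "tf g * (tf f * w) = tf g * \<nu>" using e unfolding w(2) by (simp only: ac_simps)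
      then have "tf f * w = \<nu>" using tf_fg0(2) by simp
      then have "tf f * w \<in> mpow (c + (n - d - c))" using mn(2) n by simp
      then have "w \<in> mpow (n - d - c)" by (rule mpow_cancel[OF f w(1)])
      then have "tf g * w \<in> mpow (d + (n - d - c))" by (rule mpow_mult[OF tf_mem_mpow[OF g(1)]])
      then have "tf g * w \<in> mpow (n - c)" using n by simp
      then have "tf g * w + \<mu> \<in> mpow (n - c)" using mn(1) by (rule submod_add[OF submod_mpow])
      then have "r \<in> mpow (n - c)" unfolding w(2)[symmetric] by simp
      then show "z \<in> tf f *\<^sub>S mpow (n - c)" using r(2) smulI by simp
    qed
    show "tf f *\<^sub>S mpow (n - c) \<subseteq> tf f *\<^sub>S mpow 0 \<inter> koszul_image n"
      unfolding koszul_image_def by (intro Int_greatest sub splus_upper1[OF sm_smul])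
  qed
  have "rlen constants ?Y (koszul_image n) = rlen constants (tf f *\<^sub>S mpow 0) (tf f *\<^sub>S mpow 0 \<inter> koszul_image n)"
    unfolding eq by (rule rlen_diamond[OF submod_constants[OF sm_koszul_image] submod_constants[OF sm_smul]])
  also have "\<dots> = rlen constants (mpow 0) (mpow (n - c) :: 'k rational_function set)"
    unfolding int by (rule rlen_smul[OF submod_constants[OF submod_mpow] mpow_antimono tf_fg0(1)]) simp
  finally show ?thesis unfolding rlen_mpow .
qed

lemma koszul_image_sub: "c \<le> n \<Longrightarrow> d \<le> n \<Longrightarrow> koszul_image n \<subseteq> mpow n"
  unfolding koszul_image_def using smul_mpow_subset(1)[of "n - c"] smul_mpow_subset(2)[of "n - d"]
  by (intro splus_least[OF submod_mpow]) simp_all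

text \<open>The colength of \<open>koszul_image n\<close> is computed along two towers: through
  \<open>mpow n\<close>, and through \<open>(f, g)\<close> and the intermediate ideal
  \<open>?Y\<close>. The remaining lengths are combinations of triangular numbers, and
  \<open>tri_koszul\<close> leaves \<open>c d\<close>.\<close>

lemma rlen_koszul:
  assumes n: "c + d \<le> n" shows "rlen constants (mpow n) (koszul_image n) + enat (c * d) = enat origin_mult"
proof -
  let ?Y = "tf f *\<^sub>S mpow 0 \<boxplus> tf g *\<^sub>S mpow (n - d)"
  have smY: "submod (mpow 0) ?Y" by (intro submod_splus sm_smul)
  have NY: "koszul_image n \<subseteq> ?Y" unfolding koszul_image_def by (intro splus_mono smul_mono mpow_antimono order_refl) simp
  have YI: "?Y \<subseteq> origin_curves" unfolding origin_curves_def by (intro splus_mono smul_mono mpow_antimono order_refl) simp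
  have Nm: "koszul_image n \<subseteq> mpow n" using n by (intro koszul_image_sub) simp_all
  have m0: "mpow n \<subseteq> (mpow 0 :: 'k rational_function set)" by (rule mpow_antimono) simp
  note constants = submod_constants[OF sm_koszul_image] submod_constants[OF smY] submod_constants[OF sm_origin_curves] submod_constants[OF submod_mpow]
  have 1: "rlen constants origin_curves (koszul_image n) = rlen constants origin_curves ?Y + rlen constants ?Y (koszul_image n)"
    by (rule rlen_additive[OF constants(1,2,3) NY YI])
  have 2: "rlen constants (mpow 0) (koszul_image n) = rlen constants (mpow 0) origin_curves + rlen constants origin_curves (koszul_image n)"
    by (rule rlen_additive[OF constants(1,3,4) order_trans[OF NY YI] origin_curves_sub])
  have 3: "rlen constants (mpow 0) (koszul_image n) = rlen constants (mpow 0) (mpow n :: 'k rational_function set) + rlen constants (mpow n) (koszul_image n)"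
    by (rule rlen_additive[OF constants(1,4,4) Nm m0])
  have 4: "rlen constants (mpow 0) (f_plus_power (n - d)) + enat (tri (n - d - c)) = enat (tri (n - d))"
    using n by (intro rlen_f_plus_power) simp
  obtain w where w: "rlen constants (mpow 0) (f_plus_power (n - d)) = enat w" using 4 by (cases "rlen constants (mpow 0) (f_plus_power (n - d))") auto
  have e: "enat (tri n) + rlen constants (mpow n) (koszul_image n) = enat origin_mult + (enat w + enat (tri (n - c)))"
    using 1 2 3 unfolding rlen_koszul1 rlen_koszul2[OF n] rlen_origin_curves rlen_mpow w by simp
  obtain v where v: "rlen constants (mpow n) (koszul_image n) = enat v" using e by (cases "rlen constants (mpow n) (koszul_image n)") auto
  obtain m where m: "n = c + d + m" using n by (metis le_Suc_ex)
  have "tri n + v = origin_mult + (w + tri (n - c))" using e unfolding v by simp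
  moreover have "w + tri m = tri (n - d)" using 4 unfolding w by (simp add: m)
  moreover have "n - d = c + m" "n - c = d + m" using m by simp_all
  ultimately have "v + c * d = origin_mult" using tri_koszul[of c m d] m by simp
  then show ?thesis unfolding v by simp
qed

lemma intersection_multiplicity_eq: "intersection_multiplicity f g = real origin_mult"
  unfolding intersection_multiplicity_def origin_ring_eq
proof (rule multiplicity_of_regular_pair[OF is_subring_mpow])
  show "r \<in> tf f *\<^sub>S mpow 0" if "a \<in> mpow 0" "r \<in> mpow 0" "tf f * a = tf g * r" for a r
    by (rule reg(1)[OF that])
  show "krull_dim (subring_of (mpow 0 :: 'k rational_function set)) = 2" by (rule krull_dim_origin)
  show "rlen (mpow 0) (mpow 0) (tf f *\<^sub>S mpow 0 \<boxplus> tf g *\<^sub>S mpow 0) = enat origin_mult"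
    using rlen_origin_curves rlen_constants_eq[OF submod_mpow sm_origin_curves origin_curves_sub] unfolding origin_curves_def by simp
qed (use f0 g0 in simp_all)

end

section \<open>Localization of quotients of finite length\<close>

lemma enat_decreasing_stable:
  fixes a :: "nat \<Rightarrow> enat"
  assumes dec: "\<And>i. a (Suc i) \<le> a i" and fin: "a 0 \<noteq> \<infinity>"
  shows "\<exists>i. a (Suc i) = a i"
proof (rule ccontr)
  assume "\<not> ?thesis"
  then have lt: "a (Suc i) < a i" for i using dec[of i] by (metis order_le_less)
  obtain n where n: "a 0 = enat n" using fin by auto
  have "a i + enat i \<le> enat n" for i
  proof (induction i)
    case 0
    then show ?case by (simp add: n zero_enat_def[symmetric])
  next
    case (Suc i)
    obtain x where x: "a i = enat x" using Suc by (cases "a i") auto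
    obtain y where y: "a (Suc i) = enat y" using lt[of i] x by (cases "a (Suc i)") auto
    show ?case using Suc lt[of i] unfolding x y by simp
  qed
  from this[of "Suc n"] show False by (cases "a (Suc n)") auto
qed

text \<open>A proper overideal of least colength is maximal, since a larger proper ideal would have
  smaller colength. Finite length thus takes the place of Zorn's lemma.\<close>

lemma prime_over_ideal:
  fixes B :: "'a::field set"
  assumes B: "is_subring B" and k: "k \<subseteq> B" and Q: "submod B Q" "Q \<subseteq> B" "1 \<notin> Q" and fin: "rlen k B Q \<noteq> \<infinity>"
  shows "\<exists>P. is_prime B P \<and> Q \<subseteq> P"
proof -
  note sk = submod_subset[OF _ k]
  define S where "S = {P. submod B P \<and> P \<subseteq> B \<and> 1 \<notin> P \<and> Q \<subseteq> P}"
  define m where "m P = the_enat (rlen k B P)" for P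
  have finS: "rlen k B P = enat (m P)" if "P \<in> S" for P
  proof -
    have "rlen k B P \<le> rlen k B Q" using that by (intro rlen_mono sk) (auto simp: S_def Q)
    then have "rlen k B P \<noteq> \<infinity>" using fin by (metis enat_ord_simps(5))
    then show ?thesis by (auto simp: m_def)
  qed
  have "Q \<in> S" using Q by (simp add: S_def)
  then obtain P where P: "P \<in> S" and min: "\<And>P'. P' \<in> S \<Longrightarrow> m P \<le> m P'"
    using ex_has_least_nat[of "\<lambda>P. P \<in> S" Q m] by blast
  have max: "J = P \<or> J = B" if J: "submod B J" "P \<subseteq> J" "J \<subseteq> B" for J
  proof (rule disjCI)
    assume "J \<noteq> B"
    then have "1 \<notin> J" using submod_eq_if_1_mem[OF B J(1,3)] by auto
    then have JS: "J \<in> S" using J P by (auto simp: S_def)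
    have smP: "submod B P" using P by (simp add: S_def)
    have "rlen k B P = rlen k B J + rlen k J P"
      by (rule rlen_additive[OF sk[OF smP] sk[OF J(1)] sk[OF is_subring_submod[OF B]] J(2,3)])
    then have "enat (m P) = enat (m J) + rlen k J P" using finS[OF P] finS[OF JS] by simp
    then have "rlen k J P = 0" using min[OF JS] by (cases "rlen k J P") (auto simp: zero_enat_def)
    then show "J = P" using rlen_eq_0_iff[OF sk[OF smP] sk[OF J(1)] J(2)] by simp
  qed
  have "maximalideal P (subring_of B)"
    unfolding maximalideal_subring_of_iff[OF B] using P max by (auto simp: S_def)
  then show ?thesis using maximalideal_imp_is_prime[OF B] P by (auto simp: S_def)
qed

text \<open>\<open>B/I\<close> has finite length and its primes are among the finitely many,
  pairwise incomparable \<open>M p\<close>. Lengths are taken over \<open>k\<close>, so that those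
  of \<open>B\<close> and of its localizations can be added.\<close>

locale artinian =
  fixes B I :: "'a::field set" and k :: "'a set" and Z :: "'p set" and M :: "'p \<Rightarrow> 'a set"
  assumes B: "is_subring B" and k: "k \<subseteq> B" and I: "submod B I" "I \<subseteq> B" and fin: "rlen k B I \<noteq> \<infinity>"
    and Z: "finite Z" and M: "\<And>p. p \<in> Z \<Longrightarrow> is_prime B (M p)"
    and primes: "\<And>P. is_prime B P \<Longrightarrow> I \<subseteq> P \<Longrightarrow> \<exists>p\<in>Z. P = M p"
    and sep: "\<And>p q. p \<in> Z \<Longrightarrow> q \<in> Z \<Longrightarrow> p \<noteq> q \<Longrightarrow> \<not> M p \<subseteq> M q"
begin

text \<open>The preimage in \<open>B\<close> of the ideal generated by \<open>I\<close> in the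
  localization at \<open>M p\<close>, so that \<open>B / primary_part p\<close> is the local
  component at \<open>p\<close>.\<close>

definition primary_part :: "'p \<Rightarrow> 'a set" where
  "primary_part p = {b \<in> B. \<exists>v\<in>B. v \<notin> M p \<and> v * b \<in> I}"

lemma M_props:
  assumes "p \<in> Z"
  shows "submod B (M p)" "M p \<subseteq> B" "1 \<notin> M p" "a \<in> B \<Longrightarrow> b \<in> B \<Longrightarrow> a * b \<in> M p \<Longrightarrow> a \<in> M p \<or> b \<in> M p"
  using M[OF assms] unfolding is_prime_def by blast+

lemma notin_M_mult: "p \<in> Z \<Longrightarrow> a \<in> B \<Longrightarrow> b \<in> B \<Longrightarrow> a \<notin> M p \<Longrightarrow> b \<notin> M p \<Longrightarrow> a * b \<notin> M p"
  using M_props(4) by metis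

lemma notin_M_power: "p \<in> Z \<Longrightarrow> a \<in> B \<Longrightarrow> a \<notin> M p \<Longrightarrow> a ^ n \<notin> M p"
  using is_prime_power[OF M B] by metis

lemma submod_primary_part:
  assumes p: "p \<in> Z" shows "submod B (primary_part p)"
proof (rule submodI)
  show "0 \<in> primary_part p" unfolding primary_part_def
    using is_subring_0[OF B] is_subring_1[OF B] M_props(3)[OF p] submod_zero[OF I(1)] by force
next
  fix u v assume "u \<in> primary_part p" "v \<in> primary_part p"
  then obtain a b where ab: "a \<in> B" "a \<notin> M p" "a * u \<in> I" "b \<in> B" "b \<notin> M p" "b * v \<in> I" and uv: "u \<in> B" "v \<in> B"
    unfolding primary_part_def by blast
  have "b * (a * u) - a * (b * v) \<in> I" by (intro submod_diff[OF I(1)] submod_mult[OF I(1)] ab)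
  then have "(a * b) * (u - v) \<in> I" by (simp add: algebra_simps)
  moreover have "a * b \<in> B" "a * b \<notin> M p" "u - v \<in> B"
    using is_subring_mult[OF B ab(1,4)] notin_M_mult[OF p ab(1,4,2,5)] is_subring_diff[OF B uv] by simp_all
  ultimately show "u - v \<in> primary_part p" unfolding primary_part_def by blast
next
  fix r v assume r: "r \<in> B" and "v \<in> primary_part p"
  then obtain b where b: "b \<in> B" "b \<notin> M p" "b * v \<in> I" and v: "v \<in> B" unfolding primary_part_def by blast
  have "b * (r * v) \<in> I" using submod_mult[OF I(1) r b(3)] by (simp add: mult.left_commute)
  then show "r * v \<in> primary_part p" using b(1,2) is_subring_mult[OF B r v] unfolding primary_part_def by blast
qed

lemma primary_part_sub: "primary_part p \<subseteq> B"
  unfolding primary_part_def by blast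

lemma I_sub_primary_part: assumes p: "p \<in> Z" shows "I \<subseteq> primary_part p"
proof
  fix i assume "i \<in> I"
  then have "i \<in> B" "1 * i \<in> I" using I(2) by auto
  then show "i \<in> primary_part p" unfolding primary_part_def using is_subring_1[OF B] M_props(3)[OF p] by blast
qed

lemma primary_part_saturated:
  assumes p: "p \<in> Z" and v: "v \<in> B" "v \<notin> M p" and b: "b \<in> B" "v * b \<in> primary_part p" shows "b \<in> primary_part p"
proof -
  obtain w where w: "w \<in> B" "w \<notin> M p" "w * (v * b) \<in> I" using b(2) unfolding primary_part_def by blast
  then have "(w * v) * b \<in> I" by (simp add: mult.assoc)
  then show ?thesis unfolding primary_part_def using b(1) is_subring_mult[OF B w(1) v(1)] notin_M_mult[OF p w(1) v(1) w(2) v(2)] by blast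
qed

lemmas sk = submod_subset[OF _ k]

lemma fin_primary_part: assumes p: "p \<in> Z" shows "rlen k B (primary_part p) \<noteq> \<infinity>"
proof -
  have "rlen k B (primary_part p) \<le> rlen k B I"
    by (rule rlen_mono[OF sk[OF I(1)] I_sub_primary_part[OF p] sk[OF submod_primary_part[OF p]] primary_part_sub order_refl])
  then show ?thesis using fin by (metis enat_ord_simps(5))
qed

text \<open>Multiplication by \<open>v\<close> is injective modulo \<open>primary_part p\<close> and
  the length is finite, so it is surjective: elements outside \<open>M p\<close> act
  invertibly.\<close>

lemma splus_primary_part:
  assumes p: "p \<in> Z" and v: "v \<in> B" "v \<notin> M p" shows "B = v *\<^sub>S B \<boxplus> primary_part p"
proof (rule splus_smul_eq[OF sk[OF submod_primary_part[OF p]] sk[OF is_subring_submod[OF B]] primary_part_sub _ _ _ _ fin_primary_part[OF p]])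
  show "v *\<^sub>S B \<subseteq> B" by (rule smul_subset_submod[OF is_subring_submod[OF B] v(1)])
  show "v *\<^sub>S primary_part p \<subseteq> primary_part p" using submod_mult[OF submod_primary_part[OF p] v(1)] by (auto elim: smulE)
  show "v \<noteq> 0" using v(2) submod_zero[OF M_props(1)[OF p]] by metis
  show "b \<in> primary_part p" if "b \<in> B" "v * b \<in> primary_part p" for b by (rule primary_part_saturated[OF p v that])
qed

text \<open>The descending chain of the ideals \<open>T i\<close> becomes stationary by finite
  length, which puts \<open>v^i (1 - v b)\<close> into \<open>primary_part p\<close> for some
  \<open>b\<close>. As \<open>1 - v b\<close> is outside \<open>M p\<close>, saturation removes that
  factor.\<close>

lemma nilpotent:
  assumes p: "p \<in> Z" and v: "v \<in> M p" shows "\<exists>i. v ^ i \<in> primary_part p"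
proof -
  have vB: "v \<in> B" using v M_props(2)[OF p] by blast
  have pw: "v ^ i \<in> B" for i by (rule is_subring_power[OF B vB])
  define T where "T i = v ^ i *\<^sub>S B \<boxplus> primary_part p" for i
  have smT: "submod B (T i)" for i unfolding T_def by (intro submod_splus submod_smul is_subring_submod B submod_primary_part p)
  have JT: "primary_part p \<subseteq> T i" for i unfolding T_def by (rule splus_upper2[OF submod_smul[OF is_subring_submod[OF B]]])
  have TB: "T i \<subseteq> B" for i
    unfolding T_def by (intro splus_least[OF is_subring_submod[OF B]] smul_subset_submod[OF is_subring_submod[OF B]] pw primary_part_sub)
  have TT: "T (Suc i) \<subseteq> T i" for i
  proof -
    have "v ^ Suc i *\<^sub>S B \<subseteq> v ^ i *\<^sub>S B"
      using smul_mono[OF smul_subset_submod[OF is_subring_submod[OF B] vB], of "v ^ i"] by (simp add: smul_smul mult.commute)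
    then show ?thesis unfolding T_def by (rule splus_mono) simp
  qed
  have "\<exists>i. rlen k (T (Suc i)) (primary_part p) = rlen k (T i) (primary_part p)"
  proof (rule enat_decreasing_stable)
    show "rlen k (T (Suc i)) (primary_part p) \<le> rlen k (T i) (primary_part p)" for i
      by (rule rlen_mono[OF sk[OF submod_primary_part[OF p]] order_refl sk[OF submod_primary_part[OF p]] JT TT])
    have "rlen k (T 0) (primary_part p) \<le> rlen k B (primary_part p)"
      by (rule rlen_mono[OF sk[OF submod_primary_part[OF p]] order_refl sk[OF submod_primary_part[OF p]] JT TB])
    then show "rlen k (T 0) (primary_part p) \<noteq> \<infinity>" using fin_primary_part[OF p] by (metis enat_ord_simps(5))
  qed
  then obtain i where i: "rlen k (T (Suc i)) (primary_part p) = rlen k (T i) (primary_part p)" by blast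
  have add: "rlen k (T i) (primary_part p) = rlen k (T i) (T (Suc i)) + rlen k (T (Suc i)) (primary_part p)"
    by (rule rlen_additive[OF sk[OF submod_primary_part[OF p]] sk[OF smT] sk[OF smT] JT TT])
  have "rlen k (T i) (primary_part p) \<le> rlen k B (primary_part p)"
    by (rule rlen_mono[OF sk[OF submod_primary_part[OF p]] order_refl sk[OF submod_primary_part[OF p]] JT TB])
  then have "rlen k (T i) (primary_part p) \<noteq> \<infinity>" using fin_primary_part[OF p] by (metis enat_ord_simps(5))
  then have "rlen k (T i) (T (Suc i)) = 0" using add enat_add_self_eq i by metis
  then have "T i = T (Suc i)" using rlen_eq_0_iff[OF sk[OF smT] sk[OF smT] TT] by simp
  moreover have "v ^ i \<in> T i" unfolding T_def by (rule subsetD[OF splus_upper1[OF submod_primary_part[OF p]] mem_smul_self[OF B]])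
  ultimately have "v ^ i \<in> T (Suc i)" by simp
  then obtain b j where bj: "b \<in> B" "j \<in> primary_part p" "v ^ i = v ^ Suc i * b + j" unfolding T_def by (auto elim!: splusE smulE)
  have e: "(1 - v * b) * v ^ i = j" using bj(3) by (simp add: algebra_simps)
  have vb: "v * b \<in> M p" using submod_mult[OF M_props(1)[OF p] bj(1) v] by (simp add: mult.commute)
  have u: "1 - v * b \<in> B" by (rule is_subring_diff[OF B is_subring_1[OF B] is_subring_mult[OF B vB bj(1)]])
  have "1 - v * b \<notin> M p"
  proof
    assume "1 - v * b \<in> M p"
    from submod_add[OF M_props(1)[OF p] this vb] show False using M_props(3)[OF p] by simp
  qed
  then have "v ^ i \<in> primary_part p" by (rule primary_part_saturated[OF p u _ pw]) (simp add: e bj(2))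
  then show ?thesis by blast
qed

text \<open>Some \<open>v\<close> in \<open>M p\<close> but not in \<open>M q\<close> is nilpotent
  modulo the first ideal and invertible modulo the second.\<close>

lemma primary_part_comaximal:
  assumes p: "p \<in> Z" and q: "q \<in> Z" and pq: "p \<noteq> q"
  shows "B = primary_part p \<boxplus> primary_part q"
proof -
  obtain v where v: "v \<in> M p" "v \<notin> M q" using sep[OF p q pq] by blast
  have vB: "v \<in> B" using v(1) M_props(2)[OF p] by blast
  obtain i where i: "v ^ i \<in> primary_part p" using nilpotent[OF p v(1)] by blast
  note splus_primary_part[OF q is_subring_power[OF B vB] notin_M_power[OF q vB v(2)], of i]
  also have "v ^ i *\<^sub>S B \<boxplus> primary_part q \<subseteq> primary_part p \<boxplus> primary_part q"
    by (rule splus_mono[OF smul_subset_submod[OF submod_primary_part[OF p] i] order_refl])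
  finally have "B \<subseteq> primary_part p \<boxplus> primary_part q" .
  then show ?thesis by (rule subset_antisym) (rule splus_least[OF is_subring_submod[OF B] primary_part_sub primary_part_sub])
qed

text \<open>Chinese remainder theorem, by induction on the set of points. The second conjunct,
  comaximality with the components not yet used, is what keeps the induction going.\<close>

lemma rlen_Inter:
  "finite Y \<Longrightarrow> Y \<subseteq> Z \<Longrightarrow>
    submod B (B \<inter> (\<Inter>p\<in>Y. primary_part p)) \<and>
    (\<forall>q\<in>Z - Y. (B \<inter> (\<Inter>p\<in>Y. primary_part p)) \<boxplus> primary_part q = B) \<and>
    rlen k B (B \<inter> (\<Inter>p\<in>Y. primary_part p)) = (\<Sum>p\<in>Y. rlen k B (primary_part p))"
proof (induction Y rule: finite_induct)
  case empty
  then show ?case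
    using splus_absorb[OF is_subring_submod[OF B] submod_primary_part primary_part_sub] by (simp add: is_subring_submod[OF B])
next
  case (insert p Y)
  let ?U = "B \<inter> (\<Inter>p\<in>Y. primary_part p)"
  have p: "p \<in> Z" "p \<in> Z - Y" using insert by auto
  have IH: "submod B ?U" "\<And>q. q \<in> Z - Y \<Longrightarrow> ?U \<boxplus> primary_part q = B" "rlen k B ?U = (\<Sum>p\<in>Y. rlen k B (primary_part p))"
    using insert by auto
  have eq: "B \<inter> (\<Inter>p\<in>insert p Y. primary_part p) = ?U \<inter> primary_part p" by auto
  have sm: "submod B (?U \<inter> primary_part p)" by (rule submod_Int[OF IH(1) submod_primary_part[OF p(1)]])
  have com: "?U \<inter> primary_part p \<boxplus> primary_part q = B" if q: "q \<in> Z - insert p Y" for q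
  proof -
    have qZ: "q \<in> Z" "q \<in> Z - Y" "p \<noteq> q" using q by auto
    have "1 \<in> ?U \<boxplus> primary_part q" using IH(2)[OF qZ(2)] is_subring_1[OF B] by simp
    then obtain u j where uj: "u \<in> ?U" "j \<in> primary_part q" "1 = u + j" by (rule splusE)
    have "1 \<in> primary_part p \<boxplus> primary_part q" by (rule subsetD[OF equalityD1[OF primary_part_comaximal[OF p(1) qZ(1,3)]] is_subring_1[OF B]])
    then obtain a j' where aj: "a \<in> primary_part p" "j' \<in> primary_part q" "1 = a + j'" by (rule splusE)
    have uB: "u \<in> B" "a \<in> B" using uj(1) aj(1) primary_part_sub by blast+
    \<comment> \<open>Inserting \<open>1 = a + j'\<close> into the summand \<open>u\<close> of
      \<open>1 = u + j\<close> decomposes one with respect to the smaller intersection.\<close>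
    have "a * u + (u * j' + j) = u * (a + j') + j" by (simp add: algebra_simps)
    also have "\<dots> = 1" by (simp only: aj(3)[symmetric] mult_1_right uj(3)[symmetric])
    finally have e: "1 = a * u + (u * j' + j)" by (rule sym)
    have m1: "a * u \<in> ?U" using submod_mult[OF IH(1) uB(2) uj(1)] .
    have m2: "a * u \<in> primary_part p" using submod_mult[OF submod_primary_part[OF p(1)] uB(1) aj(1)] by (simp add: mult.commute)
    have m3: "u * j' + j \<in> primary_part q" by (intro submod_add[OF submod_primary_part[OF qZ(1)]] submod_mult[OF submod_primary_part[OF qZ(1)]] uB uj aj)
    have "a * u + (u * j' + j) \<in> ?U \<inter> primary_part p \<boxplus> primary_part q" by (rule splusI[OF IntI[OF m1 m2] m3])
    then have "1 \<in> ?U \<inter> primary_part p \<boxplus> primary_part q" by (simp only: e[symmetric])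
    moreover have "?U \<inter> primary_part p \<boxplus> primary_part q \<subseteq> B" by (rule splus_least[OF is_subring_submod[OF B]]) (use primary_part_sub in auto)
    ultimately show ?thesis
      by (intro submod_eq_if_1_mem[OF B submod_splus[OF sm submod_primary_part[OF qZ(1)]]])
  qed
  have "rlen k B (?U \<inter> primary_part p) = rlen k B ?U + rlen k ?U (?U \<inter> primary_part p)"
    by (rule rlen_additive[OF sk[OF sm] sk[OF IH(1)] sk[OF is_subring_submod[OF B]]]) auto
  also have "rlen k ?U (?U \<inter> primary_part p) = rlen k (?U \<boxplus> primary_part p) (primary_part p)"
    by (rule rlen_diamond[OF sk[OF submod_primary_part[OF p(1)]] sk[OF IH(1)], symmetric])
  also have "\<dots> = rlen k B (primary_part p)" using IH(2)[OF p(2)] by simp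
  also have "rlen k B ?U + rlen k B (primary_part p) = (\<Sum>p\<in>insert p Y. rlen k B (primary_part p))"
    unfolding sum.insert[OF insert.hyps(1,2)] IH(3) by (rule add.commute)
  finally have R: "rlen k B (?U \<inter> primary_part p) = (\<Sum>p\<in>insert p Y. rlen k B (primary_part p))" .
  show ?case unfolding eq by (intro conjI ballI sm com R)
qed

text \<open>\<open>I\<close> is the intersection of its local components: if \<open>b\<close> lies
  in all of them but not in \<open>I\<close>, the proper ideal of all \<open>v\<close> with
  \<open>v b\<close> in \<open>I\<close> is contained in some \<open>M p\<close>, although it has an
  element outside \<open>M p\<close>.\<close>

lemma rlen_eq_sum: "rlen k B I = (\<Sum>p\<in>Z. rlen k B (primary_part p))"
proof -
  have "b \<in> I" if b: "b \<in> B" "\<And>p. p \<in> Z \<Longrightarrow> b \<in> primary_part p" for b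
  proof (rule ccontr)
    assume nb: "b \<notin> I"
    define Q where "Q = {v \<in> B. v * b \<in> I}"
    have Q: "submod B Q" "Q \<subseteq> B" "1 \<notin> Q"
    proof -
      show "submod B Q"
      proof (rule submodI)
        show "0 \<in> Q" by (simp add: Q_def is_subring_0[OF B] submod_zero[OF I(1)])
        show "u - v \<in> Q" if "u \<in> Q" "v \<in> Q" for u v
          using that is_subring_diff[OF B] submod_diff[OF I(1), of "u * b" "v * b"] by (simp add: Q_def left_diff_distrib)
        show "r * v \<in> Q" if "r \<in> B" "v \<in> Q" for r v
          using that is_subring_mult[OF B] submod_mult[OF I(1), of r "v * b"] by (simp add: Q_def mult.assoc)
      qed
    qed (use nb in \<open>auto simp: Q_def\<close>)
    have IQ: "I \<subseteq> Q"
    proof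
      fix i assume "i \<in> I"
      then show "i \<in> Q" using I(2) submod_mult[OF I(1) b(1), of i] by (auto simp: Q_def mult.commute)
    qed
    have "rlen k B Q \<le> rlen k B I" by (rule rlen_mono[OF sk[OF I(1)] IQ sk[OF Q(1)] Q(2) order_refl])
    then have "rlen k B Q \<noteq> \<infinity>" using fin by (metis enat_ord_simps(5))
    then obtain P where P: "is_prime B P" "Q \<subseteq> P" using prime_over_ideal[OF B k Q] by blast
    then obtain p where p: "p \<in> Z" "P = M p" using primes[OF P(1)] IQ by blast
    obtain v where "v \<in> B" "v \<notin> M p" "v * b \<in> I" using b(2)[OF p(1)] unfolding primary_part_def by blast
    then show False using P(2) p(2) by (auto simp: Q_def)
  qed
  then have "B \<inter> (\<Inter>p\<in>Z. primary_part p) \<subseteq> I" by blast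
  moreover have "I \<subseteq> B \<inter> (\<Inter>p\<in>Z. primary_part p)" using I(2) I_sub_primary_part by blast
  ultimately have "B \<inter> (\<Inter>p\<in>Z. primary_part p) = I" by (rule subset_antisym)
  then show ?thesis using rlen_Inter[OF Z order_refl] by simp
qed

text \<open>A denominator outside \<open>M p\<close> is already invertible modulo
  \<open>primary_part p\<close>, so every fraction is congruent to an element of \<open>B\<close>.
  The local quotient is therefore a quotient of \<open>B\<close>, with kernel
  \<open>primary_part p\<close>.\<close>

lemma rlen_localization:
  assumes p: "p \<in> Z" and L: "localization B (M p) = L" and smL: "submod k L" "is_subring L"
    and IL: "submod L IL" "I \<subseteq> IL" "\<And>i v. i \<in> I \<Longrightarrow> v \<in> B \<Longrightarrow> v \<notin> M p \<Longrightarrow> i / v \<in> IL"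
    "\<And>z. z \<in> IL \<Longrightarrow> \<exists>i\<in>I. \<exists>v\<in>B. v \<notin> M p \<and> z = i / v" and kL: "k \<subseteq> L"
  shows "rlen k L IL = rlen k B (primary_part p)"
proof -
  have v0: "v \<noteq> 0" if "v \<notin> M p" for v using that submod_zero[OF M_props(1)[OF p]] by metis
  have BL: "B \<subseteq> L"
  proof
    fix b assume "b \<in> B"
    then have "b / 1 \<in> localization B (M p)" unfolding localization_def using is_subring_1[OF B] M_props(3)[OF p] by blast
    then show "b \<in> L" using L by simp
  qed
  have inv: "1 / v \<in> L" if "v \<in> B" "v \<notin> M p" for v
    using that is_subring_1[OF B] unfolding L[symmetric] localization_def by blast
  have ILL: "IL \<subseteq> L"
  proof
    fix z assume "z \<in> IL"
    then obtain i v where "i \<in> I" "v \<in> B" "v \<notin> M p" "z = i / v" using IL(4) by blast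
    then show "z \<in> L" using I(2) unfolding L[symmetric] localization_def by blast
  qed
  have int: "B \<inter> IL = primary_part p"
  proof
    show "B \<inter> IL \<subseteq> primary_part p"
    proof
      fix z assume z: "z \<in> B \<inter> IL"
      then obtain i v where iv: "i \<in> I" "v \<in> B" "v \<notin> M p" "z = i / v" using IL(4) by blast
      then have "v * z \<in> I" using v0[of v] by simp
      then have "\<exists>v\<in>B. v \<notin> M p \<and> v * z \<in> I" using iv(2,3) by (intro bexI[of _ v] conjI)
      then show "z \<in> primary_part p" unfolding primary_part_def using z by simp
    qed
    show "primary_part p \<subseteq> B \<inter> IL"
    proof
      fix z assume "z \<in> primary_part p"
      then obtain v where v: "z \<in> B" "v \<in> B" "v \<notin> M p" "v * z \<in> I" unfolding primary_part_def by blast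
      have "v * z / v \<in> IL" by (rule IL(3)[OF v(4,2,3)])
      then show "z \<in> B \<inter> IL" using v(1) v0[OF v(3)] by simp
    qed
  qed
  have eqL: "L = B \<boxplus> IL"
  proof
    show "L \<subseteq> B \<boxplus> IL"
    proof
      fix z assume "z \<in> L"
      then obtain a v where av: "a \<in> B" "v \<in> B" "v \<notin> M p" "z = a / v" unfolding L[symmetric] localization_def by blast
      have "1 \<in> v *\<^sub>S B \<boxplus> primary_part p" by (rule subsetD[OF equalityD1[OF splus_primary_part[OF p av(2,3)]] is_subring_1[OF B]])
      then obtain b j where bj: "b \<in> B" "j \<in> primary_part p" "1 = v * b + j" by (auto elim!: splusE smulE)
      have "j \<in> IL" using bj(2) int by blast
      then have "a / v * j \<in> IL" using submod_mult[OF IL(1), of "a / v" j] \<open>z \<in> L\<close> av(4) by simp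
      then have "a * b + a / v * j \<in> B \<boxplus> IL" by (rule splusI[OF is_subring_mult[OF B av(1) bj(1)]])
      moreover have "a * b + a / v * j = a / v * (v * b + j)" using v0[OF av(3)] by (simp add: distrib_left)
      ultimately show "z \<in> B \<boxplus> IL" using bj(3) av(4) by simp
    qed
    show "B \<boxplus> IL \<subseteq> L" by (rule splus_least[OF is_subring_submod[OF smL(2)] BL ILL])
  qed
  have "rlen k L IL = rlen k (B \<boxplus> IL) IL" by (simp only: eqL[symmetric])
  also have "\<dots> = rlen k B (B \<inter> IL)"
    by (rule rlen_diamond[OF submod_subset[OF IL(1) kL] sk[OF is_subring_submod[OF B]]])
  finally show ?thesis unfolding int .
qed

end

section \<open>Affine charts of the blowing up\<close>

lemma evp_scale: "evp (t * a, t * b) n P = t ^ n * evp (a, b) n P"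
  unfolding evp_def by (simp add: eval2_homogeneous_scale)

lemma point_ring_scale: assumes "t \<noteq> 0" shows "point_ring (t * a, t * b) = point_ring (a, b)" and "point_ideal (t * a, t * b) = point_ideal (a, b)"
  unfolding point_ring_def point_ideal_def evp_scale using assms by simp_all

lemma mpow_prime_ideal:
  assumes P: "is_prime B P" and B: "is_subring B" "mpow 0 \<subseteq> B" and N: "mpow N \<subseteq> P"
  shows "tf px \<in> P" "tf py \<in> P"
proof -
  have mem: "tf p \<in> B" for p using B(2) tf_mem_mpow_iff[of p 0] by auto
  have lin: "tf p \<in> P" if "homogeneous 1 p" for p
  proof (rule is_prime_power[OF P B(1) mem])
    show "tf p ^ N \<in> P"
      using N ordge_homogeneous[OF homogeneous_power[OF that, of N]] tf_mem_mpow[of N "p ^ N"] by (simp add: subset_iff)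
  qed
  show "tf px \<in> P" "tf py \<in> P" by (rule lin[OF homogeneous_px], rule lin[OF homogeneous_py])
qed

text \<open>An affine chart of the blowing up that meets the exceptional line where
  \<open>\<sigma> \<rho>\<close> does not vanish. The linear form \<open>\<sigma>\<close> is the
  equation of the exceptional line, and \<open>\<rho>\<close> removes further points:
  \<open>\<rho> = 1\<close> gives the usual charts, \<open>\<sigma> = y\<close> and
  \<open>\<rho> = x\<close> the ring generated by both quotients.\<close>

locale chart =
  fixes \<sigma> \<rho> :: "'k::alg_closed_field poly poly" and e :: nat
  assumes \<sigma>: "homogeneous 1 \<sigma>" "\<sigma> \<noteq> 0" and \<rho>: "homogeneous e \<rho>" "\<rho> \<noteq> 0"
begin

definition s :: "'k poly poly" where "s = \<sigma> * \<rho>"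

text \<open>The degree zero part of the Rees algebra of the maximal ideal after inverting
  \<open>s\<close>, placed in degree \<open>Suc e\<close>.\<close>

definition chart_ring :: "'k rational_function set" where
  "chart_ring = {u / tf s ^ j |u j. u \<in> mpow (j * Suc e)}"

definition chart_ideal :: "'k \<times> 'k \<Rightarrow> 'k rational_function set" where
  "chart_ideal p = chart_ring \<inter> point_ideal p"

lemma s_hom: "homogeneous (Suc e) s"
  unfolding s_def using homogeneous_mult[OF \<sigma>(1) \<rho>(1)] by simp

lemma nz: "tf s \<noteq> 0" "tf \<sigma> \<noteq> 0" "tf \<rho> \<noteq> 0"
  using \<sigma>(2) \<rho>(2) by (simp_all add: s_def)

lemma tf_s: "tf s = tf \<sigma> * tf \<rho>"
  by (simp add: s_def)

lemma s_pow: "tf s ^ j \<in> mpow (j * Suc e)" "tf \<rho> ^ j \<in> mpow (j * e)" "tf \<sigma> ^ j \<in> mpow j"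
proof -
  have "homogeneous (j * 1) (\<sigma> ^ j)" by (rule homogeneous_power[OF \<sigma>(1)])
  then show "tf \<sigma> ^ j \<in> mpow j" using tf_mem_mpow[of j "\<sigma> ^ j"] by (simp add: ordge_homogeneous)
  show "tf s ^ j \<in> mpow (j * Suc e)" "tf \<rho> ^ j \<in> mpow (j * e)"
    using tf_mem_mpow[OF ordge_homogeneous[OF homogeneous_power[OF s_hom, of j]]]
      tf_mem_mpow[OF ordge_homogeneous[OF homogeneous_power[OF \<rho>(1), of j]]] by simp_all
qed

lemma chart_ring_I: "u \<in> mpow (j * Suc e) \<Longrightarrow> u / tf s ^ j \<in> chart_ring"
  unfolding chart_ring_def by blast

lemma chart_ring_E: assumes "z \<in> chart_ring" obtains u j where "z = u / tf s ^ j" "u \<in> mpow (j * Suc e)"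
  using assms unfolding chart_ring_def by blast

lemma mpow_sub_chart_ring: "mpow 0 \<subseteq> chart_ring"
  using chart_ring_I[of _ 0] by auto

lemma tf_mem_chart_ring: "tf p \<in> chart_ring"
  using mpow_sub_chart_ring tf_mem_mpow_iff[of p 0] by auto

lemma is_subring_chart_ring: "is_subring chart_ring"
  unfolding is_subring_def
proof (intro conjI ballI)
  show "1 \<in> chart_ring" using mpow_sub_chart_ring is_subring_1[OF is_subring_mpow] by blast
  fix a b assume "a \<in> chart_ring" "b \<in> chart_ring"
  then obtain u i v j where u: "a = u / tf s ^ i" "u \<in> mpow (i * Suc e)" and v: "b = v / tf s ^ j" "v \<in> mpow (j * Suc e)"
    by (elim chart_ring_E) (rule that)
  have "u * tf s ^ j - v * tf s ^ i \<in> mpow ((i + j) * Suc e)"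
    using mpow_mult[OF u(2) s_pow(1)[of j]] mpow_mult[OF v(2) s_pow(1)[of i]]
    by (intro mpow_diff) (simp_all add: algebra_simps)
  then have "(u * tf s ^ j - v * tf s ^ i) / tf s ^ (i + j) \<in> chart_ring" by (rule chart_ring_I)
  moreover have "(u * tf s ^ j - v * tf s ^ i) / tf s ^ (i + j) = a - b"
    unfolding u(1) v(1) using nz(1) by (simp add: diff_frac_eq power_add)
  ultimately show "a - b \<in> chart_ring" by simp
  have "u * v \<in> mpow ((i + j) * Suc e)" using mpow_mult[OF u(2) v(2)] by (simp only: add_mult_distrib)
  then have "u * v / tf s ^ (i + j) \<in> chart_ring" by (rule chart_ring_I)
  then show "a * b \<in> chart_ring" unfolding u(1) v(1) by (simp add: power_add)
qed

lemma sm_chart_ring: "submod chart_ring chart_ring"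
  by (rule is_subring_submod[OF is_subring_chart_ring])

lemma constants_sub_chart_ring: "constants \<subseteq> chart_ring"
  using constants_subset_mpow mpow_sub_chart_ring by (rule order_trans)

lemma div_\<sigma>: assumes "u \<in> mpow n" shows "u / tf \<sigma> ^ n \<in> chart_ring"
proof -
  have "u * tf \<rho> ^ n \<in> mpow (n * Suc e)" using mpow_mult[OF assms s_pow(2)[of n]] by simp
  then have "u * tf \<rho> ^ n / tf s ^ n \<in> chart_ring" by (rule chart_ring_I)
  moreover have "u * tf \<rho> ^ n / tf s ^ n = u / tf \<sigma> ^ n" unfolding tf_s using nz(3) by (simp add: power_mult_distrib)
  ultimately show ?thesis by simp
qed

lemma \<sigma>_nonzero_at: "eval2 s (fst p) (snd p) \<noteq> 0 \<Longrightarrow> eval2 \<sigma> (fst p) (snd p) \<noteq> 0"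
  by (simp add: s_def)

lemma s_nonzero_point: assumes "eval2 s (fst p) (snd p) \<noteq> 0" shows "p \<noteq> (0, 0)"
proof
  assume "p = (0, 0)"
  then have "eval2 s (fst p) (snd p) = eval2 s (0 * 1) (0 * 1)" by simp
  also have "\<dots> = 0" by (subst eval2_homogeneous_scale[OF s_hom]) simp
  finally show False using assms by simp
qed

lemma chart_ring_sub_point_ring: assumes "eval2 s (fst p) (snd p) \<noteq> 0" shows "chart_ring \<subseteq> point_ring p"
  using mpow_div_mem_point_ring[OF _ s_hom assms] by (auto elim!: chart_ring_E)

lemma is_prime_chart_ideal: assumes p: "eval2 s (fst p) (snd p) \<noteq> 0" shows "is_prime chart_ring (chart_ideal p)"
  unfolding is_prime_def chart_ideal_def
proof (intro conjI ballI impI)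
  show "submod chart_ring (chart_ring \<inter> point_ideal p)"
    by (rule submod_Int[OF sm_chart_ring submod_subset[OF submod_point_ideal chart_ring_sub_point_ring[OF p]]])
  show "1 \<notin> chart_ring \<inter> point_ideal p" using one_notin_point_ideal[of p] by simp
  fix a b assume "a \<in> chart_ring" "b \<in> chart_ring" "a * b \<in> chart_ring \<inter> point_ideal p"
  then show "a \<in> chart_ring \<inter> point_ideal p \<or> b \<in> chart_ring \<inter> point_ideal p"
    using is_prime_point_ideal[of p] chart_ring_sub_point_ring[OF p] unfolding is_prime_def by (simp add: subset_iff)
qed simp

text \<open>The residue field at \<open>p\<close> consists of the constants, so an element outside
  \<open>chart_ideal p\<close> differs from a nonzero constant by an element of it.\<close>

lemma chart_ideal_maximal:
  assumes p: "eval2 s (fst p) (snd p) \<noteq> 0" and J: "submod chart_ring J" "J \<subseteq> chart_ring" "chart_ideal p \<subseteq> J" and z: "z \<in> J" "z \<notin> chart_ideal p"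
  shows "1 \<in> J"
proof -
  have zB: "z \<in> chart_ring" using z(1) J(2) by blast
  then have "z \<in> point_ring p" using chart_ring_sub_point_ring[OF p] by blast
  then obtain c where c: "c \<in> constants" "z - c \<in> point_ideal p" using point_ring_residue by blast
  have cB: "c \<in> chart_ring" using c(1) constants_sub_chart_ring by blast
  have "z - c \<in> chart_ideal p" unfolding chart_ideal_def using c(2) is_subring_diff[OF is_subring_chart_ring zB cB] by simp
  then have "z - (z - c) \<in> J" using submod_diff[OF J(1) z(1)] J(3) by blast
  then have cJ: "c \<in> J" by simp
  have "c \<noteq> 0" using z(2) c(2) zB by (auto simp: chart_ideal_def)
  then obtain d where d: "d \<in> constants" "d * c = 1" using is_subfield_constants c(1) unfolding is_subfield_def by blast
  then show ?thesis using submod_mult[OF J(1) _ cJ, of d] constants_sub_chart_ring by auto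
qed

lemma maximalideal_chart_ideal: assumes p: "eval2 s (fst p) (snd p) \<noteq> 0" shows "maximalideal (chart_ideal p) (subring_of chart_ring)"
  unfolding maximalideal_subring_of_iff[OF is_subring_chart_ring]
proof (intro conjI allI impI)
  show "submod chart_ring (chart_ideal p)" "chart_ideal p \<subseteq> chart_ring" "1 \<notin> chart_ideal p" using is_prime_chart_ideal[OF p] unfolding is_prime_def by blast+
  fix J assume J: "submod chart_ring J \<and> chart_ideal p \<subseteq> J \<and> J \<subseteq> chart_ring"
  show "J = chart_ideal p \<or> J = chart_ring"
  proof (rule disjCI)
    assume "J \<noteq> chart_ring"
    then have "1 \<notin> J" using submod_eq_if_1_mem[OF is_subring_chart_ring] J by blast
    then have "J \<subseteq> chart_ideal p" using chart_ideal_maximal[OF p] J by blast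
    then show "J = chart_ideal p" using J by blast
  qed
qed

text \<open>A fraction in the local ring at \<open>p\<close> with numerator and denominator of order
  at least \<open>j\<close> becomes a quotient of chart functions after both are divided by
  \<open>\<sigma> ^ j\<close>.\<close>

lemma localization_chart_ideal: assumes p: "eval2 s (fst p) (snd p) \<noteq> 0" shows "localization chart_ring (chart_ideal p) = point_ring p"
proof
  show "localization chart_ring (chart_ideal p) \<subseteq> point_ring p"
  proof
    fix z assume "z \<in> localization chart_ring (chart_ideal p)"
    then obtain a b where ab: "a \<in> chart_ring" "b \<in> chart_ring" "b \<notin> chart_ideal p" "z = a / b" unfolding localization_def by blast
    have L: "a \<in> point_ring p" "b \<in> point_ring p" "b \<notin> point_ideal p" using ab chart_ring_sub_point_ring[OF p] by (auto simp: chart_ideal_def)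
    have "a * (1 / b) \<in> point_ring p" by (rule is_subring_mult[OF is_subring_point_ring L(1) point_ring_inverse(1)[OF L(2,3)]])
    then show "z \<in> point_ring p" using ab(4) by simp
  qed
  show "point_ring p \<subseteq> localization chart_ring (chart_ideal p)"
  proof
    fix z assume "z \<in> point_ring p"
    then obtain U V j where z: "z = tf U / tf V" "ordge j U" "ordge j V" "evp p j V \<noteq> 0" "tf V \<noteq> 0" by (rule point_ring_E)
    have sj: "ordge j (\<sigma> ^ j)" "evp p j (\<sigma> ^ j) \<noteq> 0"
      using evp_power[OF ordge_homogeneous[OF \<sigma>(1)], of j p] \<sigma>_nonzero_at[OF p] by (simp_all add: evp_homogeneous[OF \<sigma>(1), simplified])
    have B: "tf U / tf \<sigma> ^ j \<in> chart_ring" "tf V / tf \<sigma> ^ j \<in> chart_ring" by (rule div_\<sigma>, simp add: z)+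
    have "tf V / tf (\<sigma> ^ j) \<notin> point_ideal p" unfolding point_ideal_iff[OF z(3) sj] by (rule z(4))
    then have nM: "tf V / tf \<sigma> ^ j \<notin> chart_ideal p" by (simp add: chart_ideal_def)
    have "z = (tf U / tf \<sigma> ^ j) / (tf V / tf \<sigma> ^ j)" using nz(2) unfolding z(1) by simp
    then show "z \<in> localization chart_ring (chart_ideal p)" unfolding localization_def using B nM by blast
  qed
qed

text \<open>A prime that contains a power of the maximal ideal of \<open>A\<close> contains
  \<open>x\<close> and \<open>y\<close>, so modulo \<open>P\<close> only leading forms matter. The
  leading form of \<open>U\<close> splits into linear factors, one of which, divided by
  \<open>\<sigma>\<close>, lies in \<open>P\<close>; it determines the point.\<close>

lemma prime_eq_chart_ideal:
  assumes P: "is_prime chart_ring P" and N: "mpow N \<subseteq> P" and U: "ordge n U" "hp n U \<noteq> 0" "tf U / tf \<sigma> ^ n \<in> P"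
  shows "\<exists>p. eval2 s (fst p) (snd p) \<noteq> 0 \<and> P = chart_ideal p"
proof -
  have sm: "submod chart_ring P" and 1: "1 \<notin> P" and PB: "P \<subseteq> chart_ring" using P unfolding is_prime_def by blast+
  note xy = mpow_prime_ideal[OF P is_subring_chart_ring mpow_sub_chart_ring N]
  \<comment> \<open>Numerators of one order more than required are combinations of \<open>x\<close>
    and \<open>y\<close> with chart functions as coefficients.\<close>
  have K: "u / tf s ^ j \<in> P" if "u \<in> mpow (Suc (j * Suc e))" for u j
  proof -
    obtain a b where ab: "a \<in> mpow (j * Suc e)" "b \<in> mpow (j * Suc e)" "u = tf px * a + tf py * b"
      using \<open>u \<in> mpow (Suc (j * Suc e))\<close> unfolding mpow_Suc by (auto elim!: splusE smulE)
    have "a / tf s ^ j * tf px + b / tf s ^ j * tf py \<in> P"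
      by (intro submod_add[OF sm] submod_mult[OF sm] chart_ring_I ab xy)
    then show ?thesis unfolding ab(3) by (simp add: add_divide_distrib mult.commute)
  qed
  have "tf (U - hp n U) / tf \<sigma> ^ n \<in> P"
  proof -
    have "tf (U - hp n U) * tf \<rho> ^ n \<in> mpow (Suc n + n * e)"
      by (rule mpow_mult[OF tf_mem_mpow[OF hp_decomp_ordge[OF U(1)]] s_pow(2)])
    then have "tf (U - hp n U) * tf \<rho> ^ n / tf s ^ n \<in> P" by (intro K) simp
    moreover have "tf (U - hp n U) * tf \<rho> ^ n / tf s ^ n = tf (U - hp n U) / tf \<sigma> ^ n"
      unfolding tf_s using nz(3) by (simp add: power_mult_distrib)
    ultimately show ?thesis by (simp only:)
  qed
  from submod_diff[OF sm U(3) this] have H: "tf (hp n U) / tf \<sigma> ^ n \<in> P" by (simp add: diff_divide_distrib)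
  have "\<exists>p. p \<noteq> (0, 0) \<and> eval2 (hp n U) (fst p) (snd p) = 0 \<and> tf (lp p) / tf \<sigma> \<in> P"
  proof (rule is_prime_form[OF P _ homogeneous_hp U(2) H \<sigma>(2)])
    show "tf H / tf \<sigma> ^ n \<in> chart_ring" if "homogeneous n H" for n H
      by (rule div_\<sigma>) (simp add: ordge_homogeneous[OF that])
  qed
  then obtain p where p: "p \<noteq> (0, 0)" "tf (lp p) / tf \<sigma> \<in> P" by blast
  \<comment> \<open>At a zero of \<open>s\<close> the form \<open>lp p\<close> would divide
    \<open>s\<close>, so \<open>lp p / \<sigma>\<close> would be a unit of the chart and
    \<open>P\<close> the whole ring.\<close>
  have sp: "eval2 s (fst p) (snd p) \<noteq> 0"
  proof
    assume z: "eval2 s (fst p) (snd p) = 0"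
    have "linear_form (snd p) (- fst p) dvd s" by (rule linear_form_dvd[OF s_hom z]) (use p(1) in simp)
    then obtain s' where s': "s = lp p * s'" unfolding lp_def by (rule dvdE)
    have "ordge (Suc e) (lp p * s')" using ordge_homogeneous[OF s_hom] unfolding s' .
    then have o: "ordge e s'" by (rule ordge_lp_cancel[OF p(1)])
    have "tf \<sigma> ^ 1 * tf s' \<in> mpow (1 + e)" by (rule mpow_mult[OF s_pow(3)]) (simp add: o)
    then have "tf \<sigma> * tf s' / tf s ^ 1 \<in> chart_ring" by (intro chart_ring_I) simp
    from submod_mult[OF sm this p(2)] have "tf \<sigma> * tf s' / tf s ^ 1 * (tf (lp p) / tf \<sigma>) \<in> P" .
    moreover have "tf \<sigma> * tf s' / tf s ^ 1 * (tf (lp p) / tf \<sigma>) = (tf (lp p) * tf s') / tf s"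
      using nz(2) by (simp add: mult.commute)
    also have "\<dots> = 1" using nz(1) by (metis divide_self s' to_fract_mult)
    ultimately show False using 1 by simp
  qed
  have "chart_ideal p \<subseteq> P"
  proof
    fix b assume b: "b \<in> chart_ideal p"
    then obtain u j where u: "b = u / tf s ^ j" "u \<in> mpow (j * Suc e)" unfolding chart_ideal_def by (auto elim: chart_ring_E)
    obtain R Q where R: "u = tf R / tf Q" "ordge (j * Suc e) R" "eval2 Q 0 0 \<noteq> 0" by (rule mpow_E[OF u(2)])
    let ?m = "j * Suc e"
    have sj: "ordge ?m (s ^ j)" "evp p ?m (s ^ j) \<noteq> 0"
      using evp_power[OF ordge_homogeneous[OF s_hom], of j p] sp by (simp_all add: evp_homogeneous[OF s_hom])
    have V: "ordge ?m (Q * s ^ j)" "evp p ?m (Q * s ^ j) \<noteq> 0"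
      using ordge_mult_left[OF sj(1)] evp_mult[of 0 Q ?m "s ^ j" p] sj R(3) by (simp_all add: evp_0)
    have "b = tf R / tf (Q * s ^ j)" unfolding u(1) R(1) by simp
    then have "tf R / tf (Q * s ^ j) \<in> point_ideal p" using b by (simp add: chart_ideal_def)
    then have ev: "evp p ?m R = 0" unfolding point_ideal_iff[OF R(2) V] .
    have 1: "tf (R - hp ?m R) / tf s ^ j \<in> P" by (rule K[OF tf_mem_mpow[OF hp_decomp_ordge[OF R(2)]]])
    have 2: "tf (hp ?m R) / tf s ^ j \<in> P"
    proof (cases j)
      case 0
      then have "hp ?m R = 0" using ev by (simp add: evp_0 hp_zero)
      then show ?thesis using submod_zero[OF sm] by simp
    next
      case (Suc i)
      obtain m where m: "?m = Suc m" using Suc by simp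
      have "linear_form (snd p) (- fst p) dvd hp ?m R"
        by (rule linear_form_dvd[OF homogeneous_hp]) (use ev p(1) in \<open>simp_all add: evp_def\<close>)
      then obtain R1 where R1: "hp ?m R = lp p * R1" unfolding lp_def by (rule dvdE)
      have "ordge ?m (lp p * R1)" using ordge_homogeneous[OF homogeneous_hp, of ?m R] unfolding R1 .
      then have "ordge (Suc m) (lp p * R1)" by (simp only: m)
      then have o: "ordge m R1" by (rule ordge_lp_cancel[OF p(1)])
      have "tf \<sigma> ^ 1 * tf R1 \<in> mpow (1 + m)" by (rule mpow_mult[OF s_pow(3)]) (simp add: o)
      then have "tf \<sigma> * tf R1 \<in> mpow ?m" using m by simp
      then have "tf \<sigma> * tf R1 / tf s ^ j \<in> chart_ring" by (rule chart_ring_I)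
      from submod_mult[OF sm this p(2)] have "tf \<sigma> * tf R1 / tf s ^ j * (tf (lp p) / tf \<sigma>) \<in> P" .
      moreover have "tf \<sigma> * tf R1 / tf s ^ j * (tf (lp p) / tf \<sigma>) = tf (hp ?m R) / tf s ^ j"
        unfolding R1 using nz(2) by (simp add: mult.commute)
      ultimately show ?thesis by (simp only:)
    qed
    have "tf R / tf s ^ j = tf (hp ?m R) / tf s ^ j + tf (R - hp ?m R) / tf s ^ j"
      by (simp add: add_divide_distrib[symmetric])
    then have "tf R / tf s ^ j \<in> P" using submod_add[OF sm 2 1] by (simp only:)
    then have "1 / tf Q * (tf R / tf s ^ j) \<in> P"
      using mpow_0_inverse[OF R(3)] mpow_sub_chart_ring by (intro submod_mult[OF sm]) auto
    then show "b \<in> P" unfolding u(1) R(1) by (simp add: mult.commute)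
  qed
  moreover have "P \<subseteq> chart_ideal p"
  proof
    fix z assume "z \<in> P"
    then show "z \<in> chart_ideal p" using chart_ideal_maximal[OF sp sm PB \<open>chart_ideal p \<subseteq> P\<close>, of z] 1 by blast
  qed
  ultimately show ?thesis using sp by (intro exI[of _ p] conjI subset_antisym)
qed

text \<open>The function \<open>lp p / \<sigma>\<close> vanishes at \<open>p\<close>, hence at
  \<open>q\<close>, so the two directions agree up to scaling.\<close>

lemma chart_ideal_proportional:
  assumes p: "eval2 s (fst p) (snd p) \<noteq> 0" and q: "eval2 s (fst q) (snd q) \<noteq> 0" and sub: "chart_ideal p \<subseteq> chart_ideal q"
  shows "eval2 (lp p) (fst q) (snd q) = 0"
proof -
  have o: "ordge 1 (lp p)" "ordge 1 \<sigma>" by (rule ordge_homogeneous, rule homogeneous_lp, rule ordge_homogeneous, rule \<sigma>(1))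
  have e: "evp r 1 \<sigma> \<noteq> 0" if "eval2 s (fst r) (snd r) \<noteq> 0" for r
    using \<sigma>_nonzero_at[OF that] by (simp only: evp_homogeneous[OF \<sigma>(1)] not_False_eq_True)
  have "tf (lp p) / tf \<sigma> \<in> point_ideal p"
    by (subst point_ideal_iff[OF o e[OF p]]) (simp only: evp_homogeneous[OF homogeneous_lp(1)] lp_zero)
  moreover have "tf (lp p) / tf \<sigma> ^ 1 \<in> chart_ring" by (rule div_\<sigma>) (use o in simp)
  ultimately have "tf (lp p) / tf \<sigma> \<in> point_ideal q" using sub by (auto simp: chart_ideal_def)
  then have "evp q 1 (lp p) = 0" unfolding point_ideal_iff[OF o e[OF q]] .
  then show ?thesis by (simp only: evp_homogeneous[OF homogeneous_lp(1)])
qed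

end

section \<open>Common tangent directions and their local contributions\<close>

context curve_pair
begin

text \<open>The common tangent directions as points of the projective line, with normalised
  coordinates so that equality of pairs is equality of points.\<close>

definition Z :: "('k \<times> 'k) set" where
  "Z = {p. (p = (1, 0) \<or> (\<exists>a. p = (a, 1))) \<and>
     eval2 (hp c f) (fst p) (snd p) = 0 \<and> eval2 (hp d g) (fst p) (snd p) = 0}"

lemma Z_D:
  assumes "p \<in> Z"
  shows "p \<noteq> (0, 0)" "evp p c f = 0" "evp p d g = 0" "p = (1, 0) \<or> (\<exists>a. p = (a, 1))"
  using assms by (auto simp: Z_def evp_def)

lemma finite_Z: "finite Z"
proof (rule finite_subset)
  show "Z \<subseteq> insert (1, 0) ((\<lambda>a. (a, 1)) ` {t. eval2 (hp c f) t 1 = 0})"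
    unfolding Z_def by auto
  show "finite (insert (1, 0) ((\<lambda>a. (a, 1)) ` {t. eval2 (hp c f) t 1 = 0}))"
    using finite_homogeneous_zeros[OF homogeneous_hp f(2)] by simp
qed

lemma Z_proportional:
  assumes p: "p \<in> Z" and q: "q \<in> Z" and z: "eval2 (lp q) (fst p) (snd p) = 0" shows "p = q"
proof -
  obtain t where t: "t \<noteq> 0" "p = (t * fst q, t * snd q)" by (rule lp_proportional[OF Z_D(1)[OF p] z Z_D(1)[OF q]])
  from Z_D(4)[OF p] Z_D(4)[OF q] show ?thesis using t by auto
qed

lemma Z_normalize:
  assumes p: "p \<noteq> (0, 0)" "evp p c f = 0" "evp p d g = 0"
  obtains q t where "q \<in> Z" "t \<noteq> 0" "p = (t * fst q, t * snd q)"
proof -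
  obtain a b where ab: "p = (a, b)" by (cases p)
  have scale: "(a', b') \<in> Z" if t: "t \<noteq> 0" "p = (t * a', t * b')" and n: "(a', b') = (1, 0) \<or> (\<exists>a. (a', b') = (a, 1))" for t a' b'
  proof -
    have "evp (a', b') c f = 0" "evp (a', b') d g = 0" using p(2,3) t unfolding t(2) evp_scale by simp_all
    then show ?thesis using n by (simp add: Z_def evp_def)
  qed
  show thesis
  proof (cases "b = 0")
    case True
    then have a: "a \<noteq> 0" using p(1) ab by simp
    then show thesis by (intro that[of "(1, 0)" a] scale[of a]) (simp_all add: ab True)
  next
    case False
    then show thesis by (intro that[of "(a / b, 1)" b] scale[of b]) (simp_all add: ab)
  qed
qed

text \<open>The ideal of the two strict transforms in the local ring at \<open>p\<close>, formed
  with the local equation \<open>sp p\<close> in order to be independent of a chart.\<close>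

definition point_curves :: "'k \<times> 'k \<Rightarrow> 'k rational_function set" where
  "point_curves p = (tf f / tf (sp p) ^ c) *\<^sub>S point_ring p \<boxplus> (tf g / tf (sp p) ^ d) *\<^sub>S point_ring p"

definition point_mult :: "'k \<times> 'k \<Rightarrow> nat" where
  "point_mult p = the_enat (rlen constants (point_ring p) (point_curves p))"

end

lemma smul_unit:
  fixes w :: "'a::field"
  assumes L: "is_subring L" and w: "w \<in> L" "1 / w \<in> L" "w \<noteq> 0" shows "w *\<^sub>S L = L"
proof
  show "w *\<^sub>S L \<subseteq> L" by (rule smul_subset_submod[OF is_subring_submod[OF L] w(1)])
  show "L \<subseteq> w *\<^sub>S L"
  proof
    fix z assume "z \<in> L"
    then have "w * (1 / w * z) \<in> w *\<^sub>S L" by (intro smulI is_subring_mult[OF L w(2)])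
    then show "z \<in> w *\<^sub>S L" using w(3) by simp
  qed
qed

section \<open>The strict transforms in a chart and their common points\<close>

locale curve_chart = curve_pair f g c d + chart \<sigma> \<rho> e
  for f g :: "'k::alg_closed_field poly poly" and c d :: nat and \<sigma> \<rho> :: "'k poly poly" and e :: nat
begin

definition F :: "'k rational_function" where "F = tf f / tf \<sigma> ^ c"
definition G :: "'k rational_function" where "G = tf g / tf \<sigma> ^ d"

definition chart_curves :: "'k rational_function set" where
  "chart_curves = F *\<^sub>S chart_ring \<boxplus> G *\<^sub>S chart_ring"

lemma FG_mem: "F \<in> chart_ring" "G \<in> chart_ring"
  unfolding F_def G_def by (rule div_\<sigma>, simp add: f g)+

lemma FG_nz: "F \<noteq> 0" "G \<noteq> 0"
  using tf_fg0 nz unfolding F_def G_def by simp_all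

lemma sm_chart_curves: "submod chart_ring chart_curves"
  unfolding chart_curves_def by (intro submod_splus submod_smul sm_chart_ring)

lemma chart_curves_sub: "chart_curves \<subseteq> chart_ring"
  unfolding chart_curves_def by (intro splus_least[OF sm_chart_ring] smul_subset_submod[OF sm_chart_ring] FG_mem)

lemma FG_chart_curves: "F \<in> chart_curves" "G \<in> chart_curves"
  unfolding chart_curves_def
  by (rule subsetD[OF splus_upper1[OF submod_smul[OF sm_chart_ring]] mem_smul_self[OF is_subring_chart_ring]],
      rule subsetD[OF splus_upper2[OF submod_smul[OF sm_chart_ring]] mem_smul_self[OF is_subring_chart_ring]])

lemma evp_\<sigma>: assumes "eval2 s (fst p) (snd p) \<noteq> 0" shows "ordge j (\<sigma> ^ j)" "evp p j (\<sigma> ^ j) \<noteq> 0"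
  using evp_power[OF ordge_homogeneous[OF \<sigma>(1)], of j p] \<sigma>_nonzero_at[OF assms]
  by (simp_all add: evp_homogeneous[OF \<sigma>(1), simplified])

lemma FG_point_ideal_iff:
  assumes p: "eval2 s (fst p) (snd p) \<noteq> 0"
  shows "F \<in> point_ideal p \<longleftrightarrow> evp p c f = 0" "G \<in> point_ideal p \<longleftrightarrow> evp p d g = 0"
  using point_ideal_iff[OF f(1) evp_\<sigma>[OF p, of c]] point_ideal_iff[OF g(1) evp_\<sigma>[OF p, of d]] by (simp_all add: F_def G_def)

lemma FG_mem_chart_ideal:
  assumes "p \<in> Z" "eval2 s (fst p) (snd p) \<noteq> 0" shows "F \<in> chart_ideal p" "G \<in> chart_ideal p"
  using FG_point_ideal_iff[OF assms(2)] Z_D(2,3)[OF assms(1)] FG_mem by (simp_all add: chart_ideal_def)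

text \<open>Since \<open>f = \<sigma>^c F\<close> and \<open>g = \<sigma>^d G\<close>, the prime
  contains \<open>(f, g) A\<close> and therefore a power of the maximal ideal of \<open>A\<close>:
  the common points of the strict transforms lie on the exceptional line.\<close>

lemma prime_classification:
  assumes P: "is_prime chart_ring P" and FG: "F \<in> P" "G \<in> P"
  shows "\<exists>p\<in>Z. eval2 s (fst p) (snd p) \<noteq> 0 \<and> P = chart_ideal p"
proof -
  have sm: "submod chart_ring P" using P unfolding is_prime_def by blast
  have smA: "submod (mpow 0) P" by (rule submod_subset[OF sm mpow_sub_chart_ring])
  have "tf \<sigma> ^ c * F \<in> P" "tf \<sigma> ^ d * G \<in> P"
    by (rule submod_mult[OF sm is_subring_power[OF is_subring_chart_ring tf_mem_chart_ring] FG(1)], rule submod_mult[OF sm is_subring_power[OF is_subring_chart_ring tf_mem_chart_ring] FG(2)])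
  then have fg: "tf f \<in> P" "tf g \<in> P" using nz(2) by (simp_all add: F_def G_def)
  obtain N where "mpow N \<subseteq> origin_curves" using origin_curves_contains by blast
  also have "origin_curves \<subseteq> P" unfolding origin_curves_def by (intro splus_least[OF smA] smul_subset_submod[OF smA] fg)
  finally have N: "mpow N \<subseteq> P" .
  obtain p where p: "eval2 s (fst p) (snd p) \<noteq> 0" "P = chart_ideal p"
    using prime_eq_chart_ideal[OF P N f FG(1)[unfolded F_def]] by blast
  have "F \<in> point_ideal p" "G \<in> point_ideal p" using FG p(2) by (simp_all add: chart_ideal_def)
  then have "evp p c f = 0" "evp p d g = 0" using FG_point_ideal_iff[OF p(1)] by simp_all
  then obtain q t where q: "q \<in> Z" "t \<noteq> 0" "p = (t * fst q, t * snd q)"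
    by (rule Z_normalize[OF s_nonzero_point[OF p(1)]])
  have "chart_ideal p = chart_ideal q" unfolding chart_ideal_def q(3) point_ring_scale(2)[OF q(2)] by simp
  moreover have "eval2 s (fst q) (snd q) \<noteq> 0"
    using p(1) unfolding q(3) by (simp add: eval2_homogeneous_scale[OF s_hom])
  ultimately show ?thesis using q(1) p(2) by blast
qed

text \<open>The local equations \<open>\<sigma>\<close> and \<open>sp p\<close> differ by the unit
  \<open>w\<close>, so the strict transforms change by powers of \<open>w\<close>.\<close>

lemma IL_eq:
  assumes p: "eval2 s (fst p) (snd p) \<noteq> 0"
  shows "F *\<^sub>S point_ring p \<boxplus> G *\<^sub>S point_ring p = point_curves p"
proof -
  have p0: "p \<noteq> (0, 0)" by (rule s_nonzero_point[OF p])
  define w where "w = tf \<sigma> / tf (sp p)"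
  have o: "ordge 1 \<sigma>" "ordge 1 (sp p)" "evp p 1 \<sigma> \<noteq> 0"
    using evp_\<sigma>[OF p, of 1] by (simp_all add: ordge_homogeneous[OF homogeneous_sp, simplified])
  have w: "w \<in> point_ring p" "1 / w \<in> point_ring p" "w \<noteq> 0"
    unfolding w_def using point_ring_I[OF o(1,2) evp_sp[OF p0]] point_ring_I[OF o(2,1,3)] nz(2) by simp_all
  have wn: "w ^ n *\<^sub>S point_ring p = point_ring p" for n
    using smul_unit[OF is_subring_point_ring is_subring_power[OF is_subring_point_ring w(1), of n]] is_subring_power[OF is_subring_point_ring w(2), of n] w(3)
    by (simp add: power_one_over)
  have "tf f / tf (sp p) ^ c = F * w ^ c" "tf g / tf (sp p) ^ d = G * w ^ d"
    unfolding F_def G_def w_def using nz(2) by (simp_all add: power_divide)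
  then show ?thesis unfolding point_curves_def by (simp add: smul_smul[symmetric] wn)
qed

text \<open>Cross multiplication and coprimality make \<open>f\<close> divide
  \<open>\<sigma>^c U' V\<close>. The cofactor \<open>t\<close> has order at least
  \<open>i + j\<close> because orders add, so \<open>t / (V V')\<close> is again in the local
  ring.\<close>

lemma regular_point_ring:
  assumes p: "eval2 s (fst p) (snd p) \<noteq> 0" and a: "a \<in> point_ring p" and r: "r \<in> point_ring p" and eq: "F * a = G * r"
  shows "r \<in> F *\<^sub>S point_ring p"
proof -
  obtain U V i where U: "a = tf U / tf V" "ordge i U" "ordge i V" "evp p i V \<noteq> 0" "tf V \<noteq> 0" by (rule point_ring_E[OF a])
  obtain U' V' j where U': "r = tf U' / tf V'" "ordge j U'" "ordge j V'" "evp p j V' \<noteq> 0" "tf V' \<noteq> 0" by (rule point_ring_E[OF r])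
  have "tf f * tf U / (tf \<sigma> ^ c * tf V) = tf g * tf U' / (tf \<sigma> ^ d * tf V')"
    using eq unfolding U(1) U'(1) F_def G_def by simp
  then have "tf f * tf U * (tf \<sigma> ^ d * tf V') = tf g * tf U' * (tf \<sigma> ^ c * tf V)"
    using U(5) U'(5) nz(2) by (simp only: frac_eq_eq mult_eq_0_iff power_eq_0_iff simp_thms)
  then have "tf (f * (U * (\<sigma> ^ d * V'))) = tf (g * (\<sigma> ^ c * U' * V))"
    by (simp add: ac_simps)
  then have "f * (U * (\<sigma> ^ d * V')) = g * (\<sigma> ^ c * U' * V)" by (simp only: to_fract_eq_iff)
  then have "f dvd g * (\<sigma> ^ c * U' * V)" by (metis dvd_triv_left)
  then have "f dvd \<sigma> ^ c * U' * V" by (rule no_common_factor_dvd_cancel[OF f0 no_common_factor])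
  then obtain t where t: "\<sigma> ^ c * U' * V = f * t" by (rule dvdE)
  have "ordge (c + j + i) (\<sigma> ^ c * U' * V)" by (intro ordge_mult evp_\<sigma>[OF p] U U')
  then have "ordge (c + (i + j)) (f * t)" unfolding t by (simp add: add.commute add.left_commute)
  then have ot: "ordge (i + j) t" by (rule ordge_cancel[OF f])
  have VV: "ordge (i + j) (V * V')" "evp p (i + j) (V * V') \<noteq> 0"
    using ordge_mult[OF U(3) U'(3)] evp_mult[OF U(3) U'(3), of p] U(4) U'(4) by simp_all
  have tt: "tf \<sigma> ^ c * tf U' * tf V = tf f * tf t" using t by (metis to_fract_mult tf_power)
  have "r = tf \<sigma> ^ c * tf U' * tf V / (tf \<sigma> ^ c * tf V * tf V')" unfolding U'(1) using U(5) nz(2) by simp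
  also have "\<dots> = F * (tf t / tf (V * V'))" unfolding tt F_def by simp
  finally show ?thesis using smulI[OF point_ring_I[OF ot VV], of F] by simp
qed

lemma multiplicity_at:
  assumes p: "eval2 s (fst p) (snd p) \<noteq> 0" and fin: "rlen constants (point_ring p) (point_curves p) \<noteq> \<infinity>"
  shows "multiplicity_of_ideal (subring_of (point_ring p)) (Idl\<^bsub>subring_of (point_ring p)\<^esub> {F, G}) = real (point_mult p)"
proof (rule multiplicity_of_regular_pair[OF is_subring_point_ring])
  have L: "chart_ring \<subseteq> point_ring p" by (rule chart_ring_sub_point_ring[OF p])
  show FL: "F \<in> point_ring p" "G \<in> point_ring p" using FG_mem L by auto
  show "F \<noteq> 0" "G \<noteq> 0" by (rule FG_nz)+
  show "r \<in> F *\<^sub>S point_ring p" if "a \<in> point_ring p" "r \<in> point_ring p" "F * a = G * r" for a r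
    by (rule regular_point_ring[OF p that])
  show "krull_dim (subring_of (point_ring p)) = 2" by (rule krull_dim_point_ring[OF s_nonzero_point[OF p]])
  have smL: "submod (point_ring p) (point_ring p)" by (rule is_subring_submod[OF is_subring_point_ring])
  have sm: "submod (point_ring p) (F *\<^sub>S point_ring p \<boxplus> G *\<^sub>S point_ring p)" by (intro submod_splus submod_smul smL)
  have sub: "F *\<^sub>S point_ring p \<boxplus> G *\<^sub>S point_ring p \<subseteq> point_ring p" by (intro splus_least[OF smL] smul_subset_submod[OF smL] FL)
  show "rlen (point_ring p) (point_ring p) (F *\<^sub>S point_ring p \<boxplus> G *\<^sub>S point_ring p) = enat (point_mult p)"
    unfolding rlen_constants_point_ring[OF smL sm sub, symmetric] unfolding IL_eq[OF p] point_mult_def using fin by auto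
qed

text \<open>The maximal ideals containing both strict transforms correspond to the points of
  \<open>Z\<close> in the chart, and the localization at each is the local ring defined without the
  chart. So every chart yields the same summand for a given point.\<close>

lemma total_multiplicity_eq:
  assumes fin: "\<And>p. p \<in> Z \<Longrightarrow> rlen constants (point_ring p) (point_curves p) \<noteq> \<infinity>"
  shows "total_multiplicity chart_ring (Idl\<^bsub>subring_of chart_ring\<^esub> {F, G}) =
    (\<Sum>p\<in>{p \<in> Z. eval2 s (fst p) (snd p) \<noteq> 0}. real (point_mult p))"
proof -
  let ?I = "Idl\<^bsub>subring_of chart_ring\<^esub> {F, G}"
  let ?Y = "{p \<in> Z. eval2 s (fst p) (snd p) \<noteq> 0}"
  have I: "?I = chart_curves" unfolding chart_curves_def by (rule genideal_pair[OF is_subring_chart_ring FG_mem])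
  have bij: "bij_betw chart_ideal ?Y {M. maximalideal M (subring_of chart_ring) \<and> ?I \<subseteq> M}"
    unfolding bij_betw_def
  proof
    show "inj_on chart_ideal ?Y"
    proof (rule inj_onI)
      fix p q assume p: "p \<in> ?Y" and q: "q \<in> ?Y" and eq: "chart_ideal p = chart_ideal q"
      then have "eval2 (lp p) (fst q) (snd q) = 0" by (intro chart_ideal_proportional) auto
      then show "p = q" using Z_proportional[of q p] p q by simp
    qed
    show "chart_ideal ` ?Y = {M. maximalideal M (subring_of chart_ring) \<and> ?I \<subseteq> M}"
    proof
      show "chart_ideal ` ?Y \<subseteq> {M. maximalideal M (subring_of chart_ring) \<and> ?I \<subseteq> M}"
      proof
        fix M assume "M \<in> chart_ideal ` ?Y"
        then obtain p where p: "p \<in> Z" "eval2 s (fst p) (snd p) \<noteq> 0" "M = chart_ideal p" by auto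
        have sm: "submod chart_ring (chart_ideal p)" using is_prime_chart_ideal[OF p(2)] unfolding is_prime_def by blast
        have "chart_curves \<subseteq> chart_ideal p" unfolding chart_curves_def
          by (intro splus_least[OF sm] smul_subset_submod[OF sm] FG_mem_chart_ideal p)
        then show "M \<in> {M. maximalideal M (subring_of chart_ring) \<and> ?I \<subseteq> M}"
          using maximalideal_chart_ideal[OF p(2)] p(3) I by simp
      qed
      show "{M. maximalideal M (subring_of chart_ring) \<and> ?I \<subseteq> M} \<subseteq> chart_ideal ` ?Y"
      proof
        fix M assume "M \<in> {M. maximalideal M (subring_of chart_ring) \<and> ?I \<subseteq> M}"
        then have M: "maximalideal M (subring_of chart_ring)" "chart_curves \<subseteq> M" using I by auto
        have "F \<in> M" "G \<in> M" using M(2) FG_chart_curves by auto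
        then obtain p where "p \<in> Z" "eval2 s (fst p) (snd p) \<noteq> 0" "M = chart_ideal p"
          using prime_classification[OF maximalideal_imp_is_prime[OF is_subring_chart_ring M(1)]] by blast
        then show "M \<in> chart_ideal ` ?Y" by blast
      qed
    qed
  qed
  have val: "multiplicity_of_ideal (subring_of (localization chart_ring (chart_ideal p))) (Idl\<^bsub>subring_of (localization chart_ring (chart_ideal p))\<^esub> ?I) = real (point_mult p)"
    if p: "p \<in> ?Y" for p
  proof -
    have sp: "eval2 s (fst p) (snd p) \<noteq> 0" and pZ: "p \<in> Z" using p by auto
    have L: "chart_ring \<subseteq> point_ring p" by (rule chart_ring_sub_point_ring[OF sp])
    have FL: "F \<in> point_ring p" "G \<in> point_ring p" using FG_mem L by auto
    have smL: "submod (point_ring p) (point_ring p)" by (rule is_subring_submod[OF is_subring_point_ring])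
    have "Idl\<^bsub>subring_of (point_ring p)\<^esub> chart_curves = F *\<^sub>S point_ring p \<boxplus> G *\<^sub>S point_ring p"
    proof (rule genideal_subring_of_eq[OF is_subring_point_ring])
      show "submod (point_ring p) (F *\<^sub>S point_ring p \<boxplus> G *\<^sub>S point_ring p)" by (intro submod_splus submod_smul smL)
      show "F *\<^sub>S point_ring p \<boxplus> G *\<^sub>S point_ring p \<subseteq> point_ring p" by (intro splus_least[OF smL] smul_subset_submod[OF smL] FL)
      show "chart_curves \<subseteq> F *\<^sub>S point_ring p \<boxplus> G *\<^sub>S point_ring p" unfolding chart_curves_def by (intro splus_mono smul_mono L)
      show "F *\<^sub>S point_ring p \<boxplus> G *\<^sub>S point_ring p \<subseteq> J" if J: "submod (point_ring p) J" "chart_curves \<subseteq> J" for J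
        using FG_chart_curves J(2) by (intro splus_least[OF J(1)] smul_subset_submod[OF J(1)]) auto
    qed
    also have "\<dots> = Idl\<^bsub>subring_of (point_ring p)\<^esub> {F, G}" by (rule genideal_pair[OF is_subring_point_ring FL, symmetric])
    finally show ?thesis unfolding localization_chart_ideal[OF sp] I using multiplicity_at[OF sp fin[OF pZ]] by simp
  qed
  show ?thesis
    unfolding total_multiplicity_def Let_def sum.reindex_bij_betw[OF bij, symmetric]
    by (rule sum.cong[OF refl]) (rule val)
qed

end

section \<open>Noether's formula\<close>

text \<open>The chart of a linear form misses only the point \<open>q\<close> of the exceptional
  line. As \<open>q\<close> is no tangent direction of \<open>f\<close>, that point is not in
  \<open>Z\<close>.\<close>

locale generic_direction = curve_pair f g c d
  for f g :: "'k::alg_closed_field poly poly" and c d :: nat +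
  fixes q :: "'k \<times> 'k"
  assumes q: "evp q c f \<noteq> 0" "q \<noteq> (0, 0)"

sublocale generic_direction \<subseteq> curve_chart f g c d "lp q" 1 0
  by unfold_locales (simp_all add: lp_nz[OF q(2)])

context generic_direction
begin

abbreviation \<Lambda> :: "'k rational_function" where "\<Lambda> \<equiv> tf (lp q)"

lemma \<Lambda>_power: "\<Lambda> ^ n \<in> mpow n"
  by (rule s_pow(3))

lemma s_eq: "s = lp q"
  by (simp add: s_def)

lemma chart_I: "u \<in> mpow j \<Longrightarrow> u / \<Lambda> ^ j \<in> chart_ring"
  by (rule div_\<sigma>)

lemma chart_E: assumes "z \<in> chart_ring" obtains u j where "z = u / \<Lambda> ^ j" "u \<in> mpow j"
proof -
  obtain u j where "z = u / tf s ^ j" "u \<in> mpow (j * Suc 0)" by (rule chart_ring_E[OF assms])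
  then show thesis by (intro that[of u j]) (simp_all add: s_eq)
qed

lemma splus_fgI: "a \<in> V \<Longrightarrow> b \<in> W \<Longrightarrow> tf f * a + tf g * b \<in> tf f *\<^sub>S V \<boxplus> tf g *\<^sub>S W"
  by (intro splusI smulI)

lemma mpow_sub_fg:
  assumes N: "mpow N \<subseteq> origin_curves" shows "mpow (i + N) \<subseteq> tf f *\<^sub>S mpow i \<boxplus> tf g *\<^sub>S mpow i"
proof (induction i)
  case 0
  then show ?case using N by (simp add: origin_curves_def)
next
  case (Suc i)
  show ?case
  proof
    fix u :: "'k rational_function" assume "u \<in> mpow (Suc i + N)"
    then have "u \<in> tf px *\<^sub>S mpow (i + N) \<boxplus> tf py *\<^sub>S mpow (i + N)" unfolding add_Suc mpow_Suc .
    then obtain a b where ab: "a \<in> mpow (i + N)" "b \<in> mpow (i + N)" "u = tf px * a + tf py * b" by (auto elim!: splusE smulE)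
    obtain a1 a2 where a: "a1 \<in> mpow i" "a2 \<in> mpow i" "a = tf f * a1 + tf g * a2"
      using subsetD[OF Suc.IH ab(1)] by (auto elim!: splusE smulE)
    obtain b1 b2 where b: "b1 \<in> mpow i" "b2 \<in> mpow i" "b = tf f * b1 + tf g * b2"
      using subsetD[OF Suc.IH ab(2)] by (auto elim!: splusE smulE)
    have "tf f * (tf px * a1 + tf py * b1) + tf g * (tf px * a2 + tf py * b2) \<in> tf f *\<^sub>S mpow (Suc i) \<boxplus> tf g *\<^sub>S mpow (Suc i)"
      unfolding mpow_Suc[of i] by (intro splus_fgI splusI smulI a b)
    moreover have "u = tf f * (tf px * a1 + tf py * b1) + tf g * (tf px * a2 + tf py * b2)"
      unfolding ab(3) a(3) b(3) by (simp add: algebra_simps)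
    ultimately show "u \<in> tf f *\<^sub>S mpow (Suc i) \<boxplus> tf g *\<^sub>S mpow (Suc i)" by simp
  qed
qed

lemma mpow_sub_koszul_image: assumes "mpow N \<subseteq> origin_curves" shows "mpow (n + N) \<subseteq> koszul_image n"
  unfolding koszul_image_def by (intro order_trans[OF mpow_sub_fg[OF assms]] splus_mono smul_mono mpow_antimono) simp_all

text \<open>Modulo multiples of \<open>lp q\<close> a form of given degree is determined by its
  value at \<open>q\<close>. Since \<open>hp c f\<close> does not vanish there, a multiple of
  \<open>f\<close> can match that value, and what remains is divisible by \<open>lp q\<close> up to
  higher order.\<close>

lemma mpow_step:
  assumes n: "c \<le> Suc m" and z: "z \<in> mpow (Suc m + k)"
  shows "z \<in> (\<Lambda> *\<^sub>S mpow m \<boxplus> koszul_image (Suc m)) \<boxplus> mpow (Suc (Suc m + k))"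
proof -
  let ?N = "Suc m + k" and ?i = "Suc m + k - c"
  obtain P Q where P: "z = tf P / tf Q" "ordge ?N P" "eval2 Q 0 0 \<noteq> 0" "tf Q \<noteq> 0" by (rule mpow_E[OF z])
  have sp: "homogeneous ?i (sp q ^ ?i)" using homogeneous_power[OF homogeneous_sp, of ?i q] by simp
  define R where "R = f * sp q ^ ?i"
  have cN: "c + ?i = ?N" using n by simp
  have e: "evp q ?i (sp q ^ ?i) \<noteq> 0" unfolding evp_homogeneous[OF sp] using eval2_sp[OF q(2)] by simp
  have R: "ordge ?N R" "evp q ?N R \<noteq> 0"
    using ordge_mult[OF f(1) ordge_homogeneous[OF sp]] evp_mult[OF f(1) ordge_homogeneous[OF sp], of q] q(1) e
    unfolding cN R_def by (simp_all only: mult_eq_0_iff simp_thms)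
  define \<alpha> where "\<alpha> = evp q ?N P / evp q ?N R"
  define P' where "P' = P - [:[:\<alpha>:]:] * R"
  have aR: "ordge ?N ([:[:\<alpha>:]:] * R)" "evp q ?N ([:[:\<alpha>:]:] * R) = \<alpha> * evp q ?N R"
    using ordge_mult[of 0 "[:[:\<alpha>:]:]", OF _ R(1)] evp_mult[of 0 "[:[:\<alpha>:]:]" ?N R q, OF _ R(1)] by (simp_all add: evp_0)
  have P': "ordge ?N P'" "evp q ?N P' = 0"
    unfolding P'_def evp_diff aR(2) using ordge_diff[OF P(2) aR(1)] R(2) by (simp_all add: \<alpha>_def)
  have "linear_form (snd q) (- fst q) dvd hp ?N P'"
    by (rule linear_form_dvd[OF homogeneous_hp]) (use P'(2) q(2) in \<open>simp_all add: evp_def prod_eq_iff\<close>)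
  then obtain H where H: "hp ?N P' = lp q * H" unfolding lp_def by (rule dvdE)
  have "ordge (Suc (m + k)) (lp q * H)" using ordge_homogeneous[OF homogeneous_hp, of ?N P'] unfolding H by simp
  then have oH: "ordge (m + k) H" by (rule ordge_lp_cancel[OF q(2)])
  have oD: "ordge (Suc ?N) (P' - hp ?N P')" using P'(1) by (rule hp_decomp_ordge)
  have "tf H / tf Q \<in> mpow m" by (rule mpow_I[OF ordge_mono[OF oH] P(3)]) simp
  moreover have "tf ([:[:\<alpha>:]:] * sp q ^ ?i) / tf Q \<in> mpow (Suc m - c)"
    by (rule mpow_I[OF ordge_mono[OF ordge_mult[of 0, OF _ ordge_homogeneous[OF sp]]] P(3)]) simp_all
  moreover have "(0 :: 'k rational_function) \<in> mpow (Suc m - d)" by (rule submod_zero[OF submod_mpow])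
  moreover have "tf (P' - hp ?N P') / tf Q \<in> mpow (Suc ?N)" by (rule mpow_I[OF oD P(3)])
  ultimately have "(\<Lambda> * (tf H / tf Q) + (tf f * (tf ([:[:\<alpha>:]:] * sp q ^ ?i) / tf Q) + tf g * 0)) + tf (P' - hp ?N P') / tf Q
      \<in> (\<Lambda> *\<^sub>S mpow m \<boxplus> koszul_image (Suc m)) \<boxplus> mpow (Suc ?N)"
    unfolding koszul_image_def by (intro splusI smulI)
  moreover have "P = lp q * H + f * ([:[:\<alpha>:]:] * sp q ^ ?i) + (P' - hp ?N P')"
    unfolding H by (simp add: P'_def R_def algebra_simps)
  then have "tf P = \<Lambda> * tf H + tf f * tf ([:[:\<alpha>:]:] * sp q ^ ?i) + tf (P' - hp ?N P')"
    by (metis to_fract_add to_fract_mult)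
  then have "z = (\<Lambda> * (tf H / tf Q) + (tf f * (tf ([:[:\<alpha>:]:] * sp q ^ ?i) / tf Q) + tf g * 0)) + tf (P' - hp ?N P') / tf Q"
    unfolding P(1) by (simp only: add_divide_distrib times_divide_eq_right mult_zero_right add_0_right)
  ultimately show ?thesis by simp
qed

lemma sm_step: "submod (mpow 0) (\<Lambda> *\<^sub>S mpow m \<boxplus> koszul_image n)"
  by (intro submod_splus sm_smul sm_koszul_image)

text \<open>\<open>mpow_step\<close> raises the order of the error by one each time, and elements of
  order at least \<open>Suc m + N\<close> already lie in \<open>koszul_image (Suc m)\<close>. Hence
  the induction runs downwards from that order.\<close>

lemma mpow_eq_splus:
  assumes n: "c \<le> Suc m" "d \<le> Suc m" shows "mpow (Suc m) = \<Lambda> *\<^sub>S mpow m \<boxplus> koszul_image (Suc m)" (is "_ = ?T")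
proof
  obtain N where N: "mpow N \<subseteq> origin_curves" using origin_curves_contains by blast
  have "mpow (Suc m + (N - j)) \<subseteq> ?T" for j
  proof (induction j)
    case 0
    then show ?case using order_trans[OF mpow_sub_koszul_image[OF N, of "Suc m"] splus_upper2[OF sm_smul]] by simp
  next
    case (Suc j)
    show ?case
    proof (cases "N - j")
      case 0
      then show ?thesis using Suc.IH by simp
    next
      case (Suc k)
      then have k: "N - Suc j = k" by simp
      have "mpow (Suc (Suc m + k)) \<subseteq> ?T" using Suc.IH unfolding Suc by simp
      then have "?T \<boxplus> mpow (Suc (Suc m + k)) \<subseteq> ?T" by (intro splus_least[OF sm_step order_refl])
      then show ?thesis unfolding k using mpow_step[OF n(1), of _ k] by blast
    qed
  qed
  from this[of N] show "mpow (Suc m) \<subseteq> ?T" by simp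
  have "\<Lambda> *\<^sub>S mpow m \<subseteq> mpow (Suc m)"
  proof
    fix z assume "z \<in> \<Lambda> *\<^sub>S mpow m"
    then obtain a where a: "a \<in> mpow m" "z = \<Lambda> * a" by (rule smulE)
    show "z \<in> mpow (Suc m)" using mpow_mult[OF \<Lambda>_power[of 1] a(1)] a(2) by simp
  qed
  then show "?T \<subseteq> mpow (Suc m)" by (rule splus_least[OF submod_mpow _ koszul_image_sub[OF n]])
qed

lemma koszul_image_\<Lambda>: assumes "v \<in> koszul_image n" "c \<le> n" "d \<le> n" shows "\<Lambda> * v \<in> koszul_image (Suc n)"
proof -
  obtain a b where ab: "a \<in> mpow (n - c)" "b \<in> mpow (n - d)" "v = tf f * a + tf g * b"
    using assms(1) unfolding koszul_image_def by (auto elim!: splusE smulE)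
  have "\<Lambda> * a \<in> mpow (Suc n - c)" "\<Lambda> * b \<in> mpow (Suc n - d)"
    using mpow_mult[OF \<Lambda>_power[of 1] ab(1)] mpow_mult[OF \<Lambda>_power[of 1] ab(2)] assms(2,3) by (simp_all add: Suc_diff_le)
  then have "tf f * (\<Lambda> * a) + tf g * (\<Lambda> * b) \<in> koszul_image (Suc n)" unfolding koszul_image_def by (rule splus_fgI)
  then show ?thesis unfolding ab(3) by (simp add: algebra_simps)
qed

text \<open>Multiplication by \<open>\<Lambda>\<close> maps \<open>mpow n / koszul_image n\<close>
  onto the corresponding quotient in degree \<open>n + 1\<close>. Both have length
  \<open>origin_mult - c d\<close>, so the map is injective.\<close>

lemma koszul_image_cancel1:
  assumes n: "c + d \<le> n" and u: "u \<in> mpow n" "\<Lambda> * u \<in> koszul_image (Suc n)" shows "u \<in> koszul_image n"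
proof -
  have cd: "c \<le> n" "d \<le> n" "c \<le> Suc n" "d \<le> Suc n" using n by simp_all
  define V where "V = {u \<in> mpow n. \<Lambda> * u \<in> koszul_image (Suc n)}"
  have smV: "submod (mpow 0) V"
  proof (rule submodI)
    show "0 \<in> V" by (simp add: V_def submod_zero[OF submod_mpow] submod_zero[OF sm_koszul_image])
    show "a - b \<in> V" if "a \<in> V" "b \<in> V" for a b
      using that submod_diff[OF sm_koszul_image, of "\<Lambda> * a" "Suc n" "\<Lambda> * b"] by (simp add: V_def mpow_diff right_diff_distrib)
    show "r * a \<in> V" if "r \<in> mpow 0" "a \<in> V" for r a
      using that submod_mult[OF sm_koszul_image that(1), of "\<Lambda> * a" "Suc n"] submod_mult[OF submod_mpow that(1), of a n]
      by (simp add: V_def mult.left_commute)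
  qed
  have NV: "koszul_image n \<subseteq> V" using koszul_image_\<Lambda> koszul_image_sub cd unfolding V_def by blast
  have Vm: "V \<subseteq> mpow n" unfolding V_def by blast
  have int: "\<Lambda> *\<^sub>S mpow n \<inter> koszul_image (Suc n) = \<Lambda> *\<^sub>S V" unfolding V_def by (auto elim!: smulE intro: smulI)
  have "rlen constants (mpow (Suc n)) (koszul_image (Suc n)) = rlen constants (\<Lambda> *\<^sub>S mpow n) (\<Lambda> *\<^sub>S mpow n \<inter> koszul_image (Suc n))"
    unfolding mpow_eq_splus[OF cd(3,4)] by (rule rlen_diamond[OF submod_constants[OF sm_koszul_image] submod_constants[OF sm_smul]])
  also have "\<dots> = rlen constants (mpow n) V" unfolding int by (rule rlen_smul[OF submod_constants[OF smV] Vm nz(2)])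
  finally have a: "rlen constants (mpow n) V + enat (c * d) = enat origin_mult" using rlen_koszul[of "Suc n"] n by simp
  then obtain v where v: "rlen constants (mpow n) V = enat v" by (cases "rlen constants (mpow n) V") auto
  have "rlen constants (mpow n) (koszul_image n) = rlen constants (mpow n) V + rlen constants V (koszul_image n)"
    by (rule rlen_additive[OF submod_constants[OF sm_koszul_image] submod_constants[OF smV] submod_constants[OF submod_mpow] NV Vm])
  then have "enat v + rlen constants V (koszul_image n) + enat (c * d) = enat v + enat (c * d)" using rlen_koszul[OF n] a v by simp
  then have "rlen constants V (koszul_image n) = 0" by (cases "rlen constants V (koszul_image n)") (auto simp: zero_enat_def)
  then have "V = koszul_image n" using rlen_eq_0_iff[OF submod_constants[OF sm_koszul_image] submod_constants[OF smV] NV] by simp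
  then show ?thesis using u unfolding V_def by blast
qed

lemma koszul_image_cancel:
  assumes n: "c + d \<le> n" and u: "u \<in> mpow n" shows "\<Lambda> ^ k * u \<in> koszul_image (n + k) \<Longrightarrow> u \<in> koszul_image n"
proof (induction k)
  case (Suc k)
  have "\<Lambda> ^ k * u \<in> mpow (n + k)" using mpow_mult[OF \<Lambda>_power u, of k] by (simp add: add.commute)
  then have "\<Lambda> ^ k * u \<in> koszul_image (n + k)" by (rule koszul_image_cancel1[rotated]) (use n Suc.prems in \<open>simp_all add: mult.assoc\<close>)
  then show ?case by (rule Suc.IH)
qed simp

lemma FG_div: "F * (a / \<Lambda> ^ i) = tf f * a / \<Lambda> ^ (c + i)" "G * (a / \<Lambda> ^ i) = tf g * a / \<Lambda> ^ (d + i)"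
  by (simp_all add: F_def G_def power_add)

lemma koszul_image_div: assumes v: "v \<in> koszul_image n" "c \<le> n" "d \<le> n" shows "v / \<Lambda> ^ n \<in> chart_curves"
proof -
  obtain a b where ab: "a \<in> mpow (n - c)" "b \<in> mpow (n - d)" "v = tf f * a + tf g * b"
    using v(1) unfolding koszul_image_def by (auto elim!: splusE smulE)
  have "F * (a / \<Lambda> ^ (n - c)) + G * (b / \<Lambda> ^ (n - d)) \<in> chart_curves"
    unfolding chart_curves_def by (intro splusI smulI chart_I ab)
  then show ?thesis unfolding FG_div ab(3) using v(2,3) by (simp add: add_divide_distrib)
qed

lemma chart_curves_E:
  assumes "z \<in> chart_curves" obtains n v where "v \<in> koszul_image (c + d + n)" "z = v / \<Lambda> ^ (c + d + n)"
proof -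
  obtain a b where ab: "a \<in> chart_ring" "b \<in> chart_ring" "z = F * a + G * b" using assms unfolding chart_curves_def by (auto elim!: splusE smulE)
  obtain u i where u: "a = u / \<Lambda> ^ i" "u \<in> mpow i" by (rule chart_E[OF ab(1)])
  obtain w j where w: "b = w / \<Lambda> ^ j" "w \<in> mpow j" by (rule chart_E[OF ab(2)])
  have m: "\<Lambda> ^ (d + j) * u \<in> mpow (c + d + (i + j) - c)" "\<Lambda> ^ (c + i) * w \<in> mpow (c + d + (i + j) - d)"
    using mpow_mult[OF \<Lambda>_power u(2), of "d + j"] mpow_mult[OF \<Lambda>_power w(2), of "c + i"] by (simp_all add: ac_simps)
  have "tf f * (\<Lambda> ^ (d + j) * u) + tf g * (\<Lambda> ^ (c + i) * w) \<in> koszul_image (c + d + (i + j))"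
    unfolding koszul_image_def by (rule splus_fgI[OF m])
  moreover have "z = (tf f * (\<Lambda> ^ (d + j) * u) + tf g * (\<Lambda> ^ (c + i) * w)) / \<Lambda> ^ (c + d + (i + j))"
    unfolding ab(3) u(1) w(1) FG_div using nz(2) by (simp add: add_divide_distrib power_add)
  ultimately show thesis by (rule that)
qed

text \<open>If \<open>u = \<Lambda> a + v\<close> with \<open>v\<close> in
  \<open>koszul_image\<close>, then \<open>u / \<Lambda>^(n+1)\<close> and
  \<open>a / \<Lambda>^n\<close> agree modulo \<open>chart_curves\<close>. So denominators can be
  lowered to \<open>\<Lambda> ^ (c + d)\<close>, a degree in which the Koszul count is
  valid.\<close>

lemma chart_ring_sub: "chart_ring \<subseteq> (1 / \<Lambda> ^ (c + d)) *\<^sub>S mpow (c + d) \<boxplus> chart_curves" (is "_ \<subseteq> ?Y")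
proof -
  have smY: "submod (mpow 0) ?Y"
    by (intro submod_splus submod_smul submod_mpow submod_subset[OF sm_chart_curves mpow_sub_chart_ring])
  have smI: "submod (mpow 0) chart_curves" by (rule submod_subset[OF sm_chart_curves mpow_sub_chart_ring])
  have smX: "submod (mpow 0) ((1 / \<Lambda> ^ (c + d)) *\<^sub>S mpow (c + d))" by (rule submod_smul[OF submod_mpow])
  have up: "u / \<Lambda> ^ (c + d + i) \<in> ?Y" if "u \<in> mpow (c + d + i)" for u i
    using that
  proof (induction i arbitrary: u)
    case 0
    then have "1 / \<Lambda> ^ (c + d) * u \<in> (1 / \<Lambda> ^ (c + d)) *\<^sub>S mpow (c + d)" by (intro smulI) simp
    then have "1 / \<Lambda> ^ (c + d) * u \<in> ?Y" by (rule subsetD[OF splus_upper1[OF smI]])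
    then show ?case by simp
  next
    case (Suc i)
    have cd: "c \<le> Suc (c + d + i)" "d \<le> Suc (c + d + i)" by simp_all
    have "u \<in> \<Lambda> *\<^sub>S mpow (c + d + i) \<boxplus> koszul_image (Suc (c + d + i))"
      by (rule subsetD[OF equalityD1[OF mpow_eq_splus[OF cd]]]) (use Suc.prems in simp)
    then obtain a v where av: "a \<in> mpow (c + d + i)" "v \<in> koszul_image (Suc (c + d + i))" "u = \<Lambda> * a + v" by (auto elim!: splusE smulE)
    have "v / \<Lambda> ^ Suc (c + d + i) \<in> ?Y" by (rule subsetD[OF splus_upper2[OF smX] koszul_image_div[OF av(2) cd]])
    with Suc.IH[OF av(1)] have "a / \<Lambda> ^ (c + d + i) + v / \<Lambda> ^ Suc (c + d + i) \<in> ?Y" by (rule submod_add[OF smY])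
    then show ?case unfolding av(3) using nz(2) by (simp add: add_divide_distrib)
  qed
  show ?thesis
  proof
    fix z assume "z \<in> chart_ring"
    then obtain u j where u: "z = u / \<Lambda> ^ j" "u \<in> mpow j" by (rule chart_E)
    have "\<Lambda> ^ (c + d) * u \<in> mpow (c + d + j)" by (rule mpow_mult[OF \<Lambda>_power u(2)])
    from up[OF this] show "z \<in> ?Y" unfolding u(1) using nz(2) by (simp add: power_add)
  qed
qed

lemma rlen_chart_ring: "rlen constants chart_ring chart_curves + enat (c * d) = enat origin_mult"
proof -
  let ?X = "(1 / \<Lambda> ^ (c + d)) *\<^sub>S mpow (c + d)"
  have smX: "submod (mpow 0) ?X" and smI: "submod (mpow 0) chart_curves" by (rule submod_smul[OF submod_mpow], rule submod_subset[OF sm_chart_curves mpow_sub_chart_ring])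
  have XB: "?X \<subseteq> chart_ring" using chart_I[of _ "c + d"] by (auto elim!: smulE)
  \<comment> \<open>This is injectivity of division by \<open>\<Lambda> ^ (c + d)\<close>: a
    denominator of higher degree is removed by \<open>koszul_image_cancel\<close>.\<close>
  have int: "?X \<inter> chart_curves = (1 / \<Lambda> ^ (c + d)) *\<^sub>S koszul_image (c + d)"
  proof
    show "?X \<inter> chart_curves \<subseteq> (1 / \<Lambda> ^ (c + d)) *\<^sub>S koszul_image (c + d)"
    proof
      fix z assume z: "z \<in> ?X \<inter> chart_curves"
      then obtain w where w: "w \<in> mpow (c + d)" "z = 1 / \<Lambda> ^ (c + d) * w" by (auto elim: smulE)
      from z have "z \<in> chart_curves" by simp
      then obtain n v where v: "v \<in> koszul_image (c + d + n)" "z = v / \<Lambda> ^ (c + d + n)" by (rule chart_curves_E)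
      have "\<Lambda> ^ n * w = v" using w(2) v(2) nz(2) by (simp add: power_add field_simps)
      then have "w \<in> koszul_image (c + d)" using v(1) by (intro koszul_image_cancel[OF order_refl w(1), of n]) simp
      then show "z \<in> (1 / \<Lambda> ^ (c + d)) *\<^sub>S koszul_image (c + d)" unfolding w(2) by (rule smulI)
    qed
    show "(1 / \<Lambda> ^ (c + d)) *\<^sub>S koszul_image (c + d) \<subseteq> ?X \<inter> chart_curves"
    proof
      fix z assume "z \<in> (1 / \<Lambda> ^ (c + d)) *\<^sub>S koszul_image (c + d)"
      then obtain v where v: "v \<in> koszul_image (c + d)" "z = 1 / \<Lambda> ^ (c + d) * v" by (rule smulE)
      have "v \<in> mpow (c + d)" by (rule subsetD[OF koszul_image_sub v(1)]) simp_all
      then have "z \<in> ?X" unfolding v(2) by (rule smulI)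
      moreover have "z \<in> chart_curves" using koszul_image_div[OF v(1)] v(2) by simp
      ultimately show "z \<in> ?X \<inter> chart_curves" by simp
    qed
  qed
  have "chart_ring = ?X \<boxplus> chart_curves" by (rule subset_antisym[OF chart_ring_sub splus_least[OF sm_chart_ring XB chart_curves_sub]])
  then have "rlen constants chart_ring chart_curves = rlen constants (?X \<boxplus> chart_curves) chart_curves" by (rule arg_cong)
  also have "\<dots> = rlen constants ?X (?X \<inter> chart_curves)" by (rule rlen_diamond[OF submod_constants[OF smI] submod_constants[OF smX]])
  also have "\<dots> = rlen constants (mpow (c + d)) (koszul_image (c + d))"
    unfolding int by (rule rlen_smul[OF submod_constants[OF sm_koszul_image] koszul_image_sub]) (use nz(2) in simp_all)
  finally show ?thesis using rlen_koszul[OF order_refl] by simp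
qed

lemma s_Z: assumes p: "p \<in> Z" shows "eval2 s (fst p) (snd p) \<noteq> 0"
proof
  assume "eval2 s (fst p) (snd p) = 0"
  then have "eval2 (lp q) (fst p) (snd p) = 0" by (simp add: s_eq)
  then obtain t where t: "t \<noteq> 0" "p = (t * fst q, t * snd q)" by (rule lp_proportional[OF Z_D(1)[OF p] _ q(2)])
  have "evp p c f = t ^ c * evp q c f" unfolding t(2) evp_scale by simp
  then show False using Z_D(2)[OF p] t(1) q(1) by simp
qed

lemma artinian_chart: "artinian chart_ring chart_curves constants Z chart_ideal"
proof (unfold_locales)
  show "rlen constants chart_ring chart_curves \<noteq> \<infinity>" using rlen_chart_ring by (cases "rlen constants chart_ring chart_curves") auto
  show "\<exists>p\<in>Z. P = chart_ideal p" if "is_prime chart_ring P" "chart_curves \<subseteq> P" for P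
    using prime_classification[OF that(1) subsetD[OF that(2) FG_chart_curves(1)] subsetD[OF that(2) FG_chart_curves(2)]] by blast
  show "\<not> chart_ideal p \<subseteq> chart_ideal r" if "p \<in> Z" "r \<in> Z" "p \<noteq> r" for p r
    using chart_ideal_proportional[OF s_Z[OF that(1)] s_Z[OF that(2)]] Z_proportional[OF that(2,1)] that(3) by blast
qed (simp_all add: is_subring_chart_ring constants_sub_chart_ring sm_chart_curves chart_curves_sub finite_Z is_prime_chart_ideal s_Z)

lemma rlen_at: assumes p: "p \<in> Z" shows "rlen constants (point_ring p) (point_curves p) = rlen constants chart_ring (artinian.primary_part chart_ring chart_curves chart_ideal p)"
proof (rule artinian.rlen_localization[OF artinian_chart p localization_chart_ideal[OF s_Z[OF p]]])
  note sp = s_Z[OF p]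
  have smL: "submod (point_ring p) (point_ring p)" by (rule is_subring_submod[OF is_subring_point_ring])
  have BL: "chart_ring \<subseteq> point_ring p" by (rule chart_ring_sub_point_ring[OF sp])
  show sm: "submod (point_ring p) (point_curves p)" unfolding IL_eq[OF sp, symmetric] by (intro submod_splus submod_smul smL)
  show IL: "chart_curves \<subseteq> point_curves p" unfolding IL_eq[OF sp, symmetric] chart_curves_def by (intro splus_mono smul_mono BL)
  show "i / v \<in> point_curves p" if "i \<in> chart_curves" "v \<in> chart_ring" "v \<notin> chart_ideal p" for i v
  proof -
    have "1 / v \<in> point_ring p" by (rule point_ring_inverse(1)) (use that(2,3) BL in \<open>auto simp: chart_ideal_def\<close>)
    then have "1 / v * i \<in> point_curves p" by (rule submod_mult[OF sm _ subsetD[OF IL that(1)]])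
    then show ?thesis by simp
  qed
  show "\<exists>i\<in>chart_curves. \<exists>v\<in>chart_ring. v \<notin> chart_ideal p \<and> z = i / v" if z: "z \<in> point_curves p" for z
  proof -
    obtain a b where ab: "a \<in> point_ring p" "b \<in> point_ring p" "z = F * a + G * b"
      using z unfolding IL_eq[OF sp, symmetric] by (auto elim!: splusE smulE)
    obtain a1 v where a: "a1 \<in> chart_ring" "v \<in> chart_ring" "v \<notin> chart_ideal p" "a = a1 / v"
      using ab(1) unfolding localization_chart_ideal[OF sp, symmetric] localization_def by blast
    obtain b1 w where b: "b1 \<in> chart_ring" "w \<in> chart_ring" "w \<notin> chart_ideal p" "b = b1 / w"
      using ab(2) unfolding localization_chart_ideal[OF sp, symmetric] localization_def by blast
    have P: "is_prime chart_ring (chart_ideal p)" by (rule is_prime_chart_ideal[OF sp])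
    have nz: "v \<noteq> 0" "w \<noteq> 0" using a(3) b(3) P submod_zero[of chart_ring "chart_ideal p"] unfolding is_prime_def by blast+
    have "F * (a1 * w) + G * (b1 * v) \<in> chart_curves"
      unfolding chart_curves_def by (intro splusI smulI is_subring_mult[OF is_subring_chart_ring] a b)
    moreover have "v * w \<in> chart_ring" by (intro is_subring_mult[OF is_subring_chart_ring] a b)
    moreover have "v * w \<notin> chart_ideal p" using P a(2,3) b(2,3) unfolding is_prime_def by blast
    moreover have "z = (F * (a1 * w) + G * (b1 * v)) / (v * w)"
      unfolding ab(3) a(4) b(4) using nz by (simp add: field_simps)
    ultimately show ?thesis by blast
  qed
qed (simp_all add: submod_point_ring_constants[OF is_subring_submod[OF is_subring_point_ring]] is_subring_point_ring constants_subset_point_ring)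

lemma rlen_finite: assumes p: "p \<in> Z" shows "rlen constants (point_ring p) (point_curves p) \<noteq> \<infinity>"
  unfolding rlen_at[OF p] by (rule artinian.fin_primary_part[OF artinian_chart p])

lemma noether: "origin_mult = c * d + (\<Sum>p\<in>Z. point_mult p)"
proof -
  have "rlen constants chart_ring chart_curves = (\<Sum>p\<in>Z. rlen constants chart_ring (artinian.primary_part chart_ring chart_curves chart_ideal p))"
    by (rule artinian.rlen_eq_sum[OF artinian_chart])
  also have "\<dots> = (\<Sum>p\<in>Z. enat (point_mult p))"
  proof (rule sum.cong[OF refl])
    fix p assume p: "p \<in> Z"
    show "rlen constants chart_ring (artinian.primary_part chart_ring chart_curves chart_ideal p) = enat (point_mult p)"
      unfolding rlen_at[OF p, symmetric] point_mult_def using rlen_finite[OF p] by auto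
  qed
  also have "\<dots> = enat (\<Sum>p\<in>Z. point_mult p)"
    by (simp only: of_nat_eq_enat[symmetric] of_nat_sum)
  finally show ?thesis using rlen_chart_ring by simp
qed

text \<open>Both strict transforms pass through the points of \<open>Z\<close>, so no contribution
  vanishes. The equality case of the estimate rests on this.\<close>

lemma point_mult_pos: assumes p: "p \<in> Z" shows "0 < point_mult p"
proof -
  note sp = s_Z[OF p]
  have smL: "submod (point_ring p) (point_ring p)" by (rule is_subring_submod[OF is_subring_point_ring])
  have sm: "submod (point_ring p) (point_curves p)" unfolding IL_eq[OF sp, symmetric] by (intro submod_splus submod_smul smL)
  have FM: "F \<in> point_ideal p" "G \<in> point_ideal p" using FG_mem_chart_ideal[OF p sp] by (simp_all add: chart_ideal_def)
  have "point_curves p \<subseteq> point_ideal p" unfolding IL_eq[OF sp, symmetric]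
    by (intro splus_least[OF submod_point_ideal] smul_subset_submod[OF submod_point_ideal] FM)
  moreover have "1 \<notin> point_ideal p" by (rule one_notin_point_ideal)
  ultimately have ne: "point_ring p \<noteq> point_curves p" "point_curves p \<subseteq> point_ring p" using is_subring_1[OF is_subring_point_ring, of p] point_ideal_subset_point_ring[of p] by blast+
  have "rlen constants (point_ring p) (point_curves p) \<noteq> 0"
    using rlen_eq_0_iff[OF submod_point_ring_constants[OF sm] submod_point_ring_constants[OF smL] ne(2)] ne(1) by simp
  then show ?thesis using rlen_finite[OF p] unfolding point_mult_def by (cases "rlen constants (point_ring p) (point_curves p)") (auto simp: zero_enat_def)
qed

end

section \<open>Noether's formula freed from the auxiliary direction\<close>

context curve_pair
begin

lemma generic_direction_exists: "\<exists>q. generic_direction f g c d q"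
proof -
  have "finite {t. eval2 (hp c f) t 1 = 0}" by (rule finite_homogeneous_zeros[OF homogeneous_hp f(2)])
  then obtain t where "t \<notin> {t. eval2 (hp c f) t 1 = 0}" using infinite_UNIV_alg_closed ex_new_if_finite by blast
  then have "generic_direction f g c d (t, 1)" by unfold_locales (simp_all add: evp_def)
  then show ?thesis by blast
qed

lemma noether_formula: "origin_mult = c * d + (\<Sum>p\<in>Z. point_mult p)"
  and point_mult_pos: "p \<in> Z \<Longrightarrow> 0 < point_mult p" and rlen_finite: "p \<in> Z \<Longrightarrow> rlen constants (point_ring p) (point_curves p) \<noteq> \<infinity>"
  using generic_direction_exists generic_direction.noether generic_direction.point_mult_pos generic_direction.rlen_finite by blast+

end

section \<open>The affine blowing up rings\<close>

lemma a_inv_ring_of_type_algebra: "\<ominus>\<^bsub>ring_of_type_algebra\<^esub> (a :: 'a::comm_ring_1) = - a"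
proof -
  interpret R: ring "ring_of_type_algebra :: 'a ring" by (rule ring_from_type_algebra)
  show ?thesis by (rule R.minus_equality) simp_all
qed

lemma is_subring_generate_ring: "is_subring (generate_ring ring_of_type_algebra H)"
  unfolding is_subring_def
proof (intro conjI ballI)
  let ?R = "generate_ring ring_of_type_algebra H"
  show "1 \<in> ?R" using generate_ring.one[of ring_of_type_algebra H] by simp
  fix a b assume a: "a \<in> ?R" and b: "b \<in> ?R"
  show "a * b \<in> ?R" using generate_ring.eng_mult[OF a b] by simp
  have "a + - b \<in> ?R"
    using generate_ring.eng_add[OF a generate_ring.a_inv[OF b]] by (simp add: a_inv_ring_of_type_algebra)
  then show "a - b \<in> ?R" by simp
qed

lemma generate_ring_least:
  assumes B: "is_subring B" and H: "H \<subseteq> B" shows "generate_ring ring_of_type_algebra H \<subseteq> B"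
proof
  fix z assume "z \<in> generate_ring ring_of_type_algebra H"
  then show "z \<in> B"
  proof induction
    case (a_inv h)
    have "0 - h \<in> B" by (rule is_subring_diff[OF B is_subring_0[OF B] a_inv.IH])
    then show ?case by (simp add: a_inv_ring_of_type_algebra)
  next
    case (eng_add a b)
    have "a + b \<in> B" by (rule is_subring_add[OF B eng_add.IH])
    then show ?case by simp
  next
    case (eng_mult a b)
    have "a * b \<in> B" by (rule is_subring_mult[OF B eng_mult.IH])
    then show ?case by simp
  qed (use is_subring_1[OF B] H in auto)
qed

context chart
begin

text \<open>A generation criterion: if elements of order \<open>Suc e + n\<close> are combinations
  of some \<open>w\<close> with \<open>w / s\<close> in \<open>R\<close> and coefficients of order
  \<open>n\<close>, then factors \<open>s\<close> can be split off the denominator one at a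
  time.\<close>

lemma chart_ring_least:
  assumes R: "is_subring R" "mpow 0 \<subseteq> R"
    and step: "\<And>u n. u \<in> mpow (Suc e + n) \<Longrightarrow>
      \<exists>T. finite T \<and> (\<exists>a. (\<forall>w\<in>T. w / tf s \<in> R \<and> a w \<in> mpow n) \<and> u = (\<Sum>w\<in>T. w * a w))"
  shows "chart_ring \<subseteq> R"
proof -
  have "u / tf s ^ j \<in> R" if "u \<in> mpow (j * Suc e)" for u j
    using that
  proof (induction j arbitrary: u)
    case 0
    then show ?case using R(2) by auto
  next
    case (Suc j)
    have "u \<in> mpow (Suc e + j * Suc e)" using Suc.prems by (simp add: ac_simps)
    from step[OF this] obtain T a where T: "finite T" "\<And>w. w \<in> T \<Longrightarrow> w / tf s \<in> R"
      "\<And>w. w \<in> T \<Longrightarrow> a w \<in> mpow (j * Suc e)" "u = (\<Sum>w\<in>T. w * a w)" by blast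
    have "(\<Sum>w\<in>U. w / tf s * (a w / tf s ^ j)) \<in> R" if "U \<subseteq> T" for U
      using finite_subset[OF that T(1)] that
    proof (induction U rule: finite_induct)
      case empty
      then show ?case by (simp add: is_subring_0[OF R(1)])
    next
      case (insert w U)
      have w: "w \<in> T" using insert.prems by simp
      have "w / tf s * (a w / tf s ^ j) \<in> R" by (rule is_subring_mult[OF R(1) T(2)[OF w] Suc.IH[OF T(3)[OF w]]])
      moreover have "(\<Sum>w\<in>U. w / tf s * (a w / tf s ^ j)) \<in> R" using insert.IH insert.prems by simp
      ultimately show ?case unfolding sum.insert[OF insert.hyps] by (rule is_subring_add[OF R(1)])
    qed
    from this[OF order_refl] show ?case unfolding T(4) by (simp add: sum_divide_distrib mult.commute)
  qed
  then show ?thesis by (auto elim!: chart_ring_E)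
qed

end

lemma mpow_SucE:
  assumes "u \<in> mpow (Suc n)" obtains a b where "a \<in> mpow n" "b \<in> mpow n" "u = tf px * a + tf py * b"
  using assms unfolding mpow_Suc by (auto elim!: splusE smulE)

lemma blowup_ring_props: "is_subring (blowup_ring S)" "mpow 0 \<subseteq> blowup_ring S" "S \<subseteq> blowup_ring S"
  and blowup_ring_least: "is_subring B \<Longrightarrow> mpow 0 \<subseteq> B \<Longrightarrow> S \<subseteq> B \<Longrightarrow> blowup_ring S \<subseteq> B"
  unfolding blowup_ring_def origin_ring_eq
  using is_subring_generate_ring[of "mpow 0 \<union> S"] generate_ring.incl[of _ "mpow 0 \<union> S" ring_of_type_algebra]
    generate_ring_least[of B "mpow 0 \<union> S"] by auto

lemma mem_blowup_ring: "z \<in> S \<Longrightarrow> z \<in> blowup_ring S"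
  using blowup_ring_props(3) by blast

lemma pxy_nz: "tf px \<noteq> 0" "tf py \<noteq> 0" "px \<noteq> 0" "py \<noteq> 0"
  by (simp_all add: px_def py_def)

lemma px_neq_py: "tf px \<noteq> (tf py :: 'k::field rational_function)"
  by (simp add: px_def py_def to_fract_eq_iff)

lemma sum_two: "x \<noteq> y \<Longrightarrow> (\<Sum>w\<in>{x, y}. w * (if w = x then a else b)) = x * a + y * (b :: 'a::comm_ring_1)"
  by auto

lemma sum_three:
  "x \<noteq> y \<Longrightarrow> x \<noteq> z \<Longrightarrow> y \<noteq> z \<Longrightarrow>
    (\<Sum>w\<in>{x, y, z}. w * (if w = x then a else if w = y then b else c)) = x * a + (y * b + z * (c :: 'a::comm_ring_1))"
  by auto

text \<open>The generators \<open>x\<close> and \<open>y\<close> of the maximal ideal, divided by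
  \<open>\<sigma>\<close>, are \<open>1\<close> and \<open>\<tau> / \<sigma>\<close> in some order,
  and both lie in the ring.\<close>

lemma blowup_ring_affine:
  assumes st: "(\<sigma> = px \<and> \<tau> = py) \<or> (\<sigma> = py \<and> \<tau> = (px :: 'k::alg_closed_field poly poly))"
  shows "blowup_ring {tf \<tau> / tf \<sigma>} = chart.chart_ring \<sigma> 1 0"
proof -
  interpret chart \<sigma> 1 0 by unfold_locales (use st pxy_nz homogeneous_px homogeneous_py in auto)
  have s: "s = \<sigma>" by (simp add: s_def)
  have \<sigma>0: "tf \<sigma> \<noteq> 0" using st pxy_nz by auto
  let ?R = "blowup_ring {tf \<tau> / tf \<sigma>}"
  show ?thesis
  proof
    have "tf \<tau> \<in> mpow 1" using st ordge_homogeneous[OF homogeneous_px] ordge_homogeneous[OF homogeneous_py] by auto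
    then have "tf \<tau> / tf \<sigma> \<in> chart_ring" using div_\<sigma>[of "tf \<tau>" 1] by simp
    then show "?R \<subseteq> chart_ring" by (intro blowup_ring_least is_subring_chart_ring mpow_sub_chart_ring) simp
    show "chart_ring \<subseteq> ?R"
    proof (rule chart_ring_least[OF blowup_ring_props(1,2)])
      fix u :: "'k rational_function" and n assume "u \<in> mpow (Suc 0 + n)"
      then have "u \<in> mpow (Suc n)" by simp
      then obtain a b where ab: "a \<in> mpow n" "b \<in> mpow n" "u = tf px * a + tf py * b" by (rule mpow_SucE)
      have R: "tf \<tau> / tf \<sigma> \<in> ?R" "tf \<sigma> / tf \<sigma> \<in> ?R"
        using is_subring_1[OF blowup_ring_props(1)] \<sigma>0 by (auto intro: mem_blowup_ring)
      have "tf px / tf \<sigma> \<in> ?R" "tf py / tf \<sigma> \<in> ?R" using R st by auto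
      then show "\<exists>T. finite T \<and> (\<exists>a. (\<forall>w\<in>T. w / tf s \<in> ?R \<and> a w \<in> mpow n) \<and> u = (\<Sum>w\<in>T. w * a w))"
        unfolding s ab(3) sum_two[OF px_neq_py, symmetric]
        by (intro exI[of _ "{tf px, tf py}"] conjI exI[of _ "\<lambda>w. if w = tf px then a else b"] refl) (auto simp: ab)
    qed
  qed
qed

text \<open>Here \<open>s = x y\<close> has degree two. The generators \<open>x^2\<close>,
  \<open>x y\<close> and \<open>y^2\<close> of the squared maximal ideal, divided by
  \<open>x y\<close>, are \<open>x/y\<close>, \<open>1\<close> and \<open>y/x\<close>.\<close>

lemma blowup_ring_torus: "blowup_ring {tf px / tf py, tf py / tf px} = chart.chart_ring py (px :: 'k::alg_closed_field poly poly) 1"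
proof -
  interpret chart py px 1 by unfold_locales (use pxy_nz homogeneous_px homogeneous_py in auto)
  have s: "tf s = tf px * tf py" by (simp add: s_def mult.commute)
  let ?x = "tf px :: 'k rational_function" and ?y = "tf py :: 'k rational_function"
  let ?R = "blowup_ring {?x / ?y, ?y / ?x}"
  have x1: "?x \<in> mpow 1" "?y \<in> mpow 1" using ordge_homogeneous[OF homogeneous_px] ordge_homogeneous[OF homogeneous_py] by simp_all
  show ?thesis
  proof
    have m: "?x * ?x \<in> mpow (1 * Suc 1)" "?y * ?y \<in> mpow (1 * Suc 1)"
      using mpow_mult[OF x1(1,1)] mpow_mult[OF x1(2,2)] by simp_all
    have "?x * ?x / tf s ^ 1 \<in> chart_ring" "?y * ?y / tf s ^ 1 \<in> chart_ring" by (rule chart_ring_I[OF m(1)], rule chart_ring_I[OF m(2)])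
    then have "?x / ?y \<in> chart_ring" "?y / ?x \<in> chart_ring" unfolding s using pxy_nz by simp_all
    then show "?R \<subseteq> chart_ring" by (intro blowup_ring_least is_subring_chart_ring mpow_sub_chart_ring) simp
    show "chart_ring \<subseteq> ?R"
    proof (rule chart_ring_least[OF blowup_ring_props(1,2)])
      fix u :: "'k rational_function" and n assume "u \<in> mpow (Suc 1 + n)"
      then have "u \<in> mpow (Suc (Suc n))" by simp
      then obtain a b where ab: "a \<in> mpow (Suc n)" "b \<in> mpow (Suc n)" "u = tf px * a + tf py * b" by (rule mpow_SucE)
      obtain a1 a2 where a: "a1 \<in> mpow n" "a2 \<in> mpow n" "a = tf px * a1 + tf py * a2" by (rule mpow_SucE[OF ab(1)])
      obtain b1 b2 where b: "b1 \<in> mpow n" "b2 \<in> mpow n" "b = tf px * b1 + tf py * b2" by (rule mpow_SucE[OF ab(2)])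
      have R: "?x / ?y \<in> ?R" "?y / ?x \<in> ?R" "1 \<in> ?R"
        using is_subring_1[OF blowup_ring_props(1)] by (auto intro: mem_blowup_ring)
      then have R: "?x * ?x / tf s \<in> ?R" "?x * ?y / tf s \<in> ?R" "?y * ?y / tf s \<in> ?R" unfolding s using pxy_nz by simp_all
      \<comment> \<open>The coefficients are given as a function on the set of generators, so the
        three generators have to be distinct.\<close>
      have ne: "?x * ?x \<noteq> ?x * ?y" "?x * ?x \<noteq> ?y * ?y" "?x * ?y \<noteq> ?y * ?y"
      proof -
        show "?x * ?x \<noteq> ?x * ?y" "?x * ?y \<noteq> ?y * ?y" using px_neq_py pxy_nz by simp_all
        have "px * px \<noteq> (py * py :: 'k poly poly)" by (simp add: px_def py_def)
        then show "?x * ?x \<noteq> ?y * ?y" by (metis to_fract_mult to_fract_eq_iff)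
      qed
      have u: "u = ?x * ?x * a1 + (?x * ?y * (a2 + b1) + ?y * ?y * b2)"
        unfolding ab(3) a(3) b(3) by (simp add: algebra_simps)
      have "a2 + b1 \<in> mpow n" by (rule submod_add[OF submod_mpow a(2) b(1)])
      then show "\<exists>T. finite T \<and> (\<exists>a. (\<forall>w\<in>T. w / tf s \<in> ?R \<and> a w \<in> mpow n) \<and> u = (\<Sum>w\<in>T. w * a w))"
        using a(1) b(2) R unfolding u sum_three[OF ne, symmetric]
        by (intro exI[of _ "{?x * ?x, ?x * ?y, ?y * ?y}"] conjI
            exI[of _ "\<lambda>w. if w = ?x * ?x then a1 else if w = ?x * ?y then a2 + b1 else b2"] refl) auto
    qed
  qed
qed

section \<open>The three blowing up multiplicities as sums over points\<close>

context curve_pair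
begin

lemma curve_chart_axes:
  shows "curve_chart f g c d py 1 0" and "curve_chart f g c d px 1 0" and "curve_chart f g c d py px 1"
  by unfold_locales (use pxy_nz homogeneous_px homogeneous_py in auto)

lemma blowup_multiplicity_x_over_y:
  "blowup_multiplicity (blowup_ring {frac_x / frac_y}) (tf f / frac_y ^ c) (tf g / frac_y ^ d) =
    (\<Sum>p\<in>{p \<in> Z. snd p \<noteq> 0}. real (point_mult p))"
proof -
  interpret C: curve_chart f g c d py 1 0 by (rule curve_chart_axes)
  have "eval2 C.s a b = b" for a b unfolding C.s_def by (simp add: py_def eval2_def)
  then show ?thesis unfolding blowup_multiplicity_def frac_x_eq frac_y_eq
    using blowup_ring_affine[where 'k = 'k and \<sigma> = py and \<tau> = px] C.total_multiplicity_eq[OF rlen_finite] by (simp add: C.F_def C.G_def)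
qed

lemma blowup_multiplicity_y_over_x:
  "blowup_multiplicity (blowup_ring {frac_y / frac_x}) (tf f / frac_x ^ c) (tf g / frac_x ^ d) =
    (\<Sum>p\<in>{p \<in> Z. fst p \<noteq> 0}. real (point_mult p))"
proof -
  interpret C: curve_chart f g c d px 1 0 by (rule curve_chart_axes)
  have "eval2 C.s a b = a" for a b unfolding C.s_def by (simp add: px_def eval2_def)
  then show ?thesis unfolding blowup_multiplicity_def frac_x_eq frac_y_eq
    using blowup_ring_affine[where 'k = 'k and \<sigma> = px and \<tau> = py] C.total_multiplicity_eq[OF rlen_finite] by (simp add: C.F_def C.G_def)
qed

lemma blowup_multiplicity_both:
  "blowup_multiplicity (blowup_ring {frac_x / frac_y, frac_y / frac_x}) (tf f / frac_y ^ c) (tf g / frac_y ^ d) =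
    (\<Sum>p\<in>{p \<in> Z. fst p \<noteq> 0 \<and> snd p \<noteq> 0}. real (point_mult p))"
proof -
  interpret C: curve_chart f g c d py px 1 by (rule curve_chart_axes)
  have "eval2 C.s a b \<noteq> 0 \<longleftrightarrow> a \<noteq> 0 \<and> b \<noteq> 0" for a b unfolding C.s_def by (auto simp: px_def py_def eval2_def)
  then show ?thesis unfolding blowup_multiplicity_def frac_x_eq frac_y_eq
    using blowup_ring_torus[where 'k = 'k] C.total_multiplicity_eq[OF rlen_finite] by (simp add: C.F_def C.G_def)
qed

text \<open>A direction has a nonzero coordinate, so the two affine charts cover \<open>Z\<close>;
  the third ring belongs to their intersection, which is counted twice.\<close>

lemma sum_axes:
  "(\<Sum>p\<in>Z. real (point_mult p)) = (\<Sum>p\<in>{p \<in> Z. snd p \<noteq> 0}. real (point_mult p)) +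
    (\<Sum>p\<in>{p \<in> Z. fst p \<noteq> 0}. real (point_mult p)) - (\<Sum>p\<in>{p \<in> Z. fst p \<noteq> 0 \<and> snd p \<noteq> 0}. real (point_mult p))"
proof -
  have U: "Z = {p \<in> Z. snd p \<noteq> 0} \<union> {p \<in> Z. fst p \<noteq> 0}"
    using Z_D(1) by (auto simp: prod_eq_iff)
  have I: "{p \<in> Z. fst p \<noteq> 0 \<and> snd p \<noteq> 0} = {p \<in> Z. snd p \<noteq> 0} \<inter> {p \<in> Z. fst p \<noteq> 0}" by auto
  show ?thesis unfolding I
    by (subst U) (intro sum_Un, simp_all add: finite_Z)
qed

end

section \<open>Tangents and transversality\<close>

context curve_pair
begin

lemma initial_forms: "initial_degree f = c" "initial_degree g = d" "initial_form f = hp c f" "initial_form g = hp d g"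
  unfolding initial_form_def by (simp_all add: initial_degree_eq[OF f] initial_degree_eq[OF g])

definition h :: "'k poly poly" where "h = tangent_gcd f g"

lemma h_props: "h dvd hp c f" "h dvd hp d g" "D dvd hp c f \<Longrightarrow> D dvd hp d g \<Longrightarrow> D dvd h"
  unfolding h_def tangent_gcd_def initial_forms
  by (fact somegcd_ring_of_type_algebra[OF f(2)])+

lemma linear_form_dvd_h:
  assumes "(a, b) \<noteq> (0, 0)"
  shows "linear_form a b dvd h \<longleftrightarrow> eval2 (hp c f) b (- a) = 0 \<and> eval2 (hp d g) b (- a) = 0"
proof
  assume "linear_form a b dvd h"
  then have "linear_form a b dvd hp c f" "linear_form a b dvd hp d g"
    by (rule dvd_trans[OF _ h_props(1)], rule dvd_trans[OF _ h_props(2)])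
  moreover have "eval2 P b (- a) = 0" if L: "linear_form a b dvd P" for P
  proof -
    obtain K where "P = linear_form a b * K" using L by (rule dvdE)
    then show ?thesis by simp
  qed
  ultimately show "eval2 (hp c f) b (- a) = 0 \<and> eval2 (hp d g) b (- a) = 0" by blast
next
  assume z: "eval2 (hp c f) b (- a) = 0 \<and> eval2 (hp d g) b (- a) = 0"
  have "linear_form (- a) (- b) dvd hp c f" "linear_form (- a) (- b) dvd hp d g"
    by (rule linear_form_dvd[OF homogeneous_hp], use z assms in auto)+
  moreover have "linear_form (- a) (- b) = - linear_form a b" by (simp add: linear_form_def)
  ultimately show "linear_form a b dvd h" by (intro h_props(3)) simp_all
qed

lemma common_tangents_eq: "common_tangents f g = (\<lambda>p. curve (lp p)) ` Z"
proof
  show "common_tangents f g \<subseteq> (\<lambda>p. curve (lp p)) ` Z"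
  proof
    fix L assume "L \<in> common_tangents f g"
    then obtain a b where ab: "(a, b) \<noteq> (0, 0)" "linear_form a b dvd h" "L = curve (linear_form a b)"
      unfolding common_tangents_def h_def by blast
    have z: "evp (b, - a) c f = 0" "evp (b, - a) d g = 0"
      using ab(2) unfolding linear_form_dvd_h[OF ab(1)] by (simp_all add: evp_def)
    have ne: "(b, - a) \<noteq> (0, 0)" using ab(1) by auto
    obtain q t where q: "q \<in> Z" "t \<noteq> 0" "(b, - a) = (t * fst q, t * snd q)" by (rule Z_normalize[OF ne z])
    have b: "b = t * fst q" and ma: "- a = t * snd q" using q(3) by simp_all
    have a: "a = - t * snd q" unfolding mult_minus_left ma[symmetric] by simp
    have "u * a + v * b = - t * (u * snd q + v * - fst q)" for u v unfolding a b by (simp add: algebra_simps)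
    then have "L = curve (lp q)" using q(2) unfolding ab(3) curve_def lp_def by simp
    then show "L \<in> (\<lambda>p. curve (lp p)) ` Z" using q(1) by blast
  qed
  show "(\<lambda>p. curve (lp p)) ` Z \<subseteq> common_tangents f g"
  proof
    fix L assume "L \<in> (\<lambda>p. curve (lp p)) ` Z"
    then obtain p where p: "p \<in> Z" "L = curve (lp p)" by blast
    have ne: "(snd p, - fst p) \<noteq> (0, 0)" using Z_D(1)[OF p(1)] by (auto simp: prod_eq_iff)
    have "linear_form (snd p) (- fst p) dvd h"
    proof (rule h_props(3))
      have p0: "(fst p, snd p) \<noteq> (0, 0)" using Z_D(1)[OF p(1)] by simp
      show "linear_form (snd p) (- fst p) dvd hp c f" "linear_form (snd p) (- fst p) dvd hp d g"
        by (rule linear_form_dvd[OF homogeneous_hp Z_D(2)[OF p(1), unfolded evp_def] p0],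
            rule linear_form_dvd[OF homogeneous_hp Z_D(3)[OF p(1), unfolded evp_def] p0])
    qed
    then show "L \<in> common_tangents f g" unfolding common_tangents_def p(2) lp_def h_def[symmetric] using ne by blast
  qed
qed

lemma curve_lp_axis:
  assumes "p \<in> Z" shows "curve (lp p) \<in> {x_axis, y_axis} \<longleftrightarrow> fst p = 0 \<or> snd p = 0"
proof -
  have mem: "(u, v) \<in> curve (lp p) \<longleftrightarrow> u * snd p = v * fst p" for u v by (simp add: curve_def lp_def)
  consider "p = (1, 0)" | a where "p = (a, 1)" using Z_D(4)[OF assms] by blast
  then show ?thesis
  proof cases
    case 1
    then have "curve (lp p) = x_axis" by (auto simp: curve_def lp_def x_axis_def)
    then show ?thesis using 1 by simp
  next
    case (2 a)
    have m: "(a, 1) \<in> curve (lp p)" unfolding mem by (simp add: 2)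
    show ?thesis
    proof
      assume "curve (lp p) \<in> {x_axis, y_axis}"
      then have "curve (lp p) = x_axis \<or> curve (lp p) = y_axis" by simp
      then have "(a, 1) \<in> x_axis \<or> (a, 1) \<in> (y_axis :: ('k \<times> 'k) set)" using m by (elim disjE) (simp_all only: simp_thms)
      then show "fst p = 0 \<or> snd p = 0" using 2 by (simp add: x_axis_def y_axis_def)
    next
      assume "fst p = 0 \<or> snd p = 0"
      then have "a = 0" using 2 by simp
      then have "curve (lp p) = y_axis" using 2 by (auto simp: curve_def lp_def y_axis_def)
      then show "curve (lp p) \<in> {x_axis, y_axis}" by simp
    qed
  qed
qed

text \<open>A point of \<open>Z\<close> gives a common tangent. Once all common tangents are axes,
  one of the axes is therefore among them and the disjunction is automatic.\<close>

lemma axis_condition: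
  assumes "Z \<noteq> {}"
  shows "(x_axis \<in> common_tangents f g \<or> y_axis \<in> common_tangents f g) \<and> common_tangents f g \<subseteq> {x_axis, y_axis} \<longleftrightarrow>
    {p \<in> Z. fst p \<noteq> 0 \<and> snd p \<noteq> 0} = {}"
proof -
  have "common_tangents f g \<noteq> {}" using assms by (simp add: common_tangents_eq)
  then have "(x_axis \<in> common_tangents f g \<or> y_axis \<in> common_tangents f g) \<and> common_tangents f g \<subseteq> {x_axis, y_axis} \<longleftrightarrow>
      common_tangents f g \<subseteq> {x_axis, y_axis}" by blast
  also have "\<dots> \<longleftrightarrow> (\<forall>p\<in>Z. curve (lp p) \<in> {x_axis, y_axis})" unfolding common_tangents_eq by blast
  also have "\<dots> \<longleftrightarrow> (\<forall>p\<in>Z. fst p = 0 \<or> snd p = 0)" by (rule ball_cong[OF refl curve_lp_axis])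
  finally show ?thesis by (auto simp: Ball_def)
qed

text \<open>Without common tangent directions Noether's formula gives
  \<open>origin_mult = c * d\<close>, so the Koszul quotient has length zero and
  \<open>mpow n = koszul_image n\<close>. Comparing parts of degree \<open>n\<close> yields a
  representation by the initial forms.\<close>

lemma forms_in_ideal:
  assumes Z: "Z = {}" and n: "c + d \<le> n" and H: "homogeneous n H"
  shows "\<exists>A B. H = hp c f * A + hp d g * B"
proof -
  have cd: "c \<le> n" "d \<le> n" using n by simp_all
  have "rlen constants (mpow n) (koszul_image n) = 0"
    using rlen_koszul[OF n] noether_formula Z by (cases "rlen constants (mpow n) (koszul_image n)") (auto simp: zero_enat_def)
  then have eq: "mpow n = koszul_image n"
    using rlen_eq_0_iff[OF submod_constants[OF sm_koszul_image] submod_constants[OF submod_mpow] koszul_image_sub[OF cd]] by simp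
  have "tf H \<in> mpow n" using H by (simp add: ordge_homogeneous)
  then have "tf H \<in> koszul_image n" using eq by simp
  then obtain a b where ab: "a \<in> mpow (n - c)" "b \<in> mpow (n - d)" "tf H = tf f * a + tf g * b"
    unfolding koszul_image_def by (auto elim!: splusE smulE)
  obtain A A' where A: "a = A + A'" "A \<in> forms (n - c)" "A' \<in> mpow (Suc (n - c))"
    using ab(1) unfolding mpow_eq_forms_splus[of "n - c"] by (auto elim!: splusE)
  obtain B B' where B: "b = B + B'" "B \<in> forms (n - d)" "B' \<in> mpow (Suc (n - d))"
    using ab(2) unfolding mpow_eq_forms_splus[of "n - d"] by (auto elim!: splusE)
  obtain U where U: "A = tf U" "homogeneous (n - c) U" by (rule forms_E[OF A(2)])
  obtain V where V: "B = tf V" "homogeneous (n - d) V" by (rule forms_E[OF B(2)])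
  have "tf f * A' + tf g * B' \<in> mpow (Suc n)"
    using mpow_mult[OF tf_mem_mpow[OF f(1)] A(3)] mpow_mult[OF tf_mem_mpow[OF g(1)] B(3)] cd
    by (intro submod_add[OF submod_mpow]) simp_all
  moreover have "tf (H - (f * U + g * V)) = tf f * A' + tf g * B'"
    using ab(3) unfolding A(1) B(1) U(1) V(1) by (simp add: algebra_simps)
  ultimately have "ordge (Suc n) (H - (f * U + g * V))" by (simp only: tf_mem_mpow_iff[symmetric])
  then have "hp n (H - (f * U + g * V)) = 0" by (simp add: ordge_Suc_iff)
  moreover have "hp n (f * U) = hp c f * U"
    using hp_mult_ordge[OF f(1) ordge_homogeneous[OF U(2)]] cd U(2) by (simp add: hp_homogeneous)
  moreover have "hp n (g * V) = hp d g * V"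
    using hp_mult_ordge[OF g(1) ordge_homogeneous[OF V(2)]] cd V(2) by (simp add: hp_homogeneous)
  ultimately have "H = hp c f * U + hp d g * V" using H by (simp add: hp_diff hp_add hp_homogeneous)
  then show ?thesis by blast
qed

text \<open>The part of lowest degree is subtracted repeatedly; a polynomial has only finitely many
  nonzero parts, so this ends at zero.\<close>

lemma ordge_in_ideal:
  assumes J: "\<And>a b. a \<in> J \<Longrightarrow> b \<in> J \<Longrightarrow> a + b \<in> J" "0 \<in> J" and H: "\<And>m H. n \<le> m \<Longrightarrow> homogeneous m H \<Longrightarrow> H \<in> J"
    and P: "ordge n P"
  shows "P \<in> J"
proof -
  obtain N where N: "\<And>m. N < m \<Longrightarrow> hp m P = 0" using hp_eq_0_large by blast
  have "Q \<in> J" if "ordge m Q" "\<And>i. N < i \<Longrightarrow> hp i Q = 0" "n \<le> m" "m + k = Suc N" for m k Q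
    using that
  proof (induction k arbitrary: m Q)
    case 0
    have "hp i Q = 0" for i using 0 by (cases "i < m") (auto simp: ordge_hp)
    then have "Q = 0" using ordge_exists[of Q] by metis
    then show ?case using J(2) by simp
  next
    case (Suc k)
    have "Q - hp m Q \<in> J"
    proof (rule Suc.IH)
      show "ordge (Suc m) (Q - hp m Q)" by (rule hp_decomp_ordge[OF Suc.prems(1)])
      show "hp i (Q - hp m Q) = 0" if "N < i" for i using Suc.prems(2)[OF that] Suc.prems(4) that by (simp add: hp_diff hp_hp)
    qed (use Suc.prems in simp_all)
    then have "(Q - hp m Q) + hp m Q \<in> J" by (rule J(1)) (rule H[OF Suc.prems(3) homogeneous_hp])
    then show ?case by simp
  qed
  note main = this
  show ?thesis
  proof (cases "n \<le> Suc N")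
    case True
    then show ?thesis using main[OF P N order_refl, of "Suc N - n"] by simp
  next
    case False
    have "hp i P = 0" for i using False N ordge_hp[OF P] by (cases "i < n") auto
    then have "P = 0" using ordge_exists[of P] by metis
    then show ?thesis using J(2) by simp
  qed
qed

text \<open>Forms of degree at least \<open>c + d\<close> lie in the ideal of the initial forms. So
  a chain of ideals above it induces a strict chain of vector spaces between
  \<open>mpow (c + d)\<close> and \<open>mpow 0\<close>, of length at most
  \<open>tri (c + d)\<close>. In contraposition this gives a common tangent direction when the
  intersection is not transversal.\<close>

lemma transversal:
  assumes Z: "Z = {}" shows "transversal_at_origin f g"
proof -
  define R where "R = (ring_of_type_algebra :: 'k poly poly ring)"
  interpret R: cring R unfolding R_def by (rule cring_from_type_algebra)
  have Rs: "carrier R = UNIV" "monoid.mult R = (*)" "zero R = 0" "add R = (+)" by (simp_all add: R_def)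
  let ?n = "c + d"
  have "quot_length R (carrier R) (Idl\<^bsub>R\<^esub> {hp c f, hp d g}) \<le> enat (tri ?n)"
    unfolding quot_length_def
  proof (rule Sup_least)
    fix l assume "l \<in> {enat n |n. \<exists>J. (\<forall>i\<le>n. ideal (J i) R \<and> Idl\<^bsub>R\<^esub> {hp c f, hp d g} \<subseteq> J i \<and> J i \<subseteq> carrier R) \<and>
        (\<forall>i<n. J i \<subset> J (Suc i))}"
    then obtain n J where J: "l = enat n" "\<And>i. i \<le> n \<Longrightarrow> ideal (J i) R \<and> Idl\<^bsub>R\<^esub> {hp c f, hp d g} \<subseteq> J i"
      "\<And>i. i < n \<Longrightarrow> J i \<subset> J (Suc i)" by blast
    have Jadd: "a + b \<in> J i" if "i \<le> n" "a \<in> J i" "b \<in> J i" for a b i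
      using additive_subgroup.a_closed[OF ideal.axioms(1), of "J i" R a b] J(2)[OF that(1)] that by (simp add: Rs)
    have Jmul: "a * b \<in> J i" if "i \<le> n" "b \<in> J i" for a b i
      using ideal.I_l_closed[of "J i" R b a] J(2)[OF that(1)] that by (simp add: Rs)
    have J0: "0 \<in> J i" if "i \<le> n" for i using Jmul[OF that, of _ 0] additive_subgroup.zero_closed[OF ideal.axioms(1), of "J i" R] J(2)[OF that] by (simp add: Rs)
    have gen: "hp c f \<in> J i" "hp d g \<in> J i" if "i \<le> n" for i
      using J(2)[OF that] R.genideal_self[of "{hp c f, hp d g}"] by (auto simp: Rs)
    have big: "P \<in> J i" if i: "i \<le> n" and P: "ordge ?n P" for i P
    proof (rule ordge_in_ideal[OF _ J0[OF i] _ P])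
      show "a + b \<in> J i" if "a \<in> J i" "b \<in> J i" for a b by (rule Jadd[OF i that])
      show "H \<in> J i" if H: "?n \<le> m" "homogeneous m H" for m H
      proof -
        obtain A B where AB: "H = hp c f * A + hp d g * B" using forms_in_ideal[OF Z H] by blast
        have "A * hp c f + B * hp d g \<in> J i" by (intro Jadd Jmul gen i)
        then show ?thesis unfolding AB by (simp only: mult.commute)
      qed
    qed
    \<comment> \<open>Adding \<open>mpow ?n\<close> moves the ideals into a quotient of known
      dimension. Nothing is lost, because every polynomial of order at least \<open>?n\<close> is in
      \<open>J i\<close>.\<close>
    define K where "K i = tf ` J i \<boxplus> mpow ?n" for i
    have smJ: "submod constants (tf ` J i)" if i: "i \<le> n" for i
    proof (rule submodI)
      show "0 \<in> tf ` J i" using J0[OF i] by (metis image_eqI to_fract_0)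
      show "u - v \<in> tf ` J i" if "u \<in> tf ` J i" "v \<in> tf ` J i" for u v
      proof -
        obtain a b where ab: "a \<in> J i" "b \<in> J i" "u = tf a" "v = tf b" using \<open>u \<in> tf ` J i\<close> \<open>v \<in> tf ` J i\<close> by blast
        have "a + - 1 * b \<in> J i" by (intro Jadd Jmul i ab)
        then show ?thesis unfolding ab(3,4) by (metis ab(1) diff_conv_add_uminus image_eqI mult_minus1 to_fract_diff)
      qed
      show "r * v \<in> tf ` J i" if "r \<in> constants" "v \<in> tf ` J i" for r v
      proof -
        obtain t b where "b \<in> J i" "r = tf [:[:t:]:]" "v = tf b" using \<open>r \<in> constants\<close> \<open>v \<in> tf ` J i\<close> unfolding constants_def by blast
        then show ?thesis using Jmul[OF i, of b "[:[:t:]:]"] by (metis image_eqI to_fract_mult)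
      qed
    qed
    have smK: "submod constants (K i)" if "i \<le> n" for i
      unfolding K_def by (intro submod_splus smJ that submod_constants[OF submod_mpow])
    have mem: "P \<in> J i" if i: "i \<le> n" and P: "tf P \<in> K i" for i P
    proof -
      obtain a v where a: "a \<in> J i" "v \<in> mpow ?n" "tf P = tf a + v" using P unfolding K_def by (auto elim!: splusE)
      have "tf (P - a) \<in> mpow ?n" using a(2,3) by simp
      then have "ordge ?n (P - a)" by (simp only: tf_mem_mpow_iff)
      then have "a + (P - a) \<in> J i" by (intro Jadd[OF i a(1)] big[OF i])
      then show ?thesis by simp
    qed
    have "mchain constants (mpow 0) (mpow ?n) n K"
      unfolding mchain_def
    proof (intro conjI allI impI)
      fix i assume i: "i \<le> n"
      show "submod constants (K i)" by (rule smK[OF i])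
      show "mpow ?n \<subseteq> K i" unfolding K_def by (rule splus_upper2[OF smJ[OF i]])
      show "K i \<subseteq> mpow 0" unfolding K_def
        by (intro splus_least[OF submod_mpow] mpow_antimono) auto
    next
      fix i assume i: "i < n"
      have "K i \<subseteq> K (Suc i)" unfolding K_def by (rule splus_mono) (use J(3)[OF i] in auto)
      moreover obtain P where P: "P \<in> J (Suc i)" "P \<notin> J i" using J(3)[OF i] by blast
      have "tf P \<in> K (Suc i)" unfolding K_def by (rule subsetD[OF splus_upper1[OF submod_mpow] imageI[OF P(1)]])
      moreover have "tf P \<notin> K i" using mem[of i P] P(2) i by auto
      ultimately show "K i \<subset> K (Suc i)" by blast
    qed
    then have "enat n \<le> rlen constants (mpow 0) (mpow ?n :: 'k rational_function set)"
      using enat_le_rlen_iff[OF submod_constants[OF submod_mpow] mpow_antimono[OF le0]] by blast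
    then show "l \<le> enat (tri ?n)" unfolding rlen_mpow J(1) .
  qed
  then have "quot_length R (carrier R) (Idl\<^bsub>R\<^esub> {hp c f, hp d g}) \<noteq> \<infinity>" by (auto dest: enat_ile)
  then show ?thesis
    unfolding transversal_at_origin_def initial_forms homogeneous_sop_def Let_def R_def
    using pos homogeneous_hp by blast
qed

end

section \<open>The number of common tangents\<close>

lemma total_degree_homogeneous:
  fixes P :: "'k::field poly poly"
  assumes P: "homogeneous n P" "P \<noteq> 0" shows "total_degree P = n"
proof -
  obtain i j where "cc P i j \<noteq> 0" using poly2_eqI[of P 0] P(2) by auto
  then have "{i + j |i j. cc P i j \<noteq> 0} = {n}" using P(1) unfolding homogeneous_def by blast
  then show ?thesis unfolding total_degree_def by simp
qed

lemma homogeneous_degree_unique: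
  fixes P :: "'k::field poly poly"
  assumes "homogeneous m P" "homogeneous n P" "P \<noteq> 0" shows "m = n"
  using total_degree_homogeneous[OF assms(1,3)] total_degree_homogeneous[OF assms(2,3)] by simp

lemma homogeneous_dvd:
  fixes P H :: "'k::field poly poly"
  assumes P: "homogeneous a P" "P \<noteq> 0" and H: "homogeneous (a + n) H" and dvd: "P dvd H"
  obtains K where "H = P * K" "homogeneous n K"
proof -
  obtain Q where Q: "H = P * Q" using dvd by (rule dvdE)
  have nz: "hp a P \<noteq> 0" using P by (simp add: hp_homogeneous)
  have "ordge (a + n) (P * Q)" using ordge_homogeneous[OF H] unfolding Q .
  then have o: "ordge n Q" by (rule ordge_cancel[OF ordge_homogeneous[OF P(1)] nz])
  have "H = hp (a + n) (P * Q)" using H unfolding Q by (simp add: homogeneous_iff_hp)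
  also have "\<dots> = P * hp n Q" using hp_mult_ordge[OF ordge_homogeneous[OF P(1)] o] P(1) by (simp add: hp_homogeneous)
  finally show thesis by (rule that) simp
qed

text \<open>For a form \<open>P\<close> of degree \<open>a\<close>: the elements of order at least
  \<open>a + n\<close> whose part of degree \<open>a + n\<close> is a multiple of
  \<open>P\<close>.\<close>

definition form_multiples :: "nat \<Rightarrow> nat \<Rightarrow> 'k::field poly poly \<Rightarrow> 'k rational_function set" where
  "form_multiples a n P = tf P *\<^sub>S forms n \<boxplus> mpow (Suc (a + n))"

lemma submod_form_multiples: "submod constants (form_multiples a n P)"
  unfolding form_multiples_def by (intro submod_splus submod_smul submod_forms submod_constants submod_mpow)

lemma mpow_sub_form_multiples: "mpow (Suc (a + n)) \<subseteq> form_multiples a n P"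
  unfolding form_multiples_def by (rule splus_upper2[OF submod_smul[OF submod_forms]])

lemma rlen_form_multiples:
  fixes P :: "'k::field poly poly"
  assumes P: "homogeneous a P" "P \<noteq> 0"
  shows "rlen constants (form_multiples a n P) (mpow (Suc (a + n))) = enat (Suc n)"
proof -
  have z: "(0 :: 'k rational_function) \<in> forms n" "(0 :: 'k rational_function) \<in> mpow (Suc (a + n))"
    by (rule submod_zero[OF submod_forms], rule submod_zero[OF submod_mpow])
  have m: "0 \<in> tf P *\<^sub>S forms n" using smulI[OF z(1), of "tf P"] by simp
  have int: "tf P *\<^sub>S forms n \<inter> mpow (Suc (a + n)) = tf P *\<^sub>S {0}"
  proof
    have "tf P *\<^sub>S forms n \<subseteq> forms (a + n)"
    proof
      fix u assume "u \<in> tf P *\<^sub>S forms n"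
      then obtain K where K: "u = tf P * tf K" "homogeneous n K" by (auto elim!: smulE forms_E)
      show "u \<in> forms (a + n)" using forms_I[OF homogeneous_mult[OF P(1) K(2)]] K(1) by simp
    qed
    then have "tf P *\<^sub>S forms n \<inter> mpow (Suc (a + n)) \<subseteq> forms (a + n) \<inter> mpow (Suc (a + n))" by (rule Int_mono) simp
    also have "\<dots> = {0}" by (rule forms_Int_mpow)
    also have "{0} \<subseteq> tf P *\<^sub>S {0}" using smulI[of 0 "{0}" "tf P"] by simp
    finally show "tf P *\<^sub>S forms n \<inter> mpow (Suc (a + n)) \<subseteq> tf P *\<^sub>S {0}" .
    have "tf P *\<^sub>S {0} = {0}" by (auto simp: smul_def)
    then show "tf P *\<^sub>S {0} \<subseteq> tf P *\<^sub>S forms n \<inter> mpow (Suc (a + n))" using m z(2) by simp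
  qed
  have "rlen constants (form_multiples a n P) (mpow (Suc (a + n))) = rlen constants (tf P *\<^sub>S forms n) (tf P *\<^sub>S forms n \<inter> mpow (Suc (a + n)))"
    unfolding form_multiples_def by (rule rlen_diamond[OF submod_constants[OF submod_mpow] submod_smul[OF submod_forms]])
  also have "\<dots> = rlen constants (forms n) ({0} :: 'k rational_function set)"
    unfolding int by (rule rlen_smul) (use P(2) z(1) submod_trivial in auto)
  finally show ?thesis unfolding rlen_forms .
qed

section \<open>The colon ideal and its leading forms\<close>

context curve_pair
begin

definition colon_g :: "nat \<Rightarrow> 'k rational_function set" where
  "colon_g n = {a \<in> mpow 0. a * tf g \<in> f_plus_power n}"

lemma sm_colon_g: "submod (mpow 0) (colon_g n)"
proof (rule submodI)
  show "0 \<in> colon_g n" by (simp add: colon_g_def submod_zero[OF submod_mpow] submod_zero[OF sm_f_plus_power])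
  show "a - b \<in> colon_g n" if "a \<in> colon_g n" "b \<in> colon_g n" for a b
    using that submod_diff[OF sm_f_plus_power, of "a * tf g" n "b * tf g"] by (simp add: colon_g_def mpow_diff left_diff_distrib)
  show "r * a \<in> colon_g n" if "r \<in> mpow 0" "a \<in> colon_g n" for r a
    using that submod_mult[OF sm_f_plus_power that(1), of "a * tf g" n] submod_mult[OF submod_mpow that(1), of a 0]
    by (simp add: colon_g_def mult.assoc)
qed

lemma colon_g_sub: "colon_g n \<subseteq> mpow 0"
  unfolding colon_g_def by blast

lemma colon_g_I: "a \<in> mpow 0 \<Longrightarrow> a * tf g \<in> f_plus_power n \<Longrightarrow> a \<in> colon_g n"
  by (simp add: colon_g_def)

lemma f_plus_power_I: "a \<in> mpow 0 \<Longrightarrow> b \<in> mpow n \<Longrightarrow> tf f * a + b \<in> f_plus_power n"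
  unfolding f_plus_power_def by (intro splusI smulI)

lemma f_plus_power_E: assumes "z \<in> f_plus_power n" obtains a b where "a \<in> mpow 0" "b \<in> mpow n" "z = tf f * a + b"
  using assms unfolding f_plus_power_def by (auto elim!: splusE smulE)

lemma f_plus_power_sub_colon_g: "f_plus_power k \<subseteq> colon_g (k + d)"
proof
  fix z assume z: "z \<in> f_plus_power k"
  then obtain a b where ab: "a \<in> mpow 0" "b \<in> mpow k" "z = tf f * a + b" by (rule f_plus_power_E)
  have "tf f * (a * tf g) + b * tf g \<in> f_plus_power (k + d)"
    by (intro f_plus_power_I mpow_mult[OF ab(2) tf_mem_mpow[OF g(1)]] is_subring_mult[OF is_subring_mpow ab(1)]) simp
  then have "z * tf g \<in> f_plus_power (k + d)" unfolding ab(3) by (simp add: algebra_simps)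
  then show "z \<in> colon_g (k + d)" by (rule colon_g_I[OF subsetD[OF f_plus_power_sub z]])
qed

lemma f_plus_power_antimono: "k \<le> n \<Longrightarrow> f_plus_power n \<subseteq> f_plus_power k"
  unfolding f_plus_power_def by (intro splus_mono order_refl mpow_antimono)

text \<open>Multiplication by \<open>g\<close> identifies \<open>A / colon_g n\<close> with
  \<open>(f, g) / f_plus_power n\<close>, where the hypothesis ensures that the second ideal is
  contained in the first. The colengths of \<open>f_plus_power\<close> in degrees \<open>n\<close>
  and \<open>n - d\<close> are differences of triangular numbers, and \<open>tri_koszul\<close>
  yields \<open>c d\<close> once more.\<close>

lemma rlen_colon_g:
  assumes N: "mpow (c + d + m) \<subseteq> origin_curves"
  shows "rlen constants (colon_g (c + d + m)) (f_plus_power (c + m)) + enat (c * d) = enat origin_mult"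
proof -
  let ?n = "c + d + m"
  note sk = submod_constants[OF submod_mpow] submod_constants[OF sm_f_plus_power] submod_constants[OF sm_origin_curves] submod_constants[OF sm_colon_g]
  have WI: "f_plus_power ?n \<subseteq> origin_curves" unfolding f_plus_power_def origin_curves_def
    by (intro splus_least[OF sm_origin_curves[unfolded origin_curves_def]] splus_upper1[OF sm_smul] N[unfolded origin_curves_def])
  have eq: "origin_curves = tf g *\<^sub>S mpow 0 \<boxplus> f_plus_power ?n"
  proof
    show "origin_curves \<subseteq> tf g *\<^sub>S mpow 0 \<boxplus> f_plus_power ?n" unfolding origin_curves_def
    proof (rule splus_least[OF submod_splus[OF sm_smul sm_f_plus_power]])
      show "tf f *\<^sub>S mpow 0 \<subseteq> tf g *\<^sub>S mpow 0 \<boxplus> f_plus_power ?n"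
        unfolding f_plus_power_def by (rule order_trans[OF splus_upper1[OF submod_mpow] splus_upper2[OF sm_smul]])
      show "tf g *\<^sub>S mpow 0 \<subseteq> tf g *\<^sub>S mpow 0 \<boxplus> f_plus_power ?n" by (rule splus_upper1[OF sm_f_plus_power])
    qed
    have "tf g *\<^sub>S mpow 0 \<subseteq> origin_curves" unfolding origin_curves_def by (rule splus_upper2[OF sm_smul])
    then show "tf g *\<^sub>S mpow 0 \<boxplus> f_plus_power ?n \<subseteq> origin_curves" by (rule splus_least[OF sm_origin_curves _ WI])
  qed
  have int: "tf g *\<^sub>S mpow 0 \<inter> f_plus_power ?n = tf g *\<^sub>S colon_g ?n"
    unfolding colon_g_def by (auto elim!: smulE intro: smulI simp: mult.commute)
  have "rlen constants origin_curves (f_plus_power ?n) = rlen constants (tf g *\<^sub>S mpow 0 \<boxplus> f_plus_power ?n) (f_plus_power ?n)" by (simp only: eq[symmetric])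
  also have "\<dots> = rlen constants (tf g *\<^sub>S mpow 0) (tf g *\<^sub>S mpow 0 \<inter> f_plus_power ?n)"
    by (rule rlen_diamond[OF sk(2) submod_constants[OF sm_smul]])
  also have "\<dots> = rlen constants (mpow 0) (colon_g ?n)"
    unfolding int by (rule rlen_smul[OF sk(4) colon_g_sub tf_fg0(2)])
  finally have 1: "rlen constants origin_curves (f_plus_power ?n) = rlen constants (mpow 0) (colon_g ?n)" .
  have WJ: "f_plus_power (c + m) \<subseteq> colon_g ?n" using f_plus_power_sub_colon_g[of "c + m"] by (simp add: ac_simps)
  have 2: "rlen constants (mpow 0) (f_plus_power ?n) = enat origin_mult + rlen constants (mpow 0) (colon_g ?n)"
    using rlen_additive[OF sk(2,3,1) WI origin_curves_sub] unfolding 1 rlen_origin_curves .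
  have 3: "rlen constants (mpow 0) (f_plus_power (c + m)) = rlen constants (mpow 0) (colon_g ?n) + rlen constants (colon_g ?n) (f_plus_power (c + m))"
    by (rule rlen_additive[OF sk(2,4,1) WJ colon_g_sub])
  have 4: "rlen constants (mpow 0) (f_plus_power ?n) + enat (tri (d + m)) = enat (tri ?n)"
    "rlen constants (mpow 0) (f_plus_power (c + m)) + enat (tri m) = enat (tri (c + m))"
    using rlen_f_plus_power[of ?n] rlen_f_plus_power[of "c + m"] by simp_all
  obtain w where w: "rlen constants (mpow 0) (f_plus_power (c + m)) = enat w" using 4(2) by (cases "rlen constants (mpow 0) (f_plus_power (c + m))") auto
  obtain j where j: "rlen constants (mpow 0) (colon_g ?n) = enat j" using 3 w by (cases "rlen constants (mpow 0) (colon_g ?n)") auto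
  obtain x where x: "rlen constants (colon_g ?n) (f_plus_power (c + m)) = enat x" using 3 w by (cases "rlen constants (colon_g ?n) (f_plus_power (c + m))") auto
  have "w = j + x" "origin_mult + j + tri (d + m) = tri ?n" "w + tri m = tri (c + m)"
    using 2 3 4 unfolding w j x by simp_all
  then have "x + c * d = origin_mult" using tri_koszul[of c m d] by simp
  then show ?thesis unfolding x by simp
qed

text \<open>If \<open>f a + b\<close> has order at least \<open>c + i\<close> and \<open>b\<close>
  has higher order, then \<open>a\<close> has order at least \<open>i\<close>, and the part of
  degree \<open>c + i\<close> is \<open>hp c f\<close> times the part of degree \<open>i\<close> of
  \<open>a\<close>.\<close>

lemma f_plus_power_Int_mpow:
  "mpow (c + i) \<inter> f_plus_power (Suc (c + i)) = form_multiples c i (hp c f)"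
proof
  have D: "ordge (Suc c) (f - hp c f)" by (rule hp_decomp_ordge[OF f(1)])
  have diff: "tf (f - hp c f) * b \<in> mpow (Suc (c + i))" if "b \<in> mpow i" for b
    using mpow_mult[OF tf_mem_mpow[OF D] that] by simp
  show "mpow (c + i) \<inter> f_plus_power (Suc (c + i)) \<subseteq> form_multiples c i (hp c f)"
  proof
    fix u assume u: "u \<in> mpow (c + i) \<inter> f_plus_power (Suc (c + i))"
    then have "u \<in> f_plus_power (Suc (c + i))" by simp
    then obtain a b where ab: "a \<in> mpow 0" "b \<in> mpow (Suc (c + i))" "u = tf f * a + b" by (rule f_plus_power_E)
    have "b \<in> mpow (c + i)" by (rule subsetD[OF mpow_antimono ab(2)]) simp
    then have "u - b \<in> mpow (c + i)" using u by (intro mpow_diff) simp_all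
    then have "tf f * a \<in> mpow (c + i)" using ab(3) by simp
    then have a: "a \<in> mpow i" by (rule mpow_cancel[OF f ab(1)])
    then obtain A r where A: "A \<in> forms i" "r \<in> mpow (Suc i)" "a = A + r" unfolding mpow_eq_forms_splus[of i] by (rule splusE)
    have "tf f * r \<in> mpow (Suc (c + i))" using mpow_mult[OF tf_mem_mpow[OF f(1)] A(2)] by simp
    moreover have "tf (f - hp c f) * A \<in> mpow (Suc (c + i))" by (rule diff[OF subsetD[OF forms_subset_mpow A(1)]])
    ultimately have "tf (f - hp c f) * A + tf f * r + b \<in> mpow (Suc (c + i))" by (intro submod_add[OF submod_mpow] ab(2))
    then have "tf (hp c f) * A + (tf (f - hp c f) * A + tf f * r + b) \<in> form_multiples c i (hp c f)"
      unfolding form_multiples_def by (intro splusI smulI A(1))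
    then show "u \<in> form_multiples c i (hp c f)" unfolding ab(3) A(3) by (simp add: algebra_simps)
  qed
  show "form_multiples c i (hp c f) \<subseteq> mpow (c + i) \<inter> f_plus_power (Suc (c + i))"
  proof
    fix u assume "u \<in> form_multiples c i (hp c f)"
    then obtain A b where A: "A \<in> forms i" "b \<in> mpow (Suc (c + i))" "u = tf (hp c f) * A + b"
      unfolding form_multiples_def by (auto elim!: splusE smulE)
    have Ai: "A \<in> mpow i" by (rule subsetD[OF forms_subset_mpow A(1)])
    have "tf (hp c f) * A \<in> mpow (c + i)" by (rule mpow_mult[OF _ Ai]) (simp add: ordge_homogeneous)
    moreover have "b \<in> mpow (c + i)" by (rule subsetD[OF mpow_antimono A(2)]) simp
    ultimately have 1: "u \<in> mpow (c + i)" unfolding A(3) by (rule submod_add[OF submod_mpow])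
    have "A \<in> mpow 0" by (rule subsetD[OF mpow_antimono Ai]) simp
    then have "tf f * A + (b - tf (f - hp c f) * A) \<in> f_plus_power (Suc (c + i))"
      by (rule f_plus_power_I) (intro mpow_diff diff Ai A(2))
    moreover have "u = tf f * A + (b - tf (f - hp c f) * A)" unfolding A(3) by (simp add: algebra_simps)
    ultimately show "u \<in> mpow (c + i) \<inter> f_plus_power (Suc (c + i))" using 1 by simp
  qed
qed

lemma gcd_factors:
  obtains f' g' t where "hp c f = h * f'" "hp d g = h * g'" "c = t + (c - t)" "d = t + (d - t)"
    "homogeneous (c - t) f'" "homogeneous (d - t) g'" "f' \<noteq> 0" "no_common_factor f' g'" "t = common_tangent_number f g"
proof -
  obtain f' where f': "hp c f = h * f'" using h_props(1) by (rule dvdE)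
  obtain g' where g': "hp d g = h * g'" using h_props(2) by (rule dvdE)
  have nz: "h * f' \<noteq> 0" "h * g' \<noteq> 0" "h \<noteq> 0" "f' \<noteq> 0" using f(2) g(2) f' g' by auto
  have "homogeneous c (h * f')" using homogeneous_hp[of c f] unfolding f' .
  then obtain a b where a: "c = a + b" "homogeneous a h" "homogeneous b f'" by (rule homogeneous_factors[OF _ nz(1)])
  have "homogeneous d (h * g')" using homogeneous_hp[of d g] unfolding g' .
  then obtain a' b' where b: "d = a' + b'" "homogeneous a' h" "homogeneous b' g'" by (rule homogeneous_factors[OF _ nz(2)])
  have aa: "a' = a" by (rule homogeneous_degree_unique[OF b(2) a(2) nz(3)])
  have no_common_factor: "no_common_factor f' g'" by (rule no_common_factor_cofactors[OF nz(1)]) (rule h_props(3), simp_all add: f' g')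
  have t: "a = common_tangent_number f g"
    unfolding common_tangent_number_def h_def[symmetric] using total_degree_homogeneous[OF a(2) nz(3)] by simp
  show thesis by (rule that[OF f' g' _ _ _ _ nz(4) no_common_factor t]) (use a b aa in simp_all)
qed

text \<open>A leading form \<open>H\<close> occurs exactly if some \<open>f B\<close> cancels the
  leading form of \<open>H g\<close>, which means that the product of \<open>H\<close> with
  \<open>hp d g\<close> equals that of \<open>hp c f\<close> with \<open>B\<close>. After division
  by \<open>h\<close> this says that \<open>f'\<close> divides \<open>H\<close>; conversely, for
  \<open>H = f' K\<close> the choice \<open>B = g' K\<close> works.\<close>

lemma colon_g_Int_mpow:
  assumes f': "hp c f = h * f'" and g': "hp d g = h * g'" and t: "c = t + c'" "d = t + d'"
    and hom: "homogeneous c' f'" "homogeneous d' g'" "f' \<noteq> 0" and cop': "no_common_factor f' g'"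
  shows "colon_g (Suc (c + i + d)) \<inter> mpow (c + i) = form_multiples c' (t + i) f'"
proof
  let ?n = "Suc (c + i + d)" and ?E = "c + i"
  have E: "?E = c' + (t + i)" using t by simp
  have WJ: "f_plus_power (Suc ?E) \<subseteq> colon_g ?n" using f_plus_power_sub_colon_g[of "Suc ?E"] by simp
  have MW: "mpow (Suc ?E) \<subseteq> f_plus_power (Suc ?E)" unfolding f_plus_power_def by (rule splus_upper2[OF sm_smul])
  note MJ = order_trans[OF MW WJ]
  show "colon_g ?n \<inter> mpow ?E \<subseteq> form_multiples c' (t + i) f'"
  proof
    fix u assume u: "u \<in> colon_g ?n \<inter> mpow ?E"
    then have "u \<in> mpow ?E" by simp
    then obtain U r where U: "U \<in> forms ?E" "r \<in> mpow (Suc ?E)" "u = U + r" unfolding mpow_eq_forms_splus[of ?E] by (rule splusE)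
    obtain H where H: "U = tf H" "homogeneous ?E H" by (rule forms_E[OF U(1)])
    have "u - r \<in> colon_g ?n" using u subsetD[OF MJ U(2)] by (intro submod_diff[OF sm_colon_g]) simp_all
    then have "tf H * tf g \<in> f_plus_power ?n" unfolding U(3) H(1) by (simp add: colon_g_def)
    then obtain a b where ab: "a \<in> mpow 0" "b \<in> mpow ?n" "tf H * tf g = tf f * a + b" by (rule f_plus_power_E)
    have "tf H * tf g \<in> mpow (?E + d)" by (intro mpow_mult tf_mem_mpow ordge_homogeneous H(2) g(1))
    moreover have "b \<in> mpow (?E + d)" by (rule subsetD[OF mpow_antimono ab(2)]) simp
    ultimately have "tf H * tf g - b \<in> mpow (?E + d)" by (rule mpow_diff)
    then have "tf f * a \<in> mpow (c + (i + d))" using ab(3) by (simp add: ac_simps)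
    then have "a \<in> mpow (i + d)" by (rule mpow_cancel[OF f ab(1)])
    then obtain A s where A: "A \<in> forms (i + d)" "s \<in> mpow (Suc (i + d))" "a = A + s"
      unfolding mpow_eq_forms_splus[of "i + d"] by (rule splusE)
    obtain B where B: "A = tf B" "homogeneous (i + d) B" by (rule forms_E[OF A(1)])
    have "tf f * s \<in> mpow ?n" using mpow_mult[OF tf_mem_mpow[OF f(1)] A(2)] by (simp add: ac_simps)
    then have "b + tf f * s \<in> mpow ?n" by (rule submod_add[OF submod_mpow ab(2)])
    moreover have "tf (H * g - f * B) = b + tf f * s" using ab(3) unfolding A(3) B(1) by (simp add: algebra_simps)
    ultimately have "ordge ?n (H * g - f * B)" by (simp only: tf_mem_mpow_iff[symmetric])
    then have "hp (?E + d) (H * g - f * B) = 0" by (simp add: ordge_Suc_iff)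
    moreover have "hp (?E + d) (H * g) = H * hp d g"
      using hp_mult_ordge[OF ordge_homogeneous[OF H(2)] g(1)] H(2) by (simp add: hp_homogeneous)
    moreover have "hp (c + (i + d)) (f * B) = hp c f * B"
      using hp_mult_ordge[OF f(1) ordge_homogeneous[OF B(2)]] B(2) by (simp add: hp_homogeneous)
    ultimately have "H * hp d g = hp c f * B" by (simp add: hp_diff ac_simps)
    then have "h * (f' * B) = h * (g' * H)" unfolding f' g' by (simp only: ac_simps)
    moreover have "h \<noteq> 0" using f(2) f' by auto
    ultimately have "f' * B = g' * H" by simp
    then have "f' dvd g' * H" by (metis dvd_triv_left)
    then have "f' dvd H" by (rule no_common_factor_dvd_cancel[OF hom(3) cop'])
    then obtain K where K: "H = f' * K" "homogeneous (t + i) K" by (rule homogeneous_dvd[OF hom(1,3) H(2)[unfolded E]])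
    have "tf f' * tf K + r \<in> form_multiples c' (t + i) f'" unfolding form_multiples_def
      by (intro splusI smulI forms_I K(2)) (use U(2) in \<open>simp add: E\<close>)
    then show "u \<in> form_multiples c' (t + i) f'" unfolding U(3) H(1) K(1) by simp
  qed
  show "form_multiples c' (t + i) f' \<subseteq> colon_g ?n \<inter> mpow ?E"
  proof
    fix u assume "u \<in> form_multiples c' (t + i) f'"
    then obtain A r where A: "A \<in> forms (t + i)" "r \<in> mpow (Suc (c' + (t + i)))" "u = tf f' * A + r"
      unfolding form_multiples_def by (auto elim!: splusE smulE)
    obtain K where K: "A = tf K" "homogeneous (t + i) K" by (rule forms_E[OF A(1)])
    have r: "r \<in> mpow (Suc ?E)" using A(2) unfolding E .
    define H where "H = f' * K"
    have H: "homogeneous ?E H" unfolding H_def E by (rule homogeneous_mult[OF hom(1) K(2)])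
    have oH: "ordge ?E H" by (rule ordge_homogeneous[OF H])
    have gK: "ordge (d' + (t + i)) (g' * K)" by (rule ordge_homogeneous[OF homogeneous_mult[OF hom(2) K(2)]])
    have "ordge (?E + Suc d) (H * (g - hp d g))" by (rule ordge_mult[OF oH hp_decomp_ordge[OF g(1)]])
    moreover have "ordge (Suc c + (d' + (t + i))) ((f - hp c f) * (g' * K))"
      by (rule ordge_mult[OF hp_decomp_ordge[OF f(1)] gK])
    then have "ordge (?E + Suc d) ((f - hp c f) * (g' * K))" using t by (simp add: ac_simps)
    ultimately have "ordge (?E + Suc d) (H * (g - hp d g) - (f - hp c f) * (g' * K))" by (rule ordge_diff)
    moreover have "H * (g - hp d g) - (f - hp c f) * (g' * K) = H * g - f * (g' * K)"
      unfolding f' g' H_def by (simp add: algebra_simps)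
    ultimately have "ordge ?n (H * g - f * (g' * K))" by simp
    then have "tf (H * g - f * (g' * K)) \<in> mpow ?n" by (rule tf_mem_mpow)
    then have "tf f * tf (g' * K) + tf (H * g - f * (g' * K)) \<in> f_plus_power ?n"
      by (rule f_plus_power_I[OF tf_mem_mpow[OF ordge_0(1)]])
    moreover have "tf f * tf (g' * K) + tf (H * g - f * (g' * K)) = tf H * tf g" by simp
    ultimately have "tf H * tf g \<in> f_plus_power ?n" by (simp only:)
    then have "tf H \<in> colon_g ?n" by (rule colon_g_I[OF tf_mem_mpow[OF ordge_0(1)]])
    moreover have "r \<in> colon_g ?n" by (rule subsetD[OF MJ r])
    ultimately have "tf H + r \<in> colon_g ?n" by (rule submod_add[OF sm_colon_g])
    moreover have "tf H + r \<in> mpow ?E"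
      by (intro submod_add[OF submod_mpow] tf_mem_mpow oH subsetD[OF mpow_antimono r]) simp
    moreover have "u = tf H + r" unfolding A(3) K(1) H_def by simp
    ultimately show "u \<in> colon_g ?n \<inter> mpow ?E" by simp
  qed
qed

text \<open>In degree \<open>c + i\<close> the leading forms of the colon ideal are the multiples of
  \<open>f'\<close>, a space of dimension \<open>t + i + 1\<close>; those of
  \<open>f_plus_power (Suc (c + i))\<close> are the multiples of \<open>hp c f\<close>, a space of
  dimension \<open>i + 1\<close>. The difference is \<open>t\<close>.\<close>

lemma rlen_tangents:
  "rlen constants (colon_g (Suc (c + i + d)) \<inter> f_plus_power (c + i)) (f_plus_power (Suc (c + i))) = enat (common_tangent_number f g)"
proof -
  let ?n = "Suc (c + i + d)" and ?E = "c + i"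
  obtain f' g' t where fg: "hp c f = h * f'" "hp d g = h * g'" "c = t + (c - t)" "d = t + (d - t)"
    "homogeneous (c - t) f'" "homogeneous (d - t) g'" "f' \<noteq> 0" "no_common_factor f' g'" and t: "t = common_tangent_number f g"
    by (rule gcd_factors)
  let ?U = "colon_g ?n \<inter> mpow ?E"
  have U: "?U = form_multiples (c - t) (t + i) f'" by (rule colon_g_Int_mpow[OF fg])
  have E: "?E = c - t + (t + i)" using fg(3) by simp
  have WJ: "f_plus_power (Suc ?E) \<subseteq> colon_g ?n" using f_plus_power_sub_colon_g[of "Suc ?E"] by simp
  have smU: "submod (mpow 0) ?U" by (rule submod_Int[OF sm_colon_g submod_mpow])
  note sk = submod_constants[OF smU] submod_constants[OF sm_f_plus_power] submod_constants[OF submod_mpow] submod_form_multiples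
  \<comment> \<open>The summand \<open>f a\<close> of an element of \<open>f_plus_power ?E\<close>
    lies in both ideals anyway, so only the summand of order at least \<open>?E\<close>
    matters.\<close>
  have T: "colon_g ?n \<inter> f_plus_power ?E = ?U \<boxplus> f_plus_power (Suc ?E)"
  proof
    show "colon_g ?n \<inter> f_plus_power ?E \<subseteq> ?U \<boxplus> f_plus_power (Suc ?E)"
    proof
      fix z assume z: "z \<in> colon_g ?n \<inter> f_plus_power ?E"
      then have "z \<in> f_plus_power ?E" by simp
      then obtain a b where ab: "a \<in> mpow 0" "b \<in> mpow ?E" "z = tf f * a + b" by (rule f_plus_power_E)
      have W: "tf f * a + 0 \<in> f_plus_power (Suc ?E)" by (rule f_plus_power_I[OF ab(1) submod_zero[OF submod_mpow]])
      then have "z - (tf f * a + 0) \<in> colon_g ?n" using z WJ by (intro submod_diff[OF sm_colon_g]) auto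
      then have "b \<in> ?U" using ab(2,3) by simp
      then have "b + (tf f * a + 0) \<in> ?U \<boxplus> f_plus_power (Suc ?E)" using W by (rule splusI)
      then show "z \<in> ?U \<boxplus> f_plus_power (Suc ?E)" unfolding ab(3) by (simp add: add.commute)
    qed
    have MW: "mpow ?E \<subseteq> f_plus_power ?E" unfolding f_plus_power_def by (rule splus_upper2[OF sm_smul])
    have W: "f_plus_power (Suc ?E) \<subseteq> f_plus_power ?E" by (rule f_plus_power_antimono) simp
    show "?U \<boxplus> f_plus_power (Suc ?E) \<subseteq> colon_g ?n \<inter> f_plus_power ?E"
      by (rule splus_least[OF submod_Int[OF sm_colon_g sm_f_plus_power]]) (use MW WJ W in blast)+
  qed
  have MJ: "mpow (Suc ?E) \<subseteq> f_plus_power (Suc ?E)" unfolding f_plus_power_def by (rule splus_upper2[OF sm_smul])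
  have I: "?U \<inter> f_plus_power (Suc ?E) = form_multiples c i (hp c f)" unfolding f_plus_power_Int_mpow[symmetric] using WJ by blast
  have "rlen constants (colon_g ?n \<inter> f_plus_power ?E) (f_plus_power (Suc ?E)) = rlen constants ?U (form_multiples c i (hp c f))"
    unfolding T I[symmetric] by (rule rlen_diamond[OF sk(2,1)])
  moreover have "rlen constants ?U (mpow (Suc ?E)) = rlen constants ?U (form_multiples c i (hp c f)) + rlen constants (form_multiples c i (hp c f)) (mpow (Suc ?E))"
    by (rule rlen_additive[OF sk(3,4,1) mpow_sub_form_multiples]) (use I in blast)
  moreover have "rlen constants ?U (mpow (Suc ?E)) = enat (Suc (t + i))"
    unfolding U using rlen_form_multiples[OF fg(5,7), of "t + i"] unfolding E by simp
  moreover have "rlen constants (form_multiples c i (hp c f)) (mpow (Suc ?E)) = enat (Suc i)"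
    by (rule rlen_form_multiples[OF homogeneous_hp f(2)])
  ultimately have e: "enat (Suc (t + i)) = rlen constants (colon_g ?n \<inter> f_plus_power ?E) (f_plus_power (Suc ?E)) + enat (Suc i)" by simp
  then show ?thesis unfolding t[symmetric] by (cases "rlen constants (colon_g ?n \<inter> f_plus_power ?E) (f_plus_power (Suc ?E))") auto
qed

text \<open>The exponent \<open>n - d - 1\<close> is one below \<open>n - d\<close>, for which
  \<open>f_plus_power\<close> is contained in the colon ideal. This single degree accounts for the
  common tangents.\<close>

lemma rlen_quotient:
  assumes N: "mpow N \<subseteq> origin_curves" and n: "Suc (c + d) \<le> n" "N \<le> n"
  shows "rlen constants (colon_g n) (colon_g n \<inter> f_plus_power (n - d - 1)) + enat (c * d + common_tangent_number f g) = enat origin_mult"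
proof -
  obtain i where i: "n = Suc (c + i + d)" using n(1) by (metis add.assoc add.commute add_Suc le_Suc_ex)
  have 1: "rlen constants (colon_g n) (f_plus_power (Suc (c + i))) + enat (c * d) = enat origin_mult"
    using rlen_colon_g[of "Suc i"] order_trans[OF mpow_antimono[OF n(2)] N] by (simp add: i ac_simps)
  have E: "n - d - 1 = c + i" using i by simp
  have WJ: "f_plus_power (Suc (c + i)) \<subseteq> colon_g n" using f_plus_power_sub_colon_g[of "Suc (c + i)"] by (simp add: i)
  have W: "f_plus_power (Suc (c + i)) \<subseteq> colon_g n \<inter> f_plus_power (c + i)" using WJ f_plus_power_antimono[of "c + i" "Suc (c + i)"] by simp
  have "rlen constants (colon_g n) (f_plus_power (Suc (c + i))) =
      rlen constants (colon_g n) (colon_g n \<inter> f_plus_power (c + i)) + rlen constants (colon_g n \<inter> f_plus_power (c + i)) (f_plus_power (Suc (c + i)))"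
    by (rule rlen_additive[OF submod_constants[OF sm_f_plus_power] submod_constants[OF submod_Int[OF sm_colon_g sm_f_plus_power]] submod_constants[OF sm_colon_g] W]) simp
  then have 2: "rlen constants (colon_g n) (f_plus_power (Suc (c + i))) = rlen constants (colon_g n) (colon_g n \<inter> f_plus_power (c + i)) + enat (common_tangent_number f g)"
    using rlen_tangents[of i] unfolding i by simp
  have "rlen constants (colon_g n) (colon_g n \<inter> f_plus_power (n - d - 1)) + enat (c * d + common_tangent_number f g) =
      rlen constants (colon_g n) (colon_g n \<inter> f_plus_power (c + i)) + enat (common_tangent_number f g) + enat (c * d)"
    unfolding E by (simp add: ac_simps)
  then show ?thesis using 1 unfolding 2 by simp
qed

lemma ideal_plus_power_eq: "ideal_plus_power f n = f_plus_power n"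
  unfolding ideal_plus_power_def ideal_power_origin unfolding origin_ring_eq f_plus_power_def
  by (rule genideal_insert[OF is_subring_mpow _ submod_mpow mpow_antimono]) simp_all

lemma colon_ideal_eq: "colon_ideal origin_A (ideal_plus_power f n) (tf g) = colon_g n"
  unfolding colon_ideal_def ideal_plus_power_eq origin_ring_eq colon_g_def by simp

lemma eventually_quot_length:
  "\<exists>l. (\<forall>\<^sub>F n in sequentially.
      (let J = colon_ideal origin_A (ideal_plus_power f n) (tf g)
       in quot_length origin_A J (J \<inter> ideal_plus_power f (n - d - 1))) = enat l) \<and>
    origin_mult = c * d + common_tangent_number f g + l"
proof -
  obtain N where N: "mpow N \<subseteq> origin_curves" using origin_curves_contains by blast
  \<comment> \<open>The truncated subtraction is exact: for large \<open>n\<close> the length and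
    \<open>c * d + common_tangent_number f g\<close> add up to \<open>origin_mult\<close>.\<close>
  define l where "l = origin_mult - (c * d + common_tangent_number f g)"
  have main: "rlen constants (colon_g n) (colon_g n \<inter> f_plus_power (n - d - 1)) = enat l \<and> origin_mult = c * d + common_tangent_number f g + l"
    if n: "max N (Suc (c + d)) \<le> n" for n
  proof -
    have e: "rlen constants (colon_g n) (colon_g n \<inter> f_plus_power (n - d - 1)) + enat (c * d + common_tangent_number f g) = enat origin_mult"
      by (rule rlen_quotient[OF N]) (use n in simp_all)
    then obtain x where x: "rlen constants (colon_g n) (colon_g n \<inter> f_plus_power (n - d - 1)) = enat x"
      by (cases "rlen constants (colon_g n) (colon_g n \<inter> f_plus_power (n - d - 1))") auto
    show ?thesis using e unfolding x l_def by simp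
  qed
  have q: "(let J = colon_ideal origin_A (ideal_plus_power f n) (tf g)
       in quot_length origin_A J (J \<inter> ideal_plus_power f (n - d - 1))) = enat l" if n: "max N (Suc (c + d)) \<le> n" for n
  proof -
    have "quot_length origin_A (colon_g n) (colon_g n \<inter> f_plus_power (n - d - 1)) = rlen (mpow 0) (colon_g n) (colon_g n \<inter> f_plus_power (n - d - 1))"
      unfolding origin_ring_eq by (rule quot_length_subring_of[OF is_subring_mpow colon_g_sub])
    also have "\<dots> = rlen constants (colon_g n) (colon_g n \<inter> f_plus_power (n - d - 1))"
      by (rule rlen_constants_eq[OF sm_colon_g submod_Int[OF sm_colon_g sm_f_plus_power], symmetric]) simp
    finally show ?thesis using main[OF n] unfolding Let_def colon_ideal_eq unfolding ideal_plus_power_eq by simp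
  qed
  show ?thesis
  proof (intro exI[of _ l] conjI)
    show "\<forall>\<^sub>F n in sequentially. (let J = colon_ideal origin_A (ideal_plus_power f n) (tf g)
       in quot_length origin_A J (J \<inter> ideal_plus_power f (n - d - 1))) = enat l"
      unfolding eventually_sequentially using q by blast
    show "origin_mult = c * d + common_tangent_number f g + l" using main[OF order_refl] by simp
  qed
qed

end

lemma no_common_factor_if_curve_components:
  assumes "curve_components f \<inter> curve_components g = {}" shows "no_common_factor f g"
  unfolding no_common_factor_def
proof (intro allI impI notI)
  fix q assume "Factorial_Ring.irreducible q" "q dvd f" "q dvd g"
  then have "curve q \<in> curve_components f \<inter> curve_components g" unfolding curve_components_def by blast
  then show False using assms by simp
qed

lemma order_pos:
  assumes "hp c f \<noteq> 0" "eval2 f 0 0 = 0" shows "0 < c"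
  using assms by (cases c) (simp_all add: hp_zero)

theorem theorem1p1:
  fixes f g :: "'k::alg_closed_field poly poly"
    and c d :: nat
    and e e1 e2 e3 :: real
  assumes "f \<noteq> 0" and "g \<noteq> 0"
    and "curve_components f \<inter> curve_components g = {}"
    and "(0, 0) \<in> curve f \<inter> curve g"
    and "c = initial_degree f" and "d = initial_degree g"
    and "e = intersection_multiplicity f g"
    and "e1 = blowup_multiplicity (blowup_ring {frac_x / frac_y})
                (to_fract f / frac_y ^ c) (to_fract g / frac_y ^ d)"
    and "e2 = blowup_multiplicity (blowup_ring {frac_y / frac_x})
                (to_fract f / frac_x ^ c) (to_fract g / frac_x ^ d)"
    and "e3 = blowup_multiplicity (blowup_ring {frac_x / frac_y, frac_y / frac_x})
                (to_fract f / frac_y ^ c) (to_fract g / frac_y ^ d)"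
  shows
    "(\<exists>l::nat.
        (\<forall>\<^sub>F n in sequentially.
           (let J = colon_ideal origin_A (ideal_plus_power f n) (to_fract g)
            in quot_length origin_A J (J \<inter> ideal_plus_power f (n - d - 1))) = enat l) \<and>
        e = real (c * d + common_tangent_number f g + l))
     \<and> e = real (c * d) + e1 + e2 - e3
     \<and> (\<not> transversal_at_origin f g \<longrightarrow>
          e \<le> real (c * d) + e1 + e2 \<and>
          (e = real (c * d) + e1 + e2 \<longleftrightarrow>
             (x_axis \<in> common_tangents f g \<or> y_axis \<in> common_tangents f g) \<and>
             common_tangents f g \<subseteq> {x_axis, y_axis}))"
proof -
  obtain c' where c': "ordge c' f" "hp c' f \<noteq> 0" by (rule ordge_exists[OF assms(1)])
  obtain d' where d': "ordge d' g" "hp d' g \<noteq> 0" by (rule ordge_exists[OF assms(2)])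
  have cd: "c' = c" "d' = d" using initial_degree_eq[OF c'] initial_degree_eq[OF d'] assms(5,6) by simp_all
  have 0: "eval2 f 0 0 = 0" "eval2 g 0 0 = 0" using assms(4) by (simp_all add: curve_def)
  interpret curve_pair f g c d
    using c' d' order_pos[OF c'(2) 0(1)] order_pos[OF d'(2) 0(2)] no_common_factor_if_curve_components[OF assms(3)]
    unfolding cd by unfold_locales
  let ?Z3 = "{p \<in> Z. fst p \<noteq> 0 \<and> snd p \<noteq> 0}"
  have e: "e = real origin_mult" using assms(7) intersection_multiplicity_eq by simp
  have e3: "e3 = (\<Sum>p\<in>?Z3. real (point_mult p))" unfolding assms(10) by (rule blowup_multiplicity_both)
  have "e = real (c * d) + (\<Sum>p\<in>Z. real (point_mult p))" unfolding e noether_formula by simp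
  also have "\<dots> = real (c * d) + (e1 + e2 - e3)"
    unfolding sum_axes assms(8-10) blowup_multiplicity_x_over_y blowup_multiplicity_y_over_x blowup_multiplicity_both by simp
  finally have b: "e = real (c * d) + e1 + e2 - e3" by simp
  \<comment> \<open>All contributions are positive, so the sum vanishes exactly if no common tangent
    direction lies off the axes.\<close>
  have e3_0: "e3 = 0 \<longleftrightarrow> ?Z3 = {}"
  proof -
    have "e3 = 0 \<longleftrightarrow> (\<forall>p\<in>?Z3. real (point_mult p) = 0)"
      unfolding e3 by (rule sum_nonneg_eq_0_iff) (simp_all add: finite_Z)
    also have "\<dots> \<longleftrightarrow> ?Z3 = {}" using point_mult_pos by (metis (no_types, lifting) empty_iff ex_in_conv mem_Collect_eq neq0_conv of_nat_eq_0_iff)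
    finally show ?thesis .
  qed
  have "0 \<le> e3" unfolding e3 by (rule sum_nonneg) simp
  then have le: "e \<le> real (c * d) + e1 + e2" using b by simp
  have iff: "e = real (c * d) + e1 + e2 \<longleftrightarrow> (x_axis \<in> common_tangents f g \<or> y_axis \<in> common_tangents f g) \<and>
      common_tangents f g \<subseteq> {x_axis, y_axis}" if "\<not> transversal_at_origin f g"
  proof -
    \<comment> \<open>Non-transversality enters here: without common tangents equality would hold
      although no axis is a common tangent.\<close>
    have "Z \<noteq> {}" using transversal that by blast
    note axis_condition[OF this]
    moreover have "e = real (c * d) + e1 + e2 \<longleftrightarrow> e3 = 0" using b by auto
    ultimately show ?thesis using e3_0 by simp
  qed
  have a: "\<exists>l. (\<forall>\<^sub>F n in sequentially.
      (let J = colon_ideal origin_A (ideal_plus_power f n) (tf g)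
       in quot_length origin_A J (J \<inter> ideal_plus_power f (n - d - 1))) = enat l) \<and>
    e = real (c * d + common_tangent_number f g + l)"
    using eventually_quot_length unfolding e of_nat_eq_iff .
  show ?thesis by (intro conjI impI a b le iff)
qed

end
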